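(* Let $f$ be a continuous function on $\mathbb R$ such that $$|f(t)|\le a_1|t|^{q_1-1}+a_2|t|^{q_2-1}\quad\forall t\in\mathbb R$$ for some constants $a_1,a_2>0$ and $18/7<q_1<q_2<3$. Assume that $f(t)=\lambda|t|t+g(t)$ with $\lambda\in\mathbb R$, where $$|g(t)|\le a_3|t|^{q_3-1}+a_4|t|^{q_4-1}\quad\forall t\in\mathbb R$$ for some constants $a_3,a_4>0$ and $3<q_3<q_4<6$, and that $G(t)=\int_0^tg(\tau)\,d\tau$ satisfies $G(t)<0$ for all $t\in\mathbb R\setminus\{0\}$. Consider the equation $$-\Delta u+\Big(\frac1{4\pi|x|}\star u^2\Big)u=f(u)\quad\text{in }\mathbb R^3,\tag{$*$}$$ and let $(\lambda_k)$ be the sequence of minimax eigenvalues defined in the context. (i) If $\lambda>\lambda_1$, then $( * )$ has a nontrivial solution. (ii) If $\lambda>\lambda_2$, then $( * )$ has two nontrivial solutions.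
   Context: $E(\mathbb R^3)=\{u\in D^{1,2}(\mathbb R^3):\int_{\mathbb R^3}\int_{\mathbb R^3}\frac{u^2(x)u^2(y)}{|x-y|}\,dx\,dy<\infty\}$ with norm $\|u\|=\big[\int_{\mathbb R^3}|\nabla u|^2dx+\big(\int_{\mathbb R^3}\int_{\mathbb R^3}\frac{u^2(x)u^2(y)}{|x-y|}\,dx\,dy\big)^{1/2}\big]^{1/2}$, and $E_r(\mathbb R^3)$ is the subspace of radial functions. For $u\in E_r(\mathbb R^3)$, $$I_s(u)=\frac12\int_{\mathbb R^3}|\nabla u|^2dx+\frac1{16\pi}\int_{\mathbb R^3}\int_{\mathbb R^3}\frac{u^2(x)u^2(y)}{|x-y|}\,dx\,dy,\qquad J_s(u)=\frac13\int_{\mathbb R^3}|u|^3dx .$$ Solutions of $( * )$ are the critical points of $\Phi(u)=I_s(u)-\int_{\mathbb R^3}F(u)\,dx$ on $E_r(\mathbb R^3)$, $F(t)=\int_0^tf(\tau)\,d\tau$; that is, $u\in E_r(\mathbb R^3)$ with $\int\nabla u\cdot\nabla v\,dx+\frac1{4\pi}\iint\frac{u^2(x)u(y)v(y)}{|x-y|}dx\,dy=\int f(u)v\,dx$ for all $v\in E_r(\mathbb R^3)$. Cohomological index (Fadell–Rabinowitz): for a symmetric set $A\subset E_r(\mathbb R^3)\setminus\{0\}$ (i.e. $-A=A$), let $\overline A=A/\mathbb Z_2$ be the quotient identifying $u$ and $-u$, let $h:\overline A\to\mathbb{RP}^\infty$ be its classifying map and $h^*:H^*(\mathbb{RP}^\infty)\to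 H^*(\overline A)$ the induced homomorphism of Alexander–Spanier cohomology rings with $\mathbb Z_2$ coefficients. Then $i(\emptyset)=0$ and, for $A\ne\emptyset$, $i(A)=\sup\{m\ge1:h^*(\omega^{m-1})\ne0\}$, where $\omega\in H^1(\mathbb{RP}^\infty)$ is the generator of $H^*(\mathbb{RP}^\infty)=\mathbb Z_2[\omega]$. Minimax eigenvalues (of $-\Delta u+(\frac1{4\pi|x|}\star u^2)u=\lambda|u|u$): with $\mathcal M_s=\{u\in E_r(\mathbb R^3):I_s(u)=1\}$ and $\widetilde\Psi(u)=1/J_s(u)$ for $u\in\mathcal M_s$, set $\lambda_k=\inf_{M}\sup_{u\in M}\widetilde\Psi(u)$, $k\ge1$, the infimum being over all symmetric $M\subset\mathcal M_s$ with $i(M)\ge k$. *)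

theory Defs
  imports "HOL-Analysis.Analysis" "HOL-Library.Z2"
begin

section \<open>The space $E_r(\mathbb{R}^3)$\<close>

type_synonym R3 = "real^3"

fun Ck :: "nat \<Rightarrow> (R3 \<Rightarrow> real) \<Rightarrow> bool" where
  "Ck 0 \<phi> \<longleftrightarrow> continuous_on UNIV \<phi>"
| "Ck (Suc n) \<phi> \<longleftrightarrow> (\<forall>x. \<phi> differentiable at x) \<and>
     (\<forall>i. Ck n (\<lambda>x. frechet_derivative \<phi> (at x) (axis i 1)))"

definition test_function :: "(R3 \<Rightarrow> real) \<Rightarrow> bool" where
  "test_function \<phi> \<longleftrightarrow> (\<forall>n. Ck n \<phi>) \<and> compact (closure {x. \<phi> x \<noteq> 0})"

definition loc_integrable :: "(R3 \<Rightarrow> 'b::{banach,second_countable_topology}) \<Rightarrow> bool" where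
  "loc_integrable u \<longleftrightarrow> u \<in> borel_measurable borel \<and>
     (\<forall>K. compact K \<longrightarrow> set_integrable lborel K u)"

definition weak_gradient :: "(R3 \<Rightarrow> real) \<Rightarrow> (R3 \<Rightarrow> R3) \<Rightarrow> bool" where
  "weak_gradient u w \<longleftrightarrow> loc_integrable u \<and> loc_integrable w \<and>
     (\<forall>\<phi>. test_function \<phi> \<longrightarrow> (\<forall>i.
        (LINT x|lborel. u x * frechet_derivative \<phi> (at x) (axis i 1))
          = - (LINT x|lborel. (w x $ i) * \<phi> x)))"

(* A weak gradient is unique up to a null set. *)
definition grad :: "(R3 \<Rightarrow> real) \<Rightarrow> R3 \<Rightarrow> R3" where
  "grad u = (SOME w. weak_gradient u w)"

(* D^{1,2} in its description as {u in L^6 : grad u in L^2}, 6 being the critical Sobolev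
   exponent.  Here and below elements of function spaces are Borel representatives; functions
   that agree almost everywhere are identified in the type Er. *)
definition D12 :: "(R3 \<Rightarrow> real) set" where
  "D12 = {u \<in> borel_measurable borel. integrable lborel (\<lambda>x. \<bar>u x\<bar> ^ 6) \<and>
     (\<exists>w. weak_gradient u w \<and> integrable lborel (\<lambda>x. (norm (w x))\<^sup>2))}"

(* Division by zero on the diagonal is harmless: the diagonal is a null set. *)
definition coulomb_integrand :: "(R3 \<Rightarrow> real) \<Rightarrow> (R3 \<Rightarrow> real) \<Rightarrow> R3 \<times> R3 \<Rightarrow> real" where
  "coulomb_integrand a b = (\<lambda>(x, y). a x * b y / norm (x - y))"

definition coulomb :: "(R3 \<Rightarrow> real) \<Rightarrow> (R3 \<Rightarrow> real) \<Rightarrow> real" where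
  "coulomb a b = integral\<^sup>L (lborel \<Otimes>\<^sub>M lborel) (coulomb_integrand a b)"

definition E_space :: "(R3 \<Rightarrow> real) set" where
  "E_space = {u \<in> D12. integrable (lborel \<Otimes>\<^sub>M lborel)
      (coulomb_integrand (\<lambda>x. (u x)\<^sup>2) (\<lambda>x. (u x)\<^sup>2))}"

definition E_norm :: "(R3 \<Rightarrow> real) \<Rightarrow> real" where
  "E_norm u = sqrt ((LINT x|lborel. (norm (grad u x))\<^sup>2)
      + sqrt (coulomb (\<lambda>x. (u x)\<^sup>2) (\<lambda>x. (u x)\<^sup>2)))"

definition radial :: "(R3 \<Rightarrow> real) \<Rightarrow> bool" where
  "radial u \<longleftrightarrow> (\<exists>\<rho> \<in> borel_measurable borel. AE x in lborel. u x = \<rho> (norm x))"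

definition Er_space :: "(R3 \<Rightarrow> real) set" where
  "Er_space = {u \<in> E_space. radial u}"

definition Er_rel :: "(R3 \<Rightarrow> real) \<Rightarrow> (R3 \<Rightarrow> real) \<Rightarrow> bool" where
  "Er_rel u v \<longleftrightarrow> u \<in> Er_space \<and> v \<in> Er_space \<and> (AE x in lborel. u x = v x)"

lemma weak_gradient_zero: "weak_gradient (\<lambda>x. 0) (\<lambda>x. 0)"
  by (simp add: weak_gradient_def loc_integrable_def set_integrable_def)

lemma weak_gradient_uminus:
  assumes "weak_gradient u w"
  shows "weak_gradient (\<lambda>x. - u x) (\<lambda>x. - w x)"
  using assms by (auto simp: weak_gradient_def loc_integrable_def set_integrable_def)

lemma zero_in_Er_space: "(\<lambda>x. 0) \<in> Er_space"
proof -
  have "(\<lambda>x. 0) \<in> D12"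
    using weak_gradient_zero by (auto simp: D12_def intro!: exI[of _ "\<lambda>x. 0"])
  moreover have "radial (\<lambda>x. 0)"
    unfolding radial_def by (rule bexI[of _ "\<lambda>x. 0"]) auto
  ultimately show ?thesis
    by (simp add: Er_space_def E_space_def coulomb_integrand_def case_prod_unfold)
qed

lemma uminus_in_Er_space:
  assumes "u \<in> Er_space"
  shows "(\<lambda>x. - u x) \<in> Er_space"
proof -
  obtain w where w: "weak_gradient u w" "integrable lborel (\<lambda>x. (norm (w x))\<^sup>2)"
    using assms by (auto simp: Er_space_def E_space_def D12_def)
  have "\<exists>w. weak_gradient (\<lambda>x. - u x) w \<and> integrable lborel (\<lambda>x. (norm (w x))\<^sup>2)"
    using weak_gradient_uminus[OF w(1)] w(2) by (intro exI[of _ "\<lambda>x. - w x"]) auto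
  moreover have "radial (\<lambda>x. - u x)"
  proof -
    obtain \<rho> where "\<rho> \<in> borel_measurable borel" "AE x in lborel. u x = \<rho> (norm x)"
      using assms by (auto simp: Er_space_def radial_def)
    then show ?thesis
      unfolding radial_def by (intro bexI[of _ "\<lambda>r. - \<rho> r"]) auto
  qed
  ultimately show ?thesis
    using assms by (auto simp: Er_space_def E_space_def D12_def)
qed

quotient_type Er = "R3 \<Rightarrow> real" / partial: Er_rel
proof (rule part_equivpI)
  show "\<exists>u. Er_rel u u"
    using zero_in_Er_space by (auto simp: Er_rel_def)
  show "symp Er_rel"
    by (auto simp: symp_def Er_rel_def elim: eventually_mono)
  show "transp Er_rel"
  proof (rule transpI)
    fix u v w assume uv: "Er_rel u v" and vw: "Er_rel v w"
    have "AE x in lborel. u x = w x"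
      using uv vw unfolding Er_rel_def by (auto elim: eventually_elim2)
    then show "Er_rel u w" using uv vw by (simp add: Er_rel_def)
  qed
qed

instantiation Er :: "{zero, uminus}"
begin

lift_definition zero_Er :: Er is "\<lambda>x. 0"
  by (simp add: Er_rel_def zero_in_Er_space)

lift_definition uminus_Er :: "Er \<Rightarrow> Er" is "\<lambda>u x. - u x"
  by (auto simp: Er_rel_def uminus_in_Er_space)

instance ..

end

lemma rep_Er_in_Er_space: "rep_Er u \<in> Er_space"
  using Quotient_rep_reflp[OF Quotient_Er, of u] by (simp add: Er_rel_def)

lemma Er_eq_iff: "u = v \<longleftrightarrow> (AE x in lborel. rep_Er u x = rep_Er v x)"
  using Quotient_rel_rep[OF Quotient_Er, of u v] rep_Er_in_Er_space[of u] rep_Er_in_Er_space[of v]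
  by (simp add: Er_rel_def)

(* The norm topology. *)
instantiation Er :: topological_space
begin

definition open_Er :: "Er set \<Rightarrow> bool" where
  "open_Er U \<longleftrightarrow> (\<forall>u\<in>U. \<exists>e>0. \<forall>v. E_norm (\<lambda>x. rep_Er v x - rep_Er u x) < e \<longrightarrow> v \<in> U)"

instance
proof
  show "open (UNIV :: Er set)"
    unfolding open_Er_def by (auto intro: exI[of _ 1])
  fix S T :: "Er set" assume S: "open S" and T: "open T"
  show "open (S \<inter> T)"
    unfolding open_Er_def
  proof
    fix u assume "u \<in> S \<inter> T"
    then obtain d e where "d > 0" "e > 0"
      and "\<forall>v. E_norm (\<lambda>x. rep_Er v x - rep_Er u x) < d \<longrightarrow> v \<in> S"
      and "\<forall>v. E_norm (\<lambda>x. rep_Er v x - rep_Er u x) < e \<longrightarrow> v \<in> T"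
      using S T unfolding open_Er_def by blast
    then show "\<exists>e>0. \<forall>v. E_norm (\<lambda>x. rep_Er v x - rep_Er u x) < e \<longrightarrow> v \<in> S \<inter> T"
      by (intro exI[of _ "min d e"]) auto
  qed
next
  fix K :: "Er set set" assume "\<forall>S\<in>K. open S"
  then show "open (\<Union>K)"
    unfolding open_Er_def by (metis Union_iff)
qed

end


section \<open>Alexander--Spanier cohomology with coefficients in $\mathbb{Z}_2$\<close>

(* A p-cochain is a function of (p+1)-tuples of points, encoded as lists of length p+1.
   Its values on other lists never matter, because cochains are only considered modulo
   those that vanish on all (p+1)-tuples that are small of some order (locally zero cochains). *)
type_synonym 'a cochain = "'a list \<Rightarrow> bit"

definition loc_zero :: "'a topology \<Rightarrow> nat \<Rightarrow> 'a cochain \<Rightarrow> bool" where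
  "loc_zero X p \<phi> \<longleftrightarrow> (\<exists>\<U>. (\<forall>U\<in>\<U>. openin X U) \<and> \<Union>\<U> = topspace X \<and>
     (\<forall>U\<in>\<U>. \<forall>xs. length xs = Suc p \<and> set xs \<subseteq> U \<longrightarrow> \<phi> xs = 0))"

(* No signs are needed modulo 2. *)
definition coboundary :: "'a cochain \<Rightarrow> 'a cochain" where
  "coboundary \<phi> = (\<lambda>xs. \<Sum>i<length xs. \<phi> (take i xs @ drop (Suc i) xs))"

definition cocycles :: "'a topology \<Rightarrow> nat \<Rightarrow> 'a cochain set" where
  "cocycles X p = {\<phi>. loc_zero X (Suc p) (coboundary \<phi>)}"

(* Degree 0 is separate since the cohomology is unreduced: there are no (-1)-cochains. *)
fun coboundaries :: "'a topology \<Rightarrow> nat \<Rightarrow> 'a cochain set" where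
  "coboundaries X 0 = {\<phi>. loc_zero X 0 \<phi>}"
| "coboundaries X (Suc p) = {\<phi>. \<exists>\<psi>. loc_zero X (Suc p) (\<lambda>xs. \<phi> xs - coboundary \<psi> xs)}"

definition cohomologous :: "'a topology \<Rightarrow> nat \<Rightarrow> ('a cochain \<times> 'a cochain) set" where
  "cohomologous X p = {(\<phi>, \<psi>). \<phi> \<in> cocycles X p \<and> \<psi> \<in> cocycles X p \<and>
     (\<lambda>xs. \<phi> xs - \<psi> xs) \<in> coboundaries X p}"

definition cohomology :: "'a topology \<Rightarrow> nat \<Rightarrow> 'a cochain set set" where
  "cohomology X p = cocycles X p // cohomologous X p"

definition cohom_class :: "'a topology \<Rightarrow> nat \<Rightarrow> 'a cochain \<Rightarrow> 'a cochain set" where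
  "cohom_class X p \<phi> = cohomologous X p `` {\<phi>}"

definition cohom_zero :: "'a topology \<Rightarrow> nat \<Rightarrow> 'a cochain set" where
  "cohom_zero X p = cohom_class X p (\<lambda>xs. 0)"

definition cohom_one :: "'a topology \<Rightarrow> 'a cochain set" where
  "cohom_one X = cohom_class X 0 (\<lambda>xs. 1)"

definition cup_cochain :: "nat \<Rightarrow> 'a cochain \<Rightarrow> 'a cochain \<Rightarrow> 'a cochain" where
  "cup_cochain p \<phi> \<psi> = (\<lambda>xs. \<phi> (take (Suc p) xs) * \<psi> (drop p xs))"

definition cup :: "'a topology \<Rightarrow> nat \<Rightarrow> nat \<Rightarrow> 'a cochain set \<Rightarrow> 'a cochain set \<Rightarrow> 'a cochain set"
  where "cup X p q a b = (\<Union>\<phi>\<in>a. \<Union>\<psi>\<in>b. cohom_class X (p + q) (cup_cochain p \<phi> \<psi>))"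

(* Cup powers of a class of degree 1. *)
fun cup_power :: "'a topology \<Rightarrow> 'a cochain set \<Rightarrow> nat \<Rightarrow> 'a cochain set" where
  "cup_power X a 0 = cohom_one X"
| "cup_power X a (Suc n) = cup X 1 n a (cup_power X a n)"

(* The homomorphism from the degree p cohomology of the target of h to that of its domain X. *)
definition induced_hom :: "'a topology \<Rightarrow> ('a \<Rightarrow> 'b) \<Rightarrow> nat \<Rightarrow> 'b cochain set \<Rightarrow> 'a cochain set" where
  "induced_hom X h p b = (\<Union>\<psi>\<in>b. cohom_class X p (\<lambda>xs. \<psi> (map h xs)))"


section \<open>The cohomological index\<close>

definition antipodal_pair :: "'a::uminus \<Rightarrow> 'a set" where
  "antipodal_pair x = {x, - x}"

definition antipodal_quotient :: "'a::uminus topology \<Rightarrow> 'a set topology" where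
  "antipodal_quotient X = topology (\<lambda>U. U \<subseteq> antipodal_pair ` topspace X \<and>
     openin X {x \<in> topspace X. antipodal_pair x \<in> U})"

lemma openin_antipodal_quotient:
  "openin (antipodal_quotient X) U \<longleftrightarrow> U \<subseteq> antipodal_pair ` topspace X \<and>
     openin X {x \<in> topspace X. antipodal_pair x \<in> U}"
proof -
  have "istopology (\<lambda>U. U \<subseteq> antipodal_pair ` topspace X \<and>
     openin X {x \<in> topspace X. antipodal_pair x \<in> U})" (is "istopology ?L")
    unfolding istopology_def
  proof (intro conjI allI impI)
    fix S T assume S: "?L S" and T: "?L T"
    have "{x \<in> topspace X. antipodal_pair x \<in> S \<inter> T} =
        {x \<in> topspace X. antipodal_pair x \<in> S} \<inter> {x \<in> topspace X. antipodal_pair x \<in> T}"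
      by auto
    then show "openin X {x \<in> topspace X. antipodal_pair x \<in> S \<inter> T}"
      using S T by auto
    show "S \<inter> T \<subseteq> antipodal_pair ` topspace X" using S by auto
  next
    fix K assume K: "\<forall>S\<in>K. ?L S"
    have "{x \<in> topspace X. antipodal_pair x \<in> \<Union>K} =
        (\<Union>S\<in>K. {x \<in> topspace X. antipodal_pair x \<in> S})"
      by auto
    then show "openin X {x \<in> topspace X. antipodal_pair x \<in> \<Union>K}"
      using K by auto
    show "\<Union>K \<subseteq> antipodal_pair ` topspace X" using K by auto
  qed
  then show ?thesis
    by (simp add: antipodal_quotient_def topology_inverse')
qed

lemma topspace_antipodal_quotient:
  "topspace (antipodal_quotient X) = antipodal_pair ` topspace X"
proof -
  have "{x \<in> topspace X. antipodal_pair x \<in> antipodal_pair ` topspace X} = topspace X"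
    by auto
  then have "openin (antipodal_quotient X) (antipodal_pair ` topspace X)"
    by (simp add: openin_antipodal_quotient)
  then show ?thesis
    by (metis openin_antipodal_quotient openin_subset openin_topspace subset_antisym)
qed

definition sphere_fin :: "nat \<Rightarrow> (nat \<Rightarrow> real) set" where
  "sphere_fin n = {x. (\<forall>i>n. x i = 0) \<and> (\<Sum>i\<le>n. (x i)\<^sup>2) = 1}"

(* The union of the n-spheres with the colimit (CW) topology. On each sphere_fin n the product
   topology of nat => real is the Euclidean one. *)
definition sphere_inf :: "(nat \<Rightarrow> real) topology" where
  "sphere_inf = topology (\<lambda>U. U \<subseteq> (\<Union>n. sphere_fin n) \<and>
     (\<forall>n. openin (top_of_set (sphere_fin n)) (U \<inter> sphere_fin n)))"

lemma openin_sphere_inf: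
  "openin sphere_inf U \<longleftrightarrow> U \<subseteq> (\<Union>n. sphere_fin n) \<and>
     (\<forall>n. openin (top_of_set (sphere_fin n)) (U \<inter> sphere_fin n))"
proof -
  have "istopology (\<lambda>U. U \<subseteq> (\<Union>n. sphere_fin n) \<and>
     (\<forall>n. openin (top_of_set (sphere_fin n)) (U \<inter> sphere_fin n)))" (is "istopology ?L")
    unfolding istopology_def
  proof (intro conjI allI impI)
    fix S T n assume S: "?L S" and T: "?L T"
    have "(S \<inter> T) \<inter> sphere_fin n = (S \<inter> sphere_fin n) \<inter> (T \<inter> sphere_fin n)"
      by auto
    then show "openin (top_of_set (sphere_fin n)) ((S \<inter> T) \<inter> sphere_fin n)"
      using S T by (metis openin_Int)
  next
    fix S T assume "?L S" "?L T"
    then show "S \<inter> T \<subseteq> (\<Union>n. sphere_fin n)" by auto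
  next
    fix K n assume K: "\<forall>S\<in>K. ?L S"
    have "\<Union>K \<inter> sphere_fin n = (\<Union>S\<in>K. S \<inter> sphere_fin n)"
      by auto
    then show "openin (top_of_set (sphere_fin n)) (\<Union>K \<inter> sphere_fin n)"
      using K by (metis (no_types, lifting) imageE openin_Union)
  next
    fix K assume "\<forall>S\<in>K. ?L S"
    then show "\<Union>K \<subseteq> (\<Union>n. sphere_fin n)" by blast
  qed
  then show ?thesis
    by (simp add: sphere_inf_def topology_inverse')
qed

definition RP_inf :: "(nat \<Rightarrow> real) set topology" where
  "RP_inf = antipodal_quotient sphere_inf"

(* The class omega of degree 1 with H^*(RP^inf) = Z_2[omega]. *)
definition omega :: "(nat \<Rightarrow> real) set cochain set" where
  "omega = (THE w. w \<in> cohomology RP_inf 1 \<and>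
     (\<forall>p. cohomology RP_inf p = {cohom_zero RP_inf p, cup_power RP_inf w p} \<and>
          cup_power RP_inf w p \<noteq> cohom_zero RP_inf p))"

(* h is covered by an equivariant map to the infinite sphere, i.e. it pulls the double cover of
   RP^inf back to the double cover of A/Z_2.  Such h is unique up to homotopy. *)
definition classifying_map ::
    "'a::{topological_space,uminus} set \<Rightarrow> ('a set \<Rightarrow> (nat \<Rightarrow> real) set) \<Rightarrow> bool" where
  "classifying_map A h \<longleftrightarrow>
     continuous_map (antipodal_quotient (top_of_set A)) RP_inf h \<and>
     (\<exists>s. continuous_map (top_of_set A) sphere_inf s \<and>
        (\<forall>u\<in>A. s (- u) = - s u) \<and>
        (\<forall>u\<in>A. h (antipodal_pair u) = antipodal_pair (s u)))"

definition cohom_index :: "'a::{topological_space,uminus} set \<Rightarrow> enat" where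
  "cohom_index A = (if A = {} then 0 else
     Sup {enat m | m. m \<ge> 1 \<and> (\<exists>h. classifying_map A h \<and>
       induced_hom (antipodal_quotient (top_of_set A)) h (m - 1) (cup_power RP_inf omega (m - 1))
         \<noteq> cohom_zero (antipodal_quotient (top_of_set A)) (m - 1))})"


section \<open>The minimax eigenvalues and the equation\<close>

definition I_s :: "Er \<Rightarrow> real" where
  "I_s u = 1 / 2 * (LINT x|lborel. (norm (grad (rep_Er u) x))\<^sup>2)
     + 1 / (16 * pi) * coulomb (\<lambda>x. (rep_Er u x)\<^sup>2) (\<lambda>x. (rep_Er u x)\<^sup>2)"

definition J_s :: "Er \<Rightarrow> real" where
  "J_s u = 1 / 3 * (LINT x|lborel. \<bar>rep_Er u x\<bar> ^ 3)"

definition M_s :: "Er set" where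
  "M_s = {u. I_s u = 1}"

(* The supremum over a given M may be infinite. *)
definition minimax_eigenvalue :: "nat \<Rightarrow> ereal" where
  "minimax_eigenvalue k =
     (INF M \<in> {M. M \<subseteq> M_s \<and> uminus ` M = M \<and> cohom_index M \<ge> enat k}.
        SUP u \<in> M. ereal (1 / J_s u))"

definition solution :: "(real \<Rightarrow> real) \<Rightarrow> Er \<Rightarrow> bool" where
  "solution f u \<longleftrightarrow> (\<forall>v :: Er.
     (LINT x|lborel. grad (rep_Er u) x \<bullet> grad (rep_Er v) x)
       + 1 / (4 * pi) * coulomb (\<lambda>x. (rep_Er u x)\<^sup>2) (\<lambda>y. rep_Er u y * rep_Er v y)
     = (LINT x|lborel. f (rep_Er u x) * rep_Er v x))"

end

theory Submission
  imports Defs "HOL-Complex_Analysis.Great_Picard" "HOL-Real_Asymp.Real_Asymp"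
begin

text \<open>
Two solutions of opposite sign are found by minimisation. For \<open>\<sigma> = 1\<close> and \<open>\<sigma> = -1\<close> let \<open>fe\<close> be the
odd function that equals \<open>\<sigma> * f (\<sigma> * t)\<close> for \<open>t \<ge> 0\<close>, let \<open>F\<close> be its even primitive, and let
\<open>Phi u = energy u - \<integral> F (u x) dx\<close>, where \<open>energy\<close> is the functional \<open>I_s\<close>. Replacing \<open>u\<close> by \<open>\<bar>u\<bar>\<close> leaves
the integral of \<open>F\<close> unchanged and does not increase the energy, so \<open>Phi\<close> can be minimised by a function
\<open>v \<ge> 0\<close>. The Euler equation of \<open>v\<close> sees \<open>fe\<close> only at nonnegative values, and it says that \<open>\<sigma> v\<close> solves
the original equation. If the minimum is negative, then \<open>\<sigma> v\<close> is nonzero, and the two signs give two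
distinct nontrivial solutions; this proves (i) and (ii) together.

The scaling \<open>t\<^sup>2 * u (t *\<^sub>R x)\<close> multiplies the energy and the integral of \<open>\<bar>u\<bar>\<^sup>3\<close> by \<open>t\<^sup>3\<close>, and the integral of
\<open>\<bar>u\<bar> powr q\<close> by \<open>t powr (2 * q - 3)\<close>. For \<open>q < 3\<close> this makes the integral of \<open>F\<close> sublinear in the energy, so that
\<open>Phi\<close> is coercive (\<open>Lq_coercive\<close>, \<open>Phi_coercive\<close>). At small scales it makes \<open>Phi\<close> negative:
a set of positive index is nonempty, so if \<open>l\<close> exceeds a minimax eigenvalue, there is \<open>v\<close> with \<open>I_s v = 1\<close> and
\<open>l * J_s v > 1\<close> (\<open>supercritical_direction\<close>), and along the rescalings of \<open>v\<close> the functional is at most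
\<open>t\<^sup>3 * (1 - l * J_s v)\<close> plus terms of order \<open>t powr (2 * q - 3)\<close> with \<open>q > 3\<close> (\<open>Phi_negative\<close>).

The minimum is attained for the following reasons. A radial function is the flux integral of its gradient over
the exterior of a ball (\<open>radial_representation\<close>), which bounds it by a multiple of \<open>\<bar>x\<bar> powr (-1/2)\<close> and gives
it a modulus of continuity away from the origin. Together with the bound for the mass in balls that the Coulomb energy
provides, this improves the decay at infinity to \<open>\<bar>x\<bar> powr (-7/8)\<close> (\<open>Er_profile_decay\<close>), and the tails of the
integral of \<open>\<bar>u\<bar> powr q\<close> are uniformly small as soon as \<open>7/8 * (q - 2) > 1/2\<close>, that is, \<open>q > 18/7\<close>
(\<open>Lq_tail\<close>). A minimising sequence therefore has a subsequence whose absolute values converge pointwise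
(\<open>Er_compactness\<close>) and along which the integrals of \<open>F\<close> converge (\<open>potential_converges\<close>). The Coulomb energy is lower
semicontinuous by Fatou's lemma. So is the Dirichlet integral, because a bound for it amounts
to a bound for all difference quotients (\<open>diff_energy_le\<close>, \<open>weak_gradient_of_diff_energy\<close>), and the same
characterisation shows that passing to \<open>\<bar>u\<bar>\<close> does not increase it. Differentiating the Coulomb energy
requires mixed Coulomb integrals to be finite; \<open>nn_coulomb_mixed\<close> proves this by writing \<open>1 / \<bar>x - y\<bar>\<close>, up to constant
factors, as a superposition of indicators of balls.
\<close>


section \<open>Smooth functions and test functions\<close>

subsection \<open>One variable\<close>

text \<open>The analogue for one variable of \<open>Ck\<close>: \<open>n\<close> times continuously differentiable on the whole line.\<close>
fun Dk :: "nat \<Rightarrow> (real \<Rightarrow> real) \<Rightarrow> bool" where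
  "Dk 0 f \<longleftrightarrow> continuous_on UNIV f"
| "Dk (Suc n) f \<longleftrightarrow> (\<exists>f'. (\<forall>x. (f has_real_derivative f' x) (at x)) \<and> Dk n f')"

lemma Dk_Suc_D: "Dk (Suc n) f \<Longrightarrow> Dk n f"
proof (induction n arbitrary: f)
  case 0
  then obtain f' where "\<And>x. (f has_real_derivative f' x) (at x)" by auto
  then have "isCont f x" for x by (rule DERIV_isCont)
  then show ?case by (simp add: continuous_at_imp_continuous_on)
next
  case (Suc n)
  then obtain f' where "\<forall>x. (f has_real_derivative f' x) (at x)" "Dk (Suc n) f'"
    unfolding Dk.simps(2)[of "Suc n" f] by auto
  then show ?case using Suc.IH unfolding Dk.simps(2)[of n f] by auto
qed

lemma Dk_continuous: "Dk n f \<Longrightarrow> continuous_on UNIV f"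
  by (induction n) (use Dk_Suc_D in \<open>auto simp del: Dk.simps(2)\<close>)

lemma Dk_const: "Dk n (\<lambda>x. c)"
proof (induction n arbitrary: c)
  case (Suc n)
  then show ?case by (auto intro!: exI[of _ "\<lambda>x. 0"])
qed auto

lemma Dk_ident: "Dk n (\<lambda>x. x)"
  by (cases n) (auto intro!: exI[of _ "\<lambda>x. 1"] Dk_const continuous_intros)

lemma Dk_add: "Dk n f \<Longrightarrow> Dk n g \<Longrightarrow> Dk n (\<lambda>x. f x + g x)"
proof (induction n arbitrary: f g)
  case 0
  then show ?case by (auto intro!: continuous_intros)
next
  case (Suc n)
  then obtain f' g' where "\<forall>x. (f has_real_derivative f' x) (at x)" "Dk n f'"
    "\<forall>x. (g has_real_derivative g' x) (at x)" "Dk n g'" by auto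
  then show ?case
    using Suc.IH by (auto intro!: exI[of _ "\<lambda>x. f' x + g' x"] derivative_eq_intros)
qed

lemma Dk_mult: "Dk n f \<Longrightarrow> Dk n g \<Longrightarrow> Dk n (\<lambda>x. f x * g x)"
proof (induction n arbitrary: f g)
  case 0
  then show ?case by (auto intro!: continuous_intros)
next
  case (Suc n)
  then obtain f' g' where d: "\<forall>x. (f has_real_derivative f' x) (at x)" "Dk n f'"
    "\<forall>x. (g has_real_derivative g' x) (at x)" "Dk n g'" by auto
  have "Dk n (\<lambda>x. f' x * g x + f x * g' x)"
    using d Suc.IH Suc.prems by (intro Dk_add) (auto dest: Dk_Suc_D simp del: Dk.simps(2))
  then show ?case
    using d by (auto intro!: exI[of _ "\<lambda>x. f' x * g x + f x * g' x"] derivative_eq_intros)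
qed

lemma Dk_compose: "Dk n f \<Longrightarrow> Dk n g \<Longrightarrow> Dk n (\<lambda>x. f (g x))"
proof (induction n arbitrary: f g)
  case 0
  then show ?case
    using continuous_on_compose2[of UNIV f UNIV g] by auto
next
  case (Suc n)
  then obtain f' g' where d: "\<forall>x. (f has_real_derivative f' x) (at x)" "Dk n f'"
    "\<forall>x. (g has_real_derivative g' x) (at x)" "Dk n g'" by auto
  have "Dk n (\<lambda>x. f' (g x) * g' x)"
    using d Suc.IH Suc.prems by (intro Dk_mult) (auto dest: Dk_Suc_D simp del: Dk.simps(2))
  moreover have "((\<lambda>x. f (g x)) has_real_derivative f' (g x) * g' x) (at x)" for x
    by (rule DERIV_chain2) (use d in auto)
  ultimately show ?case
    by (auto intro!: exI[of _ "\<lambda>x. f' (g x) * g' x"])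
qed

lemma Dk_exp: "Dk n exp"
  by (induction n) (auto intro!: exI[of _ exp] continuous_intros)

text \<open>The factor \<open>t powr a\<close> makes the span of this family closed under differentiation, so that smoothness of all
members follows by one induction.\<close>
definition flat :: "real \<Rightarrow> real \<Rightarrow> real" where
  "flat a t = (if t > 0 then t powr a * exp (- 1 / t) else 0)"

lemma flat_nonneg: "flat a t \<ge> 0"
  by (simp add: flat_def)

text \<open>At the origin the difference quotient vanishes in the limit because \<open>exp (- 1 / t)\<close> beats every power of \<open>t\<close>.\<close>
lemma flat_derivative:
  "(flat a has_real_derivative a * flat (a - 1) t + flat (a - 2) t) (at t)"
proof -
  consider "t < 0" | "t = 0" | "t > 0" by linarith
  then show ?thesis
  proof cases
    case 1
    have "((\<lambda>_. 0) has_real_derivative 0) (at t)" by simp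
    then have "(flat a has_real_derivative 0) (at t)"
      by (rule has_field_derivative_transform_within_open[where S="{..<0}"])
        (use 1 in \<open>auto simp: flat_def\<close>)
    then show ?thesis using 1 by (simp add: flat_def)
  next
    case 2
    have r: "((\<lambda>h. h powr (a - 1) * exp (- 1 / h)) \<longlongrightarrow> 0) (at_right (0::real))"
      by real_asymp
    have "((\<lambda>h. flat a h / h) \<longlongrightarrow> 0) (at_right 0)"
      by (rule Lim_transform_eventually[OF r])
        (auto simp: eventually_at_filter flat_def powr_diff intro!: always_eventually)
    moreover have "((\<lambda>h. flat a h / h) \<longlongrightarrow> 0) (at_left 0)"
      by (rule tendsto_eventually) (auto simp: eventually_at_filter flat_def intro!: always_eventually)
    ultimately have "((\<lambda>h. flat a h / h) \<longlongrightarrow> 0) (at 0)"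
      by (simp add: filterlim_split_at)
    then show ?thesis
      using 2 by (simp add: has_field_derivative_iff flat_def)
  next
    case 3
    have "((\<lambda>t. t powr a * exp (- 1 / t)) has_real_derivative
        a * flat (a - 1) t + flat (a - 2) t) (at t)"
      using 3 by (auto intro!: derivative_eq_intros simp: flat_def powr_diff field_simps power2_eq_square)
    then show ?thesis
      by (rule has_field_derivative_transform_within_open[where S="{0<..}"])
        (use 3 in \<open>auto simp: flat_def\<close>)
  qed
qed

lemma Dk_flat: "Dk n (flat a)"
proof (induction n arbitrary: a)
  case 0
  have "isCont (flat a) x" for x by (rule DERIV_isCont[OF flat_derivative])
  then show ?case by (simp add: continuous_at_imp_continuous_on)
next
  case (Suc n)
  have "Dk n (\<lambda>t. a * flat (a - 1) t + flat (a - 2) t)"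
    by (intro Dk_add Dk_mult Dk_const Suc)
  then show ?case using flat_derivative by (auto intro!: exI[of _ "\<lambda>t. a * flat (a - 1) t + flat (a - 2) t"])
qed

definition bump1 :: "real \<Rightarrow> real \<Rightarrow> real \<Rightarrow> real" where
  "bump1 a b t = flat 0 (t - a) * flat 0 (b - t)"

lemma bump1_nonneg: "bump1 a b t \<ge> 0"
  by (simp add: bump1_def flat_nonneg)

lemma bump1_pos: "bump1 a b t > 0 \<longleftrightarrow> a < t \<and> t < b"
  by (simp add: bump1_def flat_def)

lemma bump1_eq_0: "bump1 a b t = 0 \<longleftrightarrow> \<not> (a < t \<and> t < b)"
  by (auto simp: bump1_def flat_def)

lemma Dk_bump1: "Dk n (bump1 a b)"
proof -
  have "Dk n (\<lambda>t. flat 0 (t + - a) * flat 0 (b + (- 1) * t))"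
    by (intro Dk_mult Dk_compose[OF Dk_flat] Dk_add Dk_ident Dk_const)
  then show ?thesis by (simp add: bump1_def[abs_def])
qed

text \<open>For \<open>s \<ge> 0\<close> these functions increase with \<open>n\<close> to the indicator of \<open>s > 0\<close>. Composed with a smooth bump they give
smooth functions supported in a fixed box that converge to its indicator.\<close>
definition stepf :: "nat \<Rightarrow> real \<Rightarrow> real" where
  "stepf n s = 1 - exp (- (real n * s))"

lemma stepf_bounds: "s \<ge> 0 \<Longrightarrow> 0 \<le> stepf n s \<and> stepf n s \<le> 1"
  by (auto simp: stepf_def)

lemma stepf_0 [simp]: "stepf n 0 = 0"
  by (simp add: stepf_def)

lemma stepf_tendsto:
  assumes "s \<ge> 0"
  shows "(\<lambda>n. stepf n s) \<longlonglongrightarrow> (if s > 0 then 1 else 0)"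
proof (cases "s > 0")
  case True
  then have "(\<lambda>n. 1 - exp (- (real n * s))) \<longlonglongrightarrow> 1 - 0"
    by (intro tendsto_intros) real_asymp
  then show ?thesis using True by (simp add: stepf_def)
qed (use assms in \<open>simp add: stepf_def\<close>)

lemma Dk_stepf: "Dk k (stepf n)"
proof -
  have "Dk k (\<lambda>s. 1 + (- 1) * exp (- real n * s))"
    by (intro Dk_mult Dk_compose[OF Dk_exp] Dk_add Dk_ident Dk_const)
  then show ?thesis by (simp add: stepf_def[abs_def])
qed

lemma deriv_zero_of_locally_zero:
  fixes f :: "real \<Rightarrow> real"
  assumes "(f has_real_derivative d) (at t)" "open S" "t \<in> S" "\<And>s. s \<in> S \<Longrightarrow> f s = 0"
  shows "d = 0"
proof -
  have "((\<lambda>_. 0) has_real_derivative 0) (at t)" by simp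
  then have "(f has_real_derivative 0) (at t)"
    by (rule has_field_derivative_transform_within_open[where S=S]) (use assms in auto)
  then show ?thesis using assms(1) DERIV_unique by blast
qed

text \<open>The power is not smooth at the origin, but \<open>f\<close> vanishes near there.\<close>
lemma Dk_powr_mult:
  assumes "a > 0"
  shows "Dk n f \<Longrightarrow> (\<And>t. t < a \<Longrightarrow> f t = 0) \<Longrightarrow> Dk n (\<lambda>t. t powr p * f t)"
proof (induction n arbitrary: f p)
  case 0
  have "isCont (\<lambda>t. t powr p * f t) t" for t
  proof (cases "t > 0")
    case True
    then show ?thesis using 0
      by (auto intro!: continuous_intros simp: continuous_on_eq_continuous_at)
  next
    case False
    have "isCont (\<lambda>t. t powr p * f t) t \<longleftrightarrow> isCont (\<lambda>t. 0::real) t"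
      by (rule isCont_cong, rule eventually_nhds_in_open[of "{..<a}", THEN eventually_mono])
        (use False assms 0 in auto)
    then show ?thesis by simp
  qed
  then show ?case by (simp add: continuous_at_imp_continuous_on)
next
  case (Suc n)
  then obtain f' where f': "\<And>x. (f has_real_derivative f' x) (at x)" "Dk n f'" by auto
  have z: "f' t = 0" if "t < a" for t
    by (rule deriv_zero_of_locally_zero[OF f'(1), of "{..<a}"]) (use that Suc.prems in auto)
  have "((\<lambda>t. t powr p * f t) has_real_derivative p * (t powr (p - 1) * f t) + t powr p * f' t) (at t)" for t
  proof (cases "t > 0")
    case True
    then show ?thesis
      by (auto intro!: derivative_eq_intros f')
  next
    case False
    have "((\<lambda>_. 0) has_real_derivative 0) (at t)" by simp
    then have "((\<lambda>t. t powr p * f t) has_real_derivative 0) (at t)"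
      by (rule has_field_derivative_transform_within_open[where S="{..<a}"]) (use False assms Suc.prems in auto)
    then show ?thesis using z[of t] Suc.prems(2)[of t] False assms by simp
  qed
  moreover have "Dk n (\<lambda>t. p * (t powr (p - 1) * f t) + t powr p * f' t)"
    using Suc.prems by (intro Dk_add Dk_mult Dk_const Suc.IH f' z) (auto dest: Dk_Suc_D simp del: Dk.simps(2))
  ultimately show ?case
    by (auto intro!: exI[of _ "\<lambda>t. p * (t powr (p - 1) * f t) + t powr p * f' t"])
qed

subsection \<open>Three variables\<close>

text \<open>The \<open>i\<close>-th partial derivative, in the form in which it occurs in the definition of weak gradients.\<close>
abbreviation pd :: "(R3 \<Rightarrow> real) \<Rightarrow> 3 \<Rightarrow> R3 \<Rightarrow> real" where
  "pd \<phi> i x \<equiv> frechet_derivative \<phi> (at x) (axis i 1)"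

lemma Ck_SucI:
  assumes "\<And>x. (\<phi> has_derivative D x) (at x)" "\<And>i. Ck n (\<lambda>x. D x (axis i 1))"
  shows "Ck (Suc n) \<phi>"
proof -
  have "frechet_derivative \<phi> (at x) = D x" for x
    by (rule frechet_derivative_at[OF assms(1), symmetric])
  then show ?thesis using assms by (auto simp: differentiable_def)
qed

lemma Ck_Suc_has_derivative: "Ck (Suc n) \<phi> \<Longrightarrow> (\<phi> has_derivative frechet_derivative \<phi> (at x)) (at x)"
  by (simp add: frechet_derivative_works)

lemma Ck_Suc_D: "Ck (Suc n) f \<Longrightarrow> Ck n f"
proof (induction n arbitrary: f)
  case 0
  then show ?case
    by (auto intro!: continuous_at_imp_continuous_on differentiable_imp_continuous_within)
next
  case (Suc n)
  then show ?case by auto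
qed

lemma Ck_continuous: "Ck n f \<Longrightarrow> continuous_on UNIV f"
  by (induction n) (use Ck_Suc_D in \<open>auto simp del: Ck.simps(2)\<close>)

lemma Ck_const: "Ck n (\<lambda>x. c)"
proof (induction n arbitrary: c)
  case (Suc n)
  show ?case by (rule Ck_SucI[where D="\<lambda>x h. 0"]) (use Suc in auto)
qed auto

lemma Ck_coord: "Ck n (\<lambda>x. x $ i)"
proof (cases n)
  case (Suc m)
  show ?thesis unfolding Suc
    by (rule Ck_SucI[where D="\<lambda>x h. h $ i"])
      (auto intro!: Ck_const bounded_linear_imp_has_derivative bounded_linear_vec_nth)
qed (auto intro!: continuous_intros)

lemma Ck_add: "Ck n f \<Longrightarrow> Ck n g \<Longrightarrow> Ck n (\<lambda>x. f x + g x)"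
proof (induction n arbitrary: f g)
  case 0
  then show ?case by (auto intro!: continuous_intros)
next
  case (Suc n)
  show ?case
    by (rule Ck_SucI[OF has_derivative_add[OF Suc.prems[THEN Ck_Suc_has_derivative]]])
      (use Suc in auto)
qed

lemma Ck_mult: "Ck n f \<Longrightarrow> Ck n g \<Longrightarrow> Ck n (\<lambda>x. f x * g x)"
proof (induction n arbitrary: f g)
  case 0
  then show ?case by (auto intro!: continuous_intros)
next
  case (Suc n)
  have c: "Ck n f" "Ck n g" using Suc.prems Ck_Suc_D by blast+
  show ?case
    by (rule Ck_SucI[OF has_derivative_mult[OF Suc.prems[THEN Ck_Suc_has_derivative]]])
      (use Suc c in \<open>auto intro!: Ck_add\<close>)
qed

lemma Ck_sum: "finite I \<Longrightarrow> (\<And>i. i \<in> I \<Longrightarrow> Ck n (f i)) \<Longrightarrow> Ck n (\<lambda>x. \<Sum>i\<in>I. f i x)"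
  by (induction I rule: finite_induct) (auto intro!: Ck_const Ck_add)

lemma Ck_prod: "finite I \<Longrightarrow> (\<And>i. i \<in> I \<Longrightarrow> Ck n (f i)) \<Longrightarrow> Ck n (\<lambda>x. \<Prod>i\<in>I. f i x)"
  by (induction I rule: finite_induct) (auto intro!: Ck_const Ck_mult)

lemma has_derivative_compose_real:
  assumes "(f has_real_derivative f') (at (g x))" "(g has_derivative G) (at x)"
  shows "((\<lambda>x. f (g x)) has_derivative (\<lambda>h. f' * G h)) (at x)"
  using has_derivative_compose[OF assms(2), of f "(*) f'"] assms(1)
  by (simp add: has_field_derivative_def)

lemma Ck_compose: "Dk n f \<Longrightarrow> Ck n g \<Longrightarrow> Ck n (\<lambda>x. f (g x))"
proof (induction n arbitrary: f g)
  case 0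
  then show ?case
    using continuous_on_compose2[of UNIV f UNIV g] by auto
next
  case (Suc n)
  then obtain f' where d: "\<And>x. (f has_real_derivative f' x) (at x)" "Dk n f'" by auto
  show ?case
  proof (rule Ck_SucI[where D="\<lambda>x h. f' (g x) * frechet_derivative g (at x) h"])
    show "((\<lambda>x. f (g x)) has_derivative (\<lambda>h. f' (g x) * frechet_derivative g (at x) h)) (at x)" for x
      by (rule has_derivative_compose_real[OF d(1) Ck_Suc_has_derivative[OF Suc.prems(2)]])
    have "Ck n (\<lambda>x. f' (g x))"
      by (rule Suc.IH[OF d(2) Ck_Suc_D[OF Suc.prems(2)]])
    then show "Ck n (\<lambda>x. f' (g x) * pd g i x)" for i
      using Suc.prems(2) by (intro Ck_mult) auto
  qed
qed

lemma has_derivative_translate: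
  fixes \<phi> :: "R3 \<Rightarrow> real"
  assumes "(\<phi> has_derivative D) (at (x + a))"
  shows "((\<lambda>x. \<phi> (x + a)) has_derivative D) (at x)"
proof -
  have "((\<lambda>x. x + a) has_derivative (\<lambda>h. h)) (at x)"
    by (auto intro!: derivative_eq_intros)
  from has_derivative_compose[OF this assms] show ?thesis by simp
qed

lemma Ck_translate: "Ck n f \<Longrightarrow> Ck n (\<lambda>x. f (x + a))"
proof (induction n arbitrary: f)
  case 0
  then show ?case
    using continuous_on_compose2[of UNIV f UNIV "\<lambda>x. x + a"]
    by (auto simp: continuous_on_add continuous_on_id continuous_on_const)
next
  case (Suc n)
  show ?case
  proof (rule Ck_SucI[where D="\<lambda>x. frechet_derivative f (at (x + a))"])
    show "((\<lambda>x. f (x + a)) has_derivative frechet_derivative f (at (x + a))) (at x)" for x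
      by (rule has_derivative_translate[OF Ck_Suc_has_derivative[OF Suc.prems]])
    show "Ck n (\<lambda>x. pd f i (x + a))" for i
      by (rule Suc.IH[of "\<lambda>x. pd f i x"]) (use Suc.prems in simp)
  qed
qed

lemma test_functionI:
  assumes "\<And>n. Ck n \<phi>" "\<And>x. \<phi> x \<noteq> 0 \<Longrightarrow> x \<in> S" "compact S"
  shows "test_function \<phi>"
proof -
  have "closure {x. \<phi> x \<noteq> 0} \<subseteq> S"
    using assms by (intro closure_minimal compact_imp_closed) auto
  then show ?thesis
    using assms compact_Int_closed[OF assms(3), of "closure {x. \<phi> x \<noteq> 0}"]
    by (auto simp: test_function_def Int_absorb1)
qed

lemma test_function_has_derivative:
  "test_function \<phi> \<Longrightarrow> (\<phi> has_derivative frechet_derivative \<phi> (at x)) (at x)"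
  unfolding test_function_def using Ck_Suc_has_derivative by blast

lemma test_function_continuous: "test_function \<phi> \<Longrightarrow> continuous_on UNIV \<phi>"
  unfolding test_function_def using Ck_continuous by blast

lemma test_function_pd_continuous: 
  assumes "test_function \<phi>"
  shows "continuous_on UNIV (pd \<phi> i)"
proof -
  have "Ck (Suc 0) \<phi>" using assms unfolding test_function_def by blast
  then show ?thesis by simp
qed

lemma test_function_measurable [measurable_dest]: "test_function \<phi> \<Longrightarrow> \<phi> \<in> borel_measurable borel"
  by (simp add: test_function_continuous borel_measurable_continuous_onI)

lemma test_function_pd_measurable: "test_function \<phi> \<Longrightarrow> pd \<phi> i \<in> borel_measurable borel"
  using test_function_pd_continuous borel_measurable_continuous_onI by blast

lemma test_function_translate:
  assumes "test_function \<phi>"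
  shows "test_function (\<lambda>x. \<phi> (x + a))" "pd (\<lambda>x. \<phi> (x + a)) i x = pd \<phi> i (x + a)"
proof -
  let ?S = "(\<lambda>x. x - a) ` closure {x. \<phi> x \<noteq> 0}"
  have "compact ?S"
    using assms unfolding test_function_def
    by (intro compact_continuous_image continuous_intros) auto
  moreover have "x \<in> ?S" if "\<phi> (x + a) \<noteq> 0" for x
    using that closure_subset[of "{x. \<phi> x \<noteq> 0}"] by (intro image_eqI[of _ _ "x + a"]) auto
  ultimately show "test_function (\<lambda>x. \<phi> (x + a))"
    using assms by (intro test_functionI[where S="(\<lambda>x. x - a) ` closure {x. \<phi> x \<noteq> 0}"] Ck_translate) (auto simp: test_function_def)
  show "pd (\<lambda>x. \<phi> (x + a)) i x = pd \<phi> i (x + a)"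
    using frechet_derivative_at[OF has_derivative_translate[OF test_function_has_derivative[OF assms]], of x a]
    by simp
qed

lemma test_function_bounds:
  assumes "test_function \<phi>"
  obtains M R where "M \<ge> 0" "R > 0" "\<And>x. \<bar>\<phi> x\<bar> \<le> M" "\<And>x i. \<bar>pd \<phi> i x\<bar> \<le> M"
    "\<And>x. norm x > R \<Longrightarrow> \<phi> x = 0" "\<And>x i. norm x > R \<Longrightarrow> pd \<phi> i x = 0"
proof -
  let ?K = "closure {x. \<phi> x \<noteq> 0}"
  have K: "compact ?K" using assms by (simp add: test_function_def)
  then obtain R where R: "R > 0" "\<And>x. x \<in> ?K \<Longrightarrow> norm x \<le> R"
    using compact_imp_bounded[OF K] bounded_pos by blast
  have z: "\<phi> x = 0" if "norm x > R" for x
    using R(2)[of x] that closure_subset[of "{x. \<phi> x \<noteq> 0}"] by force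
  have z': "pd \<phi> i x = 0" if "norm x > R" for x i
  proof -
    have "((\<lambda>_. 0) has_derivative (\<lambda>h. 0)) (at x)" by simp
    then have "(\<phi> has_derivative (\<lambda>h. 0)) (at x)"
      by (rule has_derivative_transform_within_open[where s="- cball 0 R"]) (use that z in auto)
    from frechet_derivative_at[OF this, symmetric] show ?thesis by simp
  qed
  have b: "\<exists>M\<ge>0. \<forall>x. \<bar>f x\<bar> \<le> M"
    if f: "continuous_on UNIV f" "\<And>x. norm x > R \<Longrightarrow> f x = 0" for f :: "R3 \<Rightarrow> real"
  proof -
    have "compact (f ` cball 0 R)"
      by (intro compact_continuous_image continuous_on_subset[OF f(1)]) auto
    then obtain M where M: "M > 0" "\<And>y. y \<in> f ` cball 0 R \<Longrightarrow> \<bar>y\<bar> \<le> M"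
      using compact_imp_bounded bounded_pos by (metis real_norm_def)
    have "\<bar>f x\<bar> \<le> M" for x
      using M f(2)[of x] by (cases "norm x \<le> R") auto
    then show ?thesis using M(1) by (intro exI[of _ M]) auto
  qed
  obtain M0 where M0: "M0 \<ge> 0" "\<And>x. \<bar>\<phi> x\<bar> \<le> M0"
    using b[OF test_function_continuous[OF assms] z] by auto
  obtain M1 where M1: "\<And>i. M1 i \<ge> 0" "\<And>i x. \<bar>pd \<phi> i x\<bar> \<le> M1 i"
    using b[OF test_function_pd_continuous[OF assms] z'] by metis
  have "\<bar>pd \<phi> i x\<bar> \<le> M0 + (\<Sum>i\<in>UNIV. M1 i)" for i x
  proof -
    have "\<bar>pd \<phi> i x\<bar> \<le> M1 i" by (rule M1(2))
    also have "\<dots> \<le> (\<Sum>i\<in>UNIV. M1 i)" by (rule member_le_sum) (auto intro: M1(1))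
    finally show ?thesis using M0(1) by linarith
  qed
  moreover have "\<bar>\<phi> x\<bar> \<le> M0 + (\<Sum>i\<in>UNIV. M1 i)" for x
    using M0(2)[of x] sum_nonneg[of UNIV M1, OF M1(1)] by linarith
  ultimately show ?thesis
    using R z z' M0(1) M1(1) by (intro that[of "M0 + (\<Sum>i\<in>UNIV. M1 i)" R]) (auto intro!: add_nonneg_nonneg sum_nonneg)
qed

definition box_approx :: "R3 \<Rightarrow> R3 \<Rightarrow> nat \<Rightarrow> R3 \<Rightarrow> real" where
  "box_approx a b n x = stepf n (\<Prod>i\<in>UNIV. bump1 (a $ i) (b $ i) (x $ i))"

lemma box_approx_bounds: "0 \<le> box_approx a b n x \<and> box_approx a b n x \<le> 1"
  unfolding box_approx_def by (intro stepf_bounds prod_nonneg) (simp add: bump1_nonneg)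

lemma box_approx_outside: "x \<notin> box a b \<Longrightarrow> box_approx a b n x = 0"
proof -
  assume "x \<notin> box a b"
  then obtain i where "bump1 (a $ i) (b $ i) (x $ i) = 0"
    by (auto simp: mem_box_cart bump1_eq_0)
  then have "(\<Prod>i\<in>UNIV. bump1 (a $ i) (b $ i) (x $ i)) = 0"
    by (intro prod_zero) auto
  then show ?thesis by (simp only: box_approx_def stepf_0)
qed

lemma box_approx_tendsto: "(\<lambda>n. box_approx a b n x) \<longlonglongrightarrow> indicator (box a b) x"
proof -
  have "(\<Prod>i\<in>UNIV. bump1 (a $ i) (b $ i) (x $ i)) > 0 \<longleftrightarrow> x \<in> box a b"
  proof
    assume p: "(\<Prod>i\<in>UNIV. bump1 (a $ i) (b $ i) (x $ i)) > 0"
    have "bump1 (a $ i) (b $ i) (x $ i) \<noteq> 0" for i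
    proof
      assume "bump1 (a $ i) (b $ i) (x $ i) = 0"
      then have "(\<Prod>i\<in>UNIV. bump1 (a $ i) (b $ i) (x $ i)) = 0"
        by (intro prod_zero) auto
      then show False using p by linarith
    qed
    then show "x \<in> box a b" by (auto simp: mem_box_cart bump1_eq_0)
  next
    assume "x \<in> box a b"
    then show "(\<Prod>i\<in>UNIV. bump1 (a $ i) (b $ i) (x $ i)) > 0"
      by (intro prod_pos) (auto simp: mem_box_cart bump1_pos)
  qed
  then show ?thesis
    using stepf_tendsto[of "\<Prod>i\<in>UNIV. bump1 (a $ i) (b $ i) (x $ i)"]
    by (auto simp: box_approx_def indicator_def prod_nonneg bump1_nonneg)
qed

lemma test_function_box_approx: "test_function (box_approx a b n)"
proof (rule test_functionI[where S="cbox a b"])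
  show "Ck k (box_approx a b n)" for k
    unfolding box_approx_def[abs_def]
    by (intro Ck_compose[OF Dk_stepf] Ck_prod Ck_compose[OF Dk_bump1] Ck_coord) auto
  show "x \<in> cbox a b" if "box_approx a b n x \<noteq> 0" for x
    using that box_approx_outside[of x a b n] box_subset_cbox by blast
qed auto

text \<open>Testing a weak gradient with the fields \<open>\<theta> (\<bar>x\<bar>\<^sup>2) * x\<close> extracts its radial part; these are
their components and the diagonal of their Jacobian.\<close>
lemma radial_test_function:
  fixes \<theta> :: "real \<Rightarrow> real"
  assumes smooth: "\<And>n. Dk n \<theta>" and supp: "\<And>t. t > b \<Longrightarrow> \<theta> t = 0"
    and deriv: "\<And>t. (\<theta> has_real_derivative \<theta>' t) (at t)"
  shows "test_function (\<lambda>x::R3. \<theta> (x \<bullet> x) * x $ i)"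
    "pd (\<lambda>x::R3. \<theta> (x \<bullet> x) * x $ i) i x = 2 * \<theta>' (x \<bullet> x) * (x $ i)\<^sup>2 + \<theta> (x \<bullet> x)"
proof -
  show "test_function (\<lambda>x::R3. \<theta> (x \<bullet> x) * x $ i)"
  proof (rule test_functionI[where S="cball 0 (sqrt b)"])
    show "Ck n (\<lambda>x::R3. \<theta> (x \<bullet> x) * x $ i)" for n
    proof -
      have "Ck n (\<lambda>x::R3. x \<bullet> x)"
        unfolding inner_vec_def inner_real_def by (intro Ck_sum Ck_mult Ck_coord) auto
      then show ?thesis by (intro Ck_mult Ck_compose[OF smooth] Ck_coord)
    qed
    show "x \<in> cball 0 (sqrt b)" if "\<theta> (x \<bullet> x) * x $ i \<noteq> 0" for x :: R3
    proof -
      have "x \<bullet> x \<le> b" using supp[of "x \<bullet> x"] that by fastforce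
      then show ?thesis by (simp add: norm_eq_sqrt_inner)
    qed
  qed auto
  have "((\<lambda>x::R3. x \<bullet> x) has_derivative (\<lambda>h. x \<bullet> h + h \<bullet> x)) (at x)"
    by (auto intro!: derivative_eq_intros)
  from has_derivative_mult[OF has_derivative_compose_real[OF deriv this]
      bounded_linear_imp_has_derivative[OF bounded_linear_vec_nth[of i]]]
  have "((\<lambda>x::R3. \<theta> (x \<bullet> x) * x $ i) has_derivative
     (\<lambda>h. \<theta> (x \<bullet> x) * h $ i + \<theta>' (x \<bullet> x) * (x \<bullet> h + h \<bullet> x) * x $ i)) (at x)" .
  from frechet_derivative_at[OF this, symmetric] show "pd (\<lambda>x::R3. \<theta> (x \<bullet> x) * x $ i) i x = 2 * \<theta>' (x \<bullet> x) * (x $ i)\<^sup>2 + \<theta> (x \<bullet> x)"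
    by (simp add: inner_axis inner_axis' power2_eq_square)
qed


section \<open>Weak gradients\<close>

subsection \<open>The fundamental lemma and uniqueness\<close>

text \<open>The positive and the negative part of \<open>h\<close> are densities of measures that agree on the intersection-stable
generator of boxes, hence everywhere.\<close>
lemma AE_zero_of_box_integrals:
  fixes h :: "'a::euclidean_space \<Rightarrow> real"
  assumes [measurable]: "h \<in> borel_measurable borel"
    and int: "\<And>a b. integrable lborel (\<lambda>x. indicator (box a b) x * h x)"
    and zero: "\<And>a b. (LINT x|lborel. indicator (box a b) x * h x) = 0"
  shows "AE x in lborel. h x = 0"
proof -
  let ?P = "density lborel (\<lambda>x. ennreal (h x))" and ?Q = "density lborel (\<lambda>x. ennreal (- h x))"
  have eqI: "s = t" if "enn2real s = enn2real t" "s \<noteq> \<infinity>" "t \<noteq> \<infinity>" for s t :: ennreal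
    using that by (cases s; cases t) auto
  have e: "emeasure ?P (box a b) = emeasure ?Q (box a b) \<and> emeasure ?P (box a b) \<noteq> \<infinity>" for a b
  proof -
    let ?f = "\<lambda>x. indicator (box a b) x * h x"
    have P: "emeasure ?P (box a b) = (\<integral>\<^sup>+ x. ennreal (?f x) \<partial>lborel)"
      by (subst emeasure_density) (auto intro!: nn_integral_cong split: split_indicator)
    have Q: "emeasure ?Q (box a b) = (\<integral>\<^sup>+ x. ennreal (- ?f x) \<partial>lborel)"
      by (subst emeasure_density) (auto intro!: nn_integral_cong split: split_indicator)
    have f: "(\<integral>\<^sup>+ x. ennreal (?f x) \<partial>lborel) \<noteq> \<infinity>" "(\<integral>\<^sup>+ x. ennreal (- ?f x) \<partial>lborel) \<noteq> \<infinity>"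
      using int[of a b] by (auto simp: real_integrable_def)
    have "enn2real (\<integral>\<^sup>+ x. ennreal (?f x) \<partial>lborel) = enn2real (\<integral>\<^sup>+ x. ennreal (- ?f x) \<partial>lborel)"
      using zero[of a b] real_lebesgue_integral_def[OF int[of a b]] by simp
    then have "(\<integral>\<^sup>+ x. ennreal (?f x) \<partial>lborel) = (\<integral>\<^sup>+ x. ennreal (- ?f x) \<partial>lborel)"
      using f eqI by blast
    then show ?thesis using P Q f by simp
  qed
  have "?P = ?Q"
  proof (rule measure_eqI_generator_eq)
    let ?E = "range (\<lambda>(a, b). box a b::'a set)"
    show "Int_stable ?E"
      by (auto simp: Int_stable_def box_Int_box)
    show "?E \<subseteq> Pow UNIV" "sets ?P = sigma_sets UNIV ?E" "sets ?Q = sigma_sets UNIV ?E"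
      by (simp_all add: borel_eq_box)
    let ?A = "\<lambda>n::nat. box (- (real n *\<^sub>R One)) (real n *\<^sub>R One) :: 'a set"
    show "range ?A \<subseteq> ?E" "(\<Union>i. ?A i) = UNIV"
      unfolding UN_box_eq_UNIV by auto
    show "emeasure ?P (?A i) \<noteq> \<infinity>" for i using e by blast
    show "emeasure ?P X = emeasure ?Q X" if "X \<in> ?E" for X
      using that e by auto
  qed
  then have "AE x in lborel. ennreal (h x) = ennreal (- h x)"
    by (subst (asm) sigma_finite_measure.density_unique_iff[OF sigma_finite_lborel]) auto
  then show ?thesis
  proof eventually_elim
    case (elim x)
    then show ?case
      by (cases "h x \<ge> 0") (auto simp: ennreal_neg ennreal_eq_0_iff dest: sym)
  qed
qed

lemma loc_integrable_measurable: "loc_integrable u \<Longrightarrow> u \<in> borel_measurable borel"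
  by (simp add: loc_integrable_def)

lemma loc_integrable_mult:
  fixes u :: "R3 \<Rightarrow> real"
  assumes u: "loc_integrable u" and [measurable]: "g \<in> borel_measurable borel"
    and b: "\<And>x. \<bar>g x\<bar> \<le> M" and z: "\<And>x. norm x > R \<Longrightarrow> g x = 0"
  shows "integrable lborel (\<lambda>x. u x * g x)"
proof -
  have [measurable]: "u \<in> borel_measurable borel" using u by (rule loc_integrable_measurable)
  have "integrable lborel (\<lambda>x. indicator (cball 0 R) x *\<^sub>R u x)"
    using u by (auto simp: loc_integrable_def set_integrable_def)
  then have i: "integrable lborel (\<lambda>x. M * (indicator (cball 0 R) x *\<^sub>R u x))"
    by simp
  have "norm (u x * g x) \<le> norm (M * (indicator (cball 0 R) x *\<^sub>R u x))" for x
  proof (cases "norm x > R")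
    case False
    have "\<bar>u x\<bar> * \<bar>g x\<bar> \<le> \<bar>u x\<bar> * M" by (rule mult_left_mono[OF b]) simp
    moreover have "\<bar>M\<bar> = M" using b[of x] by linarith
    ultimately show ?thesis using False by (simp add: abs_mult mult.commute)
  qed (use z in simp)
  then show ?thesis
    by (intro Bochner_Integration.integrable_bound[OF i]) auto
qed

lemma loc_integrable_test:
  fixes u :: "R3 \<Rightarrow> real"
  assumes "loc_integrable u" "test_function \<phi>"
  shows "integrable lborel (\<lambda>x. u x * \<phi> x)" "integrable lborel (\<lambda>x. u x * pd \<phi> i x)"
proof -
  obtain M R where b: "\<And>x. \<bar>\<phi> x\<bar> \<le> M" "\<And>x i. \<bar>pd \<phi> i x\<bar> \<le> M"
    "\<And>x. norm x > R \<Longrightarrow> \<phi> x = 0" "\<And>x i. norm x > R \<Longrightarrow> pd \<phi> i x = 0"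
    using test_function_bounds[OF assms(2)] by metis
  show "integrable lborel (\<lambda>x. u x * \<phi> x)"
    by (rule loc_integrable_mult[OF assms(1) test_function_measurable[OF assms(2)] b(1) b(3)])
  show "integrable lborel (\<lambda>x. u x * pd \<phi> i x)"
    by (rule loc_integrable_mult[OF assms(1) test_function_pd_measurable[OF assms(2)] b(2) b(4)])
qed

lemma borel_measurable_vec_nth [measurable (raw)]:
  fixes w :: "'a \<Rightarrow> R3"
  assumes "w \<in> borel_measurable M"
  shows "(\<lambda>x. w x $ i) \<in> borel_measurable M"
proof -
  have "(\<lambda>v::R3. v $ i) \<in> borel_measurable borel"
    by (intro borel_measurable_continuous_onI continuous_intros)
  from measurable_compose[OF assms this] show ?thesis by simp
qed

lemma loc_integrable_nth:
  fixes w :: "R3 \<Rightarrow> R3"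
  assumes "loc_integrable w"
  shows "loc_integrable (\<lambda>x. w x $ i)"
  unfolding loc_integrable_def
proof (intro conjI allI impI)
  have [measurable]: "w \<in> borel_measurable borel" using assms by (rule loc_integrable_measurable)
  show m: "(\<lambda>x. w x $ i) \<in> borel_measurable borel"
    by measurable
  fix K :: "R3 set" assume "compact K"
  then have i: "integrable lborel (\<lambda>x. indicator K x *\<^sub>R w x)" and [measurable]: "K \<in> sets borel"
    using assms by (auto simp: loc_integrable_def set_integrable_def intro: borel_compact)
  show "set_integrable lborel K (\<lambda>x. w x $ i)"
    unfolding set_integrable_def
    by (rule Bochner_Integration.integrable_bound[OF i])
      (auto intro!: AE_I2 mult_left_mono simp: component_le_norm_cart abs_mult)
qed

lemma loc_integrable_of_power:
  fixes w :: "R3 \<Rightarrow> 'b::{banach,second_countable_topology}"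
  assumes [measurable]: "w \<in> borel_measurable borel" and w: "integrable lborel (\<lambda>x. norm (w x) ^ k)" and k: "k \<ge> 1"
  shows "loc_integrable w"
  unfolding loc_integrable_def
proof (intro conjI allI impI)
  fix K :: "R3 set" assume K: "compact K"
  then have [measurable]: "K \<in> sets borel" by (rule borel_compact)
  have "emeasure lborel K < \<infinity>" using K by (rule emeasure_compact_finite)
  then have i: "integrable lborel (\<lambda>x. indicator K x + norm (w x) ^ k)"
    using w by (intro Bochner_Integration.integrable_add) auto
  have "norm (w x) \<le> 1 + norm (w x) ^ k" for x
  proof (cases "norm (w x) \<le> 1")
    case True
    then show ?thesis by (simp add: add_increasing2)
  next
    case False
    then have "norm (w x) ^ 1 \<le> norm (w x) ^ k" by (intro power_increasing k) auto
    then show ?thesis by simp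
  qed
  then show "set_integrable lborel K w"
    unfolding set_integrable_def
    by (intro Bochner_Integration.integrable_bound[OF i]) (auto split: split_indicator)
qed (use assms in auto)

lemma loc_integrable_diff:
  fixes f g :: "R3 \<Rightarrow> 'b::{banach,second_countable_topology}"
  assumes "loc_integrable f" "loc_integrable g"
  shows "loc_integrable (\<lambda>x. f x - g x)"
  using assms by (auto simp: loc_integrable_def intro!: set_integral_diff)

lemma loc_integrable_add:
  fixes f g :: "R3 \<Rightarrow> 'b::{banach,second_countable_topology}"
  assumes "loc_integrable f" "loc_integrable g"
  shows "loc_integrable (\<lambda>x. f x + g x)"
  using assms by (auto simp: loc_integrable_def intro!: set_integral_add)

lemma loc_integrable_scaleR:
  fixes f :: "R3 \<Rightarrow> 'b::{banach,second_countable_topology}"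
  assumes "loc_integrable f"
  shows "loc_integrable (\<lambda>x. c *\<^sub>R f x)"
  using assms by (auto simp: loc_integrable_def)

lemma loc_integrable_cong_AE:
  fixes f :: "R3 \<Rightarrow> 'b::{banach,second_countable_topology}"
  assumes f: "loc_integrable f" and [measurable]: "g \<in> borel_measurable borel" and ae: "AE x in lborel. f x = g x"
  shows "loc_integrable g"
  unfolding loc_integrable_def
proof (intro conjI allI impI)
  have [measurable]: "f \<in> borel_measurable borel" using f by (rule loc_integrable_measurable)
  fix K :: "R3 set" assume K: "compact K"
  then have [measurable]: "K \<in> sets borel" by (rule borel_compact)
  have "integrable lborel (\<lambda>x. indicator K x *\<^sub>R f x)"
    using f K by (simp add: loc_integrable_def set_integrable_def)
  then show "set_integrable lborel K g"
    unfolding set_integrable_def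
    by (rule Bochner_Integration.integrable_cong_AE_imp) (use ae in auto)
qed fact

text \<open>By dominated convergence the test functions \<open>box_approx\<close> transfer the hypothesis to indicators of boxes.\<close>
lemma fundamental_lemma:
  fixes h :: "R3 \<Rightarrow> real"
  assumes h: "loc_integrable h" and z: "\<And>\<phi>. test_function \<phi> \<Longrightarrow> (LINT x|lborel. h x * \<phi> x) = 0"
  shows "AE x in lborel. h x = 0"
proof (rule AE_zero_of_box_integrals)
  show [measurable]: "h \<in> borel_measurable borel" using h by (rule loc_integrable_measurable)
  fix a b :: R3
  have c: "integrable lborel (\<lambda>x. indicator (cbox a b) x * h x)"
    using h by (auto simp: loc_integrable_def set_integrable_def)
  have le: "norm (indicator (box a b) x * h x) \<le> norm (indicator (cbox a b) x * h x)" for x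
    using box_subset_cbox[of a b] by (auto split: split_indicator)
  show "integrable lborel (\<lambda>x. indicator (box a b) x * h x)"
    using le by (intro Bochner_Integration.integrable_bound[OF c]) auto
  have [measurable]: "box_approx a b n \<in> borel_measurable borel" for n
    using test_function_box_approx by (rule test_function_measurable)
  have "(\<lambda>n. LINT x|lborel. h x * box_approx a b n x) \<longlonglongrightarrow> (LINT x|lborel. indicator (box a b) x * h x)"
  proof (rule integral_dominated_convergence[where w="\<lambda>x. norm (indicator (cbox a b) x * h x)"])
    show "AE x in lborel. (\<lambda>n. h x * box_approx a b n x) \<longlonglongrightarrow> indicator (box a b) x * h x"
      using tendsto_mult[OF tendsto_const box_approx_tendsto] by (auto simp: mult.commute)
    show "AE x in lborel. norm (h x * box_approx a b n x) \<le> norm (indicator (cbox a b) x * h x)" for n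
    proof (rule AE_I2)
      fix x
      show "norm (h x * box_approx a b n x) \<le> norm (indicator (cbox a b) x * h x)"
      proof (cases "x \<in> box a b")
        case True
        then show ?thesis
          using box_approx_bounds[of a b n x] box_subset_cbox[of a b]
          by (auto simp: abs_mult mult_left_le)
      qed (simp add: box_approx_outside)
    qed
    show "integrable lborel (\<lambda>x. norm (indicator (cbox a b) x * h x))"
      using c by (rule integrable_norm)
  qed measurable
  then show "(LINT x|lborel. indicator (box a b) x * h x) = 0"
    using z[OF test_function_box_approx] by (simp add: LIMSEQ_const_iff)
qed

text \<open>The choice made in \<open>grad\<close> is thereby immaterial inside integrals.\<close>
lemma weak_gradient_unique:
  assumes w: "weak_gradient u w" and w': "weak_gradient u w'"
  shows "AE x in lborel. w x = w' x"
proof -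
  have "AE x in lborel. w x $ i - w' x $ i = 0" for i
  proof (rule fundamental_lemma)
    have l: "loc_integrable (\<lambda>x. w x $ i)" "loc_integrable (\<lambda>x. w' x $ i)"
      using w w' by (auto simp: weak_gradient_def intro: loc_integrable_nth)
    then show "loc_integrable (\<lambda>x. w x $ i - w' x $ i)" by (rule loc_integrable_diff)
    fix \<phi> assume t: "test_function \<phi>"
    have "(LINT x|lborel. (w x $ i - w' x $ i) * \<phi> x)
        = (LINT x|lborel. w x $ i * \<phi> x) - (LINT x|lborel. w' x $ i * \<phi> x)"
      unfolding left_diff_distrib
      by (rule Bochner_Integration.integral_diff) (use l t loc_integrable_test in auto)
    also have "\<dots> = 0"
    proof -
      have "(LINT x|lborel. u x * pd \<phi> i x) = - (LINT x|lborel. w x $ i * \<phi> x)"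
        "(LINT x|lborel. u x * pd \<phi> i x) = - (LINT x|lborel. w' x $ i * \<phi> x)"
        using w w' t by (auto simp: weak_gradient_def)
      then show ?thesis by linarith
    qed
    finally show "(LINT x|lborel. (w x $ i - w' x $ i) * \<phi> x) = 0" .
  qed
  then have "AE x in lborel. \<forall>i. w x $ i - w' x $ i = 0"
    by (simp add: AE_all_countable)
  then show ?thesis by eventually_elim (simp add: vec_eq_iff)
qed

lemma weak_gradient_cong_AE:
  assumes w: "weak_gradient u w" and [measurable]: "u' \<in> borel_measurable borel"
    and ae: "AE x in lborel. u x = u' x"
  shows "weak_gradient u' w"
proof -
  have [measurable]: "u \<in> borel_measurable borel"
    using w by (auto simp: weak_gradient_def intro: loc_integrable_measurable)
  have "(LINT x|lborel. u x * pd \<phi> i x) = (LINT x|lborel. u' x * pd \<phi> i x)"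
    if "test_function \<phi>" for \<phi> i
  proof (rule integral_cong_AE)
    have [measurable]: "pd \<phi> i \<in> borel_measurable borel"
      using that by (rule test_function_pd_measurable)
    show "(\<lambda>x. u x * pd \<phi> i x) \<in> borel_measurable lborel"
      "(\<lambda>x. u' x * pd \<phi> i x) \<in> borel_measurable lborel" by measurable
  qed (use ae in auto)
  then show ?thesis
    using w loc_integrable_cong_AE[OF _ assms(2) ae] by (auto simp: weak_gradient_def)
qed

lemma weak_gradient_linear:
  assumes u: "weak_gradient u w" and v: "weak_gradient v z"
  shows "weak_gradient (\<lambda>x. u x + c * v x) (\<lambda>x. w x + c *\<^sub>R z x)"
proof -
  have l: "loc_integrable u" "loc_integrable v" "loc_integrable w" "loc_integrable z"
    using u v by (auto simp: weak_gradient_def)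
  have "(LINT x|lborel. (u x + c * v x) * pd \<phi> i x) = - (LINT x|lborel. (w x + c *\<^sub>R z x) $ i * \<phi> x)"
    if t: "test_function \<phi>" for \<phi> i
  proof -
    have "(LINT x|lborel. (u x + c * v x) * pd \<phi> i x)
        = (LINT x|lborel. u x * pd \<phi> i x + c * (v x * pd \<phi> i x))"
      by (simp add: algebra_simps)
    also have "\<dots> = (LINT x|lborel. u x * pd \<phi> i x) + c * (LINT x|lborel. v x * pd \<phi> i x)"
      using loc_integrable_test(2)[OF l(1) t, of i] loc_integrable_test(2)[OF l(2) t, of i] by simp
    also have "\<dots> = - ((LINT x|lborel. w x $ i * \<phi> x) + c * (LINT x|lborel. z x $ i * \<phi> x))"
      using u v t by (simp add: weak_gradient_def)
    also have "(LINT x|lborel. w x $ i * \<phi> x) + c * (LINT x|lborel. z x $ i * \<phi> x)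
        = (LINT x|lborel. w x $ i * \<phi> x + c * (z x $ i * \<phi> x))"
      using loc_integrable_test(1)[OF loc_integrable_nth[OF l(3)] t, of i]
        loc_integrable_test(1)[OF loc_integrable_nth[OF l(4)] t, of i] by simp
    also have "\<dots> = (LINT x|lborel. (w x + c *\<^sub>R z x) $ i * \<phi> x)"
      by (simp add: algebra_simps)
    finally show ?thesis .
  qed
  moreover have "loc_integrable (\<lambda>x. u x + c * v x)"
    using loc_integrable_add[OF l(1) loc_integrable_scaleR[OF l(2), of c]] by simp
  ultimately show ?thesis
    using loc_integrable_add[OF l(3) loc_integrable_scaleR[OF l(4), of c]]
    by (simp add: weak_gradient_def)
qed

definition dirichlet :: "(R3 \<Rightarrow> real) \<Rightarrow> real" where
  "dirichlet u = (LINT x|lborel. (norm (grad u x))\<^sup>2)"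

lemma dirichlet_nonneg: "dirichlet u \<ge> 0"
  by (simp add: dirichlet_def)

lemma weak_gradient_grad: "weak_gradient u w \<Longrightarrow> weak_gradient u (grad u)"
  unfolding grad_def by (rule someI[of "weak_gradient u"])

lemma weak_gradient_measurable: "weak_gradient u w \<Longrightarrow> w \<in> borel_measurable borel"
  by (auto simp: weak_gradient_def intro: loc_integrable_measurable)

lemma dirichlet_eq:
  assumes "weak_gradient u w"
  shows "dirichlet u = (LINT x|lborel. (norm (w x))\<^sup>2)"
    "integrable lborel (\<lambda>x. (norm (grad u x))\<^sup>2) \<longleftrightarrow> integrable lborel (\<lambda>x. (norm (w x))\<^sup>2)"
proof -
  have g: "weak_gradient u (grad u)" using assms by (rule weak_gradient_grad)
  note [measurable] = weak_gradient_measurable[OF g] weak_gradient_measurable[OF assms]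
  have ae: "AE x in lborel. grad u x = w x" by (rule weak_gradient_unique[OF g assms])
  show "dirichlet u = (LINT x|lborel. (norm (w x))\<^sup>2)"
    unfolding dirichlet_def by (rule integral_cong_AE) (use ae in auto)
  show "integrable lborel (\<lambda>x. (norm (grad u x))\<^sup>2) \<longleftrightarrow> integrable lborel (\<lambda>x. (norm (w x))\<^sup>2)"
    by (rule integrable_cong_AE) (use ae in auto)
qed

lemma D12_grad:
  assumes "u \<in> D12"
  shows "weak_gradient u (grad u)" "integrable lborel (\<lambda>x. (norm (grad u x))\<^sup>2)"
proof -
  obtain w where w: "weak_gradient u w" "integrable lborel (\<lambda>x. (norm (w x))\<^sup>2)"
    using assms by (auto simp: D12_def)
  show "weak_gradient u (grad u)" using w(1) by (rule weak_gradient_grad)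
  show "integrable lborel (\<lambda>x. (norm (grad u x))\<^sup>2)" using dirichlet_eq(2)[OF w(1)] w(2) by simp
qed

lemma grad_AE_eq:
  assumes "weak_gradient u w"
  shows "AE x in lborel. grad u x = w x"
  by (rule weak_gradient_unique[OF weak_gradient_grad[OF assms] assms])

subsection \<open>Strongly convergent convex combinations in the space of square integrable functions\<close>

text \<open>Completeness of the space of square integrable functions, proved in the usual way: a rapidly Cauchy subsequence
converges almost everywhere, and Fatou's lemma bounds the distance to its limit.\<close>
lemma L2_Cauchy_limit:
  fixes f :: "nat \<Rightarrow> 'a \<Rightarrow> 'b::euclidean_space"
  assumes [measurable]: "\<And>n. f n \<in> borel_measurable M"
    and cau: "\<And>e. e > 0 \<Longrightarrow> \<exists>N. \<forall>m\<ge>N. \<forall>n\<ge>N. (\<integral>\<^sup>+ x. ennreal ((norm (f m x - f n x))\<^sup>2) \<partial>M) \<le> ennreal e"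
  obtains g r where "g \<in> borel_measurable M" "strict_mono (r::nat \<Rightarrow> nat)"
    "AE x in M. (\<lambda>k. f (r k) x) \<longlonglongrightarrow> g x"
    "(\<lambda>n. \<integral>\<^sup>+ x. ennreal ((norm (f n x - g x))\<^sup>2) \<partial>M) \<longlonglongrightarrow> 0"
proof -
  have "\<exists>N. \<forall>m\<ge>N. \<forall>n\<ge>N. (\<integral>\<^sup>+ x. ennreal ((norm (f m x - f n x))\<^sup>2) \<partial>M) \<le> ennreal ((1/8)^k)" for k
    by (rule cau) simp
  then obtain N where N: "\<And>k m n. m \<ge> N k \<Longrightarrow> n \<ge> N k \<Longrightarrow>
      (\<integral>\<^sup>+ x. ennreal ((norm (f m x - f n x))\<^sup>2) \<partial>M) \<le> ennreal ((1/8)^k)"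
    by metis
  define r where "r = rec_nat (N 0) (\<lambda>k rk. Suc (max rk (N (Suc k))))"
  have r_Suc: "r (Suc k) = Suc (max (r k) (N (Suc k)))" for k by (simp add: r_def)
  have r0: "r 0 = N 0" by (simp add: r_def)
  have mono: "strict_mono r"
    by (rule strict_monoI_Suc) (simp add: r_Suc)
  have rN: "r k \<ge> N k" for k
    by (cases k) (simp_all add: r0 r_Suc)
  define D where "D k x = norm (f (r (Suc k)) x - f (r k) x)" for k x
  have [measurable]: "D k \<in> borel_measurable M" for k
    unfolding D_def by measurable
  have Dk: "(\<integral>\<^sup>+ x. ennreal ((D k x)\<^sup>2) \<partial>M) \<le> ennreal ((1/8)^k)" for k
    unfolding D_def using rN[of k] strict_monoD[OF mono, of k "Suc k"] by (intro N) auto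
  have "(\<integral>\<^sup>+ x. (\<Sum>k. ennreal (4^k * (D k x)\<^sup>2)) \<partial>M) = (\<Sum>k. \<integral>\<^sup>+ x. ennreal (4^k * (D k x)\<^sup>2) \<partial>M)"
    by (rule nn_integral_suminf) measurable
  also have "\<dots> \<le> (\<Sum>k. ennreal ((1/2)^k))"
  proof (rule suminf_le)
    fix k
    have "(\<integral>\<^sup>+ x. ennreal (4^k * (D k x)\<^sup>2) \<partial>M) = ennreal (4^k) * (\<integral>\<^sup>+ x. ennreal ((D k x)\<^sup>2) \<partial>M)"
      by (simp add: ennreal_mult nn_integral_cmult)
    also have "\<dots> \<le> ennreal (4^k) * ennreal ((1/8)^k)"
      by (intro mult_left_mono Dk) simp
    also have "\<dots> = ennreal ((1/2)^k)"
      by (simp add: ennreal_mult[symmetric] power_mult_distrib[symmetric])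
    finally show "(\<integral>\<^sup>+ x. ennreal (4^k * (D k x)\<^sup>2) \<partial>M) \<le> ennreal ((1/2)^k)" .
  qed auto
  also have "\<dots> = ennreal (\<Sum>k. (1/2)^k)"
    by (rule suminf_ennreal2) (auto intro: summable_geometric)
  also have "\<dots> < \<infinity>" by simp
  finally have "AE x in M. (\<Sum>k. ennreal (4^k * (D k x)\<^sup>2)) \<noteq> \<infinity>"
    by (intro nn_integral_PInf_AE) auto
  then have conv: "AE x in M. convergent (\<lambda>k. f (r k) x)"
  proof eventually_elim
    case (elim x)
    then have s: "summable (\<lambda>k. 4^k * (D k x)\<^sup>2)"
      by (intro summable_suminf_not_top) (auto simp: top_ennreal_def)
    then have "(\<lambda>k. 4^k * (D k x)\<^sup>2) \<longlonglongrightarrow> 0" by (rule summable_LIMSEQ_zero)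
    then have "Bseq (\<lambda>k. 4^k * (D k x)\<^sup>2)" by (intro convergent_imp_Bseq) (auto simp: convergent_def)
    then obtain C where C: "C > 0" "\<And>k. \<bar>4^k * (D k x)\<^sup>2\<bar> \<le> C"
      by (auto elim: BseqE)
    have Db: "D k x \<le> sqrt C * (1/2)^k" for k
    proof -
      have "(2^k * D k x)\<^sup>2 \<le> C"
        using C(2)[of k] by (simp add: power_mult_distrib power_mult[symmetric] power2_eq_square[of "2::real"] mult.commute[of k 2] power_mult)
      then have "2^k * D k x \<le> sqrt C" by (rule real_le_rsqrt)
      then show ?thesis by (simp add: field_simps power_divide)
    qed
    have "summable (\<lambda>k. norm (f (r (Suc k)) x - f (r k) x))"
      by (rule summable_comparison_test'[where g="\<lambda>k. sqrt C * (1/2)^k" and N=0])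
        (use Db in \<open>auto simp: D_def intro!: summable_mult summable_geometric\<close>)
    then have "summable (\<lambda>k. f (r (Suc k)) x - f (r k) x)" by (rule summable_norm_cancel)
    then have "(\<lambda>n. \<Sum>k<n. f (r (Suc k)) x - f (r k) x) \<longlonglongrightarrow> (\<Sum>k. f (r (Suc k)) x - f (r k) x)"
      by (rule summable_LIMSEQ)
    then have "(\<lambda>n. f (r n) x - f (r 0) x) \<longlonglongrightarrow> (\<Sum>k. f (r (Suc k)) x - f (r k) x)"
      by (simp add: sum_lessThan_telescope[of "\<lambda>k. f (r k) x"])
    from tendsto_add[OF this tendsto_const[of "f (r 0) x"]] show ?case
      by (auto simp: convergent_def)
  qed
  define g where "g x = lim (\<lambda>k. f (r k) x)" for x
  have [measurable]: "g \<in> borel_measurable M" unfolding g_def by measurable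
  have ae: "AE x in M. (\<lambda>k. f (r k) x) \<longlonglongrightarrow> g x"
    using conv by eventually_elim (simp add: g_def convergent_LIMSEQ_iff)
  have "(\<lambda>n. \<integral>\<^sup>+ x. ennreal ((norm (f n x - g x))\<^sup>2) \<partial>M) \<longlonglongrightarrow> 0"
  proof (rule tendsto_zero_ennreal)
    fix e :: real assume "e > 0"
    then obtain K where K: "\<And>m n. m \<ge> K \<Longrightarrow> n \<ge> K \<Longrightarrow>
      (\<integral>\<^sup>+ x. ennreal ((norm (f m x - f n x))\<^sup>2) \<partial>M) \<le> ennreal (e/2)"
      using cau[of "e/2"] by auto
    have "(\<integral>\<^sup>+ x. ennreal ((norm (f n x - g x))\<^sup>2) \<partial>M) < ennreal e" if n: "n \<ge> K" for n
    proof -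
      have "(\<integral>\<^sup>+ x. ennreal ((norm (f n x - g x))\<^sup>2) \<partial>M)
          = (\<integral>\<^sup>+ x. liminf (\<lambda>k. ennreal ((norm (f n x - f (r k) x))\<^sup>2)) \<partial>M)"
      proof (rule nn_integral_cong_AE, use ae in eventually_elim)
        fix x assume "(\<lambda>k. f (r k) x) \<longlonglongrightarrow> g x"
        then have "(\<lambda>k. ennreal ((norm (f n x - f (r k) x))\<^sup>2)) \<longlonglongrightarrow> ennreal ((norm (f n x - g x))\<^sup>2)"
          by (intro tendsto_intros)
        then show "ennreal ((norm (f n x - g x))\<^sup>2) = liminf (\<lambda>k. ennreal ((norm (f n x - f (r k) x))\<^sup>2))"
          by (rule lim_imp_Liminf[OF sequentially_bot, symmetric])
      qed
      also have "\<dots> \<le> liminf (\<lambda>k. \<integral>\<^sup>+ x. ennreal ((norm (f n x - f (r k) x))\<^sup>2) \<partial>M)"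
        by (rule nn_integral_liminf) measurable
      also have "\<dots> \<le> ennreal (e/2)"
      proof (rule Liminf_le)
        have "r k \<ge> K" if "k \<ge> K" for k
          using that strict_mono_imp_increasing[OF mono, of k] by linarith
        then show "\<forall>\<^sub>F k in sequentially. (\<integral>\<^sup>+ x. ennreal ((norm (f n x - f (r k) x))\<^sup>2) \<partial>M) \<le> ennreal (e/2)"
          using n by (auto intro!: eventually_sequentiallyI[of K] K)
      qed simp
      also have "\<dots> < ennreal e" using \<open>e > 0\<close> by (simp add: ennreal_less_iff)
      finally show ?thesis .
    qed
    then show "\<forall>\<^sub>F n in sequentially. (\<integral>\<^sup>+ x. ennreal ((norm (f n x - g x))\<^sup>2) \<partial>M) < ennreal e"
      by (rule eventually_sequentiallyI)
  qed
  then show ?thesis using that[of g r] mono ae by simp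
qed

text \<open>The functions obtained from the tail of \<open>q\<close> starting at \<open>N\<close> by repeated averaging of two functions. Midpoints suffice,
since the parallelogram law involves no other convex combination.\<close>
inductive midpoint_hull :: "(nat \<Rightarrow> 'a \<Rightarrow> 'b::real_vector) \<Rightarrow> nat \<Rightarrow> ('a \<Rightarrow> 'b) \<Rightarrow> bool"
  for q and N where
  base: "n \<ge> N \<Longrightarrow> midpoint_hull q N (q n)"
| mid: "midpoint_hull q N f \<Longrightarrow> midpoint_hull q N g \<Longrightarrow> midpoint_hull q N (\<lambda>x. (1/2) *\<^sub>R (f x + g x))"

lemma midpoint_hull_mono: "midpoint_hull q N f \<Longrightarrow> M \<le> N \<Longrightarrow> midpoint_hull q M f"
  by (induction rule: midpoint_hull.induct) (auto intro: midpoint_hull.intros)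

lemma parallelogram:
  fixes a b :: "'a::real_inner"
  shows "(norm (a - b))\<^sup>2 = 2 * (norm a)\<^sup>2 + 2 * (norm b)\<^sup>2 - 4 * (norm ((1/2) *\<^sub>R (a + b)))\<^sup>2"
  by (simp add: power2_norm_eq_inner inner_simps inner_commute field_simps)

text \<open>A form of Mazur's lemma that replaces weak compactness: let \<open>d n\<close> be the infimum of the squared norm over the midpoint hull
of the \<open>n\<close>-th tail. Near-minimisers \<open>f n\<close> form a Cauchy sequence, because \<open>d\<close> is increasing and bounded, hence convergent,
and by the parallelogram law two near-minimisers are close as soon as their midpoint cannot have a much smaller norm.\<close>
lemma mazur:
  fixes q :: "nat \<Rightarrow> 'a \<Rightarrow> 'b::euclidean_space"
  assumes q[measurable]: "\<And>n. q n \<in> borel_measurable M"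
    and bound: "\<And>n. (\<integral>\<^sup>+ x. ennreal ((norm (q n x))\<^sup>2) \<partial>M) \<le> ennreal C" and C: "C \<ge> 0"
  obtains f g where "g \<in> borel_measurable M" "(\<integral>\<^sup>+ x. ennreal ((norm (g x))\<^sup>2) \<partial>M) \<le> ennreal C"
    "\<And>n. midpoint_hull q n (f n)" "\<And>n. f n \<in> borel_measurable M"
    "(\<lambda>n. \<integral>\<^sup>+ x. ennreal ((norm (f n x - g x))\<^sup>2) \<partial>M) \<longlonglongrightarrow> 0"
proof -
  define J where "J f = (LINT x|M. (norm (f x :: 'b))\<^sup>2)" for f
  define H where "H f \<longleftrightarrow> f \<in> borel_measurable M \<and> integrable M (\<lambda>x. (norm (f x))\<^sup>2) \<and> J f \<le> C" for f :: "'a \<Rightarrow> 'b"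
  have Jn: "(\<integral>\<^sup>+ x. ennreal ((norm (f x))\<^sup>2) \<partial>M) = ennreal (J f)"
    if "integrable M (\<lambda>x. (norm (f x))\<^sup>2)" for f :: "'a \<Rightarrow> 'b"
    unfolding J_def by (rule nn_integral_eq_integral[OF that]) simp
  have mid: "integrable M (\<lambda>x. (norm ((1/2) *\<^sub>R (f x + g x)))\<^sup>2)
      \<and> integrable M (\<lambda>x. (norm (f x - g x))\<^sup>2)
      \<and> J (\<lambda>x. f x - g x) = 2 * J f + 2 * J g - 4 * J (\<lambda>x. (1/2) *\<^sub>R (f x + g x))"
    if f: "H f" and g: "H g" for f g
  proof -
    have [measurable]: "f \<in> borel_measurable M" "g \<in> borel_measurable M"
      and i: "integrable M (\<lambda>x. (norm (f x))\<^sup>2)" "integrable M (\<lambda>x. (norm (g x))\<^sup>2)"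
      using f g by (auto simp: H_def)
    have i2: "integrable M (\<lambda>x. 2 * (norm (f x))\<^sup>2 + 2 * (norm (g x))\<^sup>2)"
      using i by simp
    have b: "(norm ((1/2) *\<^sub>R (f x + g x)))\<^sup>2 \<le> 2 * (norm (f x))\<^sup>2 + 2 * (norm (g x))\<^sup>2"
      "(norm (f x - g x))\<^sup>2 \<le> 2 * (norm (f x))\<^sup>2 + 2 * (norm (g x))\<^sup>2" for x
      using parallelogram[of "f x" "g x"] zero_le_power2[of "norm (f x - g x)"]
        zero_le_power2[of "norm ((1/2) *\<^sub>R (f x + g x))"] by linarith+
    have i3: "integrable M (\<lambda>x. (norm ((1/2) *\<^sub>R (f x + g x)))\<^sup>2)"
      by (rule Bochner_Integration.integrable_bound[OF i2]) (use b(1) in auto)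
    have i4: "integrable M (\<lambda>x. (norm (f x - g x))\<^sup>2)"
      by (rule Bochner_Integration.integrable_bound[OF i2]) (use b(2) in auto)
    have "J (\<lambda>x. f x - g x) = (LINT x|M. 2 * (norm (f x))\<^sup>2 + 2 * (norm (g x))\<^sup>2 - 4 * (norm ((1/2) *\<^sub>R (f x + g x)))\<^sup>2)"
      unfolding J_def by (simp only: parallelogram)
    also have "\<dots> = 2 * J f + 2 * J g - 4 * J (\<lambda>x. (1/2) *\<^sub>R (f x + g x))"
      unfolding J_def using i i3 by simp
    finally show ?thesis using i3 i4 by blast
  qed
  have HullH: "H f" if "midpoint_hull q n f" for n f
    using that
  proof induction
    case (base m)
    have i: "integrable M (\<lambda>x. (norm (q m x))\<^sup>2)"
      using bound[of m] by (intro integrableI_bounded) (auto simp: le_less_trans)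
    then show ?case
      using bound[of m] Jn[OF i] C by (auto simp: H_def)
  next
    case (mid f g)
    have [measurable]: "f \<in> borel_measurable M" "g \<in> borel_measurable M"
      using mid.IH by (auto simp: H_def)
    have "J (\<lambda>x. f x - g x) \<ge> 0" by (simp add: J_def)
    then have "J (\<lambda>x. (1/2) *\<^sub>R (f x + g x)) \<le> C"
      using \<open>\<lbrakk>H f; H g\<rbrakk> \<Longrightarrow> _\<close>[OF mid.IH] mid.IH by (auto simp: H_def)
    then show ?case
      using \<open>\<lbrakk>H f; H g\<rbrakk> \<Longrightarrow> _\<close>[OF mid.IH] by (auto simp: H_def)
  qed
  define S where "S n = {J f | f. midpoint_hull q n f}" for n
  define d where "d n = Inf (S n)" for n
  have ne: "S n \<noteq> {}" for n unfolding S_def using midpoint_hull.base[of n n q] by blast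
  have bd: "bdd_below (S n)" for n
    by (rule bdd_belowI[of _ 0]) (auto simp: S_def J_def)
  have d_le: "d n \<le> J f" if "midpoint_hull q n f" for n f
    unfolding d_def by (rule cInf_lower[OF _ bd]) (use that in \<open>auto simp: S_def\<close>)
  have dmono: "d m \<le> d n" if "m \<le> n" for m n
    unfolding d_def
    by (rule cInf_superset_mono[OF ne bd]) (auto simp: S_def intro: midpoint_hull_mono[OF _ that])
  have dC: "d n \<le> C" for n
    using d_le[OF midpoint_hull.base[of n n q]] HullH[OF midpoint_hull.base[of n n q]]
    by (simp add: H_def)
  have d0: "0 \<le> d n" for n
    unfolding d_def by (rule cInf_greatest[OF ne]) (auto simp: S_def J_def)
  have dn: "norm (d n) \<le> C" for n using dC[of n] d0[of n] by simp
  have "convergent d"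
    by (rule Bseq_mono_convergent) (use dmono BseqI'[of d, OF dn] in auto)
  have "\<exists>f. midpoint_hull q n f \<and> J f < d n + 1 / real (Suc n)" for n
  proof -
    have "\<exists>y\<in>S n. y < d n + 1 / real (Suc n)"
      unfolding d_def by (subst cInf_less_iff[OF ne bd, symmetric]) simp
    then show ?thesis by (auto simp: S_def)
  qed
  then obtain f where f: "\<And>n. midpoint_hull q n (f n)" "\<And>n. J (f n) < d n + 1 / real (Suc n)"
    by metis
  have fm[measurable]: "f n \<in> borel_measurable M" for n using HullH[OF f(1)] by (simp add: H_def)
  \<comment> \<open>The midpoint of \<open>f m\<close> and \<open>f n\<close> lies in the \<open>k\<close>-th hull, so its squared norm is at least \<open>d k\<close>.\<close>
  have diff: "(\<integral>\<^sup>+ x. ennreal ((norm (f m x - f n x))\<^sup>2) \<partial>M)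
      \<le> ennreal (2 * (d m - d k) + 2 * (d n - d k) + 4 / real (Suc k))" if "k \<le> m" "k \<le> n" for k m n
  proof -
    have "midpoint_hull q k (\<lambda>x. (1/2) *\<^sub>R (f m x + f n x))"
      using that f(1) by (intro midpoint_hull.mid) (auto intro: midpoint_hull_mono)
    from d_le[OF this] have dk: "d k \<le> J (\<lambda>x. (1/2) *\<^sub>R (f m x + f n x))" .
    have le: "1 / real (Suc m) \<le> 1 / real (Suc k)" "1 / real (Suc n) \<le> 1 / real (Suc k)"
      using that by (auto intro!: divide_left_mono)
    have arith: "j \<le> 2 * (x - z) + 2 * (y - z) + 4 * s"
      if "j = 2 * a + 2 * b - 4 * c" "z \<le> c" "a < x + t" "b < y + u" "t \<le> s" "u \<le> s"
      for j a b c x y z s t u :: real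
      using that by argo
    have "J (\<lambda>x. f m x - f n x) \<le> 2 * (d m - d k) + 2 * (d n - d k) + 4 * (1 / real (Suc k))"
      by (rule arith[OF conjunct2[OF conjunct2[OF mid[OF HullH[OF f(1)] HullH[OF f(1)]]]] dk f(2) f(2) le])
    then have "J (\<lambda>x. f m x - f n x) \<le> 2 * (d m - d k) + 2 * (d n - d k) + 4 / real (Suc k)"
      by simp
    then show ?thesis
      using Jn[of "\<lambda>x. f m x - f n x"] mid[OF HullH[OF f(1)] HullH[OF f(1)], of m n]
      by (simp add: ennreal_leI)
  qed
  have cau: "\<exists>N. \<forall>m\<ge>N. \<forall>n\<ge>N. (\<integral>\<^sup>+ x. ennreal ((norm (f m x - f n x))\<^sup>2) \<partial>M) \<le> ennreal e"
    if e: "e > 0" for e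
  proof -
    have "Cauchy d" using \<open>convergent d\<close> by (rule convergent_Cauchy)
    then obtain N1 where N1: "\<And>m n. m \<ge> N1 \<Longrightarrow> n \<ge> N1 \<Longrightarrow> norm (d m - d n) < e/8"
      using e unfolding Cauchy_iff by (metis zero_less_divide_iff zero_less_numeral)
    obtain N2 where N2: "1 / real (Suc N2) < e/8"
      using reals_Archimedean[of "e/8"] e by (auto simp: inverse_eq_divide)
    let ?N = "max N1 N2"
    have "1 / real (Suc ?N) \<le> 1 / real (Suc N2)" by (auto intro!: divide_left_mono)
    moreover have "4 / real (Suc ?N) = 4 * (1 / real (Suc ?N))" by simp
    ultimately have s: "4 / real (Suc ?N) < e/2" using N2 by linarith
    have "(\<integral>\<^sup>+ x. ennreal ((norm (f m x - f n x))\<^sup>2) \<partial>M) \<le> ennreal e" if "m \<ge> ?N" "n \<ge> ?N" for m n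
    proof -
      have "d m - d ?N < e/8" "d n - d ?N < e/8"
        using N1[of m ?N] N1[of n ?N] that unfolding real_norm_def max.bounded_iff by linarith+
      then have "2 * (d m - d ?N) + 2 * (d n - d ?N) + 4 / real (Suc ?N) \<le> e"
        using s e by argo
      then show ?thesis using diff[OF that] by (meson ennreal_leI order_trans)
    qed
    then show ?thesis by blast
  qed
  obtain g r where g: "g \<in> borel_measurable M" "strict_mono (r::nat \<Rightarrow> nat)"
    "AE x in M. (\<lambda>k. f (r k) x) \<longlonglongrightarrow> g x"
    "(\<lambda>n. \<integral>\<^sup>+ x. ennreal ((norm (f n x - g x))\<^sup>2) \<partial>M) \<longlonglongrightarrow> 0"
    using L2_Cauchy_limit[OF fm cau] by blast
  note [measurable] = g(1)
  have "(\<integral>\<^sup>+ x. ennreal ((norm (g x))\<^sup>2) \<partial>M) = (\<integral>\<^sup>+ x. liminf (\<lambda>k. ennreal ((norm (f (r k) x))\<^sup>2)) \<partial>M)"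
  proof (rule nn_integral_cong_AE, use g(3) in eventually_elim)
    fix x assume "(\<lambda>k. f (r k) x) \<longlonglongrightarrow> g x"
    then have "(\<lambda>k. ennreal ((norm (f (r k) x))\<^sup>2)) \<longlonglongrightarrow> ennreal ((norm (g x))\<^sup>2)"
      by (intro tendsto_intros)
    then show "ennreal ((norm (g x))\<^sup>2) = liminf (\<lambda>k. ennreal ((norm (f (r k) x))\<^sup>2))"
      by (rule lim_imp_Liminf[OF sequentially_bot, symmetric])
  qed
  also have "\<dots> \<le> liminf (\<lambda>k. \<integral>\<^sup>+ x. ennreal ((norm (f (r k) x))\<^sup>2) \<partial>M)"
    by (rule nn_integral_liminf) measurable
  also have "\<dots> \<le> ennreal C"
  proof (rule Liminf_le)
    show "\<forall>\<^sub>F k in sequentially. (\<integral>\<^sup>+ x. ennreal ((norm (f (r k) x))\<^sup>2) \<partial>M) \<le> ennreal C"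
      using HullH[OF f(1)] Jn by (auto simp: H_def ennreal_leI)
  qed simp
  finally show ?thesis using that g f fm by blast
qed


subsection \<open>Difference quotients\<close>

lemma nn_integral_shift:
  fixes f :: "'a::euclidean_space \<Rightarrow> ennreal"
  assumes [measurable]: "f \<in> borel_measurable borel"
  shows "(\<integral>\<^sup>+ x. f (x + a) \<partial>lborel) = (\<integral>\<^sup>+ x. f x \<partial>lborel)"
proof -
  have "(\<integral>\<^sup>+ x. f x \<partial>distr lborel borel ((+) a)) = (\<integral>\<^sup>+ x. f (a + x) \<partial>lborel)"
    by (rule nn_integral_distr) auto
  then show ?thesis by (simp add: lborel_distr_plus add.commute)
qed

lemma integrable_shift:
  fixes f :: "'a::euclidean_space \<Rightarrow> real"
  assumes "integrable lborel f"
  shows "integrable lborel (\<lambda>x. f (x + a))"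
proof -
  have "integrable (distr lborel borel ((+) a)) f" using assms by (simp add: lborel_distr_plus)
  then have "integrable lborel (\<lambda>x. f (a + x))"
    by (subst (asm) integrable_distr_eq) (use assms in auto)
  then show ?thesis by (simp add: add.commute)
qed

lemma integral_shift:
  fixes f :: "'a::euclidean_space \<Rightarrow> real"
  assumes [measurable]: "f \<in> borel_measurable borel"
  shows "(LINT x|lborel. f (x + a)) = (LINT x|lborel. f x)"
proof -
  have "(LINT x|distr lborel borel ((+) a). f x) = (LINT x|lborel. f (a + x))"
    by (rule integral_distr) auto
  then show ?thesis by (simp add: lborel_distr_plus add.commute)
qed

lemma nn_integral_scale:
  fixes f :: "'a::euclidean_space \<Rightarrow> ennreal"
  assumes [measurable]: "f \<in> borel_measurable borel" and s: "s > 0"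
  shows "(\<integral>\<^sup>+ x. f (s *\<^sub>R x) \<partial>lborel) = ennreal (1 / s ^ DIM('a)) * (\<integral>\<^sup>+ x. f x \<partial>lborel)"
proof -
  have "(\<integral>\<^sup>+ x. f x \<partial>lborel) = (\<integral>\<^sup>+ x. f x \<partial>density (distr lborel borel (\<lambda>x. 0 + s *\<^sub>R x)) (\<lambda>_. ennreal (\<bar>s\<bar> ^ DIM('a))))"
    using s by (subst lborel_affine[of s 0, symmetric]) auto
  also have "\<dots> = ennreal (s ^ DIM('a)) * (\<integral>\<^sup>+ x. f (s *\<^sub>R x) \<partial>lborel)"
    using s by (simp add: nn_integral_density nn_integral_distr nn_integral_cmult)
  finally have "ennreal (1 / s ^ DIM('a)) * (\<integral>\<^sup>+ x. f x \<partial>lborel)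
      = (ennreal (1 / s ^ DIM('a)) * ennreal (s ^ DIM('a))) * (\<integral>\<^sup>+ x. f (s *\<^sub>R x) \<partial>lborel)"
    by (simp add: mult.assoc)
  also have "ennreal (1 / s ^ DIM('a)) * ennreal (s ^ DIM('a)) = 1"
    using s by (simp add: ennreal_mult[symmetric])
  finally show ?thesis by simp
qed

lemma abs_integral_le_nn_integral:
  fixes f :: "'a \<Rightarrow> real"
  shows "ennreal \<bar>LINT x|M. f x\<bar> \<le> (\<integral>\<^sup>+ x. ennreal \<bar>f x\<bar> \<partial>M)"
proof (cases "integrable M f")
  case True
  from integral_norm_bound_ennreal[OF this] show ?thesis by simp
next
  case False
  then show ?thesis by (simp add: not_integrable_integral_eq)
qed

lemma Cauchy_Schwarz_integral:
  fixes f g :: "'a \<Rightarrow> real"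
  assumes [measurable]: "f \<in> borel_measurable M" "g \<in> borel_measurable M"
  shows "ennreal ((LINT x|M. f x * g x)\<^sup>2) \<le> (\<integral>\<^sup>+ x. ennreal ((f x)\<^sup>2) \<partial>M) * (\<integral>\<^sup>+ x. ennreal ((g x)\<^sup>2) \<partial>M)"
proof -
  have "ennreal ((LINT x|M. f x * g x)\<^sup>2) = (ennreal \<bar>LINT x|M. f x * g x\<bar>)\<^sup>2"
    by (simp add: ennreal_power)
  also have "\<dots> \<le> (\<integral>\<^sup>+ x. ennreal \<bar>f x * g x\<bar> \<partial>M)\<^sup>2"
    by (intro power_mono abs_integral_le_nn_integral) simp
  also have "\<dots> = (\<integral>\<^sup>+ x. ennreal \<bar>f x\<bar> * ennreal \<bar>g x\<bar> \<partial>M)\<^sup>2"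
    by (simp add: abs_mult ennreal_mult)
  also have "\<dots> \<le> (\<integral>\<^sup>+ x. (ennreal \<bar>f x\<bar>)\<^sup>2 \<partial>M) * (\<integral>\<^sup>+ x. (ennreal \<bar>g x\<bar>)\<^sup>2 \<partial>M)"
    by (rule Cauchy_Schwarz_nn_integral) auto
  finally show ?thesis by (simp add: ennreal_power)
qed

lemma integrable_tensor:
  fixes a :: "'a::euclidean_space \<Rightarrow> real" and b :: "'b::euclidean_space \<Rightarrow> real"
  assumes a: "integrable lborel a" and b: "integrable lborel b"
  shows "integrable (lborel \<Otimes>\<^sub>M lborel) (\<lambda>(x, t). a x * b t)"
proof (rule integrableI_bounded)
  have [measurable]: "a \<in> borel_measurable borel" "b \<in> borel_measurable borel"
    using a b borel_measurable_integrable by auto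
  show "(\<lambda>(x, t). a x * b t) \<in> borel_measurable (lborel \<Otimes>\<^sub>M lborel)" by measurable
  have "(\<integral>\<^sup>+ z. ennreal (norm (case z of (x, t) \<Rightarrow> a x * b t)) \<partial>(lborel \<Otimes>\<^sub>M lborel))
     = (\<integral>\<^sup>+ x. \<integral>\<^sup>+ t. ennreal \<bar>a x\<bar> * ennreal \<bar>b t\<bar> \<partial>lborel \<partial>lborel)"
    by (subst lborel.nn_integral_fst[symmetric]) (auto simp: abs_mult ennreal_mult)
  also have "\<dots> = (\<integral>\<^sup>+ x. ennreal \<bar>a x\<bar> \<partial>lborel) * (\<integral>\<^sup>+ t. ennreal \<bar>b t\<bar> \<partial>lborel)"
    by (simp add: nn_integral_cmult nn_integral_multc)
  also have "\<dots> < \<infinity>"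
    using a b by (auto simp: integrable_iff_bounded ennreal_mult_less_top)
  finally show "(\<integral>\<^sup>+ z. ennreal (norm (case z of (x, t) \<Rightarrow> a x * b t)) \<partial>(lborel \<Otimes>\<^sub>M lborel)) < \<infinity>" .
qed

lemma loc_integrable_const: "loc_integrable (\<lambda>x. c :: real)"
  unfolding loc_integrable_def set_integrable_def
  by (auto intro!: integrable_mult_left integrable_real_indicator emeasure_compact_finite dest: borel_compact)

lemma test_function_square_integrable:
  assumes "test_function \<phi>"
  shows "(\<integral>\<^sup>+ x. ennreal ((\<phi> x)\<^sup>2) \<partial>lborel) < \<infinity>"
proof -
  obtain M R where b: "\<And>x. \<bar>\<phi> x\<bar> \<le> M" "\<And>x. norm x > R \<Longrightarrow> \<phi> x = 0"
    using test_function_bounds[OF assms] by metis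
  note [measurable] = test_function_measurable[OF assms]
  have b2: "\<bar>(\<phi> x)\<^sup>2\<bar> \<le> M\<^sup>2" for x
    using power_mono[OF b(1)[of x], of 2] by simp
  have "integrable lborel (\<lambda>x. 1 * (\<phi> x)\<^sup>2)"
    by (rule loc_integrable_mult[OF loc_integrable_const _ b2, of _ R]) (use b(2) in auto)
  then show ?thesis by (simp add: integrable_iff_bounded)
qed

lemma test_function_line_derivative:
  assumes "test_function \<phi>"
  shows "((\<lambda>t. \<phi> (x - t *\<^sub>R axis i 1)) has_real_derivative - pd \<phi> i (x - t *\<^sub>R axis i 1)) (at t)"
proof -
  have d: "((\<lambda>t. x - t *\<^sub>R axis i 1) has_derivative (\<lambda>s. - (s *\<^sub>R axis i 1))) (at t)"
    by (auto intro!: derivative_eq_intros)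
  note D = test_function_has_derivative[OF assms, of "x - t *\<^sub>R axis i 1"]
  interpret linear "frechet_derivative \<phi> (at (x - t *\<^sub>R axis i 1))"
    using has_derivative_linear[OF D] .
  have eq: "(\<lambda>s. frechet_derivative \<phi> (at (x - t *\<^sub>R axis i 1)) (- (s *\<^sub>R axis i 1)))
      = (*) (- pd \<phi> i (x - t *\<^sub>R axis i 1))"
    by (simp add: fun_eq_iff neg scaleR)
  show ?thesis
    using has_derivative_compose[OF d D] unfolding has_field_derivative_def eq .
qed

lemma test_function_difference:
  assumes \<phi>: "test_function \<phi>" and h: "h > 0"
  shows "\<phi> (x - h *\<^sub>R axis i 1) - \<phi> x = - (LINT t|lborel. indicator {0..h} t * pd \<phi> i (x - t *\<^sub>R axis i 1))"
proof -
  have c: "isCont (\<lambda>t. - pd \<phi> i (x - t *\<^sub>R axis i 1)) t" for t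
  proof -
    have "continuous_on UNIV (\<lambda>t. pd \<phi> i (x - t *\<^sub>R axis i 1))"
      by (rule continuous_on_compose2[OF test_function_pd_continuous[OF \<phi>, of i]])
        (auto intro!: continuous_intros)
    then show ?thesis by (intro continuous_intros) (auto simp: continuous_on_eq_continuous_at)
  qed
  have "(LINT t|lborel. - pd \<phi> i (x - t *\<^sub>R axis i 1) * indicator {0..h} t)
      = \<phi> (x - h *\<^sub>R axis i 1) - \<phi> (x - 0 *\<^sub>R axis i 1)"
    by (rule integral_FTC_Icc_real) (use h test_function_line_derivative[OF \<phi>] c in auto)
  then show ?thesis by (simp add: mult.commute)
qed

lemma nn_integral_line_average:
  fixes w :: "R3 \<Rightarrow> R3"
  assumes [measurable]: "w \<in> borel_measurable borel" and h: "h > 0"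
  shows "(\<integral>\<^sup>+ x. \<integral>\<^sup>+ t. indicator {0..h} t * ennreal ((w (x + t *\<^sub>R e) $ i)\<^sup>2) \<partial>lborel \<partial>lborel)
     = ennreal h * (\<integral>\<^sup>+ x. ennreal ((w x $ i)\<^sup>2) \<partial>lborel)"
proof -
  have "(\<integral>\<^sup>+ x. \<integral>\<^sup>+ t. indicator {0..h} t * ennreal ((w (x + t *\<^sub>R e) $ i)\<^sup>2) \<partial>lborel \<partial>lborel)
      = (\<integral>\<^sup>+ t. \<integral>\<^sup>+ x. indicator {0..h} t * ennreal ((w (x + t *\<^sub>R e) $ i)\<^sup>2) \<partial>lborel \<partial>lborel)"
    by (rule lborel_pair.Fubini'[symmetric]) measurable
  also have "\<dots> = (\<integral>\<^sup>+ t. indicator {0..h} t * (\<integral>\<^sup>+ x. ennreal ((w x $ i)\<^sup>2) \<partial>lborel) \<partial>lborel)"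
  proof (rule nn_integral_cong)
    fix t :: real
    have "(\<integral>\<^sup>+ x. ennreal ((w (x + t *\<^sub>R e) $ i)\<^sup>2) \<partial>lborel) = (\<integral>\<^sup>+ x. ennreal ((w x $ i)\<^sup>2) \<partial>lborel)"
      by (rule nn_integral_shift[of "\<lambda>x. ennreal ((w x $ i)\<^sup>2)"]) measurable
    then show "(\<integral>\<^sup>+ x. indicator {0..h} t * ennreal ((w (x + t *\<^sub>R e) $ i)\<^sup>2) \<partial>lborel)
        = indicator {0..h} t * (\<integral>\<^sup>+ x. ennreal ((w x $ i)\<^sup>2) \<partial>lborel)"
      by (simp add: nn_integral_cmult)
  qed
  also have "\<dots> = ennreal h * (\<integral>\<^sup>+ x. ennreal ((w x $ i)\<^sup>2) \<partial>lborel)"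
    using h by (simp add: nn_integral_multc)
  finally show ?thesis .
qed

lemma line_average_square_bound:
  fixes w :: "R3 \<Rightarrow> R3"
  assumes [measurable]: "w \<in> borel_measurable borel" and h: "h > 0"
  shows "(\<integral>\<^sup>+ x. ennreal ((LINT t|lborel. indicator {0..h} t * w (x + t *\<^sub>R e) $ i)\<^sup>2) \<partial>lborel)
     \<le> ennreal (h\<^sup>2) * (\<integral>\<^sup>+ x. ennreal ((w x $ i)\<^sup>2) \<partial>lborel)"
proof -
  have "ennreal ((LINT t|lborel. indicator {0..h} t * w (x + t *\<^sub>R e) $ i)\<^sup>2)
      \<le> ennreal h * (\<integral>\<^sup>+ t. indicator {0..h} t * ennreal ((w (x + t *\<^sub>R e) $ i)\<^sup>2) \<partial>lborel)" for x
  proof -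
    have i: "(LINT t|lborel. indicator {0..h} t * w (x + t *\<^sub>R e) $ i)
       = (LINT t|lborel. indicator {0..h} t * (indicator {0..h} t * w (x + t *\<^sub>R e) $ i))"
      by (intro Bochner_Integration.integral_cong) (auto split: split_indicator)
    have "ennreal ((LINT t|lborel. indicator {0..h} t * w (x + t *\<^sub>R e) $ i)\<^sup>2)
      \<le> (\<integral>\<^sup>+ t. ennreal ((indicator {0..h} t)\<^sup>2) \<partial>lborel)
        * (\<integral>\<^sup>+ t. ennreal ((indicator {0..h} t * w (x + t *\<^sub>R e) $ i)\<^sup>2) \<partial>lborel)"
      unfolding i by (rule Cauchy_Schwarz_integral) measurable
    also have "(\<integral>\<^sup>+ t. ennreal ((indicator {0..h} t)\<^sup>2) \<partial>lborel) = (\<integral>\<^sup>+ t. indicator {0..h} t \<partial>lborel)"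
      by (intro nn_integral_cong) (auto split: split_indicator)
    also have "\<dots> = ennreal h" using h by simp
    also have "(\<integral>\<^sup>+ t. ennreal ((indicator {0..h} t * w (x + t *\<^sub>R e) $ i)\<^sup>2) \<partial>lborel)
       = (\<integral>\<^sup>+ t. indicator {0..h} t * ennreal ((w (x + t *\<^sub>R e) $ i)\<^sup>2) \<partial>lborel)"
      by (intro nn_integral_cong) (auto split: split_indicator)
    finally show ?thesis .
  qed
  then have "(\<integral>\<^sup>+ x. ennreal ((LINT t|lborel. indicator {0..h} t * w (x + t *\<^sub>R e) $ i)\<^sup>2) \<partial>lborel)
    \<le> (\<integral>\<^sup>+ x. ennreal h * (\<integral>\<^sup>+ t. indicator {0..h} t * ennreal ((w (x + t *\<^sub>R e) $ i)\<^sup>2) \<partial>lborel) \<partial>lborel)"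
    by (intro nn_integral_mono)
  also have "\<dots> = ennreal h * (\<integral>\<^sup>+ x. (\<integral>\<^sup>+ t. indicator {0..h} t * ennreal ((w (x + t *\<^sub>R e) $ i)\<^sup>2) \<partial>lborel) \<partial>lborel)"
    by (rule nn_integral_cmult) measurable
  also have "\<dots> = ennreal (h\<^sup>2) * (\<integral>\<^sup>+ x. ennreal ((w x $ i)\<^sup>2) \<partial>lborel)"
    unfolding nn_integral_line_average[OF assms] using h
    by (simp add: ennreal_mult power2_eq_square[of h] mult.assoc)
  finally show ?thesis .
qed

text \<open>The increment of \<open>u\<close> in the direction \<open>i\<close> is the integral of the \<open>i\<close>-th component of its weak gradient along the segment.
Moving the increment onto the test function, the fundamental theorem of calculus and Fubini's theorem reduce this to the
definition of the weak gradient.\<close>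
lemma difference_weak:
  assumes g: "weak_gradient u w" and i2: "integrable lborel (\<lambda>x. (norm (w x))\<^sup>2)" and h: "h > 0"
    and \<phi>: "test_function \<phi>"
  shows "(LINT x|lborel. (u (x + h *\<^sub>R axis i 1) - u x) * \<phi> x)
    = (LINT x|lborel. (LINT t|lborel. indicator {0..h} t * w (x + t *\<^sub>R axis i 1) $ i) * \<phi> x)"
proof -
  let ?e = "axis i 1 :: R3"
  have lu: "loc_integrable u" and lw: "loc_integrable w" using g by (auto simp: weak_gradient_def)
  note [measurable] = loc_integrable_measurable[OF lu] loc_integrable_measurable[OF lw]
    test_function_measurable[OF \<phi>] test_function_pd_measurable[OF \<phi>]
  obtain M R where b: "M \<ge> 0" "R > 0" "\<And>x. \<bar>\<phi> x\<bar> \<le> M" "\<And>x i. \<bar>pd \<phi> i x\<bar> \<le> M"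
    "\<And>x. norm x > R \<Longrightarrow> \<phi> x = 0" "\<And>x i. norm x > R \<Longrightarrow> pd \<phi> i x = 0"
    using test_function_bounds[OF \<phi>] by metis
  have tr: "test_function (\<lambda>x. \<phi> (x - t *\<^sub>R ?e))" "pd (\<lambda>x. \<phi> (x - t *\<^sub>R ?e)) i x = pd \<phi> i (x - t *\<^sub>R ?e)" for t x
    using test_function_translate[OF \<phi>, of "- t *\<^sub>R ?e"] by simp_all
  have i1: "integrable lborel (\<lambda>x. u x * \<phi> (x - h *\<^sub>R ?e))"
    by (rule loc_integrable_test(1)[OF lu tr(1)])
  have i1': "integrable lborel (\<lambda>x. u (x + h *\<^sub>R ?e) * \<phi> x)"
    using integrable_shift[OF i1, of "h *\<^sub>R ?e"] by simp
  have i0: "integrable lborel (\<lambda>x. u x * \<phi> x)"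
    by (rule loc_integrable_test(1)[OF lu \<phi>])
  have "(LINT x|lborel. (u (x + h *\<^sub>R ?e) - u x) * \<phi> x)
     = (LINT x|lborel. u (x + h *\<^sub>R ?e) * \<phi> x) - (LINT x|lborel. u x * \<phi> x)"
    unfolding left_diff_distrib by (rule Bochner_Integration.integral_diff[OF i1' i0])
  also have "(LINT x|lborel. u (x + h *\<^sub>R ?e) * \<phi> x) = (LINT x|lborel. u x * \<phi> (x - h *\<^sub>R ?e))"
    using integral_shift[of "\<lambda>x. u x * \<phi> (x - h *\<^sub>R ?e)" "h *\<^sub>R ?e"] by simp
  also have "(LINT x|lborel. u x * \<phi> (x - h *\<^sub>R ?e)) - (LINT x|lborel. u x * \<phi> x)
     = (LINT x|lborel. u x * \<phi> (x - h *\<^sub>R ?e) - u x * \<phi> x)"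
    by (rule Bochner_Integration.integral_diff[OF i1 i0, symmetric])
  also have "\<dots> = (LINT x|lborel. - (LINT t|lborel. u x * (indicator {0..h} t * pd \<phi> i (x - t *\<^sub>R ?e))))"
  proof (rule Bochner_Integration.integral_cong[OF refl])
    fix x
    have "u x * \<phi> (x - h *\<^sub>R ?e) - u x * \<phi> x = u x * (\<phi> (x - h *\<^sub>R ?e) - \<phi> x)"
      by (simp add: algebra_simps)
    then show "u x * \<phi> (x - h *\<^sub>R ?e) - u x * \<phi> x = - (LINT t|lborel. u x * (indicator {0..h} t * pd \<phi> i (x - t *\<^sub>R ?e)))"
      by (simp add: test_function_difference[OF \<phi> h])
  qed
  also have "\<dots> = - (LINT x|lborel. (LINT t|lborel. u x * (indicator {0..h} t * pd \<phi> i (x - t *\<^sub>R ?e))))"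
    by simp
  also have "(LINT x|lborel. (LINT t|lborel. u x * (indicator {0..h} t * pd \<phi> i (x - t *\<^sub>R ?e))))
     = (LINT t|lborel. (LINT x|lborel. u x * (indicator {0..h} t * pd \<phi> i (x - t *\<^sub>R ?e))))"
  proof (rule lborel_pair.Fubini_integral[symmetric])
    have "cball (0::R3) (R + h) \<in> sets borel" by simp
    then have "(\<lambda>x::R3. M * indicator (cball 0 (R + h)) x) \<in> borel_measurable borel" by measurable
    then have "integrable lborel (\<lambda>x. u x * (M * indicator (cball 0 (R + h)) x))"
      by (rule loc_integrable_mult[OF lu, of _ M "R + h"]) (use b(1) in \<open>auto split: split_indicator\<close>)
    then have d: "integrable (lborel \<Otimes>\<^sub>M lborel) (\<lambda>(x, t). (u x * (M * indicator (cball 0 (R + h)) x)) * indicator {0..h} (t::real))"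
      by (rule integrable_tensor) (rule integrable_real_indicator, use h in auto)
    show "integrable (lborel \<Otimes>\<^sub>M lborel) (\<lambda>(x, t). u x * (indicator {0..h} t * pd \<phi> i (x - t *\<^sub>R ?e)))"
    proof (rule Bochner_Integration.integrable_bound[OF d])
      show "(\<lambda>(x, t). u x * (indicator {0..h} t * pd \<phi> i (x - t *\<^sub>R ?e))) \<in> borel_measurable (lborel \<Otimes>\<^sub>M lborel)"
        by measurable
      have "\<bar>u x * (indicator {0..h} t * pd \<phi> i (x - t *\<^sub>R ?e))\<bar>
          \<le> \<bar>u x * (M * indicator (cball 0 (R + h)) x) * indicator {0..h} t\<bar>" for x t
      proof (cases "t \<in> {0..h} \<and> norm x \<le> R + h")
        case True
        then show ?thesis using b(1,4) by (auto simp: abs_mult mult_left_mono)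
      next
        case False
        have "pd \<phi> i (x - t *\<^sub>R ?e) = 0" if t: "t \<in> {0..h}"
        proof (rule b(6))
          have "norm x \<le> norm (x - t *\<^sub>R ?e) + norm (t *\<^sub>R ?e)"
            by (metis add.commute diff_add_cancel norm_triangle_ineq)
          moreover have "norm (t *\<^sub>R ?e) \<le> h" using t by simp
          ultimately show "norm (x - t *\<^sub>R ?e) > R" using False t by linarith
        qed
        then show ?thesis by (auto split: split_indicator)
      qed
      then show "AE z in lborel \<Otimes>\<^sub>M lborel. norm (case z of (x, t) \<Rightarrow> u x * (indicator {0..h} t * pd \<phi> i (x - t *\<^sub>R ?e)))
          \<le> norm (case z of (x, t) \<Rightarrow> (u x * (M * indicator (cball 0 (R + h)) x)) * indicator {0..h} t)"
        by (auto intro!: AE_I2)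
    qed
  qed
  also have "\<dots> = (LINT t|lborel. - (LINT x|lborel. indicator {0..h} t * w (x + t *\<^sub>R ?e) $ i * \<phi> x))"
  proof (rule Bochner_Integration.integral_cong[OF refl])
    fix t :: real
    have "(LINT x|lborel. u x * pd \<phi> i (x - t *\<^sub>R ?e)) = - (LINT x|lborel. w x $ i * \<phi> (x - t *\<^sub>R ?e))"
    proof -
      have "(LINT x|lborel. u x * pd \<psi> i x) = - (LINT x|lborel. w x $ i * \<psi> x)" if "test_function \<psi>" for \<psi>
        using g that by (simp add: weak_gradient_def)
      from this[OF tr(1)] show ?thesis by (simp only: tr(2))
    qed
    also have "(LINT x|lborel. w x $ i * \<phi> (x - t *\<^sub>R ?e)) = (LINT x|lborel. w (x + t *\<^sub>R ?e) $ i * \<phi> x)"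
      using integral_shift[of "\<lambda>x. w x $ i * \<phi> (x - t *\<^sub>R ?e)" "t *\<^sub>R ?e"] by simp
    finally show "(LINT x|lborel. u x * (indicator {0..h} t * pd \<phi> i (x - t *\<^sub>R ?e)))
       = - (LINT x|lborel. indicator {0..h} t * w (x + t *\<^sub>R ?e) $ i * \<phi> x)"
      by (cases "t \<in> {0..h}") auto
  qed
  also have "\<dots> = - (LINT t|lborel. (LINT x|lborel. indicator {0..h} t * w (x + t *\<^sub>R ?e) $ i * \<phi> x))"
    by simp
  also have "(LINT t|lborel. (LINT x|lborel. indicator {0..h} t * w (x + t *\<^sub>R ?e) $ i * \<phi> x))
     = (LINT x|lborel. (LINT t|lborel. indicator {0..h} t * w (x + t *\<^sub>R ?e) $ i * \<phi> x))"
  proof (rule lborel_pair.Fubini_integral, rule integrableI_bounded)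
    show m: "(\<lambda>(x, t). indicator {0..h} t * w (x + t *\<^sub>R ?e) $ i * \<phi> x) \<in> borel_measurable (lborel \<Otimes>\<^sub>M lborel)"
      by measurable
    have "(\<integral>\<^sup>+ z. ennreal (norm (case z of (x, t) \<Rightarrow> indicator {0..h} t * w (x + t *\<^sub>R ?e) $ i * \<phi> x)) \<partial>(lborel \<Otimes>\<^sub>M lborel))
       = (\<integral>\<^sup>+ x. \<integral>\<^sup>+ t. ennreal \<bar>indicator {0..h} t * w (x + t *\<^sub>R ?e) $ i * \<phi> x\<bar> \<partial>lborel \<partial>lborel)"
      by (subst lborel.nn_integral_fst[symmetric]) auto
    also have "\<dots> \<le> (\<integral>\<^sup>+ x. \<integral>\<^sup>+ t. indicator {0..h} t * ennreal ((w (x + t *\<^sub>R ?e) $ i)\<^sup>2)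
        + indicator {0..h} t * ennreal ((\<phi> x)\<^sup>2) \<partial>lborel \<partial>lborel)"
    proof (intro nn_integral_mono)
      fix x and t :: real
      have "\<bar>a * c\<bar> \<le> a\<^sup>2 + c\<^sup>2" for a c :: real
      proof -
        have "2 * \<bar>a * c\<bar> \<le> a\<^sup>2 + c\<^sup>2"
          using zero_le_power2[of "\<bar>a\<bar> - \<bar>c\<bar>"] by (simp add: power2_diff abs_mult)
        then show ?thesis using abs_ge_zero[of "a * c"] by linarith
      qed
      then show "ennreal \<bar>indicator {0..h} t * w (x + t *\<^sub>R ?e) $ i * \<phi> x\<bar>
         \<le> indicator {0..h} t * ennreal ((w (x + t *\<^sub>R ?e) $ i)\<^sup>2) + indicator {0..h} t * ennreal ((\<phi> x)\<^sup>2)"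
        by (auto simp: ennreal_plus[symmetric] intro!: ennreal_leI simp del: ennreal_plus split: split_indicator)
    qed
    also have "\<dots> = (\<integral>\<^sup>+ x. (\<integral>\<^sup>+ t. indicator {0..h} t * ennreal ((w (x + t *\<^sub>R ?e) $ i)\<^sup>2) \<partial>lborel)
        + ennreal h * ennreal ((\<phi> x)\<^sup>2) \<partial>lborel)"
      using h by (simp add: nn_integral_add nn_integral_multc)
    also have "\<dots> = (\<integral>\<^sup>+ x. (\<integral>\<^sup>+ t. indicator {0..h} t * ennreal ((w (x + t *\<^sub>R ?e) $ i)\<^sup>2) \<partial>lborel) \<partial>lborel)
        + (\<integral>\<^sup>+ x. ennreal h * ennreal ((\<phi> x)\<^sup>2) \<partial>lborel)"
      by (rule nn_integral_add) measurable
    also have "\<dots> = ennreal h * (\<integral>\<^sup>+ x. ennreal ((w x $ i)\<^sup>2) \<partial>lborel) + ennreal h * (\<integral>\<^sup>+ x. ennreal ((\<phi> x)\<^sup>2) \<partial>lborel)"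
      using h by (simp add: nn_integral_line_average nn_integral_cmult)
    also have "\<dots> < \<infinity>"
    proof -
      have "(\<integral>\<^sup>+ x. ennreal ((w x $ i)\<^sup>2) \<partial>lborel) \<le> (\<integral>\<^sup>+ x. ennreal ((norm (w x))\<^sup>2) \<partial>lborel)"
        by (intro nn_integral_mono ennreal_leI)
          (metis component_le_norm_cart power2_abs power_mono abs_ge_zero)
      also have "\<dots> < \<infinity>" using i2 by (simp add: integrable_iff_bounded)
      finally show ?thesis
        using test_function_square_integrable[OF \<phi>] by (auto simp: ennreal_mult_less_top)
    qed
    finally show "(\<integral>\<^sup>+ z. ennreal (norm (case z of (x, t) \<Rightarrow> indicator {0..h} t * w (x + t *\<^sub>R ?e) $ i * \<phi> x)) \<partial>(lborel \<Otimes>\<^sub>M lborel)) < \<infinity>" .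
  qed
  finally show ?thesis by simp
qed

lemma loc_integrable_shift:
  fixes u :: "R3 \<Rightarrow> real"
  assumes "loc_integrable u"
  shows "loc_integrable (\<lambda>x. u (x + a))"
  unfolding loc_integrable_def set_integrable_def
proof (intro conjI allI impI)
  note [measurable] = loc_integrable_measurable[OF assms]
  show "(\<lambda>x. u (x + a)) \<in> borel_measurable borel" by measurable
  fix K :: "R3 set" assume "compact K"
  then have "compact ((\<lambda>x. x + a) ` K)"
    by (intro compact_continuous_image continuous_intros)
  then have "integrable lborel (\<lambda>x. indicator ((\<lambda>x. x + a) ` K) x *\<^sub>R u x)"
    using assms by (simp add: loc_integrable_def set_integrable_def)
  from integrable_shift[OF this, of a]
  have "integrable lborel (\<lambda>x. indicator ((\<lambda>x. x + a) ` K) (x + a) *\<^sub>R u (x + a))" .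
  moreover have "indicator ((\<lambda>x. x + a) ` K) (x + a) = (indicator K x :: real)" for x
    by (auto simp: indicator_def)
  ultimately show "integrable lborel (\<lambda>x. indicator K x *\<^sub>R u (x + a))" by simp
qed

lemma norm_square_components: "(norm (v::R3))\<^sup>2 = (\<Sum>i\<in>UNIV. (v $ i)\<^sup>2)"
  unfolding power2_norm_eq_inner inner_vec_def by (simp add: power2_eq_square)

lemma nn_integral_norm_square:
  fixes w :: "R3 \<Rightarrow> R3"
  assumes [measurable]: "w \<in> borel_measurable borel"
  shows "(\<integral>\<^sup>+ x. ennreal ((norm (w x))\<^sup>2) \<partial>lborel) = (\<Sum>i\<in>UNIV. \<integral>\<^sup>+ x. ennreal ((w x $ i)\<^sup>2) \<partial>lborel)"
  unfolding norm_square_components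
  by (subst nn_integral_sum[symmetric]) (auto intro!: nn_integral_cong simp: sum_ennreal)

text \<open>Jensen's inequality on the segment, after \<open>difference_weak\<close> has been upgraded to an identity almost everywhere.\<close>
lemma difference_bound_component:
  assumes g: "weak_gradient u w" and i2: "integrable lborel (\<lambda>x. (norm (w x))\<^sup>2)" and h: "h > 0"
  shows "(\<integral>\<^sup>+ x. ennreal ((u (x + h *\<^sub>R axis i 1) - u x)\<^sup>2) \<partial>lborel)
     \<le> ennreal (h\<^sup>2) * (\<integral>\<^sup>+ x. ennreal ((w x $ i)\<^sup>2) \<partial>lborel)"
proof -
  let ?e = "axis i 1 :: R3"
  define v where "v x = (LINT t|lborel. indicator {0..h} t * w (x + t *\<^sub>R ?e) $ i)" for x
  have lu: "loc_integrable u" and lw: "loc_integrable w" using g by (auto simp: weak_gradient_def)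
  note [measurable] = loc_integrable_measurable[OF lu] loc_integrable_measurable[OF lw]
  have [measurable]: "v \<in> borel_measurable borel" unfolding v_def by measurable
  have vb: "(\<integral>\<^sup>+ x. ennreal ((v x)\<^sup>2) \<partial>lborel) \<le> ennreal (h\<^sup>2) * (\<integral>\<^sup>+ x. ennreal ((w x $ i)\<^sup>2) \<partial>lborel)"
    unfolding v_def by (rule line_average_square_bound) (use h in auto)
  have "(\<integral>\<^sup>+ x. ennreal ((w x $ i)\<^sup>2) \<partial>lborel) \<le> (\<integral>\<^sup>+ x. ennreal ((norm (w x))\<^sup>2) \<partial>lborel)"
    by (intro nn_integral_mono ennreal_leI)
      (metis component_le_norm_cart power2_abs power_mono abs_ge_zero)
  also have "\<dots> < \<infinity>" using i2 by (simp add: integrable_iff_bounded)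
  finally have "ennreal (h\<^sup>2) * (\<integral>\<^sup>+ x. ennreal ((w x $ i)\<^sup>2) \<partial>lborel) < \<infinity>"
    by (auto simp: ennreal_mult_less_top)
  with vb have "(\<integral>\<^sup>+ x. ennreal ((v x)\<^sup>2) \<partial>lborel) < \<infinity>" by (rule le_less_trans)
  then have "integrable lborel (\<lambda>x. norm (v x) ^ 2)"
    by (intro integrableI_bounded) auto
  then have lv: "loc_integrable v" by (intro loc_integrable_of_power[where k=2]) auto
  have lsu: "loc_integrable (\<lambda>x. u (x + h *\<^sub>R ?e) - u x)"
    by (intro loc_integrable_diff loc_integrable_shift lu)
  have "AE x in lborel. (u (x + h *\<^sub>R ?e) - u x) - v x = 0"
  proof (rule fundamental_lemma)
    show "loc_integrable (\<lambda>x. (u (x + h *\<^sub>R ?e) - u x) - v x)"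
      by (intro loc_integrable_diff lsu lv)
    fix \<phi> assume t: "test_function \<phi>"
    have "(LINT x|lborel. ((u (x + h *\<^sub>R ?e) - u x) - v x) * \<phi> x)
       = (LINT x|lborel. (u (x + h *\<^sub>R ?e) - u x) * \<phi> x) - (LINT x|lborel. v x * \<phi> x)"
      unfolding left_diff_distrib[of "u (_ + _) - u _" "v _"]
      by (rule Bochner_Integration.integral_diff[OF loc_integrable_test(1)[OF lsu t] loc_integrable_test(1)[OF lv t]])
    then show "(LINT x|lborel. ((u (x + h *\<^sub>R ?e) - u x) - v x) * \<phi> x) = 0"
      using difference_weak[OF g i2 h t, of i] by (simp add: v_def)
  qed
  then have "AE x in lborel. ennreal ((u (x + h *\<^sub>R ?e) - u x)\<^sup>2) = ennreal ((v x)\<^sup>2)"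
    by eventually_elim simp
  then have "(\<integral>\<^sup>+ x. ennreal ((u (x + h *\<^sub>R ?e) - u x)\<^sup>2) \<partial>lborel) = (\<integral>\<^sup>+ x. ennreal ((v x)\<^sup>2) \<partial>lborel)"
    by (rule nn_integral_cong_AE)
  then show ?thesis using vb by simp
qed

text \<open>The squared norm of the increments in the three coordinate directions. It involves only values of \<open>u\<close>, so it
passes to pointwise limits and contractions directly, unlike the weak gradient.\<close>
definition diff_energy :: "(R3 \<Rightarrow> real) \<Rightarrow> real \<Rightarrow> ennreal" where
  "diff_energy u h = (\<integral>\<^sup>+ x. (\<Sum>i\<in>UNIV. ennreal ((u (x + h *\<^sub>R axis i 1) - u x)\<^sup>2)) \<partial>lborel)"

lemma diff_energy_le:
  assumes g: "weak_gradient u w" and i2: "integrable lborel (\<lambda>x. (norm (w x))\<^sup>2)" and h: "h > 0"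
  shows "diff_energy u h \<le> ennreal (h\<^sup>2 * (LINT x|lborel. (norm (w x))\<^sup>2))"
proof -
  have lu: "loc_integrable u" and lw: "loc_integrable w" using g by (auto simp: weak_gradient_def)
  note [measurable] = loc_integrable_measurable[OF lu] loc_integrable_measurable[OF lw]
  have "diff_energy u h = (\<Sum>i\<in>UNIV. \<integral>\<^sup>+ x. ennreal ((u (x + h *\<^sub>R axis i 1) - u x)\<^sup>2) \<partial>lborel)"
    unfolding diff_energy_def by (rule nn_integral_sum) measurable
  also have "\<dots> \<le> (\<Sum>i\<in>UNIV. ennreal (h\<^sup>2) * (\<integral>\<^sup>+ x. ennreal ((w x $ i)\<^sup>2) \<partial>lborel))"
    by (intro sum_mono difference_bound_component[OF assms])
  also have "\<dots> = ennreal (h\<^sup>2) * (\<integral>\<^sup>+ x. ennreal ((norm (w x))\<^sup>2) \<partial>lborel)"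
    by (simp add: nn_integral_norm_square sum_distrib_left)
  also have "\<dots> = ennreal (h\<^sup>2 * (LINT x|lborel. (norm (w x))\<^sup>2))"
    using i2 by (simp add: nn_integral_eq_integral ennreal_mult)
  finally show ?thesis .
qed


text \<open>Closeness to \<open>L\<close> is a convex condition, so averaging preserves it.\<close>
lemma midpoint_hull_integral:
  fixes q :: "nat \<Rightarrow> R3 \<Rightarrow> R3"
  assumes q: "\<And>n. loc_integrable (q n)" and \<phi>: "test_function \<phi>"
    and e: "\<And>n. n \<ge> N \<Longrightarrow> \<bar>(LINT x|lborel. q n x $ i * \<phi> x) - L\<bar> \<le> e"
    and f: "midpoint_hull q N f"
  shows "loc_integrable f \<and> \<bar>(LINT x|lborel. f x $ i * \<phi> x) - L\<bar> \<le> e"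
  using f
proof induction
  case (base n)
  then show ?case using q e by auto
next
  case (mid f g)
  have l: "loc_integrable f" "loc_integrable g" using mid by auto
  have i: "integrable lborel (\<lambda>x. f x $ i * \<phi> x)" "integrable lborel (\<lambda>x. g x $ i * \<phi> x)"
    using l by (auto intro: loc_integrable_test(1)[OF loc_integrable_nth \<phi>])
  have "(LINT x|lborel. ((1/2) *\<^sub>R (f x + g x)) $ i * \<phi> x)
     = (LINT x|lborel. (1/2) * (f x $ i * \<phi> x) + (1/2) * (g x $ i * \<phi> x))"
    by (intro Bochner_Integration.integral_cong) (simp_all add: algebra_simps)
  also have "\<dots> = (1/2) * (LINT x|lborel. f x $ i * \<phi> x) + (1/2) * (LINT x|lborel. g x $ i * \<phi> x)"
    using i by simp
  finally have "\<bar>(LINT x|lborel. ((1/2) *\<^sub>R (f x + g x)) $ i * \<phi> x) - L\<bar> \<le> e"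
    using mid.IH by argo
  moreover have "loc_integrable (\<lambda>x. (1/2) *\<^sub>R (f x + g x))"
    by (intro loc_integrable_scaleR loc_integrable_add l)
  ultimately show ?case by blast
qed

lemma tendsto_0_of_square_bound:
  fixes a :: "nat \<Rightarrow> real"
  assumes b: "b \<longlonglongrightarrow> 0" and K: "K < (\<infinity>::ennreal)" and le: "\<And>n. ennreal ((a n)\<^sup>2) \<le> b n * K"
  shows "a \<longlonglongrightarrow> 0"
proof -
  have "(\<lambda>n. K * b n) \<longlonglongrightarrow> K * 0"
    using K by (intro ennreal_tendsto_cmult b) auto
  then have "(\<lambda>n. b n * K) \<longlonglongrightarrow> 0" by (simp add: mult.commute)
  then have "(\<lambda>n. ennreal ((a n)\<^sup>2)) \<longlonglongrightarrow> 0"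
    by (rule tendsto_sandwich[rotated 3]) (use le in auto)
  then have "(\<lambda>n. (a n)\<^sup>2) \<longlonglongrightarrow> 0"
    using tendsto_ennreal_iff[of "\<lambda>n. (a n)\<^sup>2" sequentially 0] by simp
  then have "(\<lambda>n. sqrt ((a n)\<^sup>2)) \<longlonglongrightarrow> sqrt 0" by (rule tendsto_real_sqrt)
  then show ?thesis by (simp add: tendsto_rabs_zero_iff)
qed

text \<open>The converse of \<open>diff_energy_le\<close>. The difference quotients are bounded in the space of square integrable fields; by Mazur's
lemma suitable averages of them converge strongly to some \<open>w\<close>, and tested against \<open>\<phi>\<close> they tend
to minus the integral of \<open>u\<close> times the partial derivative of \<open>\<phi>\<close>, so \<open>w\<close> is the weak gradient.\<close>
lemma weak_gradient_of_diff_energy: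
  assumes u: "loc_integrable u" and C: "C \<ge> 0"
    and bd: "\<And>h. 0 < h \<Longrightarrow> diff_energy u h \<le> ennreal (h\<^sup>2 * C)"
  obtains w where "weak_gradient u w" "integrable lborel (\<lambda>x. (norm (w x))\<^sup>2)"
    "(LINT x|lborel. (norm (w x))\<^sup>2) \<le> C"
proof -
  note [measurable] = loc_integrable_measurable[OF u]
  define h where "h n = 1 / real (Suc n)" for n
  have h: "h n > 0" "h n \<le> 1" for n by (auto simp: h_def)
  have h0: "h \<longlonglongrightarrow> 0" unfolding h_def using LIMSEQ_inverse_real_of_nat by (simp add: inverse_eq_divide)
  define q :: "nat \<Rightarrow> R3 \<Rightarrow> R3" where
    "q n x = (\<chi> i. (u (x + h n *\<^sub>R axis i 1) - u x) / h n)" for n x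
  have qi: "q n x $ i = (1 / h n) * (u (x + h n *\<^sub>R axis i 1) - u x)" for n x i
    by (simp add: q_def)
  have qsum: "q n x = (\<Sum>i\<in>UNIV. (q n x $ i) *\<^sub>R axis i 1)" for n x
    by (simp add: vec_eq_iff axis_def if_distrib cong: if_cong)
  have qloc: "loc_integrable (q n)" for n
  proof -
    have ax: "loc_integrable (\<lambda>x. (q n x $ i) *\<^sub>R (axis i 1 :: R3))" for i
    proof -
      have l: "loc_integrable (\<lambda>x. q n x $ i)"
        unfolding qi using loc_integrable_scaleR[OF loc_integrable_diff[OF loc_integrable_shift[OF u] u], of "1 / h n"] by simp
      show ?thesis
        unfolding loc_integrable_def set_integrable_def
      proof (intro conjI allI impI)
        show "(\<lambda>x. (q n x $ i) *\<^sub>R (axis i 1 :: R3)) \<in> borel_measurable borel"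
          using loc_integrable_measurable[OF l] by measurable
        fix K :: "R3 set" assume "compact K"
        then have "integrable lborel (\<lambda>x. (indicator K x *\<^sub>R q n x $ i) *\<^sub>R (axis i 1 :: R3))"
          using l unfolding loc_integrable_def set_integrable_def by (intro integrable_scaleR_left) auto
        then show "integrable lborel (\<lambda>x. indicator K x *\<^sub>R (q n x $ i) *\<^sub>R (axis i 1 :: R3))" by simp
      qed
    qed
    have "loc_integrable (\<lambda>x. \<Sum>i\<in>I. (q n x $ i) *\<^sub>R (axis i 1 :: R3))" if "finite I" for I
      using that
    proof (induction I rule: finite_induct)
      case empty
      show ?case by (simp add: loc_integrable_def set_integrable_def)
    next
      case (insert i I)
      then show ?case using loc_integrable_add[OF ax[of i] insert.IH] by simp
    qed
    from this[of UNIV] show ?thesis unfolding qsum[symmetric] by simp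
  qed
  note qm[measurable] = loc_integrable_measurable[OF qloc]
  have qb: "(\<integral>\<^sup>+ x. ennreal ((norm (q n x))\<^sup>2) \<partial>lborel) \<le> ennreal C" for n
  proof -
    have "(\<integral>\<^sup>+ x. ennreal ((norm (q n x))\<^sup>2) \<partial>lborel)
        = (\<integral>\<^sup>+ x. ennreal (1 / (h n)\<^sup>2) * (\<Sum>i\<in>UNIV. ennreal ((u (x + h n *\<^sub>R axis i 1) - u x)\<^sup>2)) \<partial>lborel)"
    proof (rule nn_integral_cong)
      fix x
      have "(norm (q n x))\<^sup>2 = 1 / (h n)\<^sup>2 * (\<Sum>i\<in>UNIV. (u (x + h n *\<^sub>R axis i 1) - u x)\<^sup>2)"
        unfolding norm_square_components qi power_mult_distrib sum_distrib_left by (simp add: power_divide)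
      then show "ennreal ((norm (q n x))\<^sup>2) = ennreal (1 / (h n)\<^sup>2) * (\<Sum>i\<in>UNIV. ennreal ((u (x + h n *\<^sub>R axis i 1) - u x)\<^sup>2))"
        by (simp add: ennreal_mult[symmetric] sum_ennreal sum_nonneg del: sum_divide_distrib)
    qed
    also have "\<dots> = ennreal (1 / (h n)\<^sup>2) * diff_energy u (h n)"
      unfolding diff_energy_def by (rule nn_integral_cmult) measurable
    also have "\<dots> \<le> ennreal (1 / (h n)\<^sup>2) * ennreal ((h n)\<^sup>2 * C)"
      by (intro mult_left_mono bd h) simp
    also have "\<dots> = ennreal C"
      using h(1)[of n] C by (simp add: ennreal_mult[symmetric])
    finally show ?thesis .
  qed
  obtain f w where w: "w \<in> borel_measurable lborel" "(\<integral>\<^sup>+ x. ennreal ((norm (w x))\<^sup>2) \<partial>lborel) \<le> ennreal C"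
    and f: "\<And>n. midpoint_hull q n (f n)" and fm: "\<And>n. f n \<in> borel_measurable lborel"
    and lim: "(\<lambda>n. \<integral>\<^sup>+ x. ennreal ((norm (f n x - w x))\<^sup>2) \<partial>lborel) \<longlonglongrightarrow> 0"
    by (rule mazur[OF _ qb C]) (use qm in simp, rule that)
  have [measurable]: "w \<in> borel_measurable borel" "f n \<in> borel_measurable borel" for n using w(1) fm by auto
  have iw: "integrable lborel (\<lambda>x. (norm (w x))\<^sup>2)"
    using w(2) by (intro integrableI_bounded) (auto simp: le_less_trans)
  have lw: "loc_integrable w" by (rule loc_integrable_of_power[where k=2]) (use iw in auto)
  have "(LINT x|lborel. u x * pd \<phi> i x) = - (LINT x|lborel. w x $ i * \<phi> x)" if \<phi>: "test_function \<phi>" for \<phi> i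
  proof -
    note [measurable] = test_function_measurable[OF \<phi>] test_function_pd_measurable[OF \<phi>]
    let ?e = "axis i 1 :: R3"
    define L where "L = (LINT x|lborel. - (u x * pd \<phi> i x))"
    obtain M R where b: "M \<ge> 0" "R > 0" "\<And>x. \<bar>\<phi> x\<bar> \<le> M" "\<And>x i. \<bar>pd \<phi> i x\<bar> \<le> M"
      "\<And>x. norm x > R \<Longrightarrow> \<phi> x = 0" "\<And>x i. norm x > R \<Longrightarrow> pd \<phi> i x = 0"
      using test_function_bounds[OF \<phi>] by metis
    \<comment> \<open>The discrete integration by parts: the difference quotient moves onto the test function.\<close>
    have Q: "(LINT x|lborel. q n x $ i * \<phi> x) = (LINT x|lborel. u x * ((\<phi> (x - h n *\<^sub>R ?e) - \<phi> x) / h n))" for n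
    proof -
      have i1: "integrable lborel (\<lambda>x. u x * \<phi> (x - h n *\<^sub>R ?e))"
        using loc_integrable_test(1)[OF u test_function_translate(1)[OF \<phi>, of "- h n *\<^sub>R ?e"]] by simp
      have i1': "integrable lborel (\<lambda>x. u (x + h n *\<^sub>R ?e) * \<phi> x)"
        using integrable_shift[OF i1, of "h n *\<^sub>R ?e"] by simp
      have i0: "integrable lborel (\<lambda>x. u x * \<phi> x)" by (rule loc_integrable_test(1)[OF u \<phi>])
      have "(LINT x|lborel. q n x $ i * \<phi> x)
         = (LINT x|lborel. (1 / h n) * (u (x + h n *\<^sub>R ?e) * \<phi> x - u x * \<phi> x))"
        unfolding qi by (intro Bochner_Integration.integral_cong) (simp_all add: algebra_simps)
      also have "\<dots> = (1 / h n) * ((LINT x|lborel. u (x + h n *\<^sub>R ?e) * \<phi> x) - (LINT x|lborel. u x * \<phi> x))"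
        using i1' i0 by simp
      also have "(LINT x|lborel. u (x + h n *\<^sub>R ?e) * \<phi> x) = (LINT x|lborel. u x * \<phi> (x - h n *\<^sub>R ?e))"
        using integral_shift[of "\<lambda>x. u x * \<phi> (x - h n *\<^sub>R ?e)" "h n *\<^sub>R ?e"] by simp
      also have "(1 / h n) * ((LINT x|lborel. u x * \<phi> (x - h n *\<^sub>R ?e)) - (LINT x|lborel. u x * \<phi> x))
         = (LINT x|lborel. (1 / h n) * (u x * \<phi> (x - h n *\<^sub>R ?e) - u x * \<phi> x))"
        using i1 i0 by simp
      also have "\<dots> = (LINT x|lborel. u x * ((\<phi> (x - h n *\<^sub>R ?e) - \<phi> x) / h n))"
        by (intro Bochner_Integration.integral_cong) (simp_all add: right_diff_distrib diff_divide_distrib)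
      finally show ?thesis .
    qed
    have lip: "\<bar>\<phi> (x - t *\<^sub>R ?e) - \<phi> x\<bar> \<le> M * t" if "t > 0" for x t
    proof -
      have "\<exists>z. 0 < z \<and> z < t \<and> \<phi> (x - t *\<^sub>R ?e) - \<phi> (x - 0 *\<^sub>R ?e) = (t - 0) * (- pd \<phi> i (x - z *\<^sub>R ?e))"
        by (rule MVT2[OF that]) (rule test_function_line_derivative[OF \<phi>])
      then obtain z where "\<phi> (x - t *\<^sub>R ?e) - \<phi> x = t * (- pd \<phi> i (x - z *\<^sub>R ?e))" by auto
      then show ?thesis using that b(4)[of "x - z *\<^sub>R ?e" i]
        by (simp add: abs_mult mult.commute mult_left_mono)
    qed
    have "(\<lambda>n. LINT x|lborel. u x * ((\<phi> (x - h n *\<^sub>R ?e) - \<phi> x) / h n)) \<longlonglongrightarrow> L"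
      unfolding L_def
    proof (rule integral_dominated_convergence)
      have "(\<lambda>x::R3. M * indicator (cball 0 (R + 1)) x) \<in> borel_measurable borel"
        by (intro borel_measurable_times borel_measurable_indicator) auto
      then have "integrable lborel (\<lambda>x. u x * (M * indicator (cball 0 (R + 1)) x))"
        by (rule loc_integrable_mult[OF u, of _ M "R + 1"]) (use b(1) in \<open>auto split: split_indicator\<close>)
      then show "integrable lborel (\<lambda>x. norm (u x * (M * indicator (cball 0 (R + 1)) x)))"
        by (rule integrable_norm)
      show "AE x in lborel. norm (u x * ((\<phi> (x - h n *\<^sub>R ?e) - \<phi> x) / h n)) \<le> norm (u x * (M * indicator (cball 0 (R + 1)) x))" for n
      proof (rule AE_I2)
        fix x
        show "norm (u x * ((\<phi> (x - h n *\<^sub>R ?e) - \<phi> x) / h n)) \<le> norm (u x * (M * indicator (cball 0 (R + 1)) x))"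
        proof (cases "norm x \<le> R + 1")
          case True
          have "\<bar>(\<phi> (x - h n *\<^sub>R ?e) - \<phi> x) / h n\<bar> \<le> M"
            using lip[OF h(1), of x n] h(1)[of n] by (simp add: abs_divide divide_le_eq)
          then have "\<bar>u x\<bar> * \<bar>(\<phi> (x - h n *\<^sub>R ?e) - \<phi> x) / h n\<bar> \<le> \<bar>u x\<bar> * M"
            by (rule mult_left_mono) simp
          moreover have "norm (u x * (M * indicator (cball 0 (R + 1)) x)) = \<bar>u x\<bar> * M"
            using True b(1) by (simp add: abs_mult)
          ultimately show ?thesis by (simp only: real_norm_def abs_mult)
        next
          case False
          have "norm x \<le> norm (x - h n *\<^sub>R ?e) + norm (h n *\<^sub>R ?e)"
            by (metis add.commute diff_add_cancel norm_triangle_ineq)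
          moreover have "norm (h n *\<^sub>R ?e) \<le> 1" using h[of n] by simp
          ultimately have "norm (x - h n *\<^sub>R ?e) > R" "norm x > R" using False by linarith+
          then have "\<phi> (x - h n *\<^sub>R ?e) = 0" "\<phi> x = 0" using b(5) by blast+
          then show ?thesis by simp
        qed
      qed
      show "AE x in lborel. (\<lambda>n. u x * ((\<phi> (x - h n *\<^sub>R ?e) - \<phi> x) / h n)) \<longlonglongrightarrow> - (u x * pd \<phi> i x)"
      proof (rule AE_I2)
        fix x
        have "((\<lambda>t. (\<phi> (x - t *\<^sub>R ?e) - \<phi> (x - 0 *\<^sub>R ?e)) / (t - 0)) \<longlongrightarrow> - pd \<phi> i (x - 0 *\<^sub>R ?e)) (at 0)"
          using test_function_line_derivative[OF \<phi>, of x i 0] unfolding has_field_derivative_iff by simp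
        moreover have "filterlim h (at 0) sequentially"
          using h0 h(1) by (auto simp: filterlim_at eventually_sequentially intro!: exI[of _ 0] dest: less_imp_neq[symmetric])
        ultimately have "(\<lambda>n. (\<phi> (x - h n *\<^sub>R ?e) - \<phi> (x - 0 *\<^sub>R ?e)) / (h n - 0)) \<longlonglongrightarrow> - pd \<phi> i (x - 0 *\<^sub>R ?e)"
          by (rule filterlim_compose)
        from tendsto_mult[OF tendsto_const[of "u x"] this]
        show "(\<lambda>n. u x * ((\<phi> (x - h n *\<^sub>R ?e) - \<phi> x) / h n)) \<longlonglongrightarrow> - (u x * pd \<phi> i x)" by simp
      qed
    qed measurable
    then have Qlim: "(\<lambda>n. LINT x|lborel. q n x $ i * \<phi> x) \<longlonglongrightarrow> L" unfolding Q .
    have flim: "(\<lambda>n. LINT x|lborel. f n x $ i * \<phi> x) \<longlonglongrightarrow> L"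
    proof (rule LIMSEQ_I)
      fix e :: real assume "e > 0"
      then have "\<exists>N. \<forall>n\<ge>N. norm ((LINT x|lborel. q n x $ i * \<phi> x) - L) < e/2"
        by (intro LIMSEQ_D[OF Qlim]) simp
      then obtain N where N0: "\<forall>n\<ge>N. norm ((LINT x|lborel. q n x $ i * \<phi> x) - L) < e/2" ..
      have N: "\<bar>(LINT x|lborel. q n x $ i * \<phi> x) - L\<bar> \<le> e/2" if "n \<ge> N" for n
        using N0[rule_format, OF that] unfolding real_norm_def by (rule less_imp_le)
      have "norm ((LINT x|lborel. f n x $ i * \<phi> x) - L) < e" if "n \<ge> N" for n
      proof -
        have "\<bar>(LINT x|lborel. f n x $ i * \<phi> x) - L\<bar> \<le> e/2"
          using midpoint_hull_integral[OF qloc \<phi> N midpoint_hull_mono[OF f that]] by blast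
        then show ?thesis using \<open>e > 0\<close> unfolding real_norm_def by linarith
      qed
      then show "\<exists>N. \<forall>n\<ge>N. norm ((LINT x|lborel. f n x $ i * \<phi> x) - L) < e" by blast
    qed
    have hull_loc: "loc_integrable F" if "midpoint_hull q N F" for N F
      using that by induction (auto intro!: qloc loc_integrable_scaleR loc_integrable_add simp del: scaleR_add_right)
    have floc: "loc_integrable (f n)" for n by (rule hull_loc[OF f])
    have "(\<lambda>n. LINT x|lborel. (f n x - w x) $ i * \<phi> x) \<longlonglongrightarrow> 0"
    proof (rule tendsto_0_of_square_bound[OF lim test_function_square_integrable[OF \<phi>]])
      fix n
      have "ennreal ((LINT x|lborel. (f n x - w x) $ i * \<phi> x)\<^sup>2)
        \<le> (\<integral>\<^sup>+ x. ennreal (((f n x - w x) $ i)\<^sup>2) \<partial>lborel) * (\<integral>\<^sup>+ x. ennreal ((\<phi> x)\<^sup>2) \<partial>lborel)"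
        by (rule Cauchy_Schwarz_integral) measurable
      also have "(\<integral>\<^sup>+ x. ennreal (((f n x - w x) $ i)\<^sup>2) \<partial>lborel) \<le> (\<integral>\<^sup>+ x. ennreal ((norm (f n x - w x))\<^sup>2) \<partial>lborel)"
        by (intro nn_integral_mono ennreal_leI)
          (metis component_le_norm_cart power2_abs power_mono abs_ge_zero)
      finally show "ennreal ((LINT x|lborel. (f n x - w x) $ i * \<phi> x)\<^sup>2)
        \<le> (\<integral>\<^sup>+ x. ennreal ((norm (f n x - w x))\<^sup>2) \<partial>lborel) * (\<integral>\<^sup>+ x. ennreal ((\<phi> x)\<^sup>2) \<partial>lborel)"
        by (simp add: mult_right_mono)
    qed
    moreover have "(LINT x|lborel. (f n x - w x) $ i * \<phi> x) = (LINT x|lborel. f n x $ i * \<phi> x) - (LINT x|lborel. w x $ i * \<phi> x)" for n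
      unfolding vector_minus_component left_diff_distrib
      by (rule Bochner_Integration.integral_diff)
        (auto intro!: loc_integrable_test(1)[OF loc_integrable_nth \<phi>] floc lw)
    ultimately have "(\<lambda>n. (LINT x|lborel. f n x $ i * \<phi> x) - (LINT x|lborel. w x $ i * \<phi> x)) \<longlonglongrightarrow> 0" by simp
    then have "(\<lambda>n. LINT x|lborel. f n x $ i * \<phi> x) \<longlonglongrightarrow> (LINT x|lborel. w x $ i * \<phi> x)"
      by (simp add: LIM_zero_iff)
    then have "L = (LINT x|lborel. w x $ i * \<phi> x)" using flim LIMSEQ_unique by blast
    then show ?thesis by (simp add: L_def)
  qed
  then have "weak_gradient u w" using u lw by (auto simp: weak_gradient_def)
  moreover have "(LINT x|lborel. (norm (w x))\<^sup>2) \<le> C"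
    using w(2) C iw by (simp add: nn_integral_eq_integral)
  ultimately show ?thesis using that iw by blast
qed

subsection \<open>Stability of the space under modulus, limits and scaling\<close>

lemma D12_measurable: "u \<in> D12 \<Longrightarrow> u \<in> borel_measurable borel"
  by (simp add: D12_def)

lemma D12_loc_integrable: "u \<in> D12 \<Longrightarrow> loc_integrable u"
  using D12_grad(1) by (auto simp: weak_gradient_def)

lemma D12_pow6: "u \<in> D12 \<Longrightarrow> integrable lborel (\<lambda>x. \<bar>u x\<bar> ^ 6)"
  by (simp add: D12_def)

lemma diff_energy_dirichlet: "u \<in> D12 \<Longrightarrow> h > 0 \<Longrightarrow> diff_energy u h \<le> ennreal (h\<^sup>2 * dirichlet u)"
  using diff_energy_le[OF D12_grad] by (simp add: dirichlet_def)

lemma D12_of_diff_energy: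
  assumes [measurable]: "u \<in> borel_measurable borel" and u6: "integrable lborel (\<lambda>x. \<bar>u x\<bar> ^ 6)" and C: "C \<ge> 0"
    and bd: "\<And>h. 0 < h \<Longrightarrow> diff_energy u h \<le> ennreal (h\<^sup>2 * C)"
  shows "u \<in> D12" "dirichlet u \<le> C"
proof -
  have "loc_integrable u"
    by (rule loc_integrable_of_power[where k=6]) (use u6 in auto)
  from weak_gradient_of_diff_energy[OF this C bd] obtain w where w: "weak_gradient u w"
    "integrable lborel (\<lambda>x. (norm (w x))\<^sup>2)" "(LINT x|lborel. (norm (w x))\<^sup>2) \<le> C" by metis
  show "u \<in> D12" using w u6 by (auto simp: D12_def)
  show "dirichlet u \<le> C" using dirichlet_eq(1)[OF w(1)] w(3) by simp
qed

text \<open>Increments of \<open>\<bar>u\<bar>\<close> are dominated by those of \<open>u\<close>.\<close>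
lemma D12_abs:
  assumes u: "u \<in> D12"
  shows "(\<lambda>x. \<bar>u x\<bar>) \<in> D12" "dirichlet (\<lambda>x. \<bar>u x\<bar>) \<le> dirichlet u"
proof -
  note [measurable] = D12_measurable[OF u]
  have "diff_energy (\<lambda>x. \<bar>u x\<bar>) h \<le> ennreal (h\<^sup>2 * dirichlet u)" if "h > 0" for h
  proof -
    have "diff_energy (\<lambda>x. \<bar>u x\<bar>) h \<le> diff_energy u h"
      unfolding diff_energy_def
    proof (intro nn_integral_mono sum_mono ennreal_leI)
      fix x i
      have "\<bar>\<bar>u (x + h *\<^sub>R axis i 1)\<bar> - \<bar>u x\<bar>\<bar> \<le> \<bar>u (x + h *\<^sub>R axis i 1) - u x\<bar>" by linarith
      from power_mono[OF this, of 2]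
      show "(\<bar>u (x + h *\<^sub>R axis i 1)\<bar> - \<bar>u x\<bar>)\<^sup>2 \<le> (u (x + h *\<^sub>R axis i 1) - u x)\<^sup>2" by simp
    qed
    then show ?thesis using diff_energy_dirichlet[OF u that] by order
  qed
  moreover have "integrable lborel (\<lambda>x. \<bar>\<bar>u x\<bar>\<bar> ^ 6)" using D12_pow6[OF u] by simp
  ultimately show "(\<lambda>x. \<bar>u x\<bar>) \<in> D12" "dirichlet (\<lambda>x. \<bar>u x\<bar>) \<le> dirichlet u"
    using D12_of_diff_energy[of "\<lambda>x. \<bar>u x\<bar>" "dirichlet u"] dirichlet_nonneg by auto
qed

text \<open>Fatou's lemma for the increments.\<close>
lemma D12_limit:
  assumes u: "\<And>n. u n \<in> D12" and C: "\<And>n. dirichlet (u n) \<le> C"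
    and lim: "\<And>x. (\<lambda>n. u n x) \<longlonglongrightarrow> v x"
    and [measurable]: "v \<in> borel_measurable borel" and v6: "integrable lborel (\<lambda>x. \<bar>v x\<bar> ^ 6)"
  shows "v \<in> D12" "dirichlet v \<le> C"
proof -
  note [measurable] = D12_measurable[OF u]
  have C0: "C \<ge> 0" using C[of 0] dirichlet_nonneg[of "u 0"] by linarith
  have "diff_energy v h \<le> ennreal (h\<^sup>2 * C)" if h: "h > 0" for h
  proof -
    let ?g = "\<lambda>n x. \<Sum>i\<in>UNIV. ennreal ((u n (x + h *\<^sub>R axis i 1) - u n x)\<^sup>2)"
    have "diff_energy v h = (\<integral>\<^sup>+ x. liminf (\<lambda>n. ?g n x) \<partial>lborel)"
      unfolding diff_energy_def
    proof (rule nn_integral_cong)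
      fix x
      have "(\<lambda>n. ?g n x) \<longlonglongrightarrow> (\<Sum>i\<in>UNIV. ennreal ((v (x + h *\<^sub>R axis i 1) - v x)\<^sup>2))"
        by (intro tendsto_sum tendsto_ennrealI tendsto_power tendsto_diff lim)
      from lim_imp_Liminf[OF sequentially_bot this]
      show "(\<Sum>i\<in>UNIV. ennreal ((v (x + h *\<^sub>R axis i 1) - v x)\<^sup>2)) = liminf (\<lambda>n. ?g n x)" by simp
    qed
    also have "\<dots> \<le> liminf (\<lambda>n. \<integral>\<^sup>+ x. ?g n x \<partial>lborel)"
      by (rule nn_integral_liminf) measurable
    also have "\<dots> \<le> ennreal (h\<^sup>2 * C)"
    proof (rule Liminf_le)
      have "(\<integral>\<^sup>+ x. ?g n x \<partial>lborel) \<le> ennreal (h\<^sup>2 * C)" for n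
      proof -
        have "(\<integral>\<^sup>+ x. ?g n x \<partial>lborel) \<le> ennreal (h\<^sup>2 * dirichlet (u n))"
          using diff_energy_dirichlet[OF u h] by (simp add: diff_energy_def)
        also have "\<dots> \<le> ennreal (h\<^sup>2 * C)" by (intro ennreal_leI mult_left_mono C) simp
        finally show ?thesis .
      qed
      then show "\<forall>\<^sub>F n in sequentially. (\<integral>\<^sup>+ x. ?g n x \<partial>lborel) \<le> ennreal (h\<^sup>2 * C)" by simp
    qed simp
    finally show ?thesis .
  qed
  then show "v \<in> D12" "dirichlet v \<le> C"
    using D12_of_diff_energy[OF _ v6 C0] by auto
qed

lemma integrable_scale:
  fixes f :: "'a::euclidean_space \<Rightarrow> real"
  assumes f: "integrable lborel f" and s: "s > 0"
  shows "integrable lborel (\<lambda>x. f (s *\<^sub>R x))"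
proof -
  have [measurable]: "f \<in> borel_measurable borel" using f by (auto dest: borel_measurable_integrable)
  have "(\<integral>\<^sup>+ x. ennreal (norm (f (s *\<^sub>R x))) \<partial>lborel) = ennreal (1 / s ^ DIM('a)) * (\<integral>\<^sup>+ x. ennreal (norm (f x)) \<partial>lborel)"
    by (rule nn_integral_scale) (use s in auto)
  also have "\<dots> < \<infinity>" using f by (auto simp: integrable_iff_bounded ennreal_mult_less_top)
  finally show ?thesis by (intro integrableI_bounded) auto
qed

lemma integral_scale:
  fixes f :: "'a::euclidean_space \<Rightarrow> real"
  assumes [measurable]: "f \<in> borel_measurable borel" and s: "s > 0"
  shows "(LINT x|lborel. f (s *\<^sub>R x)) = (LINT x|lborel. f x) / s ^ DIM('a)"
proof -
  have "(LINT x|lborel. f x) = (LINT x|density (distr lborel borel (\<lambda>x. 0 + s *\<^sub>R x)) (\<lambda>_. ennreal (\<bar>s\<bar> ^ DIM('a))). f x)"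
    using s by (subst lborel_affine[of s 0, symmetric]) auto
  also have "\<dots> = s ^ DIM('a) * (LINT x|lborel. f (s *\<^sub>R x))"
    using s by (simp add: integral_density integral_distr)
  finally show ?thesis using s by simp
qed

text \<open>The increment of the rescaled function over a step \<open>h\<close> is a multiple of the increment of \<open>u\<close> over the step \<open>s * h\<close>.\<close>
lemma D12_scale:
  assumes u: "u \<in> D12" and s: "s > 0"
  shows "(\<lambda>x. c * u (s *\<^sub>R x)) \<in> D12" "dirichlet (\<lambda>x. c * u (s *\<^sub>R x)) \<le> c\<^sup>2 / s * dirichlet u"
proof -
  note [measurable] = D12_measurable[OF u]
  have "diff_energy (\<lambda>x. c * u (s *\<^sub>R x)) h \<le> ennreal (h\<^sup>2 * (c\<^sup>2 / s * dirichlet u))" if h: "h > 0" for h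
  proof -
    let ?g = "\<lambda>x. \<Sum>i\<in>UNIV. ennreal ((u (x + (s * h) *\<^sub>R axis i 1) - u x)\<^sup>2)"
    have "diff_energy (\<lambda>x. c * u (s *\<^sub>R x)) h = (\<integral>\<^sup>+ x. ennreal (c\<^sup>2) * ?g (s *\<^sub>R x) \<partial>lborel)"
      unfolding diff_energy_def
    proof (intro nn_integral_cong)
      fix x
      have "ennreal ((c * u (s *\<^sub>R (x + h *\<^sub>R axis i 1)) - c * u (s *\<^sub>R x))\<^sup>2)
         = ennreal (c\<^sup>2) * ennreal ((u (s *\<^sub>R x + (s * h) *\<^sub>R axis i 1) - u (s *\<^sub>R x))\<^sup>2)" for i
        by (simp add: ennreal_mult[symmetric] power_mult_distrib[symmetric] scaleR_add_right right_diff_distrib)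
      then show "(\<Sum>i\<in>UNIV. ennreal ((c * u (s *\<^sub>R (x + h *\<^sub>R axis i 1)) - c * u (s *\<^sub>R x))\<^sup>2)) = ennreal (c\<^sup>2) * ?g (s *\<^sub>R x)"
        by (simp only: sum_distrib_left)
    qed
    also have "\<dots> = ennreal (c\<^sup>2) * (\<integral>\<^sup>+ x. ?g (s *\<^sub>R x) \<partial>lborel)"
      by (rule nn_integral_cmult) measurable
    also have "(\<integral>\<^sup>+ x. ?g (s *\<^sub>R x) \<partial>lborel) = ennreal (1 / s ^ 3) * (\<integral>\<^sup>+ x. ?g x \<partial>lborel)"
      using nn_integral_scale[of ?g s] s by simp
    also have "(\<integral>\<^sup>+ x. ?g x \<partial>lborel) \<le> ennreal ((s * h)\<^sup>2 * dirichlet u)"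
      using diff_energy_dirichlet[OF u, of "s * h"] s h by (simp add: diff_energy_def)
    finally have "diff_energy (\<lambda>x. c * u (s *\<^sub>R x)) h \<le> ennreal (c\<^sup>2) * (ennreal (1 / s ^ 3) * ennreal ((s * h)\<^sup>2 * dirichlet u))"
      by (simp add: mult_left_mono)
    also have "\<dots> = ennreal (c\<^sup>2 * (1 / s ^ 3 * ((s * h)\<^sup>2 * dirichlet u)))"
      using s dirichlet_nonneg[of u] by (simp add: ennreal_mult[symmetric])
    also have "c\<^sup>2 * (1 / s ^ 3 * ((s * h)\<^sup>2 * dirichlet u)) = h\<^sup>2 * (c\<^sup>2 / s * dirichlet u)"
      using s by (simp add: field_simps power2_eq_square power3_eq_cube)
    finally show ?thesis .
  qed
  moreover have "integrable lborel (\<lambda>x. \<bar>c * u (s *\<^sub>R x)\<bar> ^ 6)"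
    using integrable_scale[OF D12_pow6[OF u] s] by (simp add: abs_mult power_mult_distrib)
  moreover have "c\<^sup>2 / s * dirichlet u \<ge> 0" using s dirichlet_nonneg by simp
  ultimately show "(\<lambda>x. c * u (s *\<^sub>R x)) \<in> D12" "dirichlet (\<lambda>x. c * u (s *\<^sub>R x)) \<le> c\<^sup>2 / s * dirichlet u"
    using D12_of_diff_energy[of "\<lambda>x. c * u (s *\<^sub>R x)" "c\<^sup>2 / s * dirichlet u"] by auto
qed


section \<open>Radial functions\<close>

subsection \<open>Polar coordinates\<close>

text \<open>The density of \<open>\<bar>x\<bar>\<^sup>2\<close> under Lebesgue measure on three-space. The squared radius is used as radial coordinate because
\<open>x \<bullet> x\<close> is smooth, so that smooth functions of it are smooth functions on three-space.\<close>
definition polar_weight :: "real \<Rightarrow> real" where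
  "polar_weight t = (if t > 0 then 2 * pi * t powr (1/2) else 0)"

lemma polar_weight_nonneg [simp]: "polar_weight t \<ge> 0"
  by (simp add: polar_weight_def)

lemma polar_weight_measurable [measurable]: "polar_weight \<in> borel_measurable borel"
  unfolding polar_weight_def[abs_def] by measurable

lemma nn_integral_powr_from_0:
  assumes a: "a > -1" and c: "c \<ge> 0"
  shows "(\<integral>\<^sup>+ t. ennreal (if t \<in> {0..c} then t powr a else 0) \<partial>lborel) = ennreal (c powr (a+1) / (a+1))"
proof (rule nn_integral_has_integral_lborel)
  show "((\<lambda>t. if t \<in> {0..c} then t powr a else 0) has_integral c powr (a+1) / (a+1)) UNIV"
    by (subst has_integral_restrict_UNIV) (rule has_integral_powr_from_0[OF a c])
qed auto

lemma nn_integral_powr_to_inf: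
  assumes a: "e < -1" and c: "c > 0"
  shows "(\<integral>\<^sup>+ t. ennreal (if t \<in> {c..} then t powr e else 0) \<partial>lborel) = ennreal (- (c powr (e+1)) / (e+1))"
proof (rule nn_integral_has_integral_lborel)
  show "((\<lambda>t. if t \<in> {c..} then t powr e else 0) has_integral - (c powr (e+1)) / (e+1)) UNIV"
    by (subst has_integral_restrict_UNIV) (rule has_integral_powr_to_inf[OF a c])
qed auto

text \<open>Both measures give a half line up to \<open>a \<ge> 0\<close> the volume of a ball of radius \<open>sqrt a\<close>.\<close>
lemma distr_norm_square:
  "distr lborel borel (\<lambda>x::R3. x \<bullet> x) = density lborel (\<lambda>t. ennreal (polar_weight t))"
proof (rule measure_eqI_generator_eq_countable)
  let ?E = "range (\<lambda>a::real. {..a})"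
  show "Int_stable ?E" by (auto simp: Int_stable_def)
  show "?E \<subseteq> Pow UNIV" "sets (distr lborel borel (\<lambda>x::R3. x \<bullet> x)) = sigma_sets UNIV ?E"
    "sets (density lborel (\<lambda>t. ennreal (polar_weight t))) = sigma_sets UNIV ?E"
    by (auto simp: borel_eq_atMost)
  have L: "emeasure (distr lborel borel (\<lambda>x::R3. x \<bullet> x)) {..a} = (if a \<ge> 0 then ennreal (4/3 * pi * a powr (3/2)) else 0)" for a
  proof -
    have "emeasure (distr lborel borel (\<lambda>x::R3. x \<bullet> x)) {..a} = emeasure lborel ((\<lambda>x::R3. x \<bullet> x) -` {..a})"
      by (subst emeasure_distr) auto
    also have "\<dots> = (if a \<ge> 0 then ennreal (4/3 * pi * a powr (3/2)) else 0)"
    proof (cases "a \<ge> 0")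
      case True
      have "norm x \<le> sqrt a \<longleftrightarrow> x \<bullet> x \<le> a" for x :: R3
        by (simp add: norm_eq_sqrt_inner)
      then have "(\<lambda>x::R3. x \<bullet> x) -` {..a} = cball 0 (sqrt a)" by auto
      moreover have "sqrt a ^ 3 = a powr (3/2)"
        using True by (cases "a = 0") (simp_all add: powr_half_sqrt[symmetric] powr_powr powr_realpow[symmetric] del: powr_half_sqrt)
      ultimately show ?thesis using True by (simp add: emeasure_cball unit_ball_vol_3)
    next
      case False
      then have "(\<lambda>x::R3. x \<bullet> x) -` {..a} = {}"
        by (auto simp: not_le) (meson inner_ge_zero le_less_trans not_less)
      then show ?thesis using False by simp
    qed
    finally show ?thesis .
  qed
  have R: "emeasure (density lborel (\<lambda>t. ennreal (polar_weight t))) {..a} = (if a \<ge> 0 then ennreal (4/3 * pi * a powr (3/2)) else 0)" for a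
  proof -
    have "emeasure (density lborel (\<lambda>t. ennreal (polar_weight t))) {..a} = (\<integral>\<^sup>+ t. ennreal (polar_weight t) * indicator {..a} t \<partial>lborel)"
      by (subst emeasure_density) auto
    also have "\<dots> = (if a \<ge> 0 then ennreal (4/3 * pi * a powr (3/2)) else 0)"
    proof (cases "a \<ge> 0")
      case True
      have "(\<integral>\<^sup>+ t. ennreal (polar_weight t) * indicator {..a} t \<partial>lborel)
         = (\<integral>\<^sup>+ t. ennreal (2 * pi) * ennreal (if t \<in> {0..a} then t powr (1/2) else 0) \<partial>lborel)"
        by (intro nn_integral_cong)
          (auto simp: polar_weight_def ennreal_mult[symmetric] less_le split: split_indicator)
      also have "\<dots> = ennreal (2 * pi) * ennreal (a powr (1/2 + 1) / (1/2 + 1))"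
        using nn_integral_powr_from_0[of "1/2" a] True by (simp add: nn_integral_cmult)
      also have "\<dots> = ennreal (4/3 * pi * a powr (3/2))"
        by (simp add: ennreal_mult[symmetric] algebra_simps)
      finally show ?thesis using True by simp
    next
      case False
      have "(\<integral>\<^sup>+ t. ennreal (polar_weight t) * indicator {..a} t \<partial>lborel) = (\<integral>\<^sup>+ t. 0 \<partial>(lborel::real measure))"
        by (intro nn_integral_cong) (use False in \<open>auto simp: polar_weight_def split: split_indicator\<close>)
      then show ?thesis using False by simp
    qed
    finally show ?thesis .
  qed
  show "emeasure (distr lborel borel (\<lambda>x::R3. x \<bullet> x)) X = emeasure (density lborel (\<lambda>t. ennreal (polar_weight t))) X"
    if "X \<in> ?E" for X using that L R by auto
  let ?A = "range (\<lambda>n::nat. {..real n})"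
  show "?A \<subseteq> ?E" "countable ?A" by auto
  show "\<Union>?A = UNIV" by (auto simp: real_arch_simple)
  show "emeasure (distr lborel borel (\<lambda>x::R3. x \<bullet> x)) X \<noteq> \<infinity>" if "X \<in> ?A" for X
    using that L by auto
qed

lemma nn_integral_polar:
  assumes [measurable]: "f \<in> borel_measurable borel"
  shows "(\<integral>\<^sup>+ x. f ((x::R3) \<bullet> x) \<partial>lborel) = (\<integral>\<^sup>+ t. ennreal (polar_weight t) * f t \<partial>lborel)"
proof -
  have "(\<integral>\<^sup>+ x. f ((x::R3) \<bullet> x) \<partial>lborel) = (\<integral>\<^sup>+ t. f t \<partial>distr lborel borel (\<lambda>x::R3. x \<bullet> x))"
    by (subst nn_integral_distr) auto
  then show ?thesis unfolding distr_norm_square by (simp add: nn_integral_density)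
qed

lemma integrable_polar:
  fixes f :: "real \<Rightarrow> real"
  assumes [measurable]: "f \<in> borel_measurable borel"
  shows "integrable lborel (\<lambda>x::R3. f (x \<bullet> x)) \<longleftrightarrow> integrable lborel (\<lambda>t. polar_weight t * f t)"
proof -
  have "integrable lborel (\<lambda>x::R3. f (x \<bullet> x)) \<longleftrightarrow> integrable (distr lborel borel (\<lambda>x::R3. x \<bullet> x)) f"
    by (subst integrable_distr_eq) auto
  then show ?thesis unfolding distr_norm_square by (simp add: integrable_density)
qed

lemma integral_polar:
  fixes f :: "real \<Rightarrow> real"
  assumes [measurable]: "f \<in> borel_measurable borel"
  shows "(LINT x|lborel. f ((x::R3) \<bullet> x)) = (LINT t|lborel. polar_weight t * f t)"
proof -
  have "(LINT x|lborel. f ((x::R3) \<bullet> x)) = (LINT t|distr lborel borel (\<lambda>x::R3. x \<bullet> x). f t)"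
    by (subst integral_distr) auto
  then show ?thesis unfolding distr_norm_square by (simp add: integral_density)
qed

lemma AE_polar:
  assumes [measurable]: "Measurable.pred borel P"
  shows "(AE x in lborel. P ((x::R3) \<bullet> x)) \<longleftrightarrow> (AE t in lborel. t > 0 \<longrightarrow> P t)"
proof -
  have "(AE x in lborel. P ((x::R3) \<bullet> x)) \<longleftrightarrow> (AE t in distr lborel borel (\<lambda>x::R3. x \<bullet> x). P t)"
    by (subst AE_distr_iff) auto
  also have "\<dots> \<longleftrightarrow> (AE t in lborel. 0 < ennreal (polar_weight t) \<longrightarrow> P t)"
    unfolding distr_norm_square by (subst AE_density) auto
  also have "\<dots> \<longleftrightarrow> (AE t in lborel. t > 0 \<longrightarrow> P t)"
    by (simp add: polar_weight_def)
  finally show ?thesis .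
qed

lemma inner_self_powr: "(x \<bullet> x) powr p = norm (x::'a::real_inner) powr (2 * p)"
proof (cases "x = 0")
  case False
  have "x \<bullet> x = norm x powr 2" using False by (simp add: powr_numeral power2_norm_eq_inner)
  then have "(x \<bullet> x) powr p = (norm x powr 2) powr p" by (rule arg_cong)
  then show ?thesis unfolding powr_powr .
qed simp

lemma inner_self_le_square: "R \<ge> 0 \<Longrightarrow> (x::'a::real_inner) \<bullet> x \<le> R\<^sup>2 \<longleftrightarrow> norm x \<le> R"
  unfolding power2_norm_eq_inner[symmetric] using abs_le_square_iff[of "norm x" R] by simp

lemma inner_self_ge_square: "R \<ge> 0 \<Longrightarrow> R\<^sup>2 \<le> (x::'a::real_inner) \<bullet> x \<longleftrightarrow> R \<le> norm x"
  unfolding power2_norm_eq_inner[symmetric] using abs_le_square_iff[of R "norm x"] by simp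

lemma square_powr:
  assumes "R > 0"
  shows "((R::real)\<^sup>2) powr ((1 - p) / 2 + 1) = R powr (3 - p)"
proof -
  have "(R\<^sup>2) powr ((1 - p) / 2 + 1) = (R powr 2) powr ((1 - p) / 2 + 1)"
    using assms by (simp add: powr_numeral)
  also have "\<dots> = R powr (2 * ((1 - p) / 2 + 1))" by (rule powr_powr)
  also have "2 * ((1 - p) / 2 + 1) = 3 - p" by (simp add: field_simps)
  finally show ?thesis .
qed

lemma nn_integral_norm_powr_ball:
  assumes p: "p < 3" and R: "R > 0"
  shows "(\<integral>\<^sup>+ x. ennreal (if norm (x::R3) \<le> R then norm x powr (- p) else 0) \<partial>lborel)
    = ennreal (4 * pi / (3 - p) * R powr (3 - p))"
proof -
  let ?f = "\<lambda>t::real. ennreal (if t \<le> R\<^sup>2 then t powr (- p / 2) else 0)"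
  have "(\<integral>\<^sup>+ x. ennreal (if norm (x::R3) \<le> R then norm x powr (- p) else 0) \<partial>lborel) = (\<integral>\<^sup>+ x. ?f ((x::R3) \<bullet> x) \<partial>lborel)"
    by (intro nn_integral_cong) (use R in \<open>auto simp: inner_self_powr inner_self_le_square\<close>)
  also have "\<dots> = (\<integral>\<^sup>+ t. ennreal (polar_weight t) * ?f t \<partial>lborel)"
    by (rule nn_integral_polar) measurable
  also have "\<dots> = (\<integral>\<^sup>+ t. ennreal (2 * pi) * ennreal (if t \<in> {0..R\<^sup>2} then t powr ((1 - p) / 2) else 0) \<partial>lborel)"
  proof (intro nn_integral_cong)
    fix t :: real
    have "t powr (1/2) * t powr (- p / 2) = t powr ((1 - p) / 2)"
      by (simp add: powr_add[symmetric] field_simps)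
    then show "ennreal (polar_weight t) * ?f t = ennreal (2 * pi) * ennreal (if t \<in> {0..R\<^sup>2} then t powr ((1 - p) / 2) else 0)"
      by (cases "t = 0") (auto simp: polar_weight_def ennreal_mult[symmetric] mult.assoc)
  qed
  also have "\<dots> = ennreal (2 * pi) * ennreal ((R\<^sup>2) powr ((1 - p) / 2 + 1) / ((1 - p) / 2 + 1))"
    using p nn_integral_powr_from_0[of "(1 - p)/2" "R\<^sup>2"] by (simp add: nn_integral_cmult)
  also have "(R\<^sup>2) powr ((1 - p) / 2 + 1) = R powr (3 - p)"
    by (rule square_powr[OF R])
  also have "ennreal (2 * pi) * ennreal (R powr (3 - p) / ((1 - p) / 2 + 1)) = ennreal (4 * pi / (3 - p) * R powr (3 - p))"
    using p by (subst ennreal_mult[symmetric]) (auto simp: field_simps)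
  finally show ?thesis .
qed

lemma nn_integral_norm_powr_outside:
  assumes p: "p > 3" and R: "R > 0"
  shows "(\<integral>\<^sup>+ x. ennreal (if R \<le> norm (x::R3) then norm x powr (- p) else 0) \<partial>lborel)
    = ennreal (4 * pi / (p - 3) * R powr (3 - p))"
proof -
  let ?f = "\<lambda>t::real. ennreal (if R\<^sup>2 \<le> t then t powr (- p / 2) else 0)"
  have "(\<integral>\<^sup>+ x. ennreal (if R \<le> norm (x::R3) then norm x powr (- p) else 0) \<partial>lborel) = (\<integral>\<^sup>+ x. ?f ((x::R3) \<bullet> x) \<partial>lborel)"
    by (intro nn_integral_cong) (use R in \<open>auto simp: inner_self_powr inner_self_ge_square\<close>)
  also have "\<dots> = (\<integral>\<^sup>+ t. ennreal (polar_weight t) * ?f t \<partial>lborel)"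
    by (rule nn_integral_polar) measurable
  also have "\<dots> = (\<integral>\<^sup>+ t. ennreal (2 * pi) * ennreal (if t \<in> {R\<^sup>2..} then t powr ((1 - p) / 2) else 0) \<partial>lborel)"
  proof (intro nn_integral_cong)
    fix t :: real
    have "t powr (1/2) * t powr (- p / 2) = t powr ((1 - p) / 2)"
      by (simp add: powr_add[symmetric] field_simps)
    moreover have "t > 0" if "R\<^sup>2 \<le> t"
    proof -
      have "R\<^sup>2 > 0" using R by simp
      then show ?thesis using that by linarith
    qed
    ultimately show "ennreal (polar_weight t) * ?f t = ennreal (2 * pi) * ennreal (if t \<in> {R\<^sup>2..} then t powr ((1 - p) / 2) else 0)"
      by (auto simp: polar_weight_def ennreal_mult[symmetric] mult.assoc)
  qed
  also have "\<dots> = ennreal (2 * pi) * ennreal (- ((R\<^sup>2) powr ((1 - p) / 2 + 1)) / ((1 - p) / 2 + 1))"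
    using p R nn_integral_powr_to_inf[of "(1 - p)/2" "R\<^sup>2"] by (simp add: nn_integral_cmult)
  also have "(R\<^sup>2) powr ((1 - p) / 2 + 1) = R powr (3 - p)"
    by (rule square_powr[OF R])
  also have "- (R powr (3 - p)) / ((1 - p) / 2 + 1) = 2 / (p - 3) * R powr (3 - p)"
    using p by (simp add: field_simps)
  also have "ennreal (2 * pi) * ennreal (2 / (p - 3) * R powr (3 - p)) = ennreal (4 * pi / (p - 3) * R powr (3 - p))"
    using p by (subst ennreal_mult[symmetric]) auto
  finally show ?thesis .
qed

subsection \<open>The radial profile of a gradient\<close>

text \<open>Up to the factor \<open>4 * pi\<close> this is the inner product of \<open>w\<close> with the gradient of the fundamental solution of the Laplacian.\<close>
definition radial_part :: "(R3 \<Rightarrow> R3) \<Rightarrow> R3 \<Rightarrow> real" where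
  "radial_part w x = (w x \<bullet> x) * norm x powr (- 3)"

text \<open>For the gradient of a smooth radial function that vanishes at infinity, integration in polar coordinates turns this into
minus the integral of the radial derivative from \<open>r\<close> to infinity, that is, into the value at radius \<open>r\<close>.\<close>
definition profile :: "(R3 \<Rightarrow> R3) \<Rightarrow> real \<Rightarrow> real" where
  "profile w r = - (1 / (4 * pi)) * (LINT x|lborel. (if r \<le> norm x then radial_part w x else 0))"

lemma radial_part_measurable [measurable]:
  assumes [measurable]: "w \<in> borel_measurable borel"
  shows "radial_part w \<in> borel_measurable borel"
  unfolding radial_part_def[abs_def] by measurable

lemma radial_part_bound: "\<bar>radial_part w x\<bar> \<le> norm (w x) * norm x powr (- 2)"
proof (cases "x = 0")
  case False
  have "\<bar>radial_part w x\<bar> \<le> (norm (w x) * norm x) * norm x powr (- 3)"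
    unfolding radial_part_def abs_mult by (intro mult_mono Cauchy_Schwarz_ineq2) auto
  also have "\<dots> = norm (w x) * (norm x * norm x powr (- 3))" by (rule mult.assoc)
  also have "norm x * norm x powr (- 3) = norm x powr (- 2)"
    using False powr_add[of "norm x" 1 "-3"] by simp
  finally show ?thesis .
qed (simp add: radial_part_def)

text \<open>Cauchy--Schwarz, with the factor \<open>\<bar>x\<bar> powr (-4)\<close> integrated over the region \<open>P\<close>.\<close>
lemma radial_part_square_bound:
  fixes w :: "R3 \<Rightarrow> R3"
  assumes [measurable]: "w \<in> borel_measurable borel" and w: "integrable lborel (\<lambda>x. (norm (w x))\<^sup>2)"
    and P[measurable]: "Measurable.pred borel P"
    and fin: "(\<integral>\<^sup>+ x. ennreal (if P (x::R3) then norm x powr (- 4) else 0) \<partial>lborel) \<le> ennreal K" and K: "K \<ge> 0"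
  shows "integrable lborel (\<lambda>x. if P x then radial_part w x else 0)"
    "(LINT x|lborel. (if P x then radial_part w x else 0))\<^sup>2 \<le> (LINT x|lborel. (norm (w x))\<^sup>2) * K"
proof -
  let ?g = "\<lambda>x::R3. if P x then norm x powr (- 2) else 0"
  have g2: "(\<integral>\<^sup>+ x. ennreal ((?g x)\<^sup>2) \<partial>lborel) \<le> ennreal K"
  proof -
    have "((norm (x::R3)) powr (- 2))\<^sup>2 = norm x powr (- 4)" for x
      by (cases "x = 0") (simp_all add: powr_add[symmetric] power2_eq_square)
    then have "(\<integral>\<^sup>+ x. ennreal ((?g x)\<^sup>2) \<partial>lborel) = (\<integral>\<^sup>+ x. ennreal (if P (x::R3) then norm x powr (- 4) else 0) \<partial>lborel)"
      by (intro nn_integral_cong) auto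
    then show ?thesis using fin by simp
  qed
  have A: "(\<integral>\<^sup>+ x. ennreal ((norm (w x))\<^sup>2) \<partial>lborel) = ennreal (LINT x|lborel. (norm (w x))\<^sup>2)"
    by (rule nn_integral_eq_integral[OF w]) simp
  have g2i: "integrable lborel (\<lambda>x. (?g x)\<^sup>2)"
    using g2 by (intro integrableI_bounded) (auto simp: le_less_trans)
  have pw: "\<bar>(if P x then radial_part w x else 0)\<bar> \<le> \<bar>norm (w x) * ?g x\<bar>" for x
    using radial_part_bound[of w x] by (auto simp: abs_mult)
  have i2: "integrable lborel (\<lambda>x. (norm (w x))\<^sup>2 + (?g x)\<^sup>2)"
    using w g2i by (rule Bochner_Integration.integrable_add)
  have b2: "\<bar>norm (w x) * ?g x\<bar> \<le> (norm (w x))\<^sup>2 + (?g x)\<^sup>2" for x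
  proof -
    have "2 * (norm (w x) * ?g x) \<le> (norm (w x))\<^sup>2 + (?g x)\<^sup>2"
      using zero_le_power2[of "norm (w x) - ?g x"] unfolding power2_diff by linarith
    moreover have "norm (w x) * ?g x \<ge> 0" by simp
    ultimately show ?thesis by linarith
  qed
  have ig: "integrable lborel (\<lambda>x. norm (w x) * ?g x)"
  proof (rule Bochner_Integration.integrable_bound[OF i2])
    show "AE x in lborel. norm (norm (w x) * ?g x) \<le> norm ((norm (w x))\<^sup>2 + (?g x)\<^sup>2)"
      using b2 by (intro AE_I2) (simp only: real_norm_def, smt (verit))
  qed measurable
  show "integrable lborel (\<lambda>x. if P x then radial_part w x else 0)"
    by (rule Bochner_Integration.integrable_bound[OF ig]) (use pw in auto)
  have "\<bar>LINT x|lborel. (if P x then radial_part w x else 0)\<bar> \<le> \<bar>LINT x|lborel. norm (w x) * ?g x\<bar>"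
  proof -
    have "ennreal \<bar>LINT x|lborel. (if P x then radial_part w x else 0)\<bar> \<le> (\<integral>\<^sup>+ x. ennreal \<bar>(if P x then radial_part w x else 0)\<bar> \<partial>lborel)"
      by (rule abs_integral_le_nn_integral)
    also have "\<dots> \<le> (\<integral>\<^sup>+ x. ennreal \<bar>norm (w x) * ?g x\<bar> \<partial>lborel)"
      by (intro nn_integral_mono ennreal_leI pw)
    also have "\<dots> = (\<integral>\<^sup>+ x. ennreal (norm (w x) * ?g x) \<partial>lborel)"
      by (intro nn_integral_cong) (simp add: abs_mult)
    also have "\<dots> = ennreal (LINT x|lborel. norm (w x) * ?g x)"
      by (rule nn_integral_eq_integral[OF ig]) simp
    also have "\<dots> \<le> ennreal \<bar>LINT x|lborel. norm (w x) * ?g x\<bar>" by (rule ennreal_leI) simp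
    finally show ?thesis by (simp add: ennreal_le_iff del: ennreal_le_iff2)
  qed
  then have "(LINT x|lborel. (if P x then radial_part w x else 0))\<^sup>2 \<le> (LINT x|lborel. norm (w x) * ?g x)\<^sup>2"
    by (rule abs_le_square_iff[THEN iffD1])
  moreover have "ennreal ((LINT x|lborel. norm (w x) * ?g x)\<^sup>2) \<le> ennreal ((LINT x|lborel. (norm (w x))\<^sup>2) * K)"
  proof -
    have "ennreal ((LINT x|lborel. norm (w x) * ?g x)\<^sup>2)
        \<le> (\<integral>\<^sup>+ x. ennreal ((norm (w x))\<^sup>2) \<partial>lborel) * (\<integral>\<^sup>+ x. ennreal ((?g x)\<^sup>2) \<partial>lborel)"
      by (rule Cauchy_Schwarz_integral) measurable
    also have "\<dots> \<le> ennreal (LINT x|lborel. (norm (w x))\<^sup>2) * ennreal K"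
      unfolding A by (intro mult_left_mono g2) simp
    finally show ?thesis using K by (simp add: ennreal_mult)
  qed
  then have "(LINT x|lborel. norm (w x) * ?g x)\<^sup>2 \<le> (LINT x|lborel. (norm (w x))\<^sup>2) * K"
    using K by (subst (asm) ennreal_le_iff) auto
  ultimately show "(LINT x|lborel. (if P x then radial_part w x else 0))\<^sup>2 \<le> (LINT x|lborel. (norm (w x))\<^sup>2) * K"
    by linarith
qed

lemma norm_powr_4_outside:
  assumes "r > 0"
  shows "(\<integral>\<^sup>+ x. ennreal (if r \<le> norm (x::R3) then norm x powr (- 4) else 0) \<partial>lborel) = ennreal (4 * pi / r)"
  using nn_integral_norm_powr_outside[of 4 r] assms by (simp add: powr_minus divide_inverse)

lemma norm_powr_4_annulus:
  assumes r: "0 < r" "r \<le> s"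
  shows "(\<integral>\<^sup>+ x. ennreal (if r \<le> norm (x::R3) \<and> norm x < s then norm x powr (- 4) else 0) \<partial>lborel) \<le> ennreal (4 * pi * (1 / r - 1 / s))"
proof -
  let ?I = "\<integral>\<^sup>+ x. ennreal (if r \<le> norm (x::R3) \<and> norm x < s then norm x powr (- 4) else 0) \<partial>lborel"
  have "ennreal (4 * pi / r) = (\<integral>\<^sup>+ x. ennreal (if r \<le> norm (x::R3) \<and> norm x < s then norm x powr (- 4) else 0)
      + ennreal (if s \<le> norm (x::R3) then norm x powr (- 4) else 0) \<partial>lborel)"
    unfolding norm_powr_4_outside[OF r(1), symmetric]
    by (intro nn_integral_cong) (use r in auto)
  also have "\<dots> = ?I + ennreal (4 * pi / s)"
    using r by (subst nn_integral_add) (auto simp: norm_powr_4_outside)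
  finally have eq: "ennreal (4 * pi / r) = ?I + ennreal (4 * pi / s)" .
  have "?I \<le> ennreal (4 * pi / r)" unfolding eq by simp
  also have "\<dots> < \<infinity>" by simp
  finally have "?I < \<infinity>" .
  then obtain i where i: "?I = ennreal i" "i \<ge> 0" by (cases "?I") auto
  have "ennreal (4 * pi / r) = ennreal (i + 4 * pi / s)"
    using eq r i by (simp add: ennreal_plus[symmetric] del: ennreal_plus)
  then have "4 * pi / r = i + 4 * pi / s" using r i(2) by (subst (asm) ennreal_inj) auto
  then have "i = 4 * pi * (1 / r - 1 / s)" by (simp add: algebra_simps)
  then show ?thesis using i by simp
qed

text \<open>The exterior of a ball of radius \<open>r\<close> has \<open>\<bar>x\<bar> powr (-4)\<close>-mass \<open>4 * pi / r\<close>: this is the classical radial decay of order one half.\<close>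
lemma profile_bound:
  fixes w :: "R3 \<Rightarrow> R3"
  assumes [measurable]: "w \<in> borel_measurable borel" and w: "integrable lborel (\<lambda>x. (norm (w x))\<^sup>2)" and r: "r > 0"
  shows "integrable lborel (\<lambda>x. if r \<le> norm x then radial_part w x else 0)"
    "(profile w r)\<^sup>2 \<le> (LINT x|lborel. (norm (w x))\<^sup>2) / (4 * pi * r)"
proof -
  note * = radial_part_square_bound[of w "\<lambda>x. r \<le> norm x" "4 * pi / r", OF assms(1,2)]
  show "integrable lborel (\<lambda>x. if r \<le> norm x then radial_part w x else 0)"
    by (rule *(1)) (use r norm_powr_4_outside[OF r] in auto)
  have "(LINT x|lborel. (if r \<le> norm x then radial_part w x else 0))\<^sup>2 \<le> (LINT x|lborel. (norm (w x))\<^sup>2) * (4 * pi / r)"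
    by (rule *(2)) (use r norm_powr_4_outside[OF r] in auto)
  then have "(1 / (4 * pi))\<^sup>2 * (LINT x|lborel. (if r \<le> norm x then radial_part w x else 0))\<^sup>2
      \<le> (1 / (4 * pi))\<^sup>2 * ((LINT x|lborel. (norm (w x))\<^sup>2) * (4 * pi / r))"
    by (rule mult_left_mono) simp
  also have "\<dots> = (LINT x|lborel. (norm (w x))\<^sup>2) / (4 * pi * r)"
    using r by (simp add: field_simps power2_eq_square)
  finally show "(profile w r)\<^sup>2 \<le> (LINT x|lborel. (norm (w x))\<^sup>2) / (4 * pi * r)"
    by (simp add: profile_def power_mult_distrib power_divide)
qed

text \<open>The same estimate on an annulus.\<close>
lemma profile_diff:
  fixes w :: "R3 \<Rightarrow> R3"
  assumes [measurable]: "w \<in> borel_measurable borel" and w: "integrable lborel (\<lambda>x. (norm (w x))\<^sup>2)" and r: "0 < r" "r \<le> s"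
  shows "(profile w r - profile w s)\<^sup>2 \<le> (LINT x|lborel. (norm (w x))\<^sup>2) / (4 * pi) * (1 / r - 1 / s)"
proof -
  have s: "s > 0" using r by simp
  have "(LINT x|lborel. (if r \<le> norm x \<and> norm x < s then radial_part w x else 0))
     = (LINT x|lborel. (if r \<le> norm x then radial_part w x else 0) - (if s \<le> norm x then radial_part w x else 0))"
    by (intro Bochner_Integration.integral_cong) (use r in auto)
  also have "\<dots> = (LINT x|lborel. (if r \<le> norm x then radial_part w x else 0)) - (LINT x|lborel. (if s \<le> norm x then radial_part w x else 0))"
    by (rule Bochner_Integration.integral_diff) (use profile_bound(1)[OF assms(1) w] r s in auto)
  finally have D: "(LINT x|lborel. (if r \<le> norm x \<and> norm x < s then radial_part w x else 0))
     = (LINT x|lborel. (if r \<le> norm x then radial_part w x else 0)) - (LINT x|lborel. (if s \<le> norm x then radial_part w x else 0))" .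
  have "profile w r - profile w s = - (1 / (4 * pi)) * (LINT x|lborel. (if r \<le> norm x \<and> norm x < s then radial_part w x else 0))"
    unfolding profile_def D by (rule right_diff_distrib[symmetric])
  moreover have "(LINT x|lborel. (if r \<le> norm x \<and> norm x < s then radial_part w x else 0))\<^sup>2
      \<le> (LINT x|lborel. (norm (w x))\<^sup>2) * (4 * pi * (1 / r - 1 / s))"
    by (rule radial_part_square_bound(2)[OF assms(1,2) _ norm_powr_4_annulus[OF r]])
      (use r s in \<open>auto simp: frac_le\<close>)
  then have "(1 / (4 * pi))\<^sup>2 * (LINT x|lborel. (if r \<le> norm x \<and> norm x < s then radial_part w x else 0))\<^sup>2
      \<le> (1 / (4 * pi))\<^sup>2 * ((LINT x|lborel. (norm (w x))\<^sup>2) * (4 * pi * (1 / r - 1 / s)))"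
    by (rule mult_left_mono) simp
  moreover have "(1 / (4 * pi))\<^sup>2 * ((LINT x|lborel. (norm (w x))\<^sup>2) * (4 * pi * (1 / r - 1 / s)))
     = (LINT x|lborel. (norm (w x))\<^sup>2) / (4 * pi) * (1 / r - 1 / s)"
    by (simp add: field_simps power2_eq_square)
  ultimately show ?thesis by (simp add: power_mult_distrib power_divide)
qed


lemma smooth_antiderivative:
  assumes smooth: "\<And>n. Dk n \<eta>" and supp: "\<And>t. \<not> (a < t \<and> t < b) \<Longrightarrow> \<eta> t = 0"
    and mean: "(LINT t|lborel. \<eta> t) = 0"
  obtains \<kappa> where "\<And>n. Dk n \<kappa>" "\<And>t. (\<kappa> has_real_derivative \<eta> t) (at t)"
    "\<And>t. t \<le> a \<Longrightarrow> \<kappa> t = 0" "\<And>t. b \<le> t \<Longrightarrow> \<kappa> t = 0"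
    "\<And>s. \<kappa> s = (LINT t|lborel. (if t \<le> s then \<eta> t else 0))"
proof -
  have cont: "isCont \<eta> t" for t
    using Dk_continuous[OF smooth] by (simp add: continuous_on_eq_continuous_at)
  obtain F where F: "\<And>t. (F has_real_derivative \<eta> t) (at t)"
    using einterval_antiderivative[of "- \<infinity>" \<infinity> \<eta>] cont
    by (auto simp: has_real_derivative_iff_has_vector_derivative)
  have FTC: "(LINT t|lborel. \<eta> t * indicator {p..q} t) = F q - F p" if "p \<le> q" for p q
    by (rule integral_FTC_Icc_real) (use that F cont in auto)
  define \<kappa> where "\<kappa> t = F t - F a" for t
  have d: "(\<kappa> has_real_derivative \<eta> t) (at t)" for t
    unfolding \<kappa>_def by (auto intro!: derivative_eq_intros F)
  have eq: "\<kappa> s = (LINT t|lborel. (if t \<le> s then \<eta> t else 0))" for s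
  proof (cases "a \<le> s")
    case True
    have "(LINT t|lborel. (if t \<le> s then \<eta> t else 0)) = (LINT t|lborel. \<eta> t * indicator {a..s} t)"
      by (intro Bochner_Integration.integral_cong) (use supp in \<open>auto split: split_indicator\<close>)
    then show ?thesis using FTC[OF True] by (simp add: \<kappa>_def)
  next
    case False
    have "(LINT t|lborel. (if t \<le> s then \<eta> t else 0)) = 0"
      by (rule integral_eq_zero_AE, rule AE_I2) (use supp False in auto)
    moreover have "(LINT t|lborel. \<eta> t * indicator {s..a} t) = 0"
      by (rule integral_eq_zero_AE, rule AE_I2) (use supp in \<open>auto split: split_indicator\<close>)
    ultimately show ?thesis using FTC[of s a] False by (simp add: \<kappa>_def)
  qed
  have z1: "\<kappa> t = 0" if "t \<le> a" for t
  proof -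
    have "(LINT s|lborel. (if s \<le> t then \<eta> s else 0)) = 0"
      by (rule integral_eq_zero_AE, rule AE_I2) (use supp that in auto)
    then show ?thesis by (simp add: eq)
  qed
  have z2: "\<kappa> t = 0" if "b \<le> t" for t
  proof -
    have "(LINT s|lborel. (if s \<le> t then \<eta> s else 0)) = (LINT s|lborel. \<eta> s)"
      by (intro Bochner_Integration.integral_cong) (use supp that in auto)
    then show ?thesis using mean by (simp add: eq)
  qed
  have "Dk (Suc n) \<kappa>" for n using d smooth by auto
  then have "Dk n \<kappa>" for n by (rule Dk_Suc_D)
  then show ?thesis using that d z1 z2 eq by blast
qed

text \<open>Let \<open>\<kappa>\<close> be the compactly supported antiderivative of \<open>\<eta>\<close>. The field \<open>\<theta> (\<bar>x\<bar>\<^sup>2) * x\<close> with \<open>\<theta> t = t powr (-3/2) * \<kappa> t\<close> has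
divergence \<open>2 * \<eta> (\<bar>x\<bar>\<^sup>2) / \<bar>x\<bar>\<close>: the power is chosen such that the terms with \<open>\<kappa>\<close> cancel in three dimensions. Testing the weak
gradient with it, the left side becomes \<open>4 * pi\<close> times the integral of \<open>U * \<eta>\<close> in polar coordinates, and on the right side
writing \<open>\<kappa>\<close> as an integral of \<open>\<eta>\<close> and exchanging the integrals produces the profile.\<close>
lemma radial_identity:
  assumes g: "weak_gradient u w" and w2: "integrable lborel (\<lambda>x. (norm (w x))\<^sup>2)"
    and U[measurable]: "U \<in> borel_measurable borel" and ae: "AE x in lborel. u x = U (x \<bullet> x)"
    and a: "0 < a" and smooth: "\<And>n. Dk n \<eta>" and supp: "\<And>t. \<not> (a < t \<and> t < b) \<Longrightarrow> \<eta> t = 0"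
    and mean: "(LINT t|lborel. \<eta> t) = 0"
  shows "(LINT t|lborel. U t * \<eta> t) = (LINT t|lborel. profile w (sqrt t) * \<eta> t)"
proof -
  have lu: "loc_integrable u" and lw: "loc_integrable w" using g by (auto simp: weak_gradient_def)
  note [measurable] = loc_integrable_measurable[OF lu] loc_integrable_measurable[OF lw]
  have \<eta>c: "continuous_on UNIV \<eta>" by (rule Dk_continuous[OF smooth])
  then have [measurable]: "\<eta> \<in> borel_measurable borel" by (rule borel_measurable_continuous_onI)
  obtain \<kappa> where \<kappa>: "\<And>n. Dk n \<kappa>" "\<And>t. (\<kappa> has_real_derivative \<eta> t) (at t)"
    "\<And>t. t \<le> a \<Longrightarrow> \<kappa> t = 0" "\<And>t. b \<le> t \<Longrightarrow> \<kappa> t = 0"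
    "\<And>s. \<kappa> s = (LINT t|lborel. (if t \<le> s then \<eta> t else 0))"
    using smooth_antiderivative[OF smooth supp mean] by blast
  have [measurable]: "\<kappa> \<in> borel_measurable borel"
    by (rule borel_measurable_continuous_onI[OF Dk_continuous[OF \<kappa>(1)]])
  define \<theta> where "\<theta> t = t powr (- 3/2) * \<kappa> t" for t
  define \<theta>' where "\<theta>' t = (- 3/2) * t powr (- 5/2) * \<kappa> t + t powr (- 3/2) * \<eta> t" for t
  have d: "(\<theta> has_real_derivative \<theta>' t) (at t)" for t
  proof (cases "t > 0")
    case True
    have "((\<lambda>t. t powr (- 3/2)) has_real_derivative (- 3/2) * t powr (- 3/2 - 1)) (at t)"
      by (rule has_real_derivative_powr[OF True])
    from DERIV_mult[OF this \<kappa>(2)] show ?thesis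
      by (simp add: \<theta>_def[abs_def] \<theta>'_def algebra_simps)
  next
    case False
    have "((\<lambda>_. 0) has_real_derivative 0) (at t)" by simp
    then have "(\<theta> has_real_derivative 0) (at t)"
      by (rule has_field_derivative_transform_within_open[where S="{..<a}"])
        (use False a \<kappa>(3) in \<open>auto simp: \<theta>_def\<close>)
    moreover have "\<theta>' t = 0" using False a \<kappa>(3)[of t] supp[of t] by (simp add: \<theta>'_def)
    ultimately show ?thesis by simp
  qed
  have \<theta>s: "Dk n \<theta>" for n
    unfolding \<theta>_def[abs_def] by (rule Dk_powr_mult[OF a \<kappa>(1)]) (use \<kappa>(3) in auto)
  have \<theta>z: "\<theta> t = 0" if "b < t" for t using \<kappa>(4)[of t] that by (simp add: \<theta>_def)
  note T = radial_test_function[OF \<theta>s \<theta>z d]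
  have E: "(LINT x|lborel. u x * (2 * \<theta>' (x \<bullet> x) * (x $ i)\<^sup>2 + \<theta> (x \<bullet> x))) = - (LINT x|lborel. w x $ i * (\<theta> (x \<bullet> x) * x $ i))" for i
  proof -
    have "(LINT x|lborel. u x * pd (\<lambda>x. \<theta> (x \<bullet> x) * x $ i) i x) = - (LINT x|lborel. w x $ i * (\<theta> (x \<bullet> x) * x $ i))"
      using g T(1)[where i=i] by (simp add: weak_gradient_def)
    then show ?thesis by (simp only: T(2))
  qed
  have I1: "integrable lborel (\<lambda>x. u x * (2 * \<theta>' (x \<bullet> x) * (x $ i)\<^sup>2 + \<theta> (x \<bullet> x)))" for i
    using loc_integrable_test(2)[OF lu T(1)[where i=i], where i=i] by (simp only: T(2))
  have I2: "integrable lborel (\<lambda>x. w x $ i * (\<theta> (x \<bullet> x) * x $ i))" for i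
    by (rule loc_integrable_test(1)[OF loc_integrable_nth[OF lw] T(1)])
  \<comment> \<open>The divergence of the field; the coefficient 3 is the dimension.\<close>
  have theta: "2 * \<theta>' t * t + 3 * \<theta> t = 2 * t powr (- 1/2) * \<eta> t" if "t \<ge> 0" for t
  proof (cases "t = 0")
    case True
    then show ?thesis using \<kappa>(3)[of 0] a by (simp add: \<theta>_def)
  next
    case False
    then have p: "t powr (- 5/2) * t = t powr (- 3/2)" "t powr (- 3/2) * t = t powr (- 1/2)"
      using that powr_add[of t "- 5/2" 1] powr_add[of t "- 3/2" 1] by simp_all
    have "2 * \<theta>' t * t + 3 * \<theta> t
       = (- 3) * (t powr (- 5/2) * t) * \<kappa> t + 2 * (t powr (- 3/2) * t) * \<eta> t + 3 * (t powr (- 3/2) * \<kappa> t)"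
      unfolding \<theta>_def \<theta>'_def by (simp add: algebra_simps)
    then show ?thesis unfolding p by simp
  qed
  have "(LINT x|lborel. u x * (2 * (x \<bullet> x) powr (- 1/2) * \<eta> (x \<bullet> x)))
     = (LINT x|lborel. (\<Sum>i\<in>UNIV. u x * (2 * \<theta>' (x \<bullet> x) * (x $ i)\<^sup>2 + \<theta> (x \<bullet> x))))"
  proof (rule Bochner_Integration.integral_cong[OF refl])
    fix x :: R3
    have "(\<Sum>i\<in>UNIV. u x * (2 * \<theta>' (x \<bullet> x) * (x $ i)\<^sup>2 + \<theta> (x \<bullet> x)))
       = u x * (2 * \<theta>' (x \<bullet> x) * (\<Sum>i\<in>UNIV. (x $ i)\<^sup>2) + 3 * \<theta> (x \<bullet> x))"
      by (simp add: sum_distrib_left[symmetric] sum.distrib)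
    also have "(\<Sum>i\<in>UNIV. (x $ i)\<^sup>2) = x \<bullet> x"
      by (simp add: norm_square_components[symmetric] power2_norm_eq_inner)
    also have "2 * \<theta>' (x \<bullet> x) * (x \<bullet> x) + 3 * \<theta> (x \<bullet> x) = 2 * (x \<bullet> x) powr (- 1/2) * \<eta> (x \<bullet> x)"
      by (rule theta) simp
    finally show "u x * (2 * (x \<bullet> x) powr (- 1/2) * \<eta> (x \<bullet> x))
      = (\<Sum>i\<in>UNIV. u x * (2 * \<theta>' (x \<bullet> x) * (x $ i)\<^sup>2 + \<theta> (x \<bullet> x)))" by (rule sym)
  qed
  also have "\<dots> = (\<Sum>i\<in>UNIV. LINT x|lborel. u x * (2 * \<theta>' (x \<bullet> x) * (x $ i)\<^sup>2 + \<theta> (x \<bullet> x)))"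
    by (rule Bochner_Integration.integral_sum) (rule I1)
  also have "\<dots> = - (\<Sum>i\<in>UNIV. LINT x|lborel. w x $ i * (\<theta> (x \<bullet> x) * x $ i))"
    unfolding E by (rule sum_negf)
  also have "(\<Sum>i\<in>UNIV. LINT x|lborel. w x $ i * (\<theta> (x \<bullet> x) * x $ i))
     = (LINT x|lborel. (\<Sum>i\<in>UNIV. w x $ i * (\<theta> (x \<bullet> x) * x $ i)))"
    by (rule Bochner_Integration.integral_sum[symmetric]) (rule I2)
  also have "\<dots> = (LINT x|lborel. (LINT t|lborel. radial_part w x * (if t \<le> x \<bullet> x then \<eta> t else 0)))"
  proof (rule Bochner_Integration.integral_cong[OF refl])
    fix x :: R3
    have "(\<Sum>i\<in>UNIV. w x $ i * (\<theta> (x \<bullet> x) * x $ i)) = \<theta> (x \<bullet> x) * (w x \<bullet> x)"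
      unfolding inner_vec_def sum_distrib_left by (intro sum.cong) auto
    also have "\<dots> = radial_part w x * \<kappa> (x \<bullet> x)"
      unfolding \<theta>_def radial_part_def inner_self_powr by simp
    also have "\<dots> = (LINT t|lborel. radial_part w x * (if t \<le> x \<bullet> x then \<eta> t else 0))"
      unfolding \<kappa>(5) by simp
    finally show "(\<Sum>i\<in>UNIV. w x $ i * (\<theta> (x \<bullet> x) * x $ i)) = (LINT t|lborel. radial_part w x * (if t \<le> x \<bullet> x then \<eta> t else 0))" .
  qed
  also have "\<dots> = (LINT t|lborel. (LINT x|lborel. radial_part w x * (if t \<le> x \<bullet> x then \<eta> t else 0)))"
  proof (rule lborel_pair.Fubini_integral[symmetric])
    have i1: "integrable lborel (\<lambda>x. if sqrt a \<le> norm x then radial_part w x else 0)"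
      by (rule profile_bound(1)) (use w2 a in auto)
    have "integrable lborel (\<lambda>t. indicator {a..b} t *\<^sub>R \<eta> t)"
      by (rule borel_integrable_compact) (auto intro: continuous_on_subset[OF \<eta>c])
    moreover have "(\<lambda>t. indicator {a..b} t *\<^sub>R \<eta> t) = \<eta>"
      using supp by (intro ext) (auto split: split_indicator)
    ultimately have i2: "integrable lborel \<eta>" by (simp only:)
    show "integrable (lborel \<Otimes>\<^sub>M lborel) (\<lambda>(x, t). radial_part w x * (if t \<le> x \<bullet> x then \<eta> t else 0))"
    proof (rule Bochner_Integration.integrable_bound[OF integrable_tensor[OF i1 i2]])
      show "(\<lambda>(x, t). radial_part w x * (if t \<le> x \<bullet> x then \<eta> t else 0)) \<in> borel_measurable (lborel \<Otimes>\<^sub>M lborel)"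
        by measurable
      have "\<bar>radial_part w x * (if t \<le> x \<bullet> x then \<eta> t else 0)\<bar> \<le> \<bar>(if sqrt a \<le> norm x then radial_part w x else 0) * \<eta> t\<bar>" for x t
      proof (cases "sqrt a \<le> norm x")
        case True
        then show ?thesis by (auto simp: abs_mult)
      next
        case False
        then have "norm x < sqrt a" by simp
        then have "x \<bullet> x < a" by (simp add: norm_eq_sqrt_inner)
        then have "t \<le> x \<bullet> x \<Longrightarrow> \<eta> t = 0" using supp[of t] by auto
        then show ?thesis by auto
      qed
      then show "AE z in lborel \<Otimes>\<^sub>M lborel. norm (case z of (x, t) \<Rightarrow> radial_part w x * (if t \<le> x \<bullet> x then \<eta> t else 0))
        \<le> norm (case z of (x, t) \<Rightarrow> (if sqrt a \<le> norm x then radial_part w x else 0) * \<eta> t)"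
        by (intro AE_I2) (auto split: prod.split simp del: abs_mult)
    qed
  qed
  also have "\<dots> = (LINT t|lborel. (- (4 * pi)) * (profile w (sqrt t) * \<eta> t))"
  proof (rule Bochner_Integration.integral_cong[OF refl])
    fix t :: real
    show "(LINT x|lborel. radial_part w x * (if t \<le> x \<bullet> x then \<eta> t else 0)) = (- (4 * pi)) * (profile w (sqrt t) * \<eta> t)"
    proof (cases "t > 0")
      case True
      have "(LINT x|lborel. radial_part w x * (if t \<le> x \<bullet> x then \<eta> t else 0))
         = (LINT x|lborel. (if sqrt t \<le> norm x then radial_part w x else 0) * \<eta> t)"
        by (intro Bochner_Integration.integral_cong) (auto simp: norm_eq_sqrt_inner)
      also have "\<dots> = (LINT x|lborel. (if sqrt t \<le> norm x then radial_part w x else 0)) * \<eta> t" by simp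
      finally show ?thesis by (simp add: profile_def)
    next
      case False
      then have "\<eta> t = 0" using supp[of t] a by auto
      then show ?thesis by (simp cong: if_cong)
    qed
  qed
  also have "- \<dots> = (4 * pi) * (LINT t|lborel. profile w (sqrt t) * \<eta> t)" by simp
  finally have R: "(LINT x|lborel. u x * (2 * (x \<bullet> x) powr (- 1/2) * \<eta> (x \<bullet> x))) = (4 * pi) * (LINT t|lborel. profile w (sqrt t) * \<eta> t)" .
  have "(LINT x|lborel. u x * (2 * (x \<bullet> x) powr (- 1/2) * \<eta> (x \<bullet> x)))
     = (LINT x|lborel. U ((x::R3) \<bullet> x) * (2 * (x \<bullet> x) powr (- 1/2) * \<eta> (x \<bullet> x)))"
  proof (rule integral_cong_AE)
    show "AE x in lborel. u x * (2 * (x \<bullet> x) powr (- 1/2) * \<eta> (x \<bullet> x)) = U (x \<bullet> x) * (2 * (x \<bullet> x) powr (- 1/2) * \<eta> (x \<bullet> x))"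
      using ae by eventually_elim simp
  qed measurable
  also have "\<dots> = (LINT t|lborel. polar_weight t * (U t * (2 * t powr (- 1/2) * \<eta> t)))"
    by (rule integral_polar[of "\<lambda>t. U t * (2 * t powr (- 1/2) * \<eta> t)"]) measurable
  also have "\<dots> = (LINT t|lborel. (4 * pi) * (U t * \<eta> t))"
  proof (rule Bochner_Integration.integral_cong[OF refl])
    fix t :: real
    show "polar_weight t * (U t * (2 * t powr (- 1/2) * \<eta> t)) = (4 * pi) * (U t * \<eta> t)"
    proof (cases "t > 0")
      case True
      have "t powr (1/2) * t powr (- 1/2) = 1" using True by (simp add: powr_add[symmetric])
      then have "(4 * pi) * (t powr (1/2) * t powr (- 1/2)) * (U t * \<eta> t) = (4 * pi) * (U t * \<eta> t)" by simp
      then show ?thesis using True by (simp add: polar_weight_def mult_ac)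
    next
      case False
      then have "\<eta> t = 0" using supp[of t] a by auto
      then show ?thesis by simp
    qed
  qed
  also have "\<dots> = (4 * pi) * (LINT t|lborel. U t * \<eta> t)" by simp
  finally show ?thesis using R by simp
qed

text \<open>Subtracting a multiple of one fixed bump gives any smooth bump mean zero, so on smooth bumps the integral against \<open>k\<close> is \<open>c\<close> times the integral;
smooth bumps approximate indicators of intervals.\<close>
lemma du_Bois_Reymond:
  fixes k :: "real \<Rightarrow> real"
  assumes k[measurable]: "k \<in> borel_measurable borel"
    and kint: "\<And>a b. 0 < a \<Longrightarrow> integrable lborel (\<lambda>t. indicator {a..b} t * k t)"
    and z: "\<And>\<eta> a b. 0 < a \<Longrightarrow> (\<And>n. Dk n \<eta>) \<Longrightarrow> (\<And>t. \<not> (a < t \<and> t < b) \<Longrightarrow> \<eta> t = 0) \<Longrightarrow>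
      (LINT t|lborel. \<eta> t) = 0 \<Longrightarrow> (LINT t|lborel. k t * \<eta> t) = 0"
  shows "\<exists>c. AE t in lborel. t > 0 \<longrightarrow> k t = c"
proof -
  define e where "e n p q t = stepf n (bump1 p q t)" for n p q t
  have e_smooth: "Dk j (e n p q)" for j n p q
    unfolding e_def[abs_def] by (rule Dk_compose[OF Dk_stepf Dk_bump1])
  have [measurable]: "e n p q \<in> borel_measurable borel" for n p q
    by (rule borel_measurable_continuous_onI[OF Dk_continuous[OF e_smooth]])
  have e01: "0 \<le> e n p q t" "e n p q t \<le> 1" for n p q t
    using stepf_bounds[OF bump1_nonneg] by (auto simp: e_def)
  have e0: "e n p q t = 0" if "\<not> (p < t \<and> t < q)" for n p q t
    using that by (simp add: e_def bump1_eq_0[THEN iffD2])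
  have fe: "integrable lborel (\<lambda>t. f t * e n p q t)"
    if [measurable]: "f \<in> borel_measurable borel" and i: "integrable lborel (\<lambda>t. indicator {p..q} t * f t)" for f n p q
  proof (rule Bochner_Integration.integrable_bound[OF i])
    have "\<bar>f t * e n p q t\<bar> \<le> \<bar>indicator {p..q} t * f t\<bar>" for t
      using e01[of n p q t] e0[of p t q n] by (cases "p < t \<and> t < q") (auto simp: abs_mult mult_left_le)
    then show "AE t in lborel. norm (f t * e n p q t) \<le> norm (indicator {p..q} t * f t)" by simp
  qed measurable
  have lim: "(\<lambda>n. LINT t|lborel. f t * e n p q t) \<longlonglongrightarrow> (LINT t|lborel. f t * indicator {p<..<q} t)"
    if [measurable]: "f \<in> borel_measurable borel" and i: "integrable lborel (\<lambda>t. indicator {p..q} t * f t)" for f p q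
  proof (rule integral_dominated_convergence)
    show "integrable lborel (\<lambda>t. norm (indicator {p..q} t * f t))" using i by (rule integrable_norm)
    have "\<bar>f t * e n p q t\<bar> \<le> \<bar>indicator {p..q} t * f t\<bar>" for t n
      using e01[of n p q t] e0[of p t q n] by (cases "p < t \<and> t < q") (auto simp: abs_mult mult_left_le)
    then show "AE t in lborel. norm (f t * e n p q t) \<le> norm (indicator {p..q} t * f t)" for n by simp
    have "(\<lambda>n. e n p q t) \<longlonglongrightarrow> indicator {p<..<q} t" for t
      using stepf_tendsto[OF bump1_nonneg[of p q t]] bump1_pos[of p q t] by (auto simp: e_def indicator_def)
    then show "AE t in lborel. (\<lambda>n. f t * e n p q t) \<longlonglongrightarrow> f t * indicator {p<..<q} t"
      by (intro AE_I2 tendsto_mult tendsto_const)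
  qed measurable
  have Icc: "integrable lborel (indicator {p..q} :: real \<Rightarrow> real)" for p q :: real
    by (rule integrable_real_indicator) (auto simp: emeasure_lborel_Icc_eq)
  then have one: "integrable lborel (\<lambda>t. indicator {p..q} t * (1::real))" for p q :: real
    by simp
  \<comment> \<open>The interval from 1 to 2 is arbitrary; it carries the reference bump.\<close>
  have "\<exists>n. (LINT t|lborel. e n 1 2 t) \<noteq> 0"
  proof (rule ccontr)
    assume "\<not> ?thesis"
    then have "(\<lambda>n. LINT t|lborel. 1 * e n 1 2 t) = (\<lambda>n. 0)" by simp
    then have "(LINT t|lborel. 1 * indicator {1<..<2::real} t) = (0::real)"
      using lim[of "\<lambda>_. 1" 1 2] one by (simp add: LIMSEQ_const_iff)
    then show False by simp
  qed
  then obtain n0 where m0: "(LINT t|lborel. e n0 1 2 t) \<noteq> 0" ..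
  define m0 where "m0 = (LINT t|lborel. e n0 1 2 t)"
  define c where "c = (LINT t|lborel. k t * e n0 1 2 t) / m0"
  have ei: "integrable lborel (e n p q)" for n p q
    using fe[of "\<lambda>_. 1" p q n] one by simp
  have eq: "(LINT t|lborel. k t * e n p q t) = c * (LINT t|lborel. e n p q t)" if "0 < p" for n p q
  proof -
    define r where "r = (LINT t|lborel. e n p q t) / m0"
    define \<eta> where "\<eta> t = e n p q t + (- r) * e n0 1 2 t" for t
    have i: "integrable lborel (\<lambda>t. k t * e n p q t)" "integrable lborel (\<lambda>t. k t * e n0 1 2 t)"
      using that by (auto intro!: fe kint)
    have "(LINT t|lborel. k t * \<eta> t) = 0"
    proof (rule z[of "min p 1" \<eta> "max q 2"])
      show "Dk j \<eta>" for j
        unfolding \<eta>_def[abs_def] by (intro Dk_add Dk_mult Dk_const e_smooth)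
      show "\<eta> t = 0" if "\<not> (min p 1 < t \<and> t < max q 2)" for t
      proof -
        have n: "\<not> (p < t \<and> t < q)" "\<not> (1 < t \<and> t < 2)" using that by (auto simp: min_less_iff_disj less_max_iff_disj)
        show ?thesis unfolding \<eta>_def e0[OF n(1)] e0[OF n(2)] by simp
      qed
      have "(LINT t|lborel. \<eta> t) = (LINT t|lborel. e n p q t) + (- r) * m0"
        unfolding \<eta>_def m0_def using ei by simp
      then show "(LINT t|lborel. \<eta> t) = 0" using m0 by (simp add: r_def m0_def)
    qed (use that in auto)
    moreover have "(LINT t|lborel. k t * \<eta> t) = (LINT t|lborel. k t * e n p q t + (- r) * (k t * e n0 1 2 t))"
      by (intro Bochner_Integration.integral_cong) (simp_all add: \<eta>_def algebra_simps)
    moreover have "\<dots> = (LINT t|lborel. k t * e n p q t) + (- r) * (LINT t|lborel. k t * e n0 1 2 t)"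
      using i by simp
    ultimately show ?thesis by (simp add: c_def r_def)
  qed
  have main: "(LINT t|lborel. indicator {p<..<q} t * (k t - c)) = 0" if p: "0 < p" "p < q" for p q
  proof -
    have "(\<lambda>n. c * (LINT t|lborel. 1 * e n p q t)) \<longlonglongrightarrow> c * (LINT t|lborel. 1 * indicator {p<..<q} t)"
      by (intro tendsto_mult tendsto_const lim one) auto
    moreover have "(\<lambda>n. LINT t|lborel. k t * e n p q t) \<longlonglongrightarrow> (LINT t|lborel. k t * indicator {p<..<q} t)"
      by (intro lim kint p) auto
    ultimately have L: "(LINT t|lborel. k t * indicator {p<..<q} t) = c * (LINT t|lborel. 1 * indicator {p<..<q} t)"
      using LIMSEQ_unique by (simp add: eq[OF p(1)])
    have i: "integrable lborel (\<lambda>t. k t * indicator {p<..<q} t)"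
      by (rule Bochner_Integration.integrable_bound[OF kint[OF p(1), of q]]) (auto split: split_indicator)
    have i': "integrable lborel (\<lambda>t. c * indicator {p<..<q} t)"
      by (intro integrable_mult_right integrable_real_indicator) (use p in \<open>auto simp: emeasure_lborel_Ioo\<close>)
    have "(LINT t|lborel. indicator {p<..<q} t * (k t - c)) = (LINT t|lborel. k t * indicator {p<..<q} t - c * indicator {p<..<q} t)"
      by (intro Bochner_Integration.integral_cong) (simp_all add: algebra_simps)
    also have "\<dots> = (LINT t|lborel. k t * indicator {p<..<q} t) - (LINT t|lborel. c * indicator {p<..<q} t)"
      by (rule Bochner_Integration.integral_diff[OF i i'])
    finally show ?thesis using L by simp
  qed
  have "AE t in lborel. indicator {1 / real (Suc m)<..<real (Suc m)} t * (k t - c) = 0" for m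
  proof (rule AE_zero_of_box_integrals)
    fix a b :: real
    let ?p = "max a (1 / real (Suc m))" and ?q = "min b (real (Suc m))"
    have ind: "indicator (box a b) t * (indicator {1 / real (Suc m)<..<real (Suc m)} t * (k t - c))
        = indicator {?p<..<?q} t * (k t - c)" for t
      by (auto simp: box_real split: split_indicator)
    have pp: "0 < ?p" by (simp add: less_max_iff_disj)
    have i: "integrable lborel (\<lambda>t. indicator {?p..?q} t * k t - c * indicator {?p..?q} t)"
      using kint[OF pp] Icc by (intro Bochner_Integration.integrable_diff integrable_mult_right)
    have "integrable lborel (\<lambda>t. indicator {?p<..<?q} t * (k t - c))"
      by (rule Bochner_Integration.integrable_bound[OF i]) (auto split: split_indicator)
    then show "integrable lborel (\<lambda>t. indicator (box a b) t * (indicator {1 / real (Suc m)<..<real (Suc m)} t * (k t - c)))"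
      unfolding ind .
    show "(LINT t|lborel. indicator (box a b) t * (indicator {1 / real (Suc m)<..<real (Suc m)} t * (k t - c))) = 0"
      unfolding ind
    proof (cases "?p < ?q")
      case True
      then show "(LINT t|lborel. indicator {?p<..<?q} t * (k t - c)) = 0" by (rule main[OF pp])
    next
      case False
      then have "indicator {?p<..<?q} t * (k t - c) = 0" for t
        by (auto split: split_indicator)
      then show "(LINT t|lborel. indicator {?p<..<?q} t * (k t - c)) = 0"
        by (intro integral_eq_zero_AE AE_I2)
    qed
  qed measurable
  then have "AE t in lborel. \<forall>m. indicator {1 / real (Suc m)<..<real (Suc m)} t * (k t - c) = 0"
    by (simp only: AE_all_countable) simp
  then have "AE t in lborel. t > 0 \<longrightarrow> k t = c"
  proof eventually_elim
    case (elim t)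
    show ?case
    proof
      assume t: "t > 0"
      obtain m1 where m1: "1 / real (Suc m1) < t" using reals_Archimedean[OF t] by (auto simp: inverse_eq_divide)
      obtain m2 where m2: "t < real m2" using reals_Archimedean2 by blast
      let ?m = "max m1 m2"
      have "1 / real (Suc ?m) \<le> 1 / real (Suc m1)" by (auto intro!: divide_left_mono)
      then have "t \<in> {1 / real (Suc ?m)<..<real (Suc ?m)}" using m1 m2 by auto
      then show "k t = c" using elim[rule_format, of ?m] by simp
    qed
  qed
  then show ?thesis ..
qed

lemma profile_measurable [measurable]:
  assumes [measurable]: "w \<in> borel_measurable borel"
  shows "profile w \<in> borel_measurable borel"
  unfolding profile_def[abs_def] by measurable

text \<open>By \<open>radial_identity\<close> the function and the profile of its gradient have the same integrals against functions of mean zero, so they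
differ by a constant; the constant is zero because the profile tends to zero at infinity and \<open>\<bar>u\<bar>\<^sup>6\<close> is integrable.\<close>
lemma radial_representation:
  assumes u: "u \<in> D12" and r: "radial u"
  shows "AE x in lborel. u x = profile (grad u) (norm x)"
proof -
  let ?w = "grad u" and ?A = "dirichlet u"
  note g = D12_grad[OF u]
  have A: "?A = (LINT x|lborel. (norm (?w x))\<^sup>2)" by (simp add: dirichlet_def)
  have lu: "loc_integrable u" by (rule D12_loc_integrable[OF u])
  note [measurable] = D12_measurable[OF u] weak_gradient_measurable[OF g(1)]
  obtain \<rho> where [measurable]: "\<rho> \<in> borel_measurable borel" and \<rho>: "AE x in lborel. u x = \<rho> (norm x)"
    using r by (auto simp: radial_def)
  define U where "U t = \<rho> (sqrt t)" for t
  have [measurable]: "U \<in> borel_measurable borel" unfolding U_def[abs_def] by measurable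
  have aeU: "AE x in lborel. u x = U (x \<bullet> x)"
    using \<rho> by eventually_elim (simp add: U_def norm_eq_sqrt_inner)
  have Uint: "integrable lborel (\<lambda>t. indicator {a..b} t * U t)" if a: "0 < a" for a b
  proof -
    let ?f = "\<lambda>t. indicator {a..b} t * U t"
    have "integrable lborel (\<lambda>x. indicator (cball 0 (sqrt b)) x *\<^sub>R u x)"
      using lu by (auto simp: loc_integrable_def set_integrable_def)
    then have "integrable lborel (\<lambda>x::R3. ?f (x \<bullet> x))"
    proof (rule Bochner_Integration.integrable_bound)
      show "AE x::R3 in lborel. norm (?f (x \<bullet> x)) \<le> norm (indicator (cball 0 (sqrt b)) x *\<^sub>R u x)"
        using aeU by eventually_elim (auto split: split_indicator simp: norm_eq_sqrt_inner)
    qed measurable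
    then have i: "integrable lborel (\<lambda>t. (1 / (2 * pi * a powr (1/2))) * (polar_weight t * ?f t))"
      by (subst (asm) integrable_polar) auto
    show ?thesis
    proof (rule Bochner_Integration.integrable_bound[OF i])
      have "\<bar>?f t\<bar> \<le> \<bar>(1 / (2 * pi * a powr (1/2))) * (polar_weight t * ?f t)\<bar>" for t
      proof (cases "t \<in> {a..b}")
        case True
        then have "a powr (1/2) \<le> t powr (1/2)" using a by (intro powr_mono2) auto
        then have "1 \<le> (1 / (2 * pi * a powr (1/2))) * polar_weight t"
          using True a by (simp add: polar_weight_def field_simps)
        then have "1 * \<bar>?f t\<bar> \<le> ((1 / (2 * pi * a powr (1/2))) * polar_weight t) * \<bar>?f t\<bar>"
          by (rule mult_right_mono) simp
        then show ?thesis by (simp add: abs_mult)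
      qed simp
      then show "AE t in lborel. norm (?f t) \<le> norm ((1 / (2 * pi * a powr (1/2))) * (polar_weight t * ?f t))" by simp
    qed measurable
  qed
  have Pint: "integrable lborel (\<lambda>t. indicator {a..b} t * profile ?w (sqrt t))" if a: "0 < a" for a b
  proof -
    let ?M = "sqrt (?A / (4 * pi * sqrt a))"
    have i: "integrable lborel (\<lambda>t. ?M * indicator {a..b} t)"
      by (intro integrable_mult_right integrable_real_indicator) (auto simp: emeasure_lborel_Icc_eq)
    show ?thesis
    proof (rule Bochner_Integration.integrable_bound[OF i])
      have "\<bar>indicator {a..b} t * profile ?w (sqrt t)\<bar> \<le> \<bar>?M * indicator {a..b} t\<bar>" for t
      proof (cases "t \<in> {a..b}")
        case True
        then have t: "t > 0" "sqrt a \<le> sqrt t" using a by auto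
        have "(profile ?w (sqrt t))\<^sup>2 \<le> ?A / (4 * pi * sqrt t)"
          unfolding A by (rule profile_bound(2)) (use g(2) t in auto)
        also have "\<dots> \<le> ?A / (4 * pi * sqrt a)"
          using t a dirichlet_nonneg[of u] by (intro divide_left_mono mult_left_mono) auto
        finally have "\<bar>profile ?w (sqrt t)\<bar> \<le> ?M" by (rule real_le_rsqrt[of "\<bar>_\<bar>", unfolded power2_abs])
        then show ?thesis using True by simp
      qed simp
      then show "AE t in lborel. norm (indicator {a..b} t * profile ?w (sqrt t)) \<le> norm (?M * indicator {a..b} t)" by simp
    qed measurable
  qed
  define k where "k t = U t - profile ?w (sqrt t)" for t
  have [measurable]: "k \<in> borel_measurable borel" unfolding k_def[abs_def] by measurable
  have "\<exists>c. AE t in lborel. t > 0 \<longrightarrow> k t = c"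
  proof (rule du_Bois_Reymond)
    show "integrable lborel (\<lambda>t. indicator {a..b} t * k t)" if "0 < a" for a b
      using Bochner_Integration.integrable_diff[OF Uint[OF that, of b] Pint[OF that, of b]] by (simp add: k_def right_diff_distrib)
    fix \<eta> and a b :: real
    assume a: "0 < a" and smooth: "\<And>n. Dk n \<eta>" and supp: "\<And>t. \<not> (a < t \<and> t < b) \<Longrightarrow> \<eta> t = 0"
      and mean: "(LINT t|lborel. \<eta> t) = 0"
    have \<eta>c: "continuous_on UNIV \<eta>" by (rule Dk_continuous[OF smooth])
    then have [measurable]: "\<eta> \<in> borel_measurable borel" by (rule borel_measurable_continuous_onI)
    have "compact (\<eta> ` {a..b})" by (intro compact_continuous_image continuous_on_subset[OF \<eta>c]) auto
    then obtain M where M: "M > 0" "\<And>t. t \<in> {a..b} \<Longrightarrow> \<bar>\<eta> t\<bar> \<le> M"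
      using compact_imp_bounded[of "\<eta> ` {a..b}"] unfolding bounded_pos by (auto simp: real_norm_def)
    have I: "integrable lborel (\<lambda>t. f t * \<eta> t)"
      if [measurable]: "f \<in> borel_measurable borel" and i: "integrable lborel (\<lambda>t. indicator {a..b} t * f t)" for f
    proof (rule Bochner_Integration.integrable_bound)
      show "integrable lborel (\<lambda>t. M * (indicator {a..b} t * f t))" using i by simp
      have "\<bar>f t * \<eta> t\<bar> \<le> \<bar>M * (indicator {a..b} t * f t)\<bar>" for t
        using M(1) M(2)[of t] supp[of t] mult_left_mono[of "\<bar>\<eta> t\<bar>" M "\<bar>f t\<bar>"]
        by (cases "a < t \<and> t < b") (auto simp: abs_mult mult.commute)
      then show "AE t in lborel. norm (f t * \<eta> t) \<le> norm (M * (indicator {a..b} t * f t))" by simp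
    qed measurable
    have "(LINT t|lborel. k t * \<eta> t) = (LINT t|lborel. U t * \<eta> t) - (LINT t|lborel. profile ?w (sqrt t) * \<eta> t)"
      unfolding k_def left_diff_distrib
      by (rule Bochner_Integration.integral_diff) (auto intro!: I Uint Pint a)
    then show "(LINT t|lborel. k t * \<eta> t) = 0"
      using radial_identity[OF g _ aeU a smooth supp mean] by simp
  qed measurable
  then obtain c where c: "AE t in lborel. t > 0 \<longrightarrow> k t = c" ..
  have "AE x::R3 in lborel. k (x \<bullet> x) = c"
    by (subst AE_polar[of "\<lambda>t. k t = c"]) (use c in auto)
  then have rep: "AE x in lborel. u x = profile ?w (norm x) + c"
    using aeU by eventually_elim (simp add: k_def norm_eq_sqrt_inner)
  have "c = 0"
  proof (rule ccontr)
    assume c0: "c \<noteq> 0"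
    define R where "R = ?A / (pi * c\<^sup>2) + 1"
    have R: "R > 0" using dirichlet_nonneg[of u] by (auto simp: R_def intro!: add_nonneg_pos divide_nonneg_nonneg)
    have small: "\<bar>profile ?w r\<bar> \<le> \<bar>c\<bar> / 2" if "R \<le> r" for r
    proof -
      have "(profile ?w r)\<^sup>2 \<le> ?A / (4 * pi * r)"
        unfolding A by (rule profile_bound(2)) (use g(2) that R in auto)
      also have "\<dots> \<le> ?A / (4 * pi * R)"
        using that R dirichlet_nonneg[of u] by (intro divide_left_mono mult_left_mono) auto
      also have "\<dots> \<le> (\<bar>c\<bar> / 2)\<^sup>2"
      proof -
        have "?A \<le> pi * c\<^sup>2 * R" unfolding R_def using c0 by (simp add: field_simps)
        then show ?thesis using R by (simp add: field_simps)
      qed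
      finally show ?thesis using abs_le_square_iff[of "profile ?w r" "\<bar>c\<bar> / 2"] by simp
    qed
    have "(\<integral>\<^sup>+ x. ennreal ((\<bar>c\<bar> / 2) ^ 6) * indicator {x. R \<le> norm x} x \<partial>(lborel :: R3 measure)) \<le> (\<integral>\<^sup>+ x. ennreal (\<bar>u x\<bar> ^ 6) \<partial>lborel)"
    proof (rule nn_integral_mono_AE)
      show "AE x in lborel. ennreal ((\<bar>c\<bar> / 2) ^ 6) * indicator {x. R \<le> norm x} x \<le> ennreal (\<bar>u x\<bar> ^ 6)"
        using rep
      proof eventually_elim
        case (elim x)
        show ?case
        proof (cases "R \<le> norm x")
          case True
          have "\<bar>c\<bar> / 2 \<le> \<bar>u x\<bar>" using small[OF True] elim by linarith
          then have "(\<bar>c\<bar> / 2) ^ 6 \<le> \<bar>u x\<bar> ^ 6" by (intro power_mono) auto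
          then show ?thesis using True by (simp add: ennreal_leI)
        qed simp
      qed
    qed
    also have "\<dots> < \<infinity>" using D12_pow6[OF u] by (simp add: integrable_iff_bounded)
    finally have "ennreal ((\<bar>c\<bar> / 2) ^ 6) * emeasure lborel {x::R3. R \<le> norm x} < \<infinity>"
      by (subst (asm) nn_integral_cmult_indicator) auto
    then have f: "emeasure lborel {x::R3. R \<le> norm x} < \<infinity>"
      using c0 by (auto simp: ennreal_mult_less_top)
    have "emeasure lborel (UNIV::R3 set) \<le> emeasure lborel {x::R3. R \<le> norm x} + emeasure lborel (cball (0::R3) R)"
    proof -
      have "(UNIV::R3 set) = {x. R \<le> norm x} \<union> cball 0 R" by auto
      then show ?thesis using emeasure_subadditive[of "{x::R3. R \<le> norm x}" lborel "cball 0 R"] by simp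
    qed
    also have "\<dots> < \<infinity>" using f emeasure_compact_finite[of "cball (0::R3) R"] by simp
    finally show False by simp
  qed
  then show ?thesis using rep by simp
qed


subsection \<open>Coulomb energy on balls and decay\<close>

text \<open>The Coulomb energy as an extended real; it is meaningful before integrability is known.\<close>
definition nn_self_energy :: "(R3 \<Rightarrow> real) \<Rightarrow> ennreal" where
  "nn_self_energy u = (\<integral>\<^sup>+ x. \<integral>\<^sup>+ y. ennreal ((u x)\<^sup>2 * (u y)\<^sup>2 / norm (x - y)) \<partial>lborel \<partial>lborel)"

definition self_energy :: "(R3 \<Rightarrow> real) \<Rightarrow> real" where
  "self_energy u = coulomb (\<lambda>x. (u x)\<^sup>2) (\<lambda>x. (u x)\<^sup>2)"

lemma self_energy_nonneg: "self_energy u \<ge> 0"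
  unfolding self_energy_def coulomb_def by (rule Bochner_Integration.integral_nonneg) (auto simp: coulomb_integrand_def)

lemma coulomb_integrand_measurable [measurable]:
  assumes [measurable]: "a \<in> borel_measurable borel" "b \<in> borel_measurable borel"
  shows "coulomb_integrand a b \<in> borel_measurable (lborel \<Otimes>\<^sub>M lborel)"
  unfolding coulomb_integrand_def by measurable

lemma nn_self_energy_eq:
  assumes [measurable]: "u \<in> borel_measurable borel"
  shows "nn_self_energy u = (\<integral>\<^sup>+ z. ennreal (coulomb_integrand (\<lambda>x. (u x)\<^sup>2) (\<lambda>x. (u x)\<^sup>2) z) \<partial>(lborel \<Otimes>\<^sub>M lborel))"
proof -
  have [measurable]: "coulomb_integrand (\<lambda>x. (u x)\<^sup>2) (\<lambda>x. (u x)\<^sup>2) \<in> borel_measurable (lborel \<Otimes>\<^sub>M lborel)"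
    by (rule coulomb_integrand_measurable) auto
  show ?thesis
    unfolding nn_self_energy_def by (subst lborel.nn_integral_fst[symmetric]) (auto simp: coulomb_integrand_def)
qed

lemma coulomb_self_integrable_iff:
  assumes [measurable]: "u \<in> borel_measurable borel"
  shows "integrable (lborel \<Otimes>\<^sub>M lborel) (coulomb_integrand (\<lambda>x. (u x)\<^sup>2) (\<lambda>x. (u x)\<^sup>2)) \<longleftrightarrow> nn_self_energy u < \<infinity>"
proof -
  have "norm (coulomb_integrand (\<lambda>x. (u x)\<^sup>2) (\<lambda>x. (u x)\<^sup>2) z) = coulomb_integrand (\<lambda>x. (u x)\<^sup>2) (\<lambda>x. (u x)\<^sup>2) z" for z
    by (auto simp: coulomb_integrand_def split: prod.split)
  then show ?thesis by (simp add: integrable_iff_bounded nn_self_energy_eq)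
qed

lemma nn_self_energy_NE:
  assumes [measurable]: "u \<in> borel_measurable borel" and f: "nn_self_energy u < \<infinity>"
  shows "nn_self_energy u = ennreal (self_energy u)"
  unfolding nn_self_energy_eq[OF assms(1)] self_energy_def coulomb_def
  by (rule nn_integral_eq_integral) (use f coulomb_self_integrable_iff[OF assms(1)] in \<open>auto simp: coulomb_integrand_def\<close>)

lemma E_space_iff: "u \<in> E_space \<longleftrightarrow> u \<in> D12 \<and> nn_self_energy u < \<infinity>"
  using coulomb_self_integrable_iff[OF D12_measurable, of u] by (auto simp: E_space_def)

lemma Er_spaceD:
  assumes "u \<in> Er_space"
  shows "u \<in> D12" "radial u" "nn_self_energy u = ennreal (self_energy u)" "u \<in> borel_measurable borel"
  using assms nn_self_energy_NE[OF D12_measurable] by (auto simp: Er_space_def E_space_iff intro: D12_measurable)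

text \<open>Two points of the ball have distance at most \<open>2 * R\<close>, so the kernel is at least \<open>1 / (2 * R)\<close> there.\<close>
lemma ball_mass_bound:
  assumes [measurable]: "u \<in> borel_measurable borel" and R: "R > 0"
  shows "(\<integral>\<^sup>+ x. ennreal (if norm x \<le> R then (u x)\<^sup>2 else 0) \<partial>lborel)\<^sup>2 \<le> ennreal (2 * R) * nn_self_energy u"
proof -
  let ?g = "\<lambda>x::R3. ennreal (if norm x \<le> R then (u x)\<^sup>2 else 0)"
  have "(\<integral>\<^sup>+ x. ?g x \<partial>lborel)\<^sup>2 = (\<integral>\<^sup>+ x. \<integral>\<^sup>+ y. ?g x * ?g y \<partial>lborel \<partial>lborel)"
    by (simp add: nn_integral_cmult nn_integral_multc power2_eq_square)
  also have "\<dots> \<le> (\<integral>\<^sup>+ x. \<integral>\<^sup>+ y. ennreal (2 * R) * ennreal ((u x)\<^sup>2 * (u y)\<^sup>2 / norm (x - y)) \<partial>lborel \<partial>lborel)"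
  proof (rule nn_integral_mono)
    fix x :: R3
    have "AE y in lborel. y \<noteq> x" by (rule AE_lborel_singleton)
    then show "(\<integral>\<^sup>+ y. ?g x * ?g y \<partial>lborel) \<le> (\<integral>\<^sup>+ y. ennreal (2 * R) * ennreal ((u x)\<^sup>2 * (u y)\<^sup>2 / norm (x - y)) \<partial>lborel)"
    proof (intro nn_integral_mono_AE, eventually_elim)
      case (elim y)
      show ?case
      proof (cases "norm x \<le> R \<and> norm y \<le> R")
        case True
        have d: "norm (x - y) > 0" using elim by simp
        have "norm (x - y) \<le> 2 * R" using norm_triangle_ineq4[of x y] True by linarith
        then have "1 \<le> 2 * R / norm (x - y)" using d by (simp add: field_simps)
        then have "((u x)\<^sup>2 * (u y)\<^sup>2) * 1 \<le> ((u x)\<^sup>2 * (u y)\<^sup>2) * (2 * R / norm (x - y))"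
          by (rule mult_left_mono) simp
        then have "(u x)\<^sup>2 * (u y)\<^sup>2 \<le> 2 * R * ((u x)\<^sup>2 * (u y)\<^sup>2 / norm (x - y))" by (simp add: algebra_simps)
        then show ?thesis using True R by (simp add: ennreal_mult[symmetric] ennreal_leI)
      qed auto
    qed
  qed
  also have "\<dots> = ennreal (2 * R) * nn_self_energy u"
    unfolding nn_self_energy_def by (simp add: nn_integral_cmult)
  finally show ?thesis .
qed

lemma ball_mass_bound_real:
  assumes u: "u \<in> Er_space" and R: "R > 0"
  shows "(\<integral>\<^sup>+ x. ennreal (if norm x \<le> R then (u x)\<^sup>2 else 0) \<partial>lborel) \<le> ennreal (sqrt (2 * R * self_energy u))"
proof -
  let ?I = "\<integral>\<^sup>+ x. ennreal (if norm x \<le> R then (u x)\<^sup>2 else 0) \<partial>lborel"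
  have "?I\<^sup>2 \<le> ennreal (2 * R * self_energy u)"
    using ball_mass_bound[OF Er_spaceD(4)[OF u] R] R self_energy_nonneg[of u] unfolding Er_spaceD(3)[OF u]
    by (simp add: ennreal_mult)
  then have *: "?I\<^sup>2 < \<infinity>" by (rule le_less_trans) simp
  have "?I < \<infinity>" using * by (simp add: power_less_top_ennreal)
  then obtain i where i: "?I = ennreal i" "i \<ge> 0" by (cases "?I") auto
  have "i\<^sup>2 \<le> 2 * R * self_energy u"
    using \<open>?I\<^sup>2 \<le> _\<close> i R self_energy_nonneg[of u] by (simp add: ennreal_power ennreal_le_iff)
  then have "i \<le> sqrt (2 * R * self_energy u)" by (rule real_le_rsqrt)
  then show ?thesis using i by (simp add: ennreal_leI)
qed

lemma annulus_volume:
  assumes "r > 0" "d \<ge> 0"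
  shows "ennreal (4 * pi * r\<^sup>2 * d) \<le> emeasure lborel {x::R3. r \<le> norm x \<and> norm x \<le> r + d}"
proof -
  let ?S = "{x::R3. r \<le> norm x \<and> norm x \<le> r + d}"
  have "ennreal (4/3 * pi * (r + d) ^ 3) = emeasure lborel (cball (0::R3) (r + d))"
    using assms by (simp add: emeasure_cball unit_ball_vol_3)
  also have "\<dots> \<le> emeasure lborel (?S \<union> cball 0 r)"
    by (rule emeasure_mono) auto
  also have "\<dots> \<le> emeasure lborel ?S + emeasure lborel (cball (0::R3) r)"
    by (rule emeasure_subadditive) auto
  also have "emeasure lborel (cball (0::R3) r) = ennreal (4/3 * pi * r ^ 3)"
    using assms by (simp add: emeasure_cball unit_ball_vol_3)
  finally have le: "ennreal (4/3 * pi * (r + d) ^ 3) \<le> emeasure lborel ?S + ennreal (4/3 * pi * r ^ 3)" .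
  show ?thesis
  proof (cases "emeasure lborel ?S")
    case (real v)
    then have "ennreal (4/3 * pi * (r + d) ^ 3) \<le> ennreal (v + 4/3 * pi * r ^ 3)"
      using le assms by (simp add: ennreal_plus)
    then have v: "4/3 * pi * (r + d) ^ 3 \<le> v + 4/3 * pi * r ^ 3"
      using real assms by (subst (asm) ennreal_le_iff) auto
    have "4/3 * pi * (r + d) ^ 3 = 4/3 * pi * r ^ 3 + 4 * pi * r\<^sup>2 * d + (4 * pi * r * d\<^sup>2 + 4/3 * pi * d ^ 3)"
      by (simp add: power2_eq_square power3_eq_cube algebra_simps)
    moreover have "4 * pi * r * d\<^sup>2 + 4/3 * pi * d ^ 3 \<ge> 0" using assms by simp
    ultimately have "4 * pi * r\<^sup>2 * d \<le> v" using v by linarith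
    then show ?thesis using real by (simp add: ennreal_leI)
  qed simp
qed

lemma Er_profile:
  assumes "u \<in> Er_space"
  shows "AE x in lborel. u x = profile (grad u) (norm x)"
  using radial_representation[OF Er_spaceD(1,2)[OF assms]] .

lemma Er_profile_bound:
  assumes "u \<in> Er_space" "r > 0"
  shows "(profile (grad u) r)\<^sup>2 \<le> dirichlet u / (4 * pi * r)"
  unfolding dirichlet_def using D12_grad[OF Er_spaceD(1)[OF assms(1)]] assms(2)
  by (intro profile_bound(2) weak_gradient_measurable[of u]) auto

lemma Er_profile_diff:
  assumes "u \<in> Er_space" "0 < r" "r \<le> s"
  shows "(profile (grad u) r - profile (grad u) s)\<^sup>2 \<le> dirichlet u / (4 * pi) * (1 / r - 1 / s)"
  unfolding dirichlet_def using D12_grad[OF Er_spaceD(1)[OF assms(1)]] assms(2,3)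
  by (intro profile_diff weak_gradient_measurable[of u]) auto

text \<open>By \<open>Er_profile_diff\<close> the profile keeps at least half of its value at \<open>r\<close> on an interval of length proportional to the square of that
value, and the resulting mass in an annulus is limited by \<open>ball_mass_bound\<close>. This couples the two parts of the norm.\<close>
lemma Er_profile_decay:
  assumes u: "u \<in> Er_space" and r: "r > 0"
  shows "(profile (grad u) r) ^ 4 * r ^ 4 \<le> dirichlet u * sqrt (r * self_energy u)"
proof -
  let ?p = "profile (grad u)" and ?A = "dirichlet u"
  have A0: "?A \<ge> 0" by (rule dirichlet_nonneg)
  show ?thesis
  proof (cases "?p r = 0")
    case True
    then show ?thesis using A0 r self_energy_nonneg[of u] by simp
  next
    case False
    have pb: "(?p r)\<^sup>2 \<le> ?A / (4 * pi * r)" by (rule Er_profile_bound[OF u r])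
    have p2: "(?p r)\<^sup>2 > 0" using False by simp
    have A: "?A > 0" using pb p2 r A0 by (cases "?A = 0") auto
    \<comment> \<open>The choice makes the bound of \<open>Er_profile_diff\<close> on the interval at most \<open>(profile r / 2)\<^sup>2\<close>.\<close>
    define d where "d = pi * (?p r)\<^sup>2 * r\<^sup>2 / ?A"
    have d0: "d > 0" using p2 A r by (simp add: d_def)
    have dr: "d \<le> r"
    proof -
      have "pi * (?p r)\<^sup>2 * r\<^sup>2 \<le> pi * (?A / (4 * pi * r)) * r\<^sup>2"
        using pb by (intro mult_right_mono mult_left_mono) auto
      also have "\<dots> = ?A * r / 4" using r by (simp add: field_simps power2_eq_square)
      finally have "d \<le> (?A * r / 4) / ?A" unfolding d_def using A by (intro divide_right_mono) auto
      then show ?thesis using A r by simp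
    qed
    have low: "(?p r)\<^sup>2 / 4 \<le> (?p s)\<^sup>2" if s: "r \<le> s" "s \<le> r + d" for s
    proof -
      have "(?p r - ?p s)\<^sup>2 \<le> ?A / (4 * pi) * (1 / r - 1 / s)" by (rule Er_profile_diff[OF u r s(1)])
      also have "1 / r - 1 / s = (s - r) / (r * s)" using r s by (simp add: field_simps)
      also have "?A / (4 * pi) * ((s - r) / (r * s)) \<le> ?A / (4 * pi) * (d / (r * r))"
        using r s d0 A0 by (intro mult_left_mono frac_le) auto
      also have "\<dots> = (\<bar>?p r\<bar> / 2)\<^sup>2" unfolding d_def using A r by (simp add: field_simps power2_eq_square)
      finally have "\<bar>?p r - ?p s\<bar> \<le> \<bar>?p r\<bar> / 2"
        using abs_le_square_iff[of "?p r - ?p s" "\<bar>?p r\<bar> / 2"] by simp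
      then have "\<bar>?p r\<bar> / 2 \<le> \<bar>?p s\<bar>" by linarith
      then have "(\<bar>?p r\<bar> / 2)\<^sup>2 \<le> \<bar>?p s\<bar>\<^sup>2" by (intro power_mono) auto
      then show ?thesis by (simp add: power_divide)
    qed
    have "ennreal ((?p r)\<^sup>2 / 4) * ennreal (4 * pi * r\<^sup>2 * d)
        \<le> ennreal ((?p r)\<^sup>2 / 4) * emeasure lborel {x::R3. r \<le> norm x \<and> norm x \<le> r + d}"
      using r d0 by (intro mult_left_mono annulus_volume) auto
    also have "\<dots> = (\<integral>\<^sup>+ x. ennreal ((?p r)\<^sup>2 / 4) * indicator {x::R3. r \<le> norm x \<and> norm x \<le> r + d} x \<partial>lborel)"
      by (subst nn_integral_cmult_indicator) auto
    also have "\<dots> \<le> (\<integral>\<^sup>+ x. ennreal (if norm x \<le> 2 * r then (u x)\<^sup>2 else 0) \<partial>lborel)"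
    proof (rule nn_integral_mono_AE)
      show "AE x in lborel. ennreal ((?p r)\<^sup>2 / 4) * indicator {x::R3. r \<le> norm x \<and> norm x \<le> r + d} x
          \<le> ennreal (if norm x \<le> 2 * r then (u x)\<^sup>2 else 0)"
        using Er_profile[OF u]
      proof eventually_elim
        case (elim x)
        then show ?case using low[of "norm x"] dr by (auto split: split_indicator intro!: ennreal_leI)
      qed
    qed
    also have "\<dots> \<le> ennreal (sqrt (2 * (2 * r) * self_energy u))"
      by (rule ball_mass_bound_real[OF u]) (use r in simp)
    finally have "(?p r)\<^sup>2 / 4 * (4 * pi * r\<^sup>2 * d) \<le> sqrt (2 * (2 * r) * self_energy u)"
      using r d0 self_energy_nonneg[of u] by (simp add: ennreal_mult[symmetric] ennreal_le_iff)
    also have "sqrt (2 * (2 * r) * self_energy u) = 2 * sqrt (r * self_energy u)"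
      by (simp add: real_sqrt_mult)
    also have "(?p r)\<^sup>2 / 4 * (4 * pi * r\<^sup>2 * d) = pi\<^sup>2 * ((?p r) ^ 4 * r ^ 4) / ?A"
      by (simp add: d_def power2_eq_square power4_eq_xxxx)
    finally have "pi\<^sup>2 * ((?p r) ^ 4 * r ^ 4) \<le> 2 * sqrt (r * self_energy u) * ?A"
      using A by (simp add: divide_le_eq)
    moreover have "2 * ((?p r) ^ 4 * r ^ 4) \<le> pi\<^sup>2 * ((?p r) ^ 4 * r ^ 4)"
    proof (rule mult_right_mono)
      have "2\<^sup>2 \<le> pi\<^sup>2" by (rule power_mono) (use pi_ge_two in auto)
      then show "2 \<le> pi\<^sup>2" by simp
    qed simp
    ultimately show ?thesis by (simp add: mult.commute)
  qed
qed

text \<open>The first bound is the better one near the origin, the second one at infinity.\<close>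
lemma Er_bounds:
  assumes u: "u \<in> Er_space" and B: "dirichlet u \<le> B" "self_energy u \<le> B" "B \<ge> 1" and r: "r > 0"
  shows "\<bar>profile (grad u) r\<bar> \<le> sqrt B * r powr (- 1/2)" "\<bar>profile (grad u) r\<bar> \<le> sqrt B * r powr (- 7/8)"
proof -
  let ?p = "profile (grad u) r"
  have B0: "B > 0" using B by simp
  have "?p\<^sup>2 \<le> dirichlet u / (4 * pi * r)" by (rule Er_profile_bound[OF u r])
  also have "\<dots> \<le> B / (1 * r)"
    using B r pi_ge_two dirichlet_nonneg[of u] by (intro frac_le mult_right_mono) auto
  also have "\<dots> = (sqrt B * r powr (- 1/2))\<^sup>2"
  proof -
    have "(r powr (- 1/2))\<^sup>2 = r powr (- 1)"
      using powr_add[of r "- 1/2" "- 1/2"] by (simp add: power2_eq_square)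
    also have "\<dots> = 1 / r" by (rule powr_neg_one[OF r])
    finally show ?thesis using B0 by (simp add: power_mult_distrib)
  qed
  finally show "\<bar>?p\<bar> \<le> sqrt B * r powr (- 1/2)"
    using abs_le_square_iff[of ?p "sqrt B * r powr (- 1/2)"] B0 by simp
  have "?p ^ 4 * r ^ 4 \<le> dirichlet u * sqrt (r * self_energy u)" by (rule Er_profile_decay[OF u r])
  also have "\<dots> \<le> B * sqrt (r * B)"
    using B B0 r self_energy_nonneg[of u] dirichlet_nonneg[of u] by (intro mult_mono real_sqrt_le_mono mult_left_mono) auto
  also have "\<dots> \<le> B * (B * sqrt r)"
  proof -
    have "sqrt B \<le> B" using B(3) B0 real_le_lsqrt[of B B] by (simp add: power2_eq_square)
    then show ?thesis using B0 r by (simp add: real_sqrt_mult mult_left_mono mult.commute)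
  qed
  finally have "?p ^ 4 * r ^ 4 \<le> B\<^sup>2 * sqrt r" by (simp add: power2_eq_square mult.assoc)
  then have "(?p ^ 4 * r ^ 4) / r ^ 4 \<le> (B\<^sup>2 * sqrt r) / r ^ 4" using r by (intro divide_right_mono) auto
  then have "?p ^ 4 \<le> B\<^sup>2 * (sqrt r / r ^ 4)" using r by simp
  also have "sqrt r / r ^ 4 = r powr (- 7/2)"
  proof -
    have "sqrt r / r ^ 4 = r powr (1/2) / r powr 4" using r by (simp add: powr_half_sqrt powr_numeral)
    also have "\<dots> = r powr (1/2 - 4)" by (rule powr_diff[symmetric])
    finally show ?thesis by simp
  qed
  also have "B\<^sup>2 * r powr (- 7/2) = (sqrt B * r powr (- 7/8)) ^ 4"
  proof -
    have "(sqrt B) ^ 4 = B\<^sup>2" using B0 by (simp add: power4_eq_xxxx power2_eq_square)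
    moreover have "(r powr (- 7/8)) ^ 4 = r powr (- 7/2)" using r by (simp add: powr_power)
    ultimately show ?thesis by (simp only: power_mult_distrib)
  qed
  finally have "\<bar>?p\<bar> ^ 4 \<le> (sqrt B * r powr (- 7/8)) ^ 4" by simp
  then show "\<bar>?p\<bar> \<le> sqrt B * r powr (- 7/8)"
    by (rule power_le_imp_le_base[of _ 3, simplified]) (use B0 in simp)
qed

text \<open>The layer-cake formula for the weight \<open>\<bar>x\<bar> powr (-\<beta>)\<close> reduces the claim to the masses in balls of radius \<open>s\<close>, which grow only like
\<open>s powr (1/2)\<close>.\<close>
lemma weighted_tail:
  assumes u: "u \<in> Er_space" and \<beta>: "\<beta> > 1/2" and R: "R > 0"
  shows "(\<integral>\<^sup>+ x. ennreal (if R \<le> norm x then norm x powr (- \<beta>) * (u x)\<^sup>2 else 0) \<partial>lborel)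
    \<le> ennreal (\<beta> * sqrt (2 * self_energy u) / (\<beta> - 1/2) * R powr (1/2 - \<beta>))"
proof -
  note [measurable] = Er_spaceD(4)[OF u]
  \<comment> \<open>The power as an integral of its derivative from \<open>r\<close> to infinity.\<close>
  have rep: "ennreal (r powr (- \<beta>)) = (\<integral>\<^sup>+ s. ennreal (if r \<le> s then \<beta> * s powr (- \<beta> - 1) else 0) \<partial>lborel)" if r: "r > 0" for r
  proof -
    have "(\<integral>\<^sup>+ s. ennreal (if r \<le> s then \<beta> * s powr (- \<beta> - 1) else 0) \<partial>lborel)
       = (\<integral>\<^sup>+ s. ennreal \<beta> * ennreal (if s \<in> {r..} then s powr (- \<beta> - 1) else 0) \<partial>lborel)"
      using \<beta> by (intro nn_integral_cong) (auto simp: ennreal_mult[symmetric])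
    also have "\<dots> = ennreal \<beta> * ennreal (- (r powr (- \<beta> - 1 + 1)) / (- \<beta> - 1 + 1))"
      using \<beta> r nn_integral_powr_to_inf[of "- \<beta> - 1" r] by (simp add: nn_integral_cmult)
    also have "\<dots> = ennreal (r powr (- \<beta>))" using \<beta> by (simp add: ennreal_mult[symmetric])
    finally show ?thesis by simp
  qed
  let ?F = "\<lambda>x s. ennreal (if R \<le> norm x \<and> norm x \<le> s then (u x)\<^sup>2 else 0) * ennreal (\<beta> * s powr (- \<beta> - 1))"
  have "(\<integral>\<^sup>+ x. ennreal (if R \<le> norm x then norm x powr (- \<beta>) * (u x)\<^sup>2 else 0) \<partial>lborel)
     = (\<integral>\<^sup>+ x. \<integral>\<^sup>+ s. ?F x s \<partial>lborel \<partial>lborel)"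
  proof (rule nn_integral_cong)
    fix x
    show "ennreal (if R \<le> norm x then norm x powr (- \<beta>) * (u x)\<^sup>2 else 0) = (\<integral>\<^sup>+ s. ?F x s \<partial>lborel)"
    proof (cases "R \<le> norm x")
      case True
      then have x: "norm x > 0" using R by linarith
      have "(\<integral>\<^sup>+ s. ?F x s \<partial>lborel) = (\<integral>\<^sup>+ s. ennreal ((u x)\<^sup>2) * ennreal (if norm x \<le> s then \<beta> * s powr (- \<beta> - 1) else 0) \<partial>lborel)"
        by (intro nn_integral_cong) (use True in auto)
      also have "\<dots> = ennreal ((u x)\<^sup>2) * ennreal (norm x powr (- \<beta>))"
        unfolding rep[OF x] by (rule nn_integral_cmult) measurable
      finally show ?thesis using True by (simp add: ennreal_mult[symmetric] mult.commute)
    qed simp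
  qed
  also have "\<dots> = (\<integral>\<^sup>+ s. \<integral>\<^sup>+ x. ?F x s \<partial>lborel \<partial>lborel)"
    by (rule lborel_pair.Fubini'[symmetric]) measurable
  also have "\<dots> \<le> (\<integral>\<^sup>+ s. ennreal (\<beta> * sqrt (2 * self_energy u)) * ennreal (if s \<in> {R..} then s powr (- \<beta> - 1/2) else 0) \<partial>lborel)"
  proof (rule nn_integral_mono)
    fix s :: real
    show "(\<integral>\<^sup>+ x. ?F x s \<partial>lborel) \<le> ennreal (\<beta> * sqrt (2 * self_energy u)) * ennreal (if s \<in> {R..} then s powr (- \<beta> - 1/2) else 0)"
    proof (cases "R \<le> s")
      case True
      then have s: "s > 0" using R by linarith
      have "(\<integral>\<^sup>+ x. ?F x s \<partial>lborel) \<le> (\<integral>\<^sup>+ x. ennreal (if norm x \<le> s then (u x)\<^sup>2 else 0) * ennreal (\<beta> * s powr (- \<beta> - 1)) \<partial>lborel)"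
        by (intro nn_integral_mono mult_right_mono ennreal_leI) auto
      also have "\<dots> = (\<integral>\<^sup>+ x. ennreal (if norm x \<le> s then (u x)\<^sup>2 else 0) \<partial>lborel) * ennreal (\<beta> * s powr (- \<beta> - 1))"
        by (rule nn_integral_multc) measurable
      also have "\<dots> \<le> ennreal (sqrt (2 * s * self_energy u)) * ennreal (\<beta> * s powr (- \<beta> - 1))"
        by (intro mult_right_mono ball_mass_bound_real[OF u s]) simp
      also have "\<dots> = ennreal (sqrt (2 * s * self_energy u) * (\<beta> * s powr (- \<beta> - 1)))"
        using \<beta> s self_energy_nonneg[of u] by (simp add: ennreal_mult[symmetric])
      also have "sqrt (2 * s * self_energy u) * (\<beta> * s powr (- \<beta> - 1)) = \<beta> * sqrt (2 * self_energy u) * (s powr (1/2) * s powr (- \<beta> - 1))"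
        using s by (simp add: real_sqrt_mult powr_half_sqrt)
      also have "s powr (1/2) * s powr (- \<beta> - 1) = s powr (- \<beta> - 1/2)"
      proof -
        have e: "1/2 + (- \<beta> - 1) = - \<beta> - 1/2" by simp
        show ?thesis unfolding powr_add[symmetric] e by (rule refl)
      qed
      finally show ?thesis using True \<beta> s self_energy_nonneg[of u] by (simp add: ennreal_mult)
    next
      case False
      have "(\<integral>\<^sup>+ x. ?F x s \<partial>lborel) = (\<integral>\<^sup>+ x. 0 \<partial>(lborel :: R3 measure))"
        by (intro nn_integral_cong) (use False in auto)
      then show ?thesis by simp
    qed
  qed
  also have "\<dots> = ennreal (\<beta> * sqrt (2 * self_energy u)) * ennreal (- (R powr (- \<beta> - 1/2 + 1)) / (- \<beta> - 1/2 + 1))"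
    using \<beta> R nn_integral_powr_to_inf[of "- \<beta> - 1/2" R] by (simp add: nn_integral_cmult)
  also have "- (R powr (- \<beta> - 1/2 + 1)) / (- \<beta> - 1/2 + 1) = R powr (1/2 - \<beta>) / (\<beta> - 1/2)"
  proof -
    have e: "- \<beta> - 1/2 + 1 = - (\<beta> - 1/2)" by simp
    show ?thesis unfolding e minus_divide_divide unfolding minus_diff_eq by (rule refl)
  qed
  finally show ?thesis
    using \<beta> self_energy_nonneg[of u] by (simp add: ennreal_mult[symmetric])
qed

definition tail_const :: "real \<Rightarrow> real \<Rightarrow> real" where
  "tail_const B q = sqrt B powr (q - 2) * ((7/8 * (q - 2)) * sqrt (2 * B) / (7/8 * (q - 2) - 1/2))"

text \<open>Write \<open>\<bar>u\<bar> powr q\<close> as \<open>\<bar>u\<bar> powr (q - 2) * u\<^sup>2\<close>, bound the first factor by the decay of order \<open>7/8\<close> and apply \<open>weighted_tail\<close> with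
\<open>\<beta> = 7/8 * (q - 2)\<close>. The condition \<open>\<beta> > 1/2\<close> is \<open>q > 18/7\<close>.\<close>
lemma Lq_tail:
  assumes u: "u \<in> Er_space" and B: "dirichlet u \<le> B" "self_energy u \<le> B" "B \<ge> 1" and q: "q > 18/7" and R: "R > 0"
  shows "(\<integral>\<^sup>+ x. ennreal (if R \<le> norm x then \<bar>u x\<bar> powr q else 0) \<partial>lborel)
    \<le> ennreal (tail_const B q * R powr (1/2 - 7/8 * (q - 2)))"
proof -
  let ?\<beta> = "7/8 * (q - 2)"
  note [measurable] = Er_spaceD(4)[OF u]
  have \<beta>: "?\<beta> > 1/2" using q by simp
  have "(\<integral>\<^sup>+ x. ennreal (if R \<le> norm x then \<bar>u x\<bar> powr q else 0) \<partial>lborel)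
     \<le> (\<integral>\<^sup>+ x. ennreal (sqrt B powr (q - 2)) * ennreal (if R \<le> norm x then norm x powr (- ?\<beta>) * (u x)\<^sup>2 else 0) \<partial>lborel)"
  proof (rule nn_integral_mono_AE)
    show "AE x in lborel. ennreal (if R \<le> norm x then \<bar>u x\<bar> powr q else 0)
      \<le> ennreal (sqrt B powr (q - 2)) * ennreal (if R \<le> norm x then norm x powr (- ?\<beta>) * (u x)\<^sup>2 else 0)"
      using Er_profile[OF u]
    proof eventually_elim
      case (elim x)
      show ?case
      proof (cases "R \<le> norm x")
        case True
        then have x: "norm x > 0" using R by linarith
        have "\<bar>u x\<bar> \<le> sqrt B * norm x powr (- 7/8)" using Er_bounds(2)[OF u B x] elim by simp
        then have "\<bar>u x\<bar> powr (q - 2) \<le> (sqrt B * norm x powr (- 7/8)) powr (q - 2)"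
          using q by (intro powr_mono2) auto
        also have "\<dots> = sqrt B powr (q - 2) * norm x powr (- ?\<beta>)"
          using B by (simp add: powr_mult powr_powr)
        finally have "\<bar>u x\<bar> powr (q - 2) * (u x)\<^sup>2 \<le> sqrt B powr (q - 2) * norm x powr (- ?\<beta>) * (u x)\<^sup>2"
          by (rule mult_right_mono) simp
        moreover have "\<bar>u x\<bar> powr q = \<bar>u x\<bar> powr (q - 2) * (u x)\<^sup>2"
        proof (cases "u x = 0")
          case False
          have "\<bar>u x\<bar> powr (q - 2 + 2) = \<bar>u x\<bar> powr (q - 2) * \<bar>u x\<bar> powr 2" by (rule powr_add)
          then show ?thesis using False by (simp add: powr_numeral)
        qed simp
        ultimately show ?thesis using True by (simp add: ennreal_mult[symmetric] ennreal_leI mult.assoc)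
      qed simp
    qed
  qed
  also have "\<dots> = ennreal (sqrt B powr (q - 2)) * (\<integral>\<^sup>+ x. ennreal (if R \<le> norm x then norm x powr (- ?\<beta>) * (u x)\<^sup>2 else 0) \<partial>lborel)"
    by (rule nn_integral_cmult) measurable
  also have "\<dots> \<le> ennreal (sqrt B powr (q - 2)) * ennreal (?\<beta> * sqrt (2 * self_energy u) / (?\<beta> - 1/2) * R powr (1/2 - ?\<beta>))"
    by (intro mult_left_mono weighted_tail[OF u \<beta> R]) simp
  also have "\<dots> \<le> ennreal (sqrt B powr (q - 2)) * ennreal (?\<beta> * sqrt (2 * B) / (?\<beta> - 1/2) * R powr (1/2 - ?\<beta>))"
    using B q by (intro mult_left_mono ennreal_leI mult_right_mono divide_right_mono) auto
  also have "\<dots> = ennreal (tail_const B q * R powr (1/2 - ?\<beta>))"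
    unfolding tail_const_def using B q by (subst ennreal_mult[symmetric]) auto
  finally show ?thesis .
qed

text \<open>On a ball the bound of order \<open>\<bar>x\<bar> powr (-1/2)\<close> is integrable to the power \<open>q\<close> as long as \<open>q < 6\<close>.\<close>
lemma Lq_core:
  assumes u: "u \<in> Er_space" and B: "dirichlet u \<le> B" "self_energy u \<le> B" "B \<ge> 1" and q: "q > 0" "q < 6" and R: "R > 0"
  shows "(\<integral>\<^sup>+ x. ennreal (if norm x \<le> R then \<bar>u x\<bar> powr q else 0) \<partial>lborel)
    \<le> ennreal (sqrt B powr q * (4 * pi / (3 - q/2) * R powr (3 - q/2)))"
proof -
  note [measurable] = Er_spaceD(4)[OF u]
  have "(\<integral>\<^sup>+ x. ennreal (if norm x \<le> R then \<bar>u x\<bar> powr q else 0) \<partial>lborel)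
     \<le> (\<integral>\<^sup>+ x. ennreal (sqrt B powr q) * ennreal (if norm (x::R3) \<le> R then norm x powr (- (q/2)) else 0) \<partial>lborel)"
  proof (rule nn_integral_mono_AE)
    have "AE x in lborel. x \<noteq> (0::R3)" by (rule AE_lborel_singleton)
    with Er_profile[OF u]
    show "AE x in lborel. ennreal (if norm x \<le> R then \<bar>u x\<bar> powr q else 0)
      \<le> ennreal (sqrt B powr q) * ennreal (if norm (x::R3) \<le> R then norm x powr (- (q/2)) else 0)"
    proof eventually_elim
      case (elim x)
      then have x: "norm x > 0" by simp
      have "\<bar>u x\<bar> \<le> sqrt B * norm x powr (- 1/2)" using Er_bounds(1)[OF u B x] elim by simp
      then have "\<bar>u x\<bar> powr q \<le> (sqrt B * norm x powr (- 1/2)) powr q"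
        using q by (intro powr_mono2) auto
      also have "\<dots> = sqrt B powr q * norm x powr (- (q/2))"
        using B by (simp add: powr_mult powr_powr)
      finally show ?case by (simp add: ennreal_mult[symmetric] ennreal_leI)
    qed
  qed
  also have "\<dots> = ennreal (sqrt B powr q) * ennreal (4 * pi / (3 - q/2) * R powr (3 - q/2))"
    using q R nn_integral_norm_powr_ball[of "q/2" R] by (simp add: nn_integral_cmult)
  also have "\<dots> = ennreal (sqrt B powr q * (4 * pi / (3 - q/2) * R powr (3 - q/2)))"
    using q by (subst ennreal_mult[symmetric]) auto
  finally show ?thesis .
qed

definition Lq_const :: "real \<Rightarrow> real \<Rightarrow> real" where
  "Lq_const B q = sqrt B powr q * (4 * pi / (3 - q/2)) + tail_const B q"

lemma Lq_bound:
  assumes u: "u \<in> Er_space" and B: "dirichlet u \<le> B" "self_energy u \<le> B" "B \<ge> 1" and q: "q > 18/7" "q < 6"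
  shows "integrable lborel (\<lambda>x. \<bar>u x\<bar> powr q)" "(LINT x|lborel. \<bar>u x\<bar> powr q) \<le> Lq_const B q"
proof -
  note [measurable] = Er_spaceD(4)[OF u]
  have t0: "tail_const B q \<ge> 0" unfolding tail_const_def using B q by (intro mult_nonneg_nonneg divide_nonneg_nonneg) auto
  have "(\<integral>\<^sup>+ x. ennreal (\<bar>u x\<bar> powr q) \<partial>lborel)
     \<le> (\<integral>\<^sup>+ x. ennreal (if norm x \<le> 1 then \<bar>u x\<bar> powr q else 0) + ennreal (if 1 \<le> norm x then \<bar>u x\<bar> powr q else 0) \<partial>lborel)"
    by (intro nn_integral_mono) auto
  also have "\<dots> = (\<integral>\<^sup>+ x. ennreal (if norm x \<le> 1 then \<bar>u x\<bar> powr q else 0) \<partial>lborel) + (\<integral>\<^sup>+ x. ennreal (if 1 \<le> norm x then \<bar>u x\<bar> powr q else 0) \<partial>lborel)"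
    by (rule nn_integral_add) measurable
  also have "\<dots> \<le> ennreal (sqrt B powr q * (4 * pi / (3 - q/2) * 1 powr (3 - q/2))) + ennreal (tail_const B q * 1 powr (1/2 - 7/8 * (q - 2)))"
    using q by (intro add_mono Lq_core[OF u B] Lq_tail[OF u B]) auto
  also have "\<dots> = ennreal (Lq_const B q)"
    using q t0 by (simp add: Lq_const_def ennreal_plus[symmetric] del: ennreal_plus)
  finally have le: "(\<integral>\<^sup>+ x. ennreal (\<bar>u x\<bar> powr q) \<partial>lborel) \<le> ennreal (Lq_const B q)" .
  show i: "integrable lborel (\<lambda>x. \<bar>u x\<bar> powr q)"
    by (rule integrableI_bounded) (use le in \<open>auto intro: le_less_trans\<close>)
  have "Lq_const B q \<ge> 0" unfolding Lq_const_def using q t0 by (intro add_nonneg_nonneg mult_nonneg_nonneg) auto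
  then show "(LINT x|lborel. \<bar>u x\<bar> powr q) \<le> Lq_const B q"
    using le by (simp add: nn_integral_eq_integral[OF i])
qed

lemma Lq_integrable:
  assumes u: "u \<in> Er_space" and q: "q > 18/7" "q < 6"
  shows "integrable lborel (\<lambda>x. \<bar>u x\<bar> powr q)"
  by (rule Lq_bound(1)[OF u _ _ _ q, of "max 1 (max (dirichlet u) (self_energy u))"]) auto

text \<open>Hardy's inequality, read off from the representation formula. The weights \<open>\<bar>y\<bar> powr (-1/4)\<close> and \<open>\<bar>y\<bar> powr (-7/4)\<close> in Cauchy--Schwarz (the
Schur test) are chosen such that both the inner and the subsequent outer integral of a power converge and the powers of \<open>\<bar>y\<bar>\<close> cancel.\<close>
lemma hardy:
  assumes u: "u \<in> Er_space"
  shows "(\<integral>\<^sup>+ x. ennreal ((u x)\<^sup>2 * norm x powr (- 2)) \<partial>lborel) \<le> ennreal (4 * dirichlet u)"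
proof -
  let ?w = "grad u"
  note g = D12_grad[OF Er_spaceD(1)[OF u]]
  note [measurable] = Er_spaceD(4)[OF u] weak_gradient_measurable[OF g(1)]
  have pw: "ennreal ((profile ?w r)\<^sup>2 * r powr (- 2))
     \<le> ennreal (1 / (2 * pi)) * (\<integral>\<^sup>+ y. ennreal ((norm (?w y))\<^sup>2 * norm y powr (- 1/2)) * ennreal (if r \<le> norm y then r powr (- 5/2) else 0) \<partial>lborel)"
    if r: "r > 0" for r
  proof -
    have "ennreal \<bar>LINT x|lborel. (if r \<le> norm x then radial_part ?w x else 0)\<bar> \<le> (\<integral>\<^sup>+ y. ennreal \<bar>if r \<le> norm y then radial_part ?w y else 0\<bar> \<partial>lborel)"
      by (rule abs_integral_le_nn_integral)
    also have "\<dots> \<le> (\<integral>\<^sup>+ y. ennreal (if r \<le> norm y then norm (?w y) * norm y powr (- 1/4) else 0) * ennreal (if r \<le> norm y then norm y powr (- 7/4) else 0) \<partial>lborel)"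
    proof (intro nn_integral_mono)
      fix y :: R3
      have "norm y powr (- 1/4) * norm y powr (- 7/4) = norm y powr (- 2)" by (simp add: powr_add[symmetric])
      then have e: "norm (?w y) * norm y powr (- 1/4) * norm y powr (- 7/4) = norm (?w y) * norm y powr (- 2)" by (simp only: mult.assoc)
      have b: "\<bar>radial_part ?w y\<bar> \<le> norm (?w y) * norm y powr (- 1/4) * norm y powr (- 7/4)"
        unfolding e by (rule radial_part_bound)
      show "ennreal \<bar>if r \<le> norm y then radial_part ?w y else 0\<bar>
        \<le> ennreal (if r \<le> norm y then norm (?w y) * norm y powr (- 1/4) else 0) * ennreal (if r \<le> norm y then norm y powr (- 7/4) else 0)"
        using ennreal_leI[OF b] by (cases "r \<le> norm y") (simp_all add: ennreal_mult)
    qed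
    finally have "(ennreal \<bar>LINT x|lborel. (if r \<le> norm x then radial_part ?w x else 0)\<bar>)\<^sup>2
       \<le> (\<integral>\<^sup>+ y. ennreal (if r \<le> norm y then norm (?w y) * norm y powr (- 1/4) else 0) * ennreal (if r \<le> norm y then norm y powr (- 7/4) else 0) \<partial>lborel)\<^sup>2"
      by (rule power_mono) simp
    also have "\<dots> \<le> (\<integral>\<^sup>+ y. (ennreal (if r \<le> norm y then norm (?w y) * norm y powr (- 1/4) else 0))\<^sup>2 \<partial>lborel)
       * (\<integral>\<^sup>+ y. (ennreal (if r \<le> norm (y::R3) then norm y powr (- 7/4) else 0))\<^sup>2 \<partial>lborel)"
      by (rule Cauchy_Schwarz_nn_integral) measurable
    also have "(\<integral>\<^sup>+ y. (ennreal (if r \<le> norm (y::R3) then norm y powr (- 7/4) else 0))\<^sup>2 \<partial>lborel) = (\<integral>\<^sup>+ y. ennreal (if r \<le> norm (y::R3) then norm y powr (- (7/2)) else 0) \<partial>lborel)"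
    proof (intro nn_integral_cong)
      fix y :: R3
      have "(norm y powr (- 7/4))\<^sup>2 = norm y powr (- (7/2))" by (simp add: power2_eq_square powr_add[symmetric])
      then show "(ennreal (if r \<le> norm y then norm y powr (- 7/4) else 0))\<^sup>2 = ennreal (if r \<le> norm y then norm y powr (- (7/2)) else 0)"
        by (cases "r \<le> norm y") (simp_all add: ennreal_power)
    qed
    also have "\<dots> = ennreal (8 * pi * r powr (- 1/2))"
      using nn_integral_norm_powr_outside[of "7/2" r] r by simp
    also have "(\<integral>\<^sup>+ y. (ennreal (if r \<le> norm y then norm (?w y) * norm y powr (- 1/4) else 0))\<^sup>2 \<partial>lborel)
       = (\<integral>\<^sup>+ y. ennreal (if r \<le> norm y then (norm (?w y))\<^sup>2 * norm y powr (- 1/2) else 0) \<partial>lborel)"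
    proof (intro nn_integral_cong)
      fix y :: R3
      have "(norm y powr (- 1/4))\<^sup>2 = norm y powr (- 1/2)" by (simp add: power2_eq_square powr_add[symmetric])
      then show "(ennreal (if r \<le> norm y then norm (?w y) * norm y powr (- 1/4) else 0))\<^sup>2 = ennreal (if r \<le> norm y then (norm (?w y))\<^sup>2 * norm y powr (- 1/2) else 0)"
        by (cases "r \<le> norm y") (simp_all add: ennreal_power power_mult_distrib)
    qed
    finally have sq: "(ennreal \<bar>LINT x|lborel. (if r \<le> norm x then radial_part ?w x else 0)\<bar>)\<^sup>2
       \<le> (\<integral>\<^sup>+ y. ennreal (if r \<le> norm y then (norm (?w y))\<^sup>2 * norm y powr (- 1/2) else 0) \<partial>lborel) * ennreal (8 * pi * r powr (- 1/2))" .
    have "ennreal ((profile ?w r)\<^sup>2 * r powr (- 2)) = ennreal ((1 / (4 * pi))\<^sup>2 * r powr (- 2)) * (ennreal \<bar>LINT x|lborel. (if r \<le> norm x then radial_part ?w x else 0)\<bar>)\<^sup>2"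
      by (simp add: profile_def ennreal_power ennreal_mult[symmetric] power_mult_distrib power_divide mult_ac)
    also have "\<dots> \<le> ennreal ((1 / (4 * pi))\<^sup>2 * r powr (- 2)) * ((\<integral>\<^sup>+ y. ennreal (if r \<le> norm y then (norm (?w y))\<^sup>2 * norm y powr (- 1/2) else 0) \<partial>lborel) * ennreal (8 * pi * r powr (- 1/2)))"
      by (intro mult_left_mono sq) simp
    also have "\<dots> = (ennreal ((1 / (4 * pi))\<^sup>2 * r powr (- 2)) * ennreal (8 * pi * r powr (- 1/2))) * (\<integral>\<^sup>+ y. ennreal (if r \<le> norm y then (norm (?w y))\<^sup>2 * norm y powr (- 1/2) else 0) \<partial>lborel)"
      by (simp only: mult_ac)
    also have "ennreal ((1 / (4 * pi))\<^sup>2 * r powr (- 2)) * ennreal (8 * pi * r powr (- 1/2)) = ennreal (1 / (2 * pi)) * ennreal (r powr (- 5/2))"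
    proof -
      have k: "r powr (- 2) * r powr (- 1/2) = r powr (- 5/2)" by (simp add: powr_add[symmetric])
      have "(1 / (4 * pi))\<^sup>2 * r powr (- 2) * (8 * pi * r powr (- 1/2)) = (1 / (4 * pi))\<^sup>2 * (8 * pi) * (r powr (- 2) * r powr (- 1/2))" by (simp only: mult_ac)
      also have "\<dots> = (1 / (4 * pi))\<^sup>2 * (8 * pi) * r powr (- 5/2)" unfolding k by (rule refl)
      also have "(1 / (4 * pi))\<^sup>2 * (8 * pi) = 1 / (2 * pi)" by (simp add: power2_eq_square)
      finally show ?thesis by (simp add: ennreal_mult[symmetric])
    qed
    also have "ennreal (1 / (2 * pi)) * ennreal (r powr (- 5/2)) * (\<integral>\<^sup>+ y. ennreal (if r \<le> norm y then (norm (?w y))\<^sup>2 * norm y powr (- 1/2) else 0) \<partial>lborel)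
       = ennreal (1 / (2 * pi)) * (\<integral>\<^sup>+ y. ennreal (r powr (- 5/2)) * ennreal (if r \<le> norm y then (norm (?w y))\<^sup>2 * norm y powr (- 1/2) else 0) \<partial>lborel)"
      by (subst nn_integral_cmult) (auto simp: mult.assoc)
    also have "(\<integral>\<^sup>+ y. ennreal (r powr (- 5/2)) * ennreal (if r \<le> norm y then (norm (?w y))\<^sup>2 * norm y powr (- 1/2) else 0) \<partial>lborel)
       = (\<integral>\<^sup>+ y. ennreal ((norm (?w y))\<^sup>2 * norm y powr (- 1/2)) * ennreal (if r \<le> norm y then r powr (- 5/2) else 0) \<partial>lborel)"
      by (intro nn_integral_cong) (auto simp: mult.commute)
    finally show ?thesis .
  qed
  have "(\<integral>\<^sup>+ x. ennreal ((u x)\<^sup>2 * norm x powr (- 2)) \<partial>lborel)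
     \<le> (\<integral>\<^sup>+ x. ennreal (1 / (2 * pi)) * (\<integral>\<^sup>+ y. ennreal ((norm (?w y))\<^sup>2 * norm y powr (- 1/2)) * ennreal (if norm (x::R3) \<le> norm y then norm x powr (- 5/2) else 0) \<partial>lborel) \<partial>lborel)"
  proof (rule nn_integral_mono_AE)
    have "AE x in lborel. x \<noteq> (0::R3)" by (rule AE_lborel_singleton)
    with Er_profile[OF u] show "AE x in lborel. ennreal ((u x)\<^sup>2 * norm x powr (- 2)) \<le> ennreal (1 / (2 * pi)) * (\<integral>\<^sup>+ y. ennreal ((norm (?w y))\<^sup>2 * norm y powr (- 1/2)) * ennreal (if norm (x::R3) \<le> norm y then norm x powr (- 5/2) else 0) \<partial>lborel)"
    proof eventually_elim
      case (elim x)
      then show ?case using pw[of "norm x"] by simp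
    qed
  qed
  also have "\<dots> = ennreal (1 / (2 * pi)) * (\<integral>\<^sup>+ x. (\<integral>\<^sup>+ y. ennreal ((norm (?w y))\<^sup>2 * norm y powr (- 1/2)) * ennreal (if norm (x::R3) \<le> norm y then norm x powr (- 5/2) else 0) \<partial>lborel) \<partial>lborel)"
    by (rule nn_integral_cmult) measurable
  also have "(\<integral>\<^sup>+ x. (\<integral>\<^sup>+ y. ennreal ((norm (?w y))\<^sup>2 * norm y powr (- 1/2)) * ennreal (if norm (x::R3) \<le> norm y then norm x powr (- 5/2) else 0) \<partial>lborel) \<partial>lborel)
     = (\<integral>\<^sup>+ y. (\<integral>\<^sup>+ x. ennreal ((norm (?w y))\<^sup>2 * norm y powr (- 1/2)) * ennreal (if norm (x::R3) \<le> norm y then norm x powr (- 5/2) else 0) \<partial>lborel) \<partial>lborel)"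
    by (rule lborel_pair.Fubini'[symmetric]) measurable
  also have "\<dots> \<le> (\<integral>\<^sup>+ y. ennreal (8 * pi) * ennreal ((norm (?w y))\<^sup>2) \<partial>lborel)"
  proof (rule nn_integral_mono)
    fix y :: R3
    have "(\<integral>\<^sup>+ x. ennreal ((norm (?w y))\<^sup>2 * norm y powr (- 1/2)) * ennreal (if norm (x::R3) \<le> norm y then norm x powr (- 5/2) else 0) \<partial>lborel)
      = ennreal ((norm (?w y))\<^sup>2 * norm y powr (- 1/2)) * (\<integral>\<^sup>+ x. ennreal (if norm (x::R3) \<le> norm y then norm x powr (- 5/2) else 0) \<partial>lborel)"
      by (rule nn_integral_cmult) measurable
    also have "\<dots> \<le> ennreal (8 * pi) * ennreal ((norm (?w y))\<^sup>2)"
    proof (cases "y = 0")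
      case False
      have I: "(\<integral>\<^sup>+ x. ennreal (if norm (x::R3) \<le> norm y then norm x powr (- 5/2) else 0) \<partial>lborel) = ennreal (8 * pi * norm y powr (1/2))"
      proof -
        have m: "- 5/2 = - (5/2 :: real)" by simp
        show ?thesis unfolding m using nn_integral_norm_powr_ball[of "5/2" "norm y"] False by simp
      qed
      have "norm y powr (- 1/2) * norm y powr (1/2) = 1" using False by (simp add: powr_add[symmetric])
      then have "8 * pi * (norm (?w y))\<^sup>2 * (norm y powr (- 1/2) * norm y powr (1/2)) = 8 * pi * (norm (?w y))\<^sup>2"
        by (simp only: mult_1_right)
      then have e: "(norm (?w y))\<^sup>2 * norm y powr (- 1/2) * (8 * pi * norm y powr (1/2)) = 8 * pi * (norm (?w y))\<^sup>2"
        by (simp only: mult_ac)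
      have "ennreal ((norm (?w y))\<^sup>2 * norm y powr (- 1/2)) * ennreal (8 * pi * norm y powr (1/2))
         = ennreal ((norm (?w y))\<^sup>2 * norm y powr (- 1/2) * (8 * pi * norm y powr (1/2)))"
        by (rule ennreal_mult[symmetric]) auto
      also have "\<dots> = ennreal (8 * pi) * ennreal ((norm (?w y))\<^sup>2)"
        unfolding e by (rule ennreal_mult) auto
      finally show ?thesis unfolding I by simp
    qed simp
    finally show "(\<integral>\<^sup>+ x. ennreal ((norm (?w y))\<^sup>2 * norm y powr (- 1/2)) * ennreal (if norm (x::R3) \<le> norm y then norm x powr (- 5/2) else 0) \<partial>lborel) \<le> ennreal (8 * pi) * ennreal ((norm (?w y))\<^sup>2)" .
  qed
  also have "\<dots> = ennreal (8 * pi) * ennreal (dirichlet u)"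
    using g(2) by (simp add: nn_integral_cmult nn_integral_eq_integral dirichlet_def)
  finally have "(\<integral>\<^sup>+ x. ennreal ((u x)\<^sup>2 * norm x powr (- 2)) \<partial>lborel) \<le> ennreal (1 / (2 * pi)) * (ennreal (8 * pi) * ennreal (dirichlet u))"
    by (simp add: mult_left_mono)
  also have "\<dots> = ennreal (4 * dirichlet u)"
    using dirichlet_nonneg[of u] by (simp add: ennreal_mult[symmetric])
  finally show ?thesis .
qed

text \<open>Sobolev's inequality at the critical exponent in weak form: four of the six factors are absorbed by the pointwise decay and
Hardy's inequality handles the remaining square. It keeps pointwise limits inside the space.\<close>
lemma L6_bound:
  assumes u: "u \<in> Er_space" and B: "dirichlet u \<le> B" "self_energy u \<le> B" "B \<ge> 1"
  shows "(\<integral>\<^sup>+ x. ennreal (\<bar>u x\<bar> ^ 6) \<partial>lborel) \<le> ennreal (4 * B ^ 3)"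
proof -
  note [measurable] = Er_spaceD(4)[OF u]
  have "(\<integral>\<^sup>+ x. ennreal (\<bar>u x\<bar> ^ 6) \<partial>lborel) \<le> (\<integral>\<^sup>+ x. ennreal (B\<^sup>2) * ennreal ((u x)\<^sup>2 * norm x powr (- 2)) \<partial>lborel)"
  proof (rule nn_integral_mono_AE)
    have "AE x in lborel. x \<noteq> (0::R3)" by (rule AE_lborel_singleton)
    with Er_profile[OF u]
    show "AE x in lborel. ennreal (\<bar>u x\<bar> ^ 6) \<le> ennreal (B\<^sup>2) * ennreal ((u x)\<^sup>2 * norm x powr (- 2))"
    proof eventually_elim
      case (elim x)
      then have x: "norm x > 0" by simp
      have "\<bar>u x\<bar> \<le> sqrt B * norm x powr (- 1/2)" using Er_bounds(1)[OF u B x] elim by simp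
      then have "\<bar>u x\<bar> ^ 4 \<le> (sqrt B * norm x powr (- 1/2)) ^ 4" by (intro power_mono) auto
      also have "\<dots> = B\<^sup>2 * norm x powr (- 2)"
      proof -
        have "(sqrt B) ^ 4 = B\<^sup>2" using B by (simp add: power4_eq_xxxx power2_eq_square)
        moreover have "(norm x powr (- 1/2)) ^ 4 = norm x powr (- 2)" using x by (simp add: powr_power)
        ultimately show ?thesis by (simp only: power_mult_distrib)
      qed
      finally have "\<bar>u x\<bar> ^ 4 * (u x)\<^sup>2 \<le> B\<^sup>2 * norm x powr (- 2) * (u x)\<^sup>2" by (rule mult_right_mono) simp
      moreover have "\<bar>u x\<bar> ^ 6 = \<bar>u x\<bar> ^ 4 * (u x)\<^sup>2"
        unfolding power2_abs[of "u x", symmetric] power_add[symmetric] by simp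
      ultimately have "\<bar>u x\<bar> ^ 6 \<le> B\<^sup>2 * ((u x)\<^sup>2 * norm x powr (- 2))" by (simp only: mult_ac)
      then show ?case by (simp add: ennreal_mult[symmetric] ennreal_leI)
    qed
  qed
  also have "\<dots> = ennreal (B\<^sup>2) * (\<integral>\<^sup>+ x. ennreal ((u x)\<^sup>2 * norm x powr (- 2)) \<partial>lborel)"
    by (rule nn_integral_cmult) measurable
  also have "\<dots> \<le> ennreal (B\<^sup>2) * ennreal (4 * dirichlet u)"
    by (intro mult_left_mono hardy[OF u]) simp
  also have "\<dots> \<le> ennreal (B\<^sup>2) * ennreal (4 * B)"
    using B by (intro mult_left_mono ennreal_leI) auto
  also have "\<dots> = ennreal (4 * B ^ 3)"
    using B by (simp add: ennreal_mult[symmetric] power2_eq_square power3_eq_cube)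
  finally show ?thesis .
qed


subsection \<open>Mixed Coulomb energies\<close>

definition nn_coulomb :: "(R3 \<Rightarrow> ennreal) \<Rightarrow> (R3 \<Rightarrow> ennreal) \<Rightarrow> ennreal" where
  "nn_coulomb a b = (\<integral>\<^sup>+ x. \<integral>\<^sup>+ y. a x * b y * ennreal (1 / norm (x - y)) \<partial>lborel \<partial>lborel)"

text \<open>The argument \<open>z\<close> encodes a ball: its radius is the first and its centre the second component.\<close>
definition ball_ind :: "real \<times> R3 \<Rightarrow> R3 \<Rightarrow> ennreal" where
  "ball_ind z x = (if norm (x - snd z) \<le> fst z then 1 else 0)"

text \<open>With this weight the kernel below is homogeneous of degree \<open>-1\<close>, like \<open>1 / \<bar>x - y\<bar>\<close>: the volume of the set of centres of
balls of radius \<open>r\<close> that contain two given points scales like \<open>r\<^sup>3\<close>, and the integral over \<open>r\<close> contributes one more power.\<close>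
definition ball_weight :: "real \<Rightarrow> ennreal" where
  "ball_weight r = ennreal (if r > 0 then r powr (- 5) else 0)"

lemma borel_measurable_fst_pair [measurable (raw)]:
  fixes f :: "'a \<Rightarrow> real \<times> R3"
  assumes "f \<in> M \<rightarrow>\<^sub>M borel"
  shows "(\<lambda>p. fst (f p)) \<in> M \<rightarrow>\<^sub>M borel" "(\<lambda>p. snd (f p)) \<in> M \<rightarrow>\<^sub>M borel"
  using measurable_compose[OF assms borel_measurable_continuous_onI[OF continuous_on_fst[OF continuous_on_id]]]
    measurable_compose[OF assms borel_measurable_continuous_onI[OF continuous_on_snd[OF continuous_on_id]]]
  by simp_all

lemma ball_weight_measurable [measurable]: "ball_weight \<in> borel_measurable borel"
  unfolding ball_weight_def by measurable

lemma ball_ind_measurable [measurable (raw)]: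
  assumes f: "f \<in> M \<rightarrow>\<^sub>M borel" and [measurable]: "g \<in> M \<rightarrow>\<^sub>M borel"
  shows "(\<lambda>p. ball_ind (f p) (g p)) \<in> borel_measurable M"
proof -
  note [measurable] = borel_measurable_fst_pair[OF f]
  show ?thesis unfolding ball_ind_def by measurable
qed

text \<open>The average of the products of ball indicators over all balls. It is comparable to \<open>1 / \<bar>x - y\<bar>\<close> and by construction a positive
definite kernel.\<close>
definition ball_kernel :: "R3 \<Rightarrow> R3 \<Rightarrow> ennreal" where
  "ball_kernel x y = (\<integral>\<^sup>+ z. ball_weight (fst z) * (ball_ind z x * ball_ind z y) \<partial>(lborel :: (real \<times> R3) measure))"

lemma ball_kernel_eq: "ball_kernel x y = (\<integral>\<^sup>+ r. ball_weight r * emeasure lborel (cball x r \<inter> cball y r) \<partial>lborel)"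
proof -
  have [measurable]: "(\<lambda>z. ball_weight (fst z) * (ball_ind z x * ball_ind z y)) \<in> borel_measurable (borel :: (real \<times> R3) measure)"
    by measurable
  have "ball_kernel x y = (\<integral>\<^sup>+ r. \<integral>\<^sup>+ c. ball_weight r * (ball_ind (r, c) x * ball_ind (r, c) y) \<partial>lborel \<partial>lborel)"
    unfolding ball_kernel_def lborel_prod[symmetric]
    by (subst lborel.nn_integral_fst[symmetric]) (auto simp: lborel_prod)
  also have "\<dots> = (\<integral>\<^sup>+ r. ball_weight r * (\<integral>\<^sup>+ c. indicator (cball x r \<inter> cball y r) c \<partial>lborel) \<partial>lborel)"
  proof (rule nn_integral_cong)
    fix r :: real
    have [measurable]: "cball x r \<inter> cball y r \<in> sets borel" by (intro sets.Int borel_closed closed_cball)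
    have "(\<integral>\<^sup>+ c. ball_weight r * (ball_ind (r, c) x * ball_ind (r, c) y) \<partial>lborel) = (\<integral>\<^sup>+ c. ball_weight r * indicator (cball x r \<inter> cball y r) c \<partial>lborel)"
      by (intro nn_integral_cong) (auto simp: ball_ind_def dist_norm split: split_indicator)
    also have "\<dots> = ball_weight r * (\<integral>\<^sup>+ c. indicator (cball x r \<inter> cball y r) c \<partial>lborel)"
      by (rule nn_integral_cmult) measurable
    finally show "(\<integral>\<^sup>+ c. ball_weight r * (ball_ind (r, c) x * ball_ind (r, c) y) \<partial>lborel) = ball_weight r * (\<integral>\<^sup>+ c. indicator (cball x r \<inter> cball y r) c \<partial>lborel)" .
  qed
  finally show ?thesis by simp
qed

lemma emeasure_cball_R3: "r \<ge> 0 \<Longrightarrow> emeasure lborel (cball (x::R3) r) = ennreal (4/3 * pi * r ^ 3)"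
  by (simp add: emeasure_cball unit_ball_vol_3)

text \<open>For \<open>r \<ge> \<bar>x - y\<bar>\<close> the intersection of the two balls contains the ball of radius \<open>r / 2\<close> around the midpoint.\<close>
lemma ball_kernel_lower:
  assumes "x \<noteq> y"
  shows "ennreal (pi / 6) * ennreal (1 / norm (x - y)) \<le> ball_kernel x y"
proof -
  let ?d = "norm (x - y)"
  have d: "?d > 0" using assms by simp
  have "ennreal (pi / 6) * ennreal (1 / ?d) = (\<integral>\<^sup>+ r. ennreal (pi / 6) * ennreal (if r \<in> {?d..} then r powr (- 2) else 0) \<partial>lborel)"
    using d nn_integral_powr_to_inf[of "- 2" ?d] by (simp add: nn_integral_cmult powr_neg_one)
  also have "\<dots> \<le> (\<integral>\<^sup>+ r. ball_weight r * emeasure lborel (cball x r \<inter> cball y r) \<partial>lborel)"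
  proof (rule nn_integral_mono)
    fix r :: real
    show "ennreal (pi / 6) * ennreal (if r \<in> {?d..} then r powr (- 2) else 0) \<le> ball_weight r * emeasure lborel (cball x r \<inter> cball y r)"
    proof (cases "?d \<le> r")
      case True
      then have r: "r > 0" using d by linarith
      let ?m = "(1/2) *\<^sub>R (x + y)"
      have "cball ?m (r / 2) \<subseteq> cball x r \<inter> cball y r"
      proof
        fix c assume c: "c \<in> cball ?m (r / 2)"
        have mx: "dist x ?m = ?d / 2"
        proof -
          have "x - ?m = (1/2) *\<^sub>R (x - y)" by (simp add: algebra_simps vec_eq_iff field_simps)
          then show ?thesis by (simp add: dist_norm)
        qed
        have my: "dist y ?m = ?d / 2"
        proof -
          have "y - ?m = (1/2) *\<^sub>R (y - x)" by (simp add: algebra_simps vec_eq_iff field_simps)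
          then show ?thesis by (simp add: dist_norm norm_minus_commute)
        qed
        have "dist x c \<le> r" using dist_triangle[of x c ?m] mx c True by simp
        moreover have "dist y c \<le> r" using dist_triangle[of y c ?m] my c True by simp
        ultimately show "c \<in> cball x r \<inter> cball y r" by simp
      qed
      then have "emeasure lborel (cball ?m (r / 2)) \<le> emeasure lborel (cball x r \<inter> cball y r)"
        by (rule emeasure_mono) auto
      then have le: "ennreal (4/3 * pi * (r / 2) ^ 3) \<le> emeasure lborel (cball x r \<inter> cball y r)"
        using r by (simp add: emeasure_cball_R3)
      have k: "r powr (- 5) * r ^ 3 = r powr (- 2)"
        using r by (simp add: powr_numeral[symmetric] powr_add[symmetric] del: powr_numeral)
      have "r powr (- 5) * (4/3 * pi * (r / 2) ^ 3) = pi / 6 * (r powr (- 5) * r ^ 3)"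
        by (simp add: power_divide)
      then have "r powr (- 5) * (4/3 * pi * (r / 2) ^ 3) = pi / 6 * r powr (- 2)"
        unfolding k .
      then have "ennreal (pi / 6) * ennreal (r powr (- 2)) = ennreal (r powr (- 5)) * ennreal (4/3 * pi * (r / 2) ^ 3)"
        using r by (simp add: ennreal_mult[symmetric])
      also have "\<dots> \<le> ball_weight r * emeasure lborel (cball x r \<inter> cball y r)"
        using r le by (simp add: ball_weight_def mult_left_mono)
      finally show ?thesis using True by simp
    qed simp
  qed
  finally show ?thesis unfolding ball_kernel_eq .
qed

text \<open>The balls are disjoint for \<open>r < \<bar>x - y\<bar> / 2\<close>.\<close>
lemma ball_kernel_upper:
  assumes "x \<noteq> y"
  shows "ball_kernel x y \<le> ennreal (8 * pi / 3) * ennreal (1 / norm (x - y))"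
proof -
  let ?d = "norm (x - y)"
  have d: "?d > 0" using assms by simp
  have "ball_kernel x y \<le> (\<integral>\<^sup>+ r. ennreal (4 * pi / 3) * ennreal (if r \<in> {?d / 2..} then r powr (- 2) else 0) \<partial>lborel)"
    unfolding ball_kernel_eq
  proof (rule nn_integral_mono)
    fix r :: real
    show "ball_weight r * emeasure lborel (cball x r \<inter> cball y r) \<le> ennreal (4 * pi / 3) * ennreal (if r \<in> {?d / 2..} then r powr (- 2) else 0)"
    proof (cases "?d / 2 \<le> r")
      case True
      then have r: "r > 0" using d by linarith
      have "emeasure lborel (cball x r \<inter> cball y r) \<le> ennreal (4/3 * pi * r ^ 3)"
        unfolding emeasure_cball_R3[OF less_imp_le[OF r], of x, symmetric] by (rule emeasure_mono) auto
      then have "ball_weight r * emeasure lborel (cball x r \<inter> cball y r) \<le> ennreal (r powr (- 5)) * ennreal (4/3 * pi * r ^ 3)"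
        using r by (simp add: ball_weight_def mult_left_mono)
      also have "\<dots> = ennreal (4 * pi / 3) * ennreal (r powr (- 2))"
      proof -
        have k: "r powr (- 5) * r ^ 3 = r powr (- 2)"
          using r by (simp add: powr_numeral[symmetric] powr_add[symmetric] del: powr_numeral)
        have "r powr (- 5) * (4/3 * pi * r ^ 3) = 4 * pi / 3 * (r powr (- 5) * r ^ 3)" by simp
        then have "r powr (- 5) * (4/3 * pi * r ^ 3) = 4 * pi / 3 * r powr (- 2)" unfolding k .
        then show ?thesis using r by (simp add: ennreal_mult[symmetric])
      qed
      finally show ?thesis using True by simp
    next
      case False
      have "c \<notin> cball x r \<inter> cball y r" for c
      proof
        assume "c \<in> cball x r \<inter> cball y r"
        then have "dist x y \<le> r + r" using dist_triangle2[of x y c] by simp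
        then show False using False by (simp add: dist_norm)
      qed
      then have "cball x r \<inter> cball y r = {}" by blast
      then show ?thesis by simp
    qed
  qed
  also have "\<dots> = ennreal (4 * pi / 3) * (\<integral>\<^sup>+ r. ennreal (if r \<in> {?d / 2..} then r powr (- 2) else 0) \<partial>lborel)"
    by (rule nn_integral_cmult) measurable
  also have "(\<integral>\<^sup>+ r. ennreal (if r \<in> {?d / 2..} then r powr (- 2) else 0) \<partial>lborel) = ennreal (2 / ?d)"
    using d nn_integral_powr_to_inf[of "- 2" "?d / 2"] by (simp add: powr_neg_one)
  also have "ennreal (4 * pi / 3) * ennreal (2 / ?d) = ennreal (8 * pi / 3) * ennreal (1 / ?d)"
    using d by (simp add: ennreal_mult[symmetric])
  finally show ?thesis .
qed

text \<open>Fubini's theorem writes the quadratic form of the kernel as an integral of products, which exhibits its positivity.\<close>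
lemma ball_kernel_form:
  assumes [measurable]: "a \<in> borel_measurable borel" "b \<in> borel_measurable borel"
  shows "(\<integral>\<^sup>+ x. \<integral>\<^sup>+ y. a x * b y * ball_kernel x y \<partial>lborel \<partial>lborel)
    = (\<integral>\<^sup>+ z. ball_weight (fst z) * ((\<integral>\<^sup>+ x. a x * ball_ind z x \<partial>lborel) * (\<integral>\<^sup>+ y. b y * ball_ind z y \<partial>lborel)) \<partial>lborel)"
proof -
  have m1[measurable]: "(\<lambda>(z, x). ball_ind z x) \<in> borel_measurable (lborel \<Otimes>\<^sub>M lborel)"
    by measurable
  have m2[measurable]: "(\<lambda>z. ball_weight (fst z)) \<in> borel_measurable (borel :: (real \<times> R3) measure)"
    by measurable
  have m3[measurable]: "(\<lambda>z. ball_ind z x) \<in> borel_measurable borel" for x by measurable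
  have m4[measurable]: "ball_ind z \<in> borel_measurable borel" for z by measurable
  have "(\<integral>\<^sup>+ x. \<integral>\<^sup>+ y. a x * b y * ball_kernel x y \<partial>lborel \<partial>lborel)
     = (\<integral>\<^sup>+ x. \<integral>\<^sup>+ y. \<integral>\<^sup>+ z. (ball_weight (fst z) * (a x * ball_ind z x)) * (b y * ball_ind z y) \<partial>lborel \<partial>lborel \<partial>lborel)"
  proof (intro nn_integral_cong)
    fix x y
    show "a x * b y * ball_kernel x y = (\<integral>\<^sup>+ z. (ball_weight (fst z) * (a x * ball_ind z x)) * (b y * ball_ind z y) \<partial>lborel)"
      unfolding ball_kernel_def by (subst nn_integral_cmult[symmetric]) (auto intro!: nn_integral_cong simp: mult_ac)
  qed
  also have "\<dots> = (\<integral>\<^sup>+ x. \<integral>\<^sup>+ z. \<integral>\<^sup>+ y. (ball_weight (fst z) * (a x * ball_ind z x)) * (b y * ball_ind z y) \<partial>lborel \<partial>lborel \<partial>lborel)"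
  proof (intro nn_integral_cong)
    fix x :: R3
    have [measurable]: "(\<lambda>(y, z). (ball_weight (fst z) * (a x * ball_ind z x)) * (b y * ball_ind z y)) \<in> borel_measurable (lborel \<Otimes>\<^sub>M lborel)"
      by measurable
    show "(\<integral>\<^sup>+ y. \<integral>\<^sup>+ z. (ball_weight (fst z) * (a x * ball_ind z x)) * (b y * ball_ind z y) \<partial>lborel \<partial>lborel)
       = (\<integral>\<^sup>+ z. \<integral>\<^sup>+ y. (ball_weight (fst z) * (a x * ball_ind z x)) * (b y * ball_ind z y) \<partial>lborel \<partial>lborel)"
      by (rule lborel_pair.Fubini'[symmetric]) measurable
  qed
  also have "\<dots> = (\<integral>\<^sup>+ x. \<integral>\<^sup>+ z. (ball_weight (fst z) * (a x * ball_ind z x)) * (\<integral>\<^sup>+ y. b y * ball_ind z y \<partial>lborel) \<partial>lborel \<partial>lborel)"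
    by (intro nn_integral_cong nn_integral_cmult) measurable
  also have "\<dots> = (\<integral>\<^sup>+ z. \<integral>\<^sup>+ x. (ball_weight (fst z) * (a x * ball_ind z x)) * (\<integral>\<^sup>+ y. b y * ball_ind z y \<partial>lborel) \<partial>lborel \<partial>lborel)"
  proof (rule lborel_pair.Fubini'[symmetric])
    have "(\<lambda>(z, y). b y * ball_ind z y) \<in> borel_measurable (lborel \<Otimes>\<^sub>M lborel)" by measurable
    then have [measurable]: "(\<lambda>z. \<integral>\<^sup>+ y. b y * ball_ind z y \<partial>lborel) \<in> borel_measurable borel"
      using lborel.borel_measurable_nn_integral[of "\<lambda>z y. b y * ball_ind z y" lborel] by simp
    show "(\<lambda>(x, z). (ball_weight (fst z) * (a x * ball_ind z x)) * (\<integral>\<^sup>+ y. b y * ball_ind z y \<partial>lborel)) \<in> borel_measurable (lborel \<Otimes>\<^sub>M lborel)"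
      by measurable
  qed
  also have "\<dots> = (\<integral>\<^sup>+ z. ball_weight (fst z) * ((\<integral>\<^sup>+ x. a x * ball_ind z x \<partial>lborel) * (\<integral>\<^sup>+ y. b y * ball_ind z y \<partial>lborel)) \<partial>lborel)"
  proof (intro nn_integral_cong)
    fix z :: "real \<times> R3"
    have "(\<integral>\<^sup>+ x. (ball_weight (fst z) * (a x * ball_ind z x)) * (\<integral>\<^sup>+ y. b y * ball_ind z y \<partial>lborel) \<partial>lborel)
       = (\<integral>\<^sup>+ x. ball_weight (fst z) * (a x * ball_ind z x) \<partial>lborel) * (\<integral>\<^sup>+ y. b y * ball_ind z y \<partial>lborel)"
      by (rule nn_integral_multc) measurable
    also have "(\<integral>\<^sup>+ x. ball_weight (fst z) * (a x * ball_ind z x) \<partial>lborel) = ball_weight (fst z) * (\<integral>\<^sup>+ x. a x * ball_ind z x \<partial>lborel)"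
      by (rule nn_integral_cmult) measurable
    finally show "(\<integral>\<^sup>+ x. (ball_weight (fst z) * (a x * ball_ind z x)) * (\<integral>\<^sup>+ y. b y * ball_ind z y \<partial>lborel) \<partial>lborel)
       = ball_weight (fst z) * ((\<integral>\<^sup>+ x. a x * ball_ind z x \<partial>lborel) * (\<integral>\<^sup>+ y. b y * ball_ind z y \<partial>lborel))"
      by (simp add: mult.assoc)
  qed
  finally show ?thesis .
qed

text \<open>A replacement for the Cauchy--Schwarz inequality of the Coulomb energy: for the form of the ball kernel, which is comparable,
\<open>s * t \<le> s * s + t * t\<close> can be applied under the integral over all balls.\<close>
lemma nn_coulomb_mixed:
  assumes [measurable]: "a \<in> borel_measurable borel" "b \<in> borel_measurable borel"
    and fa: "nn_coulomb a a < \<infinity>" and fb: "nn_coulomb b b < \<infinity>"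
  shows "nn_coulomb a b < \<infinity>"
proof -
  define Q where "Q f g = (\<integral>\<^sup>+ x. \<integral>\<^sup>+ y. f x * g y * ball_kernel x y \<partial>lborel \<partial>lborel)" for f g :: "R3 \<Rightarrow> ennreal"
  have up: "Q f f < \<infinity>" if [measurable]: "f \<in> borel_measurable borel" and "nn_coulomb f f < \<infinity>" for f
  proof -
    have "Q f f \<le> (\<integral>\<^sup>+ x. ennreal (8 * pi / 3) * (\<integral>\<^sup>+ y. f x * f y * ennreal (1 / norm (x - y)) \<partial>lborel) \<partial>lborel)"
      unfolding Q_def
    proof (rule nn_integral_mono)
      fix x :: R3
      have "(\<integral>\<^sup>+ y. f x * f y * ball_kernel x y \<partial>lborel) \<le> (\<integral>\<^sup>+ y. ennreal (8 * pi / 3) * (f x * f y * ennreal (1 / norm (x - y))) \<partial>lborel)"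
      proof (rule nn_integral_mono_AE)
        have "AE y in lborel. y \<noteq> x" by (rule AE_lborel_singleton)
        then show "AE y in lborel. f x * f y * ball_kernel x y \<le> ennreal (8 * pi / 3) * (f x * f y * ennreal (1 / norm (x - y)))"
        proof eventually_elim
          case (elim y)
          have "f x * f y * ball_kernel x y \<le> f x * f y * (ennreal (8 * pi / 3) * ennreal (1 / norm (x - y)))"
            using elim by (intro mult_left_mono ball_kernel_upper) auto
          then show ?case by (simp only: mult_ac)
        qed
      qed
      also have "\<dots> = ennreal (8 * pi / 3) * (\<integral>\<^sup>+ y. f x * f y * ennreal (1 / norm (x - y)) \<partial>lborel)"
        by (rule nn_integral_cmult) measurable
      finally show "(\<integral>\<^sup>+ y. f x * f y * ball_kernel x y \<partial>lborel) \<le> ennreal (8 * pi / 3) * (\<integral>\<^sup>+ y. f x * f y * ennreal (1 / norm (x - y)) \<partial>lborel)" .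
    qed
    also have "\<dots> = ennreal (8 * pi / 3) * nn_coulomb f f"
      unfolding nn_coulomb_def by (rule nn_integral_cmult) measurable
    also have "\<dots> < \<infinity>" using that(2) by (simp add: ennreal_mult_less_top)
    finally show ?thesis .
  qed
  have mT: "(\<lambda>z. ball_weight (fst z) * ((\<integral>\<^sup>+ x. f x * ball_ind z x \<partial>lborel) * (\<integral>\<^sup>+ y. f y * ball_ind z y \<partial>lborel))) \<in> borel_measurable (lborel :: (real \<times> R3) measure)"
    if [measurable]: "f \<in> borel_measurable borel" for f
  proof -
    have "(\<lambda>(z, y). f y * ball_ind z y) \<in> borel_measurable (lborel \<Otimes>\<^sub>M lborel)" by measurable
    then have [measurable]: "(\<lambda>z. \<integral>\<^sup>+ y. f y * ball_ind z y \<partial>lborel) \<in> borel_measurable borel"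
      using lborel.borel_measurable_nn_integral[of "\<lambda>z y. f y * ball_ind z y" lborel] by simp
    show ?thesis by measurable
  qed
  have "Q a b \<le> Q a a + Q b b"
  proof -
    have "Q a b \<le> (\<integral>\<^sup>+ z. ball_weight (fst z) * ((\<integral>\<^sup>+ x. a x * ball_ind z x \<partial>lborel) * (\<integral>\<^sup>+ y. a y * ball_ind z y \<partial>lborel))
       + ball_weight (fst z) * ((\<integral>\<^sup>+ x. b x * ball_ind z x \<partial>lborel) * (\<integral>\<^sup>+ y. b y * ball_ind z y \<partial>lborel)) \<partial>lborel)"
      unfolding Q_def ball_kernel_form[OF assms(1,2)]
    proof (intro nn_integral_mono)
      fix z :: "real \<times> R3"
      have "s * t \<le> s * s + t * t" for s t :: ennreal
      proof (cases "s \<le> t")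
        case True
        then have "s * t \<le> t * t" by (rule mult_right_mono) simp
        then show ?thesis by (simp add: add_increasing)
      next
        case False
        then have "s * t \<le> s * s" by (intro mult_left_mono) auto
        then show ?thesis by (simp add: add_increasing2)
      qed
      then show "ball_weight (fst z) * ((\<integral>\<^sup>+ x. a x * ball_ind z x \<partial>lborel) * (\<integral>\<^sup>+ y. b y * ball_ind z y \<partial>lborel))
        \<le> ball_weight (fst z) * ((\<integral>\<^sup>+ x. a x * ball_ind z x \<partial>lborel) * (\<integral>\<^sup>+ y. a y * ball_ind z y \<partial>lborel))
       + ball_weight (fst z) * ((\<integral>\<^sup>+ x. b x * ball_ind z x \<partial>lborel) * (\<integral>\<^sup>+ y. b y * ball_ind z y \<partial>lborel))"
        unfolding distrib_left[symmetric] by (intro mult_left_mono) auto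
    qed
    also have "\<dots> = Q a a + Q b b"
      unfolding Q_def ball_kernel_form[OF assms(1,1)] ball_kernel_form[OF assms(2,2)]
      by (rule nn_integral_add) (auto intro!: mT)
    finally show ?thesis .
  qed
  also have "\<dots> < \<infinity>" using up[OF assms(1) fa] up[OF assms(2) fb] by simp
  finally have Qab: "Q a b < \<infinity>" .
  have "ennreal (pi / 6) * nn_coulomb a b = (\<integral>\<^sup>+ x. ennreal (pi / 6) * (\<integral>\<^sup>+ y. a x * b y * ennreal (1 / norm (x - y)) \<partial>lborel) \<partial>lborel)"
    unfolding nn_coulomb_def by (rule nn_integral_cmult[symmetric]) measurable
  also have "\<dots> \<le> Q a b"
    unfolding Q_def
  proof (rule nn_integral_mono)
    fix x :: R3
    have "ennreal (pi / 6) * (\<integral>\<^sup>+ y. a x * b y * ennreal (1 / norm (x - y)) \<partial>lborel) = (\<integral>\<^sup>+ y. ennreal (pi / 6) * (a x * b y * ennreal (1 / norm (x - y))) \<partial>lborel)"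
      by (rule nn_integral_cmult[symmetric]) measurable
    also have "\<dots> \<le> (\<integral>\<^sup>+ y. a x * b y * ball_kernel x y \<partial>lborel)"
    proof (rule nn_integral_mono_AE)
      have "AE y in lborel. y \<noteq> x" by (rule AE_lborel_singleton)
      then show "AE y in lborel. ennreal (pi / 6) * (a x * b y * ennreal (1 / norm (x - y))) \<le> a x * b y * ball_kernel x y"
      proof eventually_elim
        case (elim y)
        have "a x * b y * (ennreal (pi / 6) * ennreal (1 / norm (x - y))) \<le> a x * b y * ball_kernel x y"
          using elim by (intro mult_left_mono ball_kernel_lower) auto
        then show ?case by (simp only: mult_ac)
      qed
    qed
    finally show "ennreal (pi / 6) * (\<integral>\<^sup>+ y. a x * b y * ennreal (1 / norm (x - y)) \<partial>lborel) \<le> (\<integral>\<^sup>+ y. a x * b y * ball_kernel x y \<partial>lborel)" .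
  qed
  finally have "ennreal (pi / 6) * nn_coulomb a b < \<infinity>" using Qab by (rule le_less_trans)
  then show ?thesis by (auto simp: ennreal_mult_less_top)
qed

lemma nn_coulomb_add:
  assumes [measurable]: "a \<in> borel_measurable borel" "b \<in> borel_measurable borel" "c \<in> borel_measurable borel"
  shows "nn_coulomb (\<lambda>x. a x + b x) c = nn_coulomb a c + nn_coulomb b c" "nn_coulomb c (\<lambda>x. a x + b x) = nn_coulomb c a + nn_coulomb c b"
  unfolding nn_coulomb_def by (simp_all add: distrib_left distrib_right nn_integral_add)

lemma nn_coulomb_square: "nn_coulomb (\<lambda>x. ennreal ((u x)\<^sup>2)) (\<lambda>x. ennreal ((u x)\<^sup>2)) = nn_self_energy u"
proof -
  have "ennreal ((u x)\<^sup>2) * ennreal ((u y)\<^sup>2) * ennreal (1 / norm (x - y)) = ennreal ((u x)\<^sup>2 * (u y)\<^sup>2 / norm (x - y))" for x y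
    by (simp add: ennreal_mult[symmetric])
  then show ?thesis by (simp add: nn_coulomb_def nn_self_energy_def)
qed

lemma nn_coulomb_sum_squares:
  assumes u: "u \<in> Er_space" and v: "v \<in> Er_space"
  shows "nn_coulomb (\<lambda>x. ennreal ((u x)\<^sup>2 + (v x)\<^sup>2)) (\<lambda>x. ennreal ((u x)\<^sup>2 + (v x)\<^sup>2)) < \<infinity>"
proof -
  note [measurable] = Er_spaceD(4)[OF u] Er_spaceD(4)[OF v]
  have f: "nn_self_energy u < \<infinity>" "nn_self_energy v < \<infinity>" using Er_spaceD(3)[OF u] Er_spaceD(3)[OF v] by auto
  let ?a = "\<lambda>x. ennreal ((u x)\<^sup>2)" and ?b = "\<lambda>x. ennreal ((v x)\<^sup>2)"
  have m: "nn_coulomb ?a ?b < \<infinity>" "nn_coulomb ?b ?a < \<infinity>"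
    by (rule nn_coulomb_mixed; use f in \<open>simp add: nn_coulomb_square\<close>)+
  have "nn_coulomb (\<lambda>x. ?a x + ?b x) (\<lambda>x. ?a x + ?b x) = (nn_coulomb ?a ?a + nn_coulomb ?b ?a) + (nn_coulomb ?a ?b + nn_coulomb ?b ?b)"
    by (simp add: nn_coulomb_add)
  also have "\<dots> < \<infinity>" using m f by (simp add: nn_coulomb_square)
  finally show ?thesis by (simp add: ennreal_plus)
qed

text \<open>One common majorant of finite self energy serves for both factors.\<close>
lemma coulomb_integrable:
  assumes [measurable]: "f1 \<in> borel_measurable borel" "f2 \<in> borel_measurable borel" "g \<in> borel_measurable borel"
    and b: "\<And>x. \<bar>f1 x\<bar> \<le> g x" "\<And>x. \<bar>f2 x\<bar> \<le> g x"
    and f: "nn_coulomb (\<lambda>x. ennreal (g x)) (\<lambda>x. ennreal (g x)) < \<infinity>"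
  shows "integrable (lborel \<Otimes>\<^sub>M lborel) (coulomb_integrand f1 f2)"
proof (rule integrableI_bounded)
  show m: "coulomb_integrand f1 f2 \<in> borel_measurable (lborel \<Otimes>\<^sub>M lborel)" by measurable
  have "(\<integral>\<^sup>+ z. ennreal (norm (coulomb_integrand f1 f2 z)) \<partial>(lborel \<Otimes>\<^sub>M lborel))
     = (\<integral>\<^sup>+ x. \<integral>\<^sup>+ y. ennreal (norm (coulomb_integrand f1 f2 (x, y))) \<partial>lborel \<partial>lborel)"
    by (rule lborel.nn_integral_fst[symmetric]) measurable
  also have "\<dots> \<le> nn_coulomb (\<lambda>x. ennreal (g x)) (\<lambda>x. ennreal (g x))"
    unfolding nn_coulomb_def
  proof (intro nn_integral_mono)
    fix x y
    have g: "g x \<ge> 0" "g y \<ge> 0" using b(1)[of x] b(1)[of y] by linarith+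
    have "\<bar>f1 x\<bar> * \<bar>f2 y\<bar> \<le> g x * g y" using b(1)[of x] b(2)[of y] g by (intro mult_mono) auto
    then have "\<bar>f1 x\<bar> * \<bar>f2 y\<bar> / norm (x - y) \<le> g x * g y / norm (x - y)" by (rule divide_right_mono) simp
    then show "ennreal (norm (coulomb_integrand f1 f2 (x, y))) \<le> ennreal (g x) * ennreal (g y) * ennreal (1 / norm (x - y))"
      using g by (simp add: coulomb_integrand_def abs_mult ennreal_mult[symmetric] ennreal_leI)
  qed
  finally show "(\<integral>\<^sup>+ z. ennreal (norm (coulomb_integrand f1 f2 z)) \<partial>(lborel \<Otimes>\<^sub>M lborel)) < \<infinity>"
    using f by (rule le_less_trans)
qed

lemma coulomb_commute:
  assumes "a \<in> borel_measurable borel" "b \<in> borel_measurable borel"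
  shows "coulomb a b = coulomb b a"
proof -
  have "integral\<^sup>L (lborel \<Otimes>\<^sub>M lborel) (\<lambda>(x, y). coulomb_integrand a b (y, x)) = integral\<^sup>L (lborel \<Otimes>\<^sub>M lborel) (coulomb_integrand a b)"
    by (rule lborel_pair.integral_product_swap) (use assms in measurable)
  moreover have "(\<lambda>(x, y). coulomb_integrand a b (y, x)) = coulomb_integrand b a"
    by (auto simp: coulomb_integrand_def fun_eq_iff norm_minus_commute mult.commute)
  ultimately show ?thesis by (simp add: coulomb_def)
qed

text \<open>Expanding \<open>(u + s * v)\<^sup>2\<close> in both variables gives nine Coulomb integrals, all of them finite by domination with \<open>u\<^sup>2 + v\<^sup>2\<close>. The
linear coefficient is the derivative that enters the equation.\<close>
lemma self_energy_line:
  assumes u: "u \<in> Er_space" and v: "v \<in> Er_space"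
  obtains R2 R3 R4 where "\<And>s. self_energy (\<lambda>x. u x + s * v x)
    = self_energy u + s * (4 * coulomb (\<lambda>x. (u x)\<^sup>2) (\<lambda>x. u x * v x)) + s\<^sup>2 * R2 + s ^ 3 * R3 + s ^ 4 * R4"
    "\<And>s. nn_self_energy (\<lambda>x. u x + s * v x) < \<infinity>"
proof -
  note [measurable] = Er_spaceD(4)[OF u] Er_spaceD(4)[OF v]
  let ?a = "\<lambda>x. (u x)\<^sup>2" and ?b = "\<lambda>x. 2 * (u x * v x)" and ?c = "\<lambda>x. (v x)\<^sup>2"
  let ?g = "\<lambda>x. (u x)\<^sup>2 + (v x)\<^sup>2"
  have bd: "\<bar>?a x\<bar> \<le> ?g x" "\<bar>?b x\<bar> \<le> ?g x" "\<bar>?c x\<bar> \<le> ?g x" for x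
  proof -
    have "0 \<le> (\<bar>u x\<bar> - \<bar>v x\<bar>)\<^sup>2" by simp
    then show "\<bar>?b x\<bar> \<le> ?g x" by (simp add: power2_diff abs_mult)
  qed auto
  have I: "integrable (lborel \<Otimes>\<^sub>M lborel) (coulomb_integrand f1 f2)"
    if "f1 \<in> {?a, ?b, ?c}" "f2 \<in> {?a, ?b, ?c}" for f1 f2
    by (rule coulomb_integrable[where g="?g"]) (use that bd nn_coulomb_sum_squares[OF u v] in auto)
  let ?D = "coulomb_integrand"
  have exp: "?D (\<lambda>x. (u x + s * v x)\<^sup>2) (\<lambda>x. (u x + s * v x)\<^sup>2) z
     = ?D ?a ?a z + s * (?D ?a ?b z + ?D ?b ?a z) + s\<^sup>2 * (?D ?a ?c z + ?D ?b ?b z + ?D ?c ?a z)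
       + s ^ 3 * (?D ?b ?c z + ?D ?c ?b z) + s ^ 4 * ?D ?c ?c z" for s z
  proof -
    obtain x y where z: "z = (x, y)" by (cases z)
    show ?thesis
      unfolding z coulomb_integrand_def prod.case divide_inverse by algebra
  qed
  have int: "integrable (lborel \<Otimes>\<^sub>M lborel) (\<lambda>z. ?D ?a ?a z + s * (?D ?a ?b z + ?D ?b ?a z) + s\<^sup>2 * (?D ?a ?c z + ?D ?b ?b z + ?D ?c ?a z)
       + s ^ 3 * (?D ?b ?c z + ?D ?c ?b z) + s ^ 4 * ?D ?c ?c z)" for s
    by (intro Bochner_Integration.integrable_add integrable_mult_right I) auto
  have N: "self_energy (\<lambda>x. u x + s * v x) = self_energy u + s * (coulomb ?a ?b + coulomb ?b ?a) + s\<^sup>2 * (coulomb ?a ?c + coulomb ?b ?b + coulomb ?c ?a)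
     + s ^ 3 * (coulomb ?b ?c + coulomb ?c ?b) + s ^ 4 * coulomb ?c ?c" for s
  proof -
    have "self_energy (\<lambda>x. u x + s * v x) = integral\<^sup>L (lborel \<Otimes>\<^sub>M lborel) (\<lambda>z. ?D ?a ?a z + s * (?D ?a ?b z + ?D ?b ?a z) + s\<^sup>2 * (?D ?a ?c z + ?D ?b ?b z + ?D ?c ?a z)
       + s ^ 3 * (?D ?b ?c z + ?D ?c ?b z) + s ^ 4 * ?D ?c ?c z)"
      unfolding self_energy_def coulomb_def by (rule Bochner_Integration.integral_cong[OF refl]) (rule exp)
    also have "\<dots> = coulomb ?a ?a + s * (coulomb ?a ?b + coulomb ?b ?a) + s\<^sup>2 * (coulomb ?a ?c + coulomb ?b ?b + coulomb ?c ?a)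
     + s ^ 3 * (coulomb ?b ?c + coulomb ?c ?b) + s ^ 4 * coulomb ?c ?c"
      unfolding coulomb_def by (simp add: I)
    finally show ?thesis by (simp add: self_energy_def)
  qed
  have D: "coulomb ?a ?b + coulomb ?b ?a = 4 * coulomb ?a (\<lambda>x. u x * v x)"
  proof -
    have "coulomb ?a ?b = integral\<^sup>L (lborel \<Otimes>\<^sub>M lborel) (\<lambda>z. 2 * ?D ?a (\<lambda>x. u x * v x) z)"
      unfolding coulomb_def by (intro Bochner_Integration.integral_cong) (auto simp: coulomb_integrand_def)
    also have "\<dots> = 2 * coulomb ?a (\<lambda>x. u x * v x)" unfolding coulomb_def by simp
    finally have "coulomb ?a ?b = 2 * coulomb ?a (\<lambda>x. u x * v x)" .
    moreover have "coulomb ?b ?a = coulomb ?a ?b" by (rule coulomb_commute) measurable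
    ultimately show ?thesis by simp
  qed
  have F: "nn_self_energy (\<lambda>x. u x + s * v x) < \<infinity>" for s
  proof -
    have "integrable (lborel \<Otimes>\<^sub>M lborel) (?D (\<lambda>x. (u x + s * v x)\<^sup>2) (\<lambda>x. (u x + s * v x)\<^sup>2))"
      using int[of s] unfolding exp[symmetric] .
    then show ?thesis by (subst (asm) coulomb_self_integrable_iff) auto
  qed
  show ?thesis by (rule that[OF N[unfolded D] F])
qed


subsection \<open>Stability of the radial space\<close>

lemma Er_spaceI: "u \<in> D12 \<Longrightarrow> radial u \<Longrightarrow> nn_self_energy u < \<infinity> \<Longrightarrow> u \<in> Er_space"
  by (simp add: Er_space_def E_space_iff)

lemma nn_self_energy_cong_AE:
  assumes "AE x in lborel. u x = u' x"
  shows "nn_self_energy u = nn_self_energy u'"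
  unfolding nn_self_energy_def
proof (rule nn_integral_cong_AE, use assms in eventually_elim)
  fix x assume x: "u x = u' x"
  show "(\<integral>\<^sup>+ y. ennreal ((u x)\<^sup>2 * (u y)\<^sup>2 / norm (x - y)) \<partial>lborel) = (\<integral>\<^sup>+ y. ennreal ((u' x)\<^sup>2 * (u' y)\<^sup>2 / norm (x - y)) \<partial>lborel)"
    by (rule nn_integral_cong_AE, use assms in eventually_elim) (simp add: x)
qed

lemma self_energy_eqI:
  assumes "u \<in> Er_space" "u' \<in> Er_space" "nn_self_energy u = nn_self_energy u'"
  shows "self_energy u = self_energy u'"
  using assms Er_spaceD(3)[OF assms(1)] Er_spaceD(3)[OF assms(2)] self_energy_nonneg[of u] self_energy_nonneg[of u'] by simp

lemma Er_cong_AE: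
  assumes u: "u \<in> Er_space" and [measurable]: "u' \<in> borel_measurable borel" and ae: "AE x in lborel. u x = u' x"
  shows "u' \<in> Er_space" "dirichlet u' = dirichlet u" "self_energy u' = self_energy u"
proof -
  note [measurable] = Er_spaceD(4)[OF u]
  note g = D12_grad[OF Er_spaceD(1)[OF u]]
  have w: "weak_gradient u' (grad u)" by (rule weak_gradient_cong_AE[OF g(1) assms(2) ae])
  have "integrable lborel (\<lambda>x. \<bar>u' x\<bar> ^ 6)"
    by (rule Bochner_Integration.integrable_cong_AE_imp[OF D12_pow6[OF Er_spaceD(1)[OF u]]]) (use ae in auto)
  then have "u' \<in> D12" using w g(2) by (auto simp: D12_def)
  moreover have "radial u'"
  proof -
    obtain \<rho> where "\<rho> \<in> borel_measurable borel" "AE x in lborel. u x = \<rho> (norm x)"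
      using Er_spaceD(2)[OF u] by (auto simp: radial_def)
    moreover from this(2) ae have "AE x in lborel. u' x = \<rho> (norm x)" by eventually_elim simp
    ultimately show ?thesis unfolding radial_def by blast
  qed
  ultimately show E: "u' \<in> Er_space" using Er_spaceD(3)[OF u] nn_self_energy_cong_AE[OF ae] by (intro Er_spaceI) auto
  show "dirichlet u' = dirichlet u" using dirichlet_eq(1)[OF w] by (simp add: dirichlet_def)
  show "self_energy u' = self_energy u" by (rule self_energy_eqI[OF E u]) (simp add: nn_self_energy_cong_AE[OF ae])
qed

lemma Er_grad_inner_integrable:
  assumes u: "u \<in> Er_space" and v: "v \<in> Er_space"
  shows "integrable lborel (\<lambda>x. grad u x \<bullet> grad v x)"
proof -
  note g = D12_grad[OF Er_spaceD(1)[OF u]] D12_grad[OF Er_spaceD(1)[OF v]]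
  note [measurable] = weak_gradient_measurable[OF g(1)] weak_gradient_measurable[OF g(3)]
  have i: "integrable lborel (\<lambda>x. (norm (grad u x))\<^sup>2 + (norm (grad v x))\<^sup>2)"
    using g(2,4) by (rule Bochner_Integration.integrable_add)
  show ?thesis
  proof (rule Bochner_Integration.integrable_bound[OF i])
    have "\<bar>grad u x \<bullet> grad v x\<bar> \<le> (norm (grad u x))\<^sup>2 + (norm (grad v x))\<^sup>2" for x
    proof -
      have "\<bar>grad u x \<bullet> grad v x\<bar> \<le> norm (grad u x) * norm (grad v x)" by (rule Cauchy_Schwarz_ineq2)
      moreover have "2 * (norm (grad u x) * norm (grad v x)) \<le> (norm (grad u x))\<^sup>2 + (norm (grad v x))\<^sup>2"
        using zero_le_power2[of "norm (grad u x) - norm (grad v x)"] unfolding power2_diff by linarith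
      moreover have "0 \<le> norm (grad u x) * norm (grad v x)" by simp
      ultimately show ?thesis by linarith
    qed
    then show "AE x in lborel. norm (grad u x \<bullet> grad v x) \<le> norm ((norm (grad u x))\<^sup>2 + (norm (grad v x))\<^sup>2)"
      by simp
  qed measurable
qed

lemma Er_line:
  assumes u: "u \<in> Er_space" and v: "v \<in> Er_space"
  shows "(\<lambda>x. u x + s * v x) \<in> Er_space"
    "dirichlet (\<lambda>x. u x + s * v x) = dirichlet u + 2 * s * (LINT x|lborel. grad u x \<bullet> grad v x) + s\<^sup>2 * dirichlet v"
    "AE x in lborel. grad (\<lambda>x. u x + s * v x) x = grad u x + s *\<^sub>R grad v x"
proof -
  note g = D12_grad[OF Er_spaceD(1)[OF u]] D12_grad[OF Er_spaceD(1)[OF v]]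
  note [measurable] = weak_gradient_measurable[OF g(1)] weak_gradient_measurable[OF g(3)] Er_spaceD(4)[OF u] Er_spaceD(4)[OF v]
  have w: "weak_gradient (\<lambda>x. u x + s * v x) (\<lambda>x. grad u x + s *\<^sub>R grad v x)"
    by (rule weak_gradient_linear[OF g(1,3)])
  have sq: "(norm (grad u x + s *\<^sub>R grad v x))\<^sup>2 = (norm (grad u x))\<^sup>2 + (2 * s) * (grad u x \<bullet> grad v x) + s\<^sup>2 * (norm (grad v x))\<^sup>2" for x
    unfolding power2_norm_eq_inner by (simp add: inner_simps inner_commute power2_eq_square[of s] algebra_simps)
  have i: "integrable lborel (\<lambda>x. (norm (grad u x + s *\<^sub>R grad v x))\<^sup>2)"
    unfolding sq using g(2,4) Er_grad_inner_integrable[OF u v] by simp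
  show "AE x in lborel. grad (\<lambda>x. u x + s * v x) x = grad u x + s *\<^sub>R grad v x"
    by (rule grad_AE_eq[OF w])
  have "dirichlet (\<lambda>x. u x + s * v x) = (LINT x|lborel. (norm (grad u x + s *\<^sub>R grad v x))\<^sup>2)"
    by (rule dirichlet_eq(1)[OF w])
  also have "\<dots> = dirichlet u + 2 * s * (LINT x|lborel. grad u x \<bullet> grad v x) + s\<^sup>2 * dirichlet v"
    unfolding sq dirichlet_def using g(2,4) Er_grad_inner_integrable[OF u v] by simp
  finally show "dirichlet (\<lambda>x. u x + s * v x) = dirichlet u + 2 * s * (LINT x|lborel. grad u x \<bullet> grad v x) + s\<^sup>2 * dirichlet v" .
  have i6: "integrable lborel (\<lambda>x. 64 * \<bar>u x\<bar> ^ 6 + 64 * \<bar>s\<bar> ^ 6 * \<bar>v x\<bar> ^ 6)"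
    using D12_pow6[OF Er_spaceD(1)[OF u]] D12_pow6[OF Er_spaceD(1)[OF v]] by simp
  have "integrable lborel (\<lambda>x. \<bar>u x + s * v x\<bar> ^ 6)"
  proof (rule Bochner_Integration.integrable_bound[OF i6])
    have "\<bar>u x + s * v x\<bar> ^ 6 \<le> 64 * \<bar>u x\<bar> ^ 6 + 64 * \<bar>s\<bar> ^ 6 * \<bar>v x\<bar> ^ 6" for x
    proof -
      let ?m = "max \<bar>u x\<bar> \<bar>s * v x\<bar>"
      have "\<bar>u x + s * v x\<bar> \<le> 2 * ?m" using abs_triangle_ineq[of "u x" "s * v x"] by linarith
      then have "\<bar>u x + s * v x\<bar> ^ 6 \<le> (2 * ?m) ^ 6" by (intro power_mono) auto
      also have "\<dots> = 64 * ?m ^ 6" by (simp add: power_mult_distrib)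
      also have "?m ^ 6 \<le> \<bar>u x\<bar> ^ 6 + \<bar>s * v x\<bar> ^ 6" by (cases "\<bar>u x\<bar> \<le> \<bar>s * v x\<bar>") (auto simp: max_def)
      finally show ?thesis by (simp add: abs_mult power_mult_distrib)
    qed
    then show "AE x in lborel. norm (\<bar>u x + s * v x\<bar> ^ 6) \<le> norm (64 * \<bar>u x\<bar> ^ 6 + 64 * \<bar>s\<bar> ^ 6 * \<bar>v x\<bar> ^ 6)" by simp
  qed measurable
  then have d: "(\<lambda>x. u x + s * v x) \<in> D12" using w i by (auto simp: D12_def)
  have "radial (\<lambda>x. u x + s * v x)"
  proof -
    obtain \<rho> \<sigma> where r: "\<rho> \<in> borel_measurable borel" "AE x in lborel. u x = \<rho> (norm x)"
      "\<sigma> \<in> borel_measurable borel" "AE x in lborel. v x = \<sigma> (norm x)"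
      using Er_spaceD(2)[OF u] Er_spaceD(2)[OF v] by (auto simp: radial_def)
    note [measurable] = r(1,3)
    have "AE x in lborel. u x + s * v x = \<rho> (norm x) + s * \<sigma> (norm x)" using r(2,4) by eventually_elim simp
    moreover have "(\<lambda>r. \<rho> r + s * \<sigma> r) \<in> borel_measurable borel" by measurable
    ultimately show ?thesis unfolding radial_def by (intro bexI[of _ "\<lambda>r. \<rho> r + s * \<sigma> r"])
  qed
  moreover obtain R2 R3 R4 where "nn_self_energy (\<lambda>x. u x + s * v x) < \<infinity>" using self_energy_line[OF u v] by metis
  ultimately show "(\<lambda>x. u x + s * v x) \<in> Er_space" using d by (intro Er_spaceI)
qed

lemma Er_abs:
  assumes u: "u \<in> Er_space"
  shows "(\<lambda>x. \<bar>u x\<bar>) \<in> Er_space" "dirichlet (\<lambda>x. \<bar>u x\<bar>) \<le> dirichlet u" "self_energy (\<lambda>x. \<bar>u x\<bar>) = self_energy u"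
proof -
  have N: "nn_self_energy (\<lambda>x. \<bar>u x\<bar>) = nn_self_energy u" by (simp add: nn_self_energy_def)
  have "radial (\<lambda>x. \<bar>u x\<bar>)"
  proof -
    obtain \<rho> where r: "\<rho> \<in> borel_measurable borel" "AE x in lborel. u x = \<rho> (norm x)"
      using Er_spaceD(2)[OF u] by (auto simp: radial_def)
    note [measurable] = r(1)
    have "AE x in lborel. \<bar>u x\<bar> = \<bar>\<rho> (norm x)\<bar>" using r(2) by eventually_elim simp
    moreover have "(\<lambda>r. \<bar>\<rho> r\<bar>) \<in> borel_measurable borel" by measurable
    ultimately show ?thesis unfolding radial_def by (intro bexI[of _ "\<lambda>r. \<bar>\<rho> r\<bar>"])
  qed
  then show E: "(\<lambda>x. \<bar>u x\<bar>) \<in> Er_space"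
    using D12_abs(1)[OF Er_spaceD(1)[OF u]] Er_spaceD(3)[OF u] N by (intro Er_spaceI) auto
  show "dirichlet (\<lambda>x. \<bar>u x\<bar>) \<le> dirichlet u" by (rule D12_abs(2)[OF Er_spaceD(1)[OF u]])
  show "self_energy (\<lambda>x. \<bar>u x\<bar>) = self_energy u" by (rule self_energy_eqI[OF E u N])
qed

text \<open>The powers follow from the change of variables; two squares and the kernel give \<open>t powr (8 + 1 - 6)\<close> in the Coulomb energy.\<close>
lemma Er_scale:
  assumes u: "u \<in> Er_space" and t: "t > 0"
  shows "(\<lambda>x. t\<^sup>2 * u (t *\<^sub>R x)) \<in> Er_space"
    "dirichlet (\<lambda>x. t\<^sup>2 * u (t *\<^sub>R x)) \<le> t ^ 3 * dirichlet u"
    "self_energy (\<lambda>x. t\<^sup>2 * u (t *\<^sub>R x)) = t ^ 3 * self_energy u"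
    "(LINT x|lborel. \<bar>t\<^sup>2 * u (t *\<^sub>R x)\<bar> powr q) = t powr (2 * q - 3) * (LINT x|lborel. \<bar>u x\<bar> powr q)"
proof -
  let ?v = "\<lambda>x. t\<^sup>2 * u (t *\<^sub>R x)"
  note [measurable] = Er_spaceD(4)[OF u]
  have N: "nn_self_energy ?v = ennreal (t ^ 3) * nn_self_energy u"
  proof -
    let ?f = "\<lambda>x y. ennreal ((u x)\<^sup>2 * (u y)\<^sup>2 / norm (x - y))"
    have inner: "(\<integral>\<^sup>+ y. ?f (t *\<^sub>R x) (t *\<^sub>R y) \<partial>lborel) = ennreal (1 / t ^ 3) * (\<integral>\<^sup>+ y. ?f (t *\<^sub>R x) y \<partial>lborel)" for x
      using nn_integral_scale[of "\<lambda>y. ?f (t *\<^sub>R x) y" t] t by simp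
    have "nn_self_energy ?v = (\<integral>\<^sup>+ x. \<integral>\<^sup>+ y. ennreal (t ^ 9) * ?f (t *\<^sub>R x) (t *\<^sub>R y) \<partial>lborel \<partial>lborel)"
      unfolding nn_self_energy_def
    proof (intro nn_integral_cong)
      fix x y :: R3
      have n: "norm (t *\<^sub>R x - t *\<^sub>R y) = t * norm (x - y)"
        using t by (simp add: scaleR_diff_right[symmetric])
      have "(t\<^sup>2 * u (t *\<^sub>R x))\<^sup>2 * (t\<^sup>2 * u (t *\<^sub>R y))\<^sup>2 / norm (x - y)
         = t ^ 9 * ((u (t *\<^sub>R x))\<^sup>2 * (u (t *\<^sub>R y))\<^sup>2 / (t * norm (x - y)))"
        using t by (simp add: power_mult_distrib power2_eq_square eval_nat_numeral)
      then show "ennreal ((t\<^sup>2 * u (t *\<^sub>R x))\<^sup>2 * (t\<^sup>2 * u (t *\<^sub>R y))\<^sup>2 / norm (x - y)) = ennreal (t ^ 9) * ?f (t *\<^sub>R x) (t *\<^sub>R y)"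
        using t by (simp add: n ennreal_mult[symmetric])
    qed
    also have "\<dots> = (\<integral>\<^sup>+ x. ennreal (t ^ 9) * (ennreal (1 / t ^ 3) * (\<integral>\<^sup>+ y. ?f (t *\<^sub>R x) y \<partial>lborel)) \<partial>lborel)"
    proof (intro nn_integral_cong)
      fix x :: R3
      have "(\<integral>\<^sup>+ y. ennreal (t ^ 9) * ?f (t *\<^sub>R x) (t *\<^sub>R y) \<partial>lborel) = ennreal (t ^ 9) * (\<integral>\<^sup>+ y. ?f (t *\<^sub>R x) (t *\<^sub>R y) \<partial>lborel)"
        by (rule nn_integral_cmult) measurable
      then show "(\<integral>\<^sup>+ y. ennreal (t ^ 9) * ?f (t *\<^sub>R x) (t *\<^sub>R y) \<partial>lborel) = ennreal (t ^ 9) * (ennreal (1 / t ^ 3) * (\<integral>\<^sup>+ y. ?f (t *\<^sub>R x) y \<partial>lborel))"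
        unfolding inner .
    qed
    also have "\<dots> = (ennreal (t ^ 9) * ennreal (1 / t ^ 3)) * (\<integral>\<^sup>+ x. (\<integral>\<^sup>+ y. ?f (t *\<^sub>R x) y \<partial>lborel) \<partial>lborel)"
      unfolding mult.assoc[symmetric] by (rule nn_integral_cmult) measurable
    also have "(\<integral>\<^sup>+ x. (\<integral>\<^sup>+ y. ?f (t *\<^sub>R x) y \<partial>lborel) \<partial>lborel) = ennreal (1 / t ^ 3) * nn_self_energy u"
      unfolding nn_self_energy_def using nn_integral_scale[of "\<lambda>x. \<integral>\<^sup>+ y. ?f x y \<partial>lborel" t] t by simp
    also have "(ennreal (t ^ 9) * ennreal (1 / t ^ 3)) * (ennreal (1 / t ^ 3) * nn_self_energy u) = (ennreal (t ^ 9) * ennreal (1 / t ^ 3) * ennreal (1 / t ^ 3)) * nn_self_energy u"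
      by (simp only: mult.assoc)
    also have "ennreal (t ^ 9) * ennreal (1 / t ^ 3) * ennreal (1 / t ^ 3) = ennreal (t ^ 3)"
      using t by (simp add: ennreal_mult[symmetric] power_add[symmetric] field_simps)
    finally show ?thesis .
  qed
  have "c\<^sup>2 / t = t ^ 3" if "c = t\<^sup>2" for c using t that by (simp add: power2_eq_square power3_eq_cube)
  then show "dirichlet ?v \<le> t ^ 3 * dirichlet u"
    using D12_scale(2)[OF Er_spaceD(1)[OF u] t, of "t\<^sup>2"] by simp
  have "radial ?v"
  proof -
    obtain \<rho> where r: "\<rho> \<in> borel_measurable borel" "AE x in lborel. u x = \<rho> (norm x)"
      using Er_spaceD(2)[OF u] by (auto simp: radial_def)
    note [measurable] = r(1)
    have "AE x in distr lborel borel (\<lambda>x. t *\<^sub>R x). u x = \<rho> (norm x)"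
    proof -
      have "absolutely_continuous lborel (distr lborel borel (\<lambda>x::R3. t *\<^sub>R x))"
        unfolding absolutely_continuous_def
      proof
        fix S :: "R3 set" assume S: "S \<in> null_sets lborel"
        then have [measurable]: "S \<in> sets borel" by auto
        have "emeasure (distr lborel borel (\<lambda>x::R3. t *\<^sub>R x)) S = (\<integral>\<^sup>+ x. indicator S x \<partial>distr lborel borel (\<lambda>x::R3. t *\<^sub>R x))"
          by simp
        also have "\<dots> = (\<integral>\<^sup>+ x. indicator S (t *\<^sub>R x) \<partial>lborel)" by (rule nn_integral_distr) auto
        also have "\<dots> = ennreal (1 / t ^ DIM(R3)) * (\<integral>\<^sup>+ x. indicator S x \<partial>lborel)"
          by (rule nn_integral_scale[OF _ t]) measurable
        also have "\<dots> = 0" using S by (auto simp: null_sets_def)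
        finally show "S \<in> null_sets (distr lborel borel (\<lambda>x::R3. t *\<^sub>R x))" by (auto intro!: null_setsI)
      qed
      from absolutely_continuous_AE[OF _ this r(2)] show ?thesis by simp
    qed
    then have "AE x in lborel. u (t *\<^sub>R x) = \<rho> (norm (t *\<^sub>R x))"
      by (subst (asm) AE_distr_iff) auto
    then have "AE x in lborel. ?v x = t\<^sup>2 * \<rho> (t * norm x)" by eventually_elim (use t in simp)
    moreover have "(\<lambda>r. t\<^sup>2 * \<rho> (t * r)) \<in> borel_measurable borel" by measurable
    ultimately show ?thesis unfolding radial_def by (intro bexI[of _ "\<lambda>r. t\<^sup>2 * \<rho> (t * r)"])
  qed
  then show E: "?v \<in> Er_space"
    using D12_scale(1)[OF Er_spaceD(1)[OF u] t] N Er_spaceD(3)[OF u] by (intro Er_spaceI) (auto simp: ennreal_mult_less_top)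
  show "self_energy ?v = t ^ 3 * self_energy u"
  proof -
    have "ennreal (self_energy ?v) = ennreal (t ^ 3 * self_energy u)"
      using N t self_energy_nonneg[of u] unfolding Er_spaceD(3)[OF E] Er_spaceD(3)[OF u] by (simp add: ennreal_mult)
    then show ?thesis using self_energy_nonneg[of ?v] self_energy_nonneg[of u] t by (subst (asm) ennreal_inj) auto
  qed
  have "(LINT x|lborel. \<bar>t\<^sup>2 * u (t *\<^sub>R x)\<bar> powr q) = (LINT x|lborel. t powr (2 * q) * (\<bar>u (t *\<^sub>R x)\<bar> powr q))"
  proof (rule Bochner_Integration.integral_cong[OF refl])
    fix x
    have "t\<^sup>2 = t powr 2" using t by (simp add: powr_numeral)
    then have "(t\<^sup>2) powr q = t powr (2 * q)" by (simp add: powr_powr)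
    then show "\<bar>t\<^sup>2 * u (t *\<^sub>R x)\<bar> powr q = t powr (2 * q) * (\<bar>u (t *\<^sub>R x)\<bar> powr q)"
      using t by (simp add: abs_mult powr_mult)
  qed
  also have "\<dots> = t powr (2 * q) * (LINT x|lborel. \<bar>u (t *\<^sub>R x)\<bar> powr q)" by simp
  also have "(LINT x|lborel. \<bar>u (t *\<^sub>R x)\<bar> powr q) = (LINT x|lborel. \<bar>u x\<bar> powr q) / t ^ 3"
    using integral_scale[of "\<lambda>x. \<bar>u x\<bar> powr q" t] t by simp
  also have "t powr (2 * q) * ((LINT x|lborel. \<bar>u x\<bar> powr q) / t ^ 3) = (t powr (2 * q) / t powr 3) * (LINT x|lborel. \<bar>u x\<bar> powr q)"
    using t by (simp add: powr_numeral)
  also have "t powr (2 * q) / t powr 3 = t powr (2 * q - 3)" by (rule powr_diff[symmetric])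
  finally show "(LINT x|lborel. \<bar>t\<^sup>2 * u (t *\<^sub>R x)\<bar> powr q) = t powr (2 * q - 3) * (LINT x|lborel. \<bar>u x\<bar> powr q)" .
qed

subsection \<open>Compactness\<close>

text \<open>A diagonal subsequence makes \<open>\<bar>profile\<bar>\<close> converge at all rational radii, and \<open>Er_profile_diff\<close> extends this to all positive radii by equicontinuity.
Absolute values are used because the limit is to be nonnegative; \<open>w n\<close> is the representative of \<open>\<bar>u (k n)\<bar>\<close> given by the profile, so that
bounds and convergence hold at every point.\<close>
lemma Er_compactness:
  assumes u: "\<And>n. u n \<in> Er_space" and B: "\<And>n. dirichlet (u n) \<le> B" "\<And>n. self_energy (u n) \<le> B" "B \<ge> 1"
  obtains k w v A N where "strict_mono (k :: nat \<Rightarrow> nat)"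
    "\<And>n. w n \<in> Er_space" "\<And>n. dirichlet (w n) \<le> B" "\<And>n. self_energy (w n) \<le> B" "\<And>n. AE x in lborel. w n x = \<bar>u (k n) x\<bar>"
    "\<And>n x. \<bar>w n x\<bar> \<le> sqrt B * norm x powr (- 1/2)"
    "v \<in> Er_space" "\<And>x. 0 \<le> v x" "\<And>x. (\<lambda>n. w n x) \<longlonglongrightarrow> v x"
    "(\<lambda>n. dirichlet (u (k n))) \<longlonglongrightarrow> A" "dirichlet v \<le> A"
    "(\<lambda>n. self_energy (u (k n))) \<longlonglongrightarrow> N" "self_energy v \<le> N"
proof -
  have B0: "B > 0" using B(3) by simp
  have sB: "sqrt B \<le> B" using B(3) B0 real_le_lsqrt[of B B] by (simp add: power2_eq_square)
  \<comment> \<open>The two energies are stored at the fictitious radii \<open>-1\<close> and \<open>-2\<close>, so that one diagonal argument treats them together with the values of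
the profile. The factor \<open>sqrt r\<close> makes the bound independent of \<open>r\<close>.\<close>
  define h where "h n r = (if r > 0 then sqrt r * \<bar>profile (grad (u n)) r\<bar> else if r = - 1 then dirichlet (u n) else self_energy (u n))" for n r
  define S where "S = (\<rat> \<inter> {0<..}) \<union> {- 1, - 2 :: real}"
  have cS: "countable S" unfolding S_def using countable_rat by (auto intro: countable_Int1)
  have hb: "norm (h n r) \<le> B" for n r
  proof (cases "r > 0")
    case True
    have "\<bar>profile (grad (u n)) r\<bar> \<le> sqrt B * r powr (- 1/2)" by (rule Er_bounds(1)[OF u B True])
    then have "sqrt r * \<bar>profile (grad (u n)) r\<bar> \<le> sqrt r * (sqrt B * r powr (- 1/2))" using True by (intro mult_left_mono) auto
    also have "\<dots> = sqrt B * (r powr (1/2) * r powr (- 1/2))" using True by (simp add: powr_half_sqrt)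
    also have "r powr (1/2) * r powr (- 1/2) = 1" using True by (simp add: powr_add[symmetric])
    finally show ?thesis using True sB by (simp add: h_def abs_mult)
  next
    case False
    then show ?thesis using B(1)[of n] B(2)[of n] dirichlet_nonneg[of "u n"] self_energy_nonneg[of "u n"] by (simp add: h_def)
  qed
  obtain k where k: "strict_mono (k :: nat \<Rightarrow> nat)" "\<And>r. r \<in> S \<Longrightarrow> \<exists>l. (\<lambda>n. h (k n) r) \<longlonglongrightarrow> l"
    using function_convergent_subsequence[OF cS, of h B] hb by blast
  obtain A where A: "(\<lambda>n. dirichlet (u (k n))) \<longlonglongrightarrow> A"
    using k(2)[of "- 1"] by (auto simp: S_def h_def)
  obtain N where N: "(\<lambda>n. self_energy (u (k n))) \<longlonglongrightarrow> N"
    using k(2)[of "- 2"] by (auto simp: S_def h_def)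
  define P where "P n r = \<bar>profile (grad (u (k n))) r\<bar>" for n r
  have Prat: "convergent (\<lambda>n. P n r)" if r: "r > 0" "r \<in> \<rat>" for r
  proof -
    obtain l where "(\<lambda>n. h (k n) r) \<longlonglongrightarrow> l" using k(2)[of r] r by (auto simp: S_def)
    then have "(\<lambda>n. sqrt r * P n r) \<longlonglongrightarrow> l" using r by (simp add: h_def P_def)
    from tendsto_divide[OF this tendsto_const[of "sqrt r"]] r have "(\<lambda>n. P n r) \<longlonglongrightarrow> l / sqrt r" by simp
    then show ?thesis by (auto simp: convergent_def)
  qed
  have Pdiff: "\<bar>P n r - P n s\<bar> \<le> sqrt (B * ((s - r) / r\<^sup>2))" if r: "0 < r" "r \<le> s" for n r s
  proof -
    have "\<bar>P n r - P n s\<bar> \<le> \<bar>profile (grad (u (k n))) r - profile (grad (u (k n))) s\<bar>" unfolding P_def by linarith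
    moreover have "(profile (grad (u (k n))) r - profile (grad (u (k n))) s)\<^sup>2 \<le> B * ((s - r) / r\<^sup>2)"
    proof -
      have "(profile (grad (u (k n))) r - profile (grad (u (k n))) s)\<^sup>2 \<le> dirichlet (u (k n)) / (4 * pi) * (1 / r - 1 / s)"
        by (rule Er_profile_diff[OF u r])
      also have "\<dots> \<le> B / 1 * ((s - r) / r\<^sup>2)"
      proof (rule mult_mono)
        show "dirichlet (u (k n)) / (4 * pi) \<le> B / 1"
          using B(1)[of "k n"] B0 pi_ge_two dirichlet_nonneg[of "u (k n)"] by (intro frac_le) auto
        have "1 / r - 1 / s = (s - r) / (r * s)" using r by (simp add: field_simps)
        also have "\<dots> \<le> (s - r) / (r * r)" using r by (intro divide_left_mono mult_left_mono mult_pos_pos) auto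
        finally show "1 / r - 1 / s \<le> (s - r) / r\<^sup>2" by (simp add: power2_eq_square)
        show "0 \<le> 1 / r - 1 / s" using r by (simp add: frac_le)
      qed (use B0 in auto)
      finally show ?thesis by simp
    qed
    then have "\<bar>profile (grad (u (k n))) r - profile (grad (u (k n))) s\<bar> \<le> sqrt (B * ((s - r) / r\<^sup>2))"
      by (rule real_le_rsqrt[of "\<bar>_\<bar>", unfolded power2_abs])
    ultimately show ?thesis by linarith
  qed
  have Pconv: "convergent (\<lambda>n. P n r)" if r: "r > 0" for r
  proof (rule Cauchy_convergent, rule CauchyI)
    fix e :: real assume e: "e > 0"
    have "\<exists>s\<in>\<rat>. r < s \<and> s < r + r\<^sup>2 * (e/3)\<^sup>2 / B"
      by (rule Rats_dense_in_real) (use r e B0 in simp)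
    then obtain s where s: "s \<in> \<rat>" "r < s" "s < r + r\<^sup>2 * (e/3)\<^sup>2 / B" by blast
    have "B * ((s - r) / r\<^sup>2) \<le> (e/3)\<^sup>2" using s r B0 by (simp add: field_simps)
    then have d: "\<bar>P n r - P n s\<bar> \<le> e/3" for n
      using Pdiff[of r s n] r s(2) e real_sqrt_le_mono[of "B * ((s - r) / r\<^sup>2)" "(e/3)\<^sup>2"] by simp
    have "Cauchy (\<lambda>n. P n s)" using Prat[of s] r s by (intro convergent_Cauchy) auto
    then obtain M where M: "\<And>m n. m \<ge> M \<Longrightarrow> n \<ge> M \<Longrightarrow> norm (P m s - P n s) < e/3"
      using e CauchyD[of "\<lambda>n. P n s" "e/3"] by auto
    have "norm (P m r - P n r) < e" if "m \<ge> M" "n \<ge> M" for m n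
      using d[of m] d[of n] M[OF that] unfolding real_norm_def by argo
    then show "\<exists>M. \<forall>m\<ge>M. \<forall>n\<ge>M. norm (P m r - P n r) < e" by blast
  qed
  have gm: "grad (u n) \<in> borel_measurable borel" for n
    by (rule weak_gradient_measurable[OF D12_grad(1)[OF Er_spaceD(1)[OF u]]])
  have Pm[measurable]: "P n \<in> borel_measurable borel" for n
    unfolding P_def[abs_def] using profile_measurable[OF gm] by measurable
  define w where "w n x = (if x = 0 then 0 else P n (norm x))" for n and x :: R3
  define \<rho> where "\<rho> r = (if r = 0 then 0 else lim (\<lambda>n. P n r))" for r :: real
  define v where "v x = \<rho> (norm x)" for x :: R3
  have [measurable]: "w n \<in> borel_measurable borel" for n unfolding w_def[abs_def] by measurable
  have [measurable]: "\<rho> \<in> borel_measurable borel" unfolding \<rho>_def[abs_def] by measurable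
  have [measurable]: "v \<in> borel_measurable borel" unfolding v_def[abs_def] by measurable
  have waeq: "AE x in lborel. w n x = \<bar>u (k n) x\<bar>" for n
  proof -
    have "AE x in lborel. x \<noteq> (0::R3)" by (rule AE_lborel_singleton)
    with Er_profile[OF u[of "k n"]] show ?thesis by eventually_elim (simp add: w_def P_def)
  qed
  have w: "w n \<in> Er_space" "dirichlet (w n) \<le> dirichlet (u (k n))" "self_energy (w n) = self_energy (u (k n))" for n
  proof -
    have ae: "AE x in lborel. \<bar>u (k n) x\<bar> = w n x" using waeq[of n] by eventually_elim simp
    show "w n \<in> Er_space" by (rule Er_cong_AE(1)[OF Er_abs(1)[OF u] _ ae]) measurable
    have "dirichlet (w n) = dirichlet (\<lambda>x. \<bar>u (k n) x\<bar>)" by (rule Er_cong_AE(2)[OF Er_abs(1)[OF u] _ ae]) measurable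
    then show "dirichlet (w n) \<le> dirichlet (u (k n))" using Er_abs(2)[OF u, of "k n"] by simp
    have "self_energy (w n) = self_energy (\<lambda>x. \<bar>u (k n) x\<bar>)" by (rule Er_cong_AE(3)[OF Er_abs(1)[OF u] _ ae]) measurable
    then show "self_energy (w n) = self_energy (u (k n))" using Er_abs(3)[OF u, of "k n"] by simp
  qed
  have lim: "(\<lambda>n. w n x) \<longlonglongrightarrow> v x" for x
    using Pconv[of "norm x"] by (cases "x = 0") (auto simp: w_def v_def \<rho>_def convergent_LIMSEQ_iff)
  have wb: "\<bar>w n x\<bar> \<le> sqrt B * norm x powr (- 1/2)" for n x
    using Er_bounds(1)[OF u B, of "norm x" "k n"] by (cases "x = 0") (auto simp: w_def P_def)
  have v0: "0 \<le> v x" for x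
    by (rule LIMSEQ_le_const[OF lim]) (auto simp: w_def P_def)
  have wB: "dirichlet (w n) \<le> B" "self_energy (w n) \<le> B" for n
    using w(2,3)[of n] B(1,2)[of "k n"] by linarith+
  have v6: "integrable lborel (\<lambda>x. \<bar>v x\<bar> ^ 6)"
  proof (rule integrableI_bounded)
    have "(\<integral>\<^sup>+ x. ennreal (norm (\<bar>v x\<bar> ^ 6)) \<partial>lborel) = (\<integral>\<^sup>+ x. liminf (\<lambda>n. ennreal (\<bar>w n x\<bar> ^ 6)) \<partial>lborel)"
    proof (rule nn_integral_cong)
      fix x
      have "(\<lambda>n. ennreal (\<bar>w n x\<bar> ^ 6)) \<longlonglongrightarrow> ennreal (\<bar>v x\<bar> ^ 6)"
        by (intro tendsto_ennrealI tendsto_power tendsto_rabs lim)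
      from lim_imp_Liminf[OF sequentially_bot this] show "ennreal (norm (\<bar>v x\<bar> ^ 6)) = liminf (\<lambda>n. ennreal (\<bar>w n x\<bar> ^ 6))" by simp
    qed
    also have "\<dots> \<le> liminf (\<lambda>n. \<integral>\<^sup>+ x. ennreal (\<bar>w n x\<bar> ^ 6) \<partial>lborel)" by (rule nn_integral_liminf) measurable
    also have "\<dots> \<le> ennreal (4 * B ^ 3)"
    proof (rule Liminf_le)
      show "\<forall>\<^sub>F n in sequentially. (\<integral>\<^sup>+ x. ennreal (\<bar>w n x\<bar> ^ 6) \<partial>lborel) \<le> ennreal (4 * B ^ 3)"
        by (intro always_eventually allI L6_bound[OF w(1) wB B(3)])
    qed simp
    finally show "(\<integral>\<^sup>+ x. ennreal (norm (\<bar>v x\<bar> ^ 6)) \<partial>lborel) < \<infinity>" by (rule le_less_trans) simp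
  qed measurable
  have vD: "v \<in> D12" by (rule D12_limit(1)[OF Er_spaceD(1)[OF w(1)] wB(1) lim _ v6]) measurable
  have vA: "dirichlet v \<le> A"
  proof (rule field_le_epsilon)
    fix e :: real assume "e > 0"
    then have "eventually (\<lambda>n. dirichlet (u (k n)) < A + e) sequentially"
      using order_tendstoD(2)[OF A] by simp
    then obtain M where M: "\<And>n. n \<ge> M \<Longrightarrow> dirichlet (u (k n)) < A + e" by (auto simp: eventually_sequentially)
    show "dirichlet v \<le> A + e"
    proof (rule D12_limit(2)[of "\<lambda>n. w (n + M)"])
      show "w (n + M) \<in> D12" for n by (rule Er_spaceD(1)[OF w(1)])
      show "dirichlet (w (n + M)) \<le> A + e" for n using M[of "n + M"] w(2)[of "n + M"] by simp
      show "(\<lambda>n. w (n + M) x) \<longlonglongrightarrow> v x" for x by (rule LIMSEQ_ignore_initial_segment[OF lim])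
    qed (use v6 in measurable)
  qed
  have NNv: "nn_self_energy v \<le> ennreal N"
  proof -
    let ?D = "\<lambda>f. coulomb_integrand (\<lambda>x. (f x)\<^sup>2) (\<lambda>x. (f x)\<^sup>2)"
    have m: "(\<lambda>z. ennreal (?D (w n) z)) \<in> borel_measurable (lborel \<Otimes>\<^sub>M lborel)" for n
      by (rule measurable_compose[OF coulomb_integrand_measurable measurable_ennreal]) measurable
    have "nn_self_energy v = (\<integral>\<^sup>+ z. liminf (\<lambda>n. ennreal (?D (w n) z)) \<partial>(lborel \<Otimes>\<^sub>M lborel))"
      unfolding nn_self_energy_eq[OF \<open>v \<in> borel_measurable borel\<close>]
    proof (rule nn_integral_cong)
      fix z :: "R3 \<times> R3"
      obtain x y where z: "z = (x, y)" by (cases z)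
      have "(\<lambda>n. (w n x)\<^sup>2 * (w n y)\<^sup>2 * inverse (norm (x - y))) \<longlonglongrightarrow> (v x)\<^sup>2 * (v y)\<^sup>2 * inverse (norm (x - y))"
        by (intro tendsto_mult tendsto_power lim tendsto_const)
      then have "(\<lambda>n. ennreal (?D (w n) z)) \<longlonglongrightarrow> ennreal (?D v z)"
        unfolding z coulomb_integrand_def prod.case divide_inverse by (rule tendsto_ennrealI)
      from lim_imp_Liminf[OF sequentially_bot this]
      show "ennreal (?D v z) = liminf (\<lambda>n. ennreal (?D (w n) z))" by simp
    qed
    also have "\<dots> \<le> liminf (\<lambda>n. \<integral>\<^sup>+ z. ennreal (?D (w n) z) \<partial>(lborel \<Otimes>\<^sub>M lborel))"
      by (rule nn_integral_liminf[OF m])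
    also have "(\<lambda>n. \<integral>\<^sup>+ z. ennreal (?D (w n) z) \<partial>(lborel \<Otimes>\<^sub>M lborel)) = (\<lambda>n. ennreal (self_energy (u (k n))))"
      using Er_spaceD(3)[OF w(1)] w(3) by (simp add: nn_self_energy_eq[OF \<open>w _ \<in> borel_measurable borel\<close>, symmetric])
    also have "liminf (\<lambda>n. ennreal (self_energy (u (k n)))) = ennreal N"
      by (rule lim_imp_Liminf[OF sequentially_bot tendsto_ennrealI[OF N]])
    finally show ?thesis .
  qed
  have "radial v" unfolding radial_def by (rule bexI[of _ \<rho>]) (auto simp: v_def)
  then have vE: "v \<in> Er_space" using vD NNv by (intro Er_spaceI) (auto intro: le_less_trans)
  have N0: "N \<ge> 0" by (rule LIMSEQ_le_const[OF N]) (auto simp: self_energy_nonneg)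
  have vN: "self_energy v \<le> N" using NNv N0 unfolding Er_spaceD(3)[OF vE] by (subst (asm) ennreal_le_iff) auto
  show ?thesis
    by (rule that[of k w v A N]) (use k(1) w(1) wB waeq wb vE v0 lim A vA N vN in auto)
qed


section \<open>The variational problem\<close>

definition energy :: "(R3 \<Rightarrow> real) \<Rightarrow> real" where
  "energy u = 1 / 2 * dirichlet u + 1 / (16 * pi) * self_energy u"

lemma energy_nonneg: "energy u \<ge> 0"
  using dirichlet_nonneg[of u] self_energy_nonneg[of u] by (simp add: energy_def)

lemma energy_controls: "dirichlet u \<le> 2 * energy u" "self_energy u \<le> 16 * pi * energy u"
  using dirichlet_nonneg[of u] self_energy_nonneg[of u] by (simp_all add: energy_def field_simps)

text \<open>Rescale \<open>u\<close> to bounded energy with \<open>t ^ 3 = 1 / (energy u + 1)\<close>, apply \<open>Lq_bound\<close> and scale back. For \<open>q < 3\<close>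
the exponent on the right is below one.\<close>
lemma Lq_coercive:
  assumes q: "18/7 < q" "q < 6"
  obtains C where "C \<ge> 0" "\<And>u. u \<in> Er_space \<Longrightarrow> (LINT x|lborel. \<bar>u x\<bar> powr q) \<le> C * (energy u + 1) powr ((2 * q - 3) / 3)"
proof (rule that[of "max 0 (Lq_const (16 * pi) q)"])
  fix u assume u: "u \<in> Er_space"
  let ?y = "energy u + 1"
  define t where "t = ?y powr (- 1/3)"
  have y: "?y > 0" "energy u \<le> ?y" using energy_nonneg[of u] by simp_all
  have t: "t > 0" using y by (simp add: t_def)
  have "t ^ 3 = t powr 3" using t by (simp add: powr_numeral)
  also have "\<dots> = ?y powr (- 1)" by (simp add: t_def powr_powr)
  also have "\<dots> = 1 / ?y" by (rule powr_neg_one[OF y(1)])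
  finally have t3: "t ^ 3 = 1 / ?y" .
  have tI: "t ^ 3 * energy u \<le> 1" unfolding t3 using y by simp
  let ?v = "\<lambda>x. t\<^sup>2 * u (t *\<^sub>R x)"
  note s = Er_scale[OF u t]
  have "t ^ 3 * dirichlet u \<le> t ^ 3 * (2 * energy u)" using energy_controls(1)[of u] t by (intro mult_left_mono) auto
  then have "dirichlet ?v \<le> 2" using s(2) tI by linarith
  then have d: "dirichlet ?v \<le> 16 * pi" using pi_ge_two by linarith
  have "t ^ 3 * self_energy u \<le> t ^ 3 * (16 * pi * energy u)" using energy_controls(2)[of u] t by (intro mult_left_mono) auto
  also have "\<dots> = 16 * pi * (t ^ 3 * energy u)" by simp
  also have "\<dots> \<le> 16 * pi * 1" using tI by (intro mult_left_mono) auto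
  finally have n: "self_energy ?v \<le> 16 * pi" using s(3) by simp
  have "(LINT x|lborel. \<bar>?v x\<bar> powr q) \<le> Lq_const (16 * pi) q"
    by (rule Lq_bound(2)[OF s(1) d n]) (use pi_ge_two q in auto)
  then have L: "t powr (2 * q - 3) * (LINT x|lborel. \<bar>u x\<bar> powr q) \<le> max 0 (Lq_const (16 * pi) q)"
    unfolding s(4) by simp
  \<comment> \<open>The scaling factor is undone.\<close>
  have inv: "t powr (2 * q - 3) * ?y powr ((2 * q - 3) / 3) = 1"
  proof -
    have "t powr (2 * q - 3) = ?y powr (- ((2 * q - 3) / 3))" by (simp add: t_def powr_powr field_simps)
    then have "t powr (2 * q - 3) * ?y powr ((2 * q - 3) / 3) = ?y powr (- ((2 * q - 3) / 3) + (2 * q - 3) / 3)"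
      by (simp only: powr_add)
    then show ?thesis using y by simp
  qed
  have "(LINT x|lborel. \<bar>u x\<bar> powr q) = (t powr (2 * q - 3) * ?y powr ((2 * q - 3) / 3)) * (LINT x|lborel. \<bar>u x\<bar> powr q)"
    unfolding inv by simp
  also have "\<dots> = (t powr (2 * q - 3) * (LINT x|lborel. \<bar>u x\<bar> powr q)) * ?y powr ((2 * q - 3) / 3)" by (simp only: mult_ac)
  also have "\<dots> \<le> max 0 (Lq_const (16 * pi) q) * ?y powr ((2 * q - 3) / 3)"
    by (rule mult_right_mono[OF L]) simp
  finally show "(LINT x|lborel. \<bar>u x\<bar> powr q) \<le> max 0 (Lq_const (16 * pi) q) * ?y powr ((2 * q - 3) / 3)" .
qed simp

lemma sublinear_absorb:
  assumes \<theta>: "0 < \<theta>" "\<theta> < (1::real)" and K: "K \<ge> 0"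
  obtains M where "\<And>y. y \<ge> 1 \<Longrightarrow> K * y powr \<theta> \<le> y / 4 + M"
proof -
  \<comment> \<open>The threshold beyond which \<open>K * y powr \<theta>\<close> is at most \<open>y / 4\<close>.\<close>
  define Y where "Y = (4 * K + 1) powr (1 / (1 - \<theta>))"
  have Y0: "Y > 0" using K by (simp add: Y_def)
  have Y1: "Y powr (1 - \<theta>) = 4 * K + 1" using \<theta> K by (simp add: Y_def powr_powr)
  have "K * y powr \<theta> \<le> y / 4 + K * Y powr \<theta>" if y: "y \<ge> 1" for y
  proof (cases "y \<le> Y")
    case True
    have "K * y powr \<theta> \<le> K * Y powr \<theta>" using True y \<theta> K by (intro mult_left_mono powr_mono2) auto
    then show ?thesis using y by linarith
  next
    case False
    have "4 * K \<le> Y powr (1 - \<theta>)" unfolding Y1 by simp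
    also have "\<dots> \<le> y powr (1 - \<theta>)" using False Y0 \<theta> by (intro powr_mono2) auto
    finally have "y powr \<theta> * (4 * K) \<le> y powr \<theta> * y powr (1 - \<theta>)" by (rule mult_left_mono) simp
    also have "\<dots> = y" using y by (simp add: powr_add[symmetric])
    finally have "K * y powr \<theta> \<le> y / 4" by (simp add: mult_ac)
    moreover have "K * Y powr \<theta> \<ge> 0" using K by simp
    ultimately show ?thesis by linarith
  qed
  then show ?thesis by (rule that)
qed

text \<open>The setting of the minimisation: an even primitive with subcubic growth. Evenness makes the functional blind to signs.\<close>
locale subcubic =
  fixes F fe :: "real \<Rightarrow> real" and a1 a2 q1 q2 :: real
  assumes deriv: "\<And>t. (F has_real_derivative fe t) (at t)" and F0: "F 0 = 0" and even: "\<And>t. F \<bar>t\<bar> = F t"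
    and cont: "continuous_on UNIV fe"
    and a: "a1 \<ge> 0" "a2 \<ge> 0" and q: "18/7 < q1" "q1 < 3" "18/7 < q2" "q2 < 3"
    and growth: "\<And>t. \<bar>fe t\<bar> \<le> a1 * \<bar>t\<bar> powr (q1 - 1) + a2 * \<bar>t\<bar> powr (q2 - 1)"
begin

lemma F_cont: "continuous_on UNIV F"
  using DERIV_isCont[OF deriv] by (simp add: continuous_at_imp_continuous_on)

lemma F_measurable [measurable]: "F \<in> borel_measurable borel"
  by (rule borel_measurable_continuous_onI[OF F_cont])

lemma fe_measurable [measurable]: "fe \<in> borel_measurable borel"
  by (rule borel_measurable_continuous_onI[OF cont])

lemma powr_step: "m * m powr (p - 1) = m powr p" if "m \<ge> 0" for m p :: real
proof (cases "m = 0")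
  case False
  then show ?thesis using that powr_add[of m 1 "p - 1"] by simp
qed simp

lemma growth_mono:
  assumes "\<bar>z\<bar> \<le> m"
  shows "\<bar>fe z\<bar> \<le> a1 * m powr (q1 - 1) + a2 * m powr (q2 - 1)"
proof -
  have "\<bar>z\<bar> powr (q1 - 1) \<le> m powr (q1 - 1)" "\<bar>z\<bar> powr (q2 - 1) \<le> m powr (q2 - 1)"
    using assms q by (auto intro!: powr_mono2)
  then have "a1 * \<bar>z\<bar> powr (q1 - 1) + a2 * \<bar>z\<bar> powr (q2 - 1) \<le> a1 * m powr (q1 - 1) + a2 * m powr (q2 - 1)"
    using a by (intro add_mono mult_left_mono) auto
  then show ?thesis using growth[of z] by linarith
qed

lemma F_increment: "\<bar>F (s + b) - F s\<bar> \<le> \<bar>b\<bar> * (a1 * (\<bar>s\<bar> + \<bar>b\<bar>) powr (q1 - 1) + a2 * (\<bar>s\<bar> + \<bar>b\<bar>) powr (q2 - 1))"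
proof -
  have "\<exists>z. \<bar>z\<bar> \<le> \<bar>s\<bar> + \<bar>b\<bar> \<and> \<bar>F (s + b) - F s\<bar> = \<bar>b\<bar> * \<bar>fe z\<bar>"
  proof -
    consider "b = 0" | "b > 0" | "b < 0" by linarith
    then show ?thesis
    proof cases
      case 1
      then show ?thesis by (intro exI[of _ s]) simp
    next
      case 2
      have "\<exists>z. s < z \<and> z < s + b \<and> F (s + b) - F s = (s + b - s) * fe z"
        by (rule MVT2) (use 2 deriv in auto)
      then obtain z where z: "s < z" "z < s + b" "F (s + b) - F s = b * fe z" by auto
      then have "\<bar>z\<bar> \<le> \<bar>s\<bar> + \<bar>b\<bar>" by linarith
      then show ?thesis using z(3) by (auto simp: abs_mult)
    next
      case 3
      have "\<exists>z. s + b < z \<and> z < s \<and> F s - F (s + b) = (s - (s + b)) * fe z"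
        by (rule MVT2) (use 3 deriv in auto)
      then obtain z where z: "s + b < z" "z < s" "F s - F (s + b) = - b * fe z" by auto
      then have "\<bar>z\<bar> \<le> \<bar>s\<bar> + \<bar>b\<bar>" by linarith
      moreover have "F (s + b) - F s = b * fe z" using z(3) by linarith
      ultimately show ?thesis by (auto simp: abs_mult)
    qed
  qed
  then obtain z where z: "\<bar>z\<bar> \<le> \<bar>s\<bar> + \<bar>b\<bar>" "\<bar>F (s + b) - F s\<bar> = \<bar>b\<bar> * \<bar>fe z\<bar>" by blast
  show ?thesis unfolding z(2) by (rule mult_left_mono[OF growth_mono[OF z(1)]]) simp
qed

text \<open>The increment from zero.\<close>
lemma F_bound: "\<bar>F t\<bar> \<le> a1 * \<bar>t\<bar> powr q1 + a2 * \<bar>t\<bar> powr q2"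
proof -
  have "\<bar>F t\<bar> \<le> \<bar>t\<bar> * (a1 * \<bar>t\<bar> powr (q1 - 1) + a2 * \<bar>t\<bar> powr (q2 - 1))"
    using F_increment[of 0 t] F0 by simp
  also have "\<dots> = a1 * (\<bar>t\<bar> * \<bar>t\<bar> powr (q1 - 1)) + a2 * (\<bar>t\<bar> * \<bar>t\<bar> powr (q2 - 1))"
    by (simp add: algebra_simps)
  also have "\<dots> = a1 * \<bar>t\<bar> powr q1 + a2 * \<bar>t\<bar> powr q2" by (simp add: powr_step)
  finally show ?thesis .
qed

definition potential :: "(R3 \<Rightarrow> real) \<Rightarrow> real" where
  "potential u = (LINT x|lborel. F (u x))"

definition Phi :: "(R3 \<Rightarrow> real) \<Rightarrow> real" where
  "Phi u = energy u - potential u"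

lemma majorant_integrable:
  assumes u: "u \<in> Er_space"
  shows "integrable lborel (\<lambda>x. a1 * \<bar>u x\<bar> powr q1 + a2 * \<bar>u x\<bar> powr q2)"
  using Lq_integrable[OF u, of q1] Lq_integrable[OF u, of q2] q by simp

lemma F_integrable:
  assumes u: "u \<in> Er_space"
  shows "integrable lborel (\<lambda>x. F (u x))"
proof (rule Bochner_Integration.integrable_bound[OF majorant_integrable[OF u]])
  note [measurable] = Er_spaceD(4)[OF u]
  show "(\<lambda>x. F (u x)) \<in> borel_measurable lborel" by measurable
  show "AE x in lborel. norm (F (u x)) \<le> norm (a1 * \<bar>u x\<bar> powr q1 + a2 * \<bar>u x\<bar> powr q2)"
    using F_bound a by (intro AE_I2) (simp add: abs_of_nonneg)
qed

lemma potential_bound: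
  assumes u: "u \<in> Er_space"
  shows "\<bar>potential u\<bar> \<le> a1 * (LINT x|lborel. \<bar>u x\<bar> powr q1) + a2 * (LINT x|lborel. \<bar>u x\<bar> powr q2)"
proof -
  have "\<bar>potential u\<bar> \<le> (LINT x|lborel. \<bar>F (u x)\<bar>)" unfolding potential_def by (rule integral_abs_bound)
  also have "\<dots> \<le> (LINT x|lborel. a1 * \<bar>u x\<bar> powr q1 + a2 * \<bar>u x\<bar> powr q2)"
    by (rule integral_mono) (use F_integrable[OF u] majorant_integrable[OF u] F_bound in auto)
  also have "\<dots> = a1 * (LINT x|lborel. \<bar>u x\<bar> powr q1) + a2 * (LINT x|lborel. \<bar>u x\<bar> powr q2)"
    using Lq_integrable[OF u, of q1] Lq_integrable[OF u, of q2] q by simp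
  finally show ?thesis .
qed

text \<open>Each of the two sublinear terms is absorbed by a quarter of the energy.\<close>
lemma Phi_coercive:
  obtains M where "\<And>u. u \<in> Er_space \<Longrightarrow> energy u \<le> 2 * Phi u + M"
proof -
  obtain C1 where C1: "C1 \<ge> 0" "\<And>u. u \<in> Er_space \<Longrightarrow> (LINT x|lborel. \<bar>u x\<bar> powr q1) \<le> C1 * (energy u + 1) powr ((2 * q1 - 3) / 3)"
    by (rule Lq_coercive[of q1]) (use q in auto)
  obtain C2 where C2: "C2 \<ge> 0" "\<And>u. u \<in> Er_space \<Longrightarrow> (LINT x|lborel. \<bar>u x\<bar> powr q2) \<le> C2 * (energy u + 1) powr ((2 * q2 - 3) / 3)"
    by (rule Lq_coercive[of q2]) (use q in auto)
  obtain M1 where M1: "\<And>y. y \<ge> 1 \<Longrightarrow> (a1 * C1) * y powr ((2 * q1 - 3) / 3) \<le> y / 4 + M1"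
    by (rule sublinear_absorb[of "(2 * q1 - 3) / 3" "a1 * C1"]) (use q a C1 in auto)
  obtain M2 where M2: "\<And>y. y \<ge> 1 \<Longrightarrow> (a2 * C2) * y powr ((2 * q2 - 3) / 3) \<le> y / 4 + M2"
    by (rule sublinear_absorb[of "(2 * q2 - 3) / 3" "a2 * C2"]) (use q a C2 in auto)
  show ?thesis
  proof (rule that[of "1 + 2 * M1 + 2 * M2"])
    fix u assume u: "u \<in> Er_space"
    have y: "energy u + 1 \<ge> 1" using energy_nonneg[of u] by simp
    have "a1 * (LINT x|lborel. \<bar>u x\<bar> powr q1) \<le> a1 * (C1 * (energy u + 1) powr ((2 * q1 - 3) / 3))"
      using C1(2)[OF u] a by (intro mult_left_mono) auto
    moreover have "a2 * (LINT x|lborel. \<bar>u x\<bar> powr q2) \<le> a2 * (C2 * (energy u + 1) powr ((2 * q2 - 3) / 3))"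
      using C2(2)[OF u] a by (intro mult_left_mono) auto
    ultimately have "potential u \<le> ((energy u + 1) / 4 + M1) + ((energy u + 1) / 4 + M2)"
      using potential_bound[OF u] M1[OF y] M2[OF y] unfolding mult.assoc by linarith
    then show "energy u \<le> 2 * Phi u + (1 + 2 * M1 + 2 * M2)" unfolding Phi_def by argo
  qed
qed

definition tail_bound :: "real \<Rightarrow> real \<Rightarrow> real" where
  "tail_bound B R = a1 * (tail_const B q1 * R powr (1/2 - 7/8 * (q1 - 2))) + a2 * (tail_const B q2 * R powr (1/2 - 7/8 * (q2 - 2)))"

lemma tail_bound_tendsto: "(\<lambda>n. tail_bound B (real (Suc n))) \<longlonglongrightarrow> 0"
proof -
  have "(\<lambda>n. real (Suc n) powr (1/2 - 7/8 * (p - 2))) \<longlonglongrightarrow> 0" if "18/7 < p" for p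
  proof (rule tendsto_neg_powr)
    show "filterlim (\<lambda>n. real (Suc n)) at_top sequentially"
      by (rule filterlim_compose[OF filterlim_real_sequentially filterlim_Suc])
  qed (use that in simp)
  then have "(\<lambda>n. tail_bound B (real (Suc n))) \<longlonglongrightarrow> a1 * (tail_const B q1 * 0) + a2 * (tail_const B q2 * 0)"
    unfolding tail_bound_def using q by (intro tendsto_add tendsto_mult tendsto_const) auto
  then show ?thesis by simp
qed

lemma tail_const_nonneg: "B \<ge> 1 \<Longrightarrow> p > 18/7 \<Longrightarrow> tail_const B p \<ge> 0"
  unfolding tail_const_def by (intro mult_nonneg_nonneg divide_nonneg_nonneg) auto

text \<open>Uniform for functions of bounded energy: this is the compactness at infinity.\<close>
lemma F_tail:
  assumes u: "u \<in> Er_space" and B: "dirichlet u \<le> B" "self_energy u \<le> B" "B \<ge> 1" and R: "R > 0"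
  shows "\<bar>LINT x|lborel. (if R \<le> norm x then F (u x) else 0)\<bar> \<le> tail_bound B R"
proof -
  note [measurable] = Er_spaceD(4)[OF u]
  let ?I = "\<lambda>p x. ennreal (if R \<le> norm x then \<bar>u x\<bar> powr p else 0)"
  have t0: "tail_bound B R \<ge> 0"
    unfolding tail_bound_def using a q tail_const_nonneg[OF B(3)] by (intro add_nonneg_nonneg mult_nonneg_nonneg) auto
  have "ennreal \<bar>LINT x|lborel. (if R \<le> norm x then F (u x) else 0)\<bar> \<le> (\<integral>\<^sup>+ x. ennreal \<bar>if R \<le> norm x then F (u x) else 0\<bar> \<partial>lborel)"
    by (rule abs_integral_le_nn_integral)
  also have "\<dots> \<le> (\<integral>\<^sup>+ x. ennreal a1 * ?I q1 x + ennreal a2 * ?I q2 x \<partial>lborel)"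
  proof (rule nn_integral_mono)
    fix x
    have "ennreal \<bar>F (u x)\<bar> \<le> ennreal (a1 * \<bar>u x\<bar> powr q1 + a2 * \<bar>u x\<bar> powr q2)" by (rule ennreal_leI[OF F_bound])
    also have "\<dots> = ennreal a1 * ennreal (\<bar>u x\<bar> powr q1) + ennreal a2 * ennreal (\<bar>u x\<bar> powr q2)"
      using a by (simp add: ennreal_plus ennreal_mult)
    finally show "ennreal \<bar>if R \<le> norm x then F (u x) else 0\<bar> \<le> ennreal a1 * ?I q1 x + ennreal a2 * ?I q2 x"
      by (cases "R \<le> norm x") simp_all
  qed
  also have "\<dots> = ennreal a1 * (\<integral>\<^sup>+ x. ?I q1 x \<partial>lborel) + ennreal a2 * (\<integral>\<^sup>+ x. ?I q2 x \<partial>lborel)"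
    by (subst nn_integral_add) (auto simp: nn_integral_cmult)
  also have "\<dots> \<le> ennreal a1 * ennreal (tail_const B q1 * R powr (1/2 - 7/8 * (q1 - 2))) + ennreal a2 * ennreal (tail_const B q2 * R powr (1/2 - 7/8 * (q2 - 2)))"
    using q by (intro add_mono mult_left_mono Lq_tail[OF u B] R) auto
  also have "\<dots> = ennreal (tail_bound B R)"
    unfolding tail_bound_def using a q tail_const_nonneg[OF B(3)] by (simp add: ennreal_mult[symmetric] ennreal_plus[symmetric] del: ennreal_plus)
  finally show ?thesis using t0 by (simp add: ennreal_le_iff)
qed

lemma ball_powr_integrable:
  assumes "p < 3" "R > 0"
  shows "integrable lborel (\<lambda>x::R3. if norm x \<le> R then norm x powr (- p) else 0)"
  by (rule integrableI_bounded) (use nn_integral_norm_powr_ball[OF assms] in \<open>auto simp: if_distrib cong: if_cong\<close>)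

text \<open>Outside a large ball the contributions are uniformly small, and inside it dominated convergence applies with the integrable majorant
that comes from the bound of order \<open>\<bar>x\<bar> powr (-1/2)\<close>.\<close>
lemma potential_converges:
  assumes w: "\<And>n. w n \<in> Er_space" and wB: "\<And>n. dirichlet (w n) \<le> B" "\<And>n. self_energy (w n) \<le> B" and B: "B \<ge> 1"
    and wb: "\<And>n x. \<bar>w n x\<bar> \<le> sqrt B * norm x powr (- 1/2)"
    and v: "v \<in> Er_space" "dirichlet v \<le> B" "self_energy v \<le> B" and lim: "\<And>x. (\<lambda>n. w n x) \<longlonglongrightarrow> v x"
  shows "(\<lambda>n. potential (w n)) \<longlonglongrightarrow> potential v"
proof (rule LIMSEQ_I)
  fix e :: real assume e: "e > 0"
  note [measurable] = Er_spaceD(4)[OF w] Er_spaceD(4)[OF v(1)]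
  obtain m where m: "tail_bound B (real (Suc m)) < e/3"
    using order_tendstoD(2)[OF tail_bound_tendsto[of B], of "e/3"] e by (auto simp: eventually_sequentially)
  define R where "R = real (Suc m)"
  have R: "R > 0" and tR: "tail_bound B R < e/3" using m by (auto simp: R_def)
  have split: "potential u = (LINT x|lborel. (if R \<le> norm x then 0 else F (u x))) + (LINT x|lborel. (if R \<le> norm x then F (u x) else 0))"
    if u: "u \<in> Er_space" for u
  proof -
    note [measurable] = Er_spaceD(4)[OF u]
    have "integrable lborel (\<lambda>x. if R \<le> norm x then 0 else F (u x))" "integrable lborel (\<lambda>x. if R \<le> norm x then F (u x) else 0)"
      by (rule Bochner_Integration.integrable_bound[OF F_integrable[OF u]]; auto)+
    note int = this
    have "potential u = (LINT x|lborel. (if R \<le> norm x then 0 else F (u x)) + (if R \<le> norm x then F (u x) else 0))"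
      unfolding potential_def by (rule Bochner_Integration.integral_cong) auto
    also have "\<dots> = (LINT x|lborel. (if R \<le> norm x then 0 else F (u x))) + (LINT x|lborel. (if R \<le> norm x then F (u x) else 0))"
      by (rule Bochner_Integration.integral_add[OF int])
    finally show ?thesis .
  qed
  let ?W = "\<lambda>x::R3. a1 * (sqrt B powr q1 * (if norm x \<le> R then norm x powr (- (q1/2)) else 0))
      + a2 * (sqrt B powr q2 * (if norm x \<le> R then norm x powr (- (q2/2)) else 0))"
  have "(\<lambda>n. LINT x|lborel. (if R \<le> norm x then 0 else F (w n x))) \<longlonglongrightarrow> (LINT x|lborel. (if R \<le> norm x then 0 else F (v x)))"
  proof (rule integral_dominated_convergence)
    show "integrable lborel ?W"
      using ball_powr_integrable[of "q1/2" R] ball_powr_integrable[of "q2/2" R] R q by simp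
    show "AE x in lborel. (\<lambda>n. if R \<le> norm x then 0 else F (w n x)) \<longlonglongrightarrow> (if R \<le> norm x then 0 else F (v x))"
    proof (rule AE_I2)
      fix x
      have "(\<lambda>n. F (w n x)) \<longlonglongrightarrow> F (v x)" by (rule isCont_tendsto_compose[OF DERIV_isCont[OF deriv] lim])
      then show "(\<lambda>n. if R \<le> norm x then 0 else F (w n x)) \<longlonglongrightarrow> (if R \<le> norm x then 0 else F (v x))" by simp
    qed
    show "AE x in lborel. norm (if R \<le> norm x then 0 else F (w n x)) \<le> ?W x" for n
    proof (rule AE_I2)
      fix x :: R3
      have p: "\<bar>w n x\<bar> powr p \<le> sqrt B powr p * norm x powr (- (p/2))" if "p > 0" for p
      proof -
        have "\<bar>w n x\<bar> powr p \<le> (sqrt B * norm x powr (- 1/2)) powr p"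
          using wb[of n x] that by (intro powr_mono2) auto
        also have "\<dots> = sqrt B powr p * norm x powr (- (p/2))" using B by (simp add: powr_mult powr_powr)
        finally show ?thesis .
      qed
      have "\<bar>F (w n x)\<bar> \<le> a1 * (sqrt B powr q1 * norm x powr (- (q1/2))) + a2 * (sqrt B powr q2 * norm x powr (- (q2/2)))"
      proof -
        have "a1 * \<bar>w n x\<bar> powr q1 + a2 * \<bar>w n x\<bar> powr q2 \<le> a1 * (sqrt B powr q1 * norm x powr (- (q1/2))) + a2 * (sqrt B powr q2 * norm x powr (- (q2/2)))"
          using a q by (intro add_mono mult_left_mono p) auto
        then show ?thesis using F_bound[of "w n x"] by linarith
      qed
      then show "norm (if R \<le> norm x then 0 else F (w n x)) \<le> ?W x" using a by auto
    qed
  qed measurable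
  note lim' = this
  have "e / 3 > 0" using e by simp
  from LIMSEQ_D[OF lim' this] obtain M where M: "\<And>n. n \<ge> M \<Longrightarrow> norm ((LINT x|lborel. (if R \<le> norm x then 0 else F (w n x))) - (LINT x|lborel. (if R \<le> norm x then 0 else F (v x)))) < e/3"
    by blast
  have "norm (potential (w n) - potential v) < e" if "n \<ge> M" for n
    using M[OF that] F_tail[OF w wB B R, of n] F_tail[OF v B R] tR unfolding split[OF w[of n]] split[OF v(1)] real_norm_def by argo
  then show "\<exists>M. \<forall>n\<ge>M. norm (potential (w n) - potential v) < e" by blast
qed

text \<open>The direct method. A minimising sequence has bounded energy by coercivity; the limit \<open>v\<close> of \<open>Er_compactness\<close> has at most the limiting
energy, and since \<open>F\<close> is even, the integrals of \<open>F\<close> along \<open>u (k n)\<close> and along \<open>w n = \<bar>u (k n)\<bar>\<close> coincide.\<close>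
lemma minimizer:
  obtains v where "v \<in> Er_space" "\<And>x. 0 \<le> v x" "\<And>u. u \<in> Er_space \<Longrightarrow> Phi v \<le> Phi u"
proof -
  obtain M where M: "\<And>u. u \<in> Er_space \<Longrightarrow> energy u \<le> 2 * Phi u + M" using Phi_coercive by blast
  define m where "m = Inf (Phi ` Er_space)"
  have ne: "Phi ` Er_space \<noteq> {}" using zero_in_Er_space by blast
  have bd: "bdd_below (Phi ` Er_space)"
  proof (rule bdd_belowI[of _ "- M / 2"])
    fix y assume "y \<in> Phi ` Er_space"
    then obtain u where u: "u \<in> Er_space" "y = Phi u" by blast
    show "- M / 2 \<le> y" using M[OF u(1)] energy_nonneg[of u] u(2) by argo
  qed
  have m_le: "m \<le> Phi u" if "u \<in> Er_space" for u unfolding m_def using that bd by (intro cInf_lower) auto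
  have "\<exists>u. u \<in> Er_space \<and> Phi u < m + 1 / real (Suc n)" for n
  proof -
    have "\<exists>y\<in>Phi ` Er_space. y < m + 1 / real (Suc n)"
      unfolding m_def by (subst cInf_less_iff[OF ne bd, symmetric]) simp
    then show ?thesis by blast
  qed
  then obtain u where u: "\<And>n. u n \<in> Er_space" "\<And>n. Phi (u n) < m + 1 / real (Suc n)" by metis
  have Plim: "(\<lambda>n. Phi (u n)) \<longlonglongrightarrow> m"
  proof (rule tendsto_sandwich)
    show "\<forall>\<^sub>F n in sequentially. m \<le> Phi (u n)" using m_le[OF u(1)] by simp
    show "\<forall>\<^sub>F n in sequentially. Phi (u n) \<le> m + 1 / real (Suc n)" using u(2) by (auto intro!: always_eventually less_imp_le)
    show "(\<lambda>n. m + 1 / real (Suc n)) \<longlonglongrightarrow> m"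
      using tendsto_add[OF tendsto_const[of m] LIMSEQ_inverse_real_of_nat] by (simp add: inverse_eq_divide)
  qed simp
  define D where "D = \<bar>2 * (m + 1) + M\<bar>"
  have IIb: "energy (u n) \<le> D" for n
  proof -
    have "1 / real (Suc n) \<le> 1" by simp
    then have "energy (u n) \<le> 2 * (m + 1) + M" using M[OF u(1), of n] u(2)[of n] by argo
    then show ?thesis unfolding D_def by (rule order_trans) (rule abs_ge_self)
  qed
  define B where "B = 16 * pi * D + 2 * D + 1"
  have D0: "D \<ge> 0" by (simp add: D_def)
  then have "16 * pi * D \<ge> 0" by simp
  then have B: "B \<ge> 1" "2 * D \<le> B" "16 * pi * D \<le> B" using D0 by (simp_all add: B_def)
  have uB: "dirichlet (u n) \<le> B" "self_energy (u n) \<le> B" for n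
  proof -
    show "dirichlet (u n) \<le> B" using energy_controls(1)[of "u n"] IIb[of n] B(2) by linarith
    have "16 * pi * energy (u n) \<le> 16 * pi * D" using IIb[of n] by (intro mult_left_mono) auto
    then show "self_energy (u n) \<le> B" using energy_controls(2)[of "u n"] B(3) by linarith
  qed
  obtain k w v A N where c: "strict_mono (k :: nat \<Rightarrow> nat)"
    "\<And>n. w n \<in> Er_space" "\<And>n. dirichlet (w n) \<le> B" "\<And>n. self_energy (w n) \<le> B" "\<And>n. AE x in lborel. w n x = \<bar>u (k n) x\<bar>"
    "\<And>n x. \<bar>w n x\<bar> \<le> sqrt B * norm x powr (- 1/2)"
    "v \<in> Er_space" "\<And>x. 0 \<le> v x" "\<And>x. (\<lambda>n. w n x) \<longlonglongrightarrow> v x"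
    "(\<lambda>n. dirichlet (u (k n))) \<longlonglongrightarrow> A" "dirichlet v \<le> A"
    "(\<lambda>n. self_energy (u (k n))) \<longlonglongrightarrow> N" "self_energy v \<le> N"
    by (rule Er_compactness[OF u(1) uB B(1)]) (rule that)
  have AB: "A \<le> B" "N \<le> B"
    using LIMSEQ_le_const2[OF c(10)] LIMSEQ_le_const2[OF c(12)] uB by blast+
  have PFw: "potential (w n) = potential (u (k n))" for n
  proof -
    note [measurable] = Er_spaceD(4)[OF c(2)[of n]] Er_spaceD(4)[OF u(1)[of "k n"]]
    have "AE x in lborel. F (w n x) = F (u (k n) x)" using c(5)[of n] by eventually_elim (simp add: even)
    then show ?thesis unfolding potential_def by (intro integral_cong_AE) auto
  qed
  have "(\<lambda>n. potential (w n)) \<longlonglongrightarrow> potential v"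
    by (rule potential_converges[OF c(2,3,4) B(1) c(6,7) _ _ c(9)]) (use c(11,13) AB in auto)
  then have "(\<lambda>n. energy (u (k n)) - potential (u (k n))) \<longlonglongrightarrow> (1 / 2 * A + 1 / (16 * pi) * N) - potential v"
    unfolding PFw energy_def by (intro tendsto_diff tendsto_add tendsto_mult tendsto_const c(10,12))
  moreover have "(\<lambda>n. energy (u (k n)) - potential (u (k n))) \<longlonglongrightarrow> m"
    using LIMSEQ_subseq_LIMSEQ[OF Plim c(1)] by (simp add: Phi_def o_def)
  ultimately have eq: "(1 / 2 * A + 1 / (16 * pi) * N) - potential v = m" by (rule LIMSEQ_unique)
  have "1 / (16 * pi) * self_energy v \<le> 1 / (16 * pi) * N" using c(13) by (intro mult_left_mono) auto
  then have "Phi v \<le> m" using c(11) eq unfolding Phi_def energy_def by linarith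
  then show ?thesis using that[OF c(7,8)] m_le by force
qed

text \<open>The energy is a polynomial along lines; for the integral of \<open>F\<close> dominated convergence applies, since the mean value
theorem bounds the quotients by the growth of \<open>fe\<close>.\<close>
lemma Phi_quotient:
  assumes v: "v \<in> Er_space" and \<phi>: "\<phi> \<in> Er_space"
    and h: "h \<longlonglongrightarrow> 0" "\<And>n. h n \<noteq> 0" "\<And>n. \<bar>h n\<bar> \<le> 1"
  shows "(\<lambda>n. (Phi (\<lambda>x. v x + h n * \<phi> x) - Phi v) / h n) \<longlonglongrightarrow>
    (LINT x|lborel. grad v x \<bullet> grad \<phi> x) + 1 / (4 * pi) * coulomb (\<lambda>x. (v x)\<^sup>2) (\<lambda>x. v x * \<phi> x) - (LINT x|lborel. fe (v x) * \<phi> x)"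
proof -
  note [measurable] = Er_spaceD(4)[OF v] Er_spaceD(4)[OF \<phi>]
  let ?G = "LINT x|lborel. grad v x \<bullet> grad \<phi> x" and ?C = "coulomb (\<lambda>x. (v x)\<^sup>2) (\<lambda>x. v x * \<phi> x)"
  obtain R2 R3 R4 where NEl: "\<And>s. self_energy (\<lambda>x. v x + s * \<phi> x) = self_energy v + s * (4 * ?C) + s\<^sup>2 * R2 + s ^ 3 * R3 + s ^ 4 * R4"
    by (rule self_energy_line[OF v \<phi>]) blast
  \<comment> \<open>Exact expansion; only the linear terms survive as the step tends to zero.\<close>
  have eq: "(Phi (\<lambda>x. v x + h n * \<phi> x) - Phi v) / h n
     = ?G + h n * (dirichlet \<phi> / 2) + 1 / (16 * pi) * (4 * ?C + h n * R2 + (h n)\<^sup>2 * R3 + (h n) ^ 3 * R4)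
       - (LINT x|lborel. (F (v x + h n * \<phi> x) - F (v x)) / h n)" for n
  proof -
    let ?h = "h n"
    have P: "potential (\<lambda>x. v x + ?h * \<phi> x) - potential v = ?h * (LINT x|lborel. (F (v x + ?h * \<phi> x) - F (v x)) / ?h)"
      using F_integrable[OF Er_line(1)[OF v \<phi>, of ?h]] F_integrable[OF v] h(2)[of n] unfolding potential_def by simp
    have "Phi (\<lambda>x. v x + ?h * \<phi> x) - Phi v = (energy (\<lambda>x. v x + ?h * \<phi> x) - energy v) - (potential (\<lambda>x. v x + ?h * \<phi> x) - potential v)"
      by (simp add: Phi_def)
    also have "energy (\<lambda>x. v x + ?h * \<phi> x) - energy v = ?h * (?G + ?h * (dirichlet \<phi> / 2) + 1 / (16 * pi) * (4 * ?C + ?h * R2 + ?h\<^sup>2 * R3 + ?h ^ 3 * R4))"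
      unfolding energy_def Er_line(2)[OF v \<phi>] NEl by (simp add: field_simps power2_eq_square eval_nat_numeral)
    finally have "Phi (\<lambda>x. v x + ?h * \<phi> x) - Phi v = ?h * ((?G + ?h * (dirichlet \<phi> / 2) + 1 / (16 * pi) * (4 * ?C + ?h * R2 + ?h\<^sup>2 * R3 + ?h ^ 3 * R4))
       - (LINT x|lborel. (F (v x + ?h * \<phi> x) - F (v x)) / ?h))"
      unfolding P right_diff_distrib .
    then show ?thesis using h(2)[of n] by simp
  qed
  have "(\<lambda>n. LINT x|lborel. (F (v x + h n * \<phi> x) - F (v x)) / h n) \<longlonglongrightarrow> (LINT x|lborel. fe (v x) * \<phi> x)"
  proof (rule integral_dominated_convergence)
    define m where "m x = \<bar>v x\<bar> + 1 * \<bar>\<phi> x\<bar>" for x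
    have mE: "m \<in> Er_space" unfolding m_def[abs_def] by (rule Er_line(1)[OF Er_abs(1)[OF v] Er_abs(1)[OF \<phi>]])
    show "integrable lborel (\<lambda>x. a1 * \<bar>m x\<bar> powr q1 + a2 * \<bar>m x\<bar> powr q2)" by (rule majorant_integrable[OF mE])
    show "AE x in lborel. norm ((F (v x + h n * \<phi> x) - F (v x)) / h n) \<le> a1 * \<bar>m x\<bar> powr q1 + a2 * \<bar>m x\<bar> powr q2" for n
    proof (rule AE_I2)
      fix x
      have hp: "\<bar>h n * \<phi> x\<bar> \<le> \<bar>\<phi> x\<bar>" using h(3)[of n] by (simp add: abs_mult mult_left_le_one_le)
      have m0: "m x \<ge> 0" "\<bar>\<phi> x\<bar> \<le> m x" by (auto simp: m_def)
      let ?Q = "\<lambda>z. a1 * z powr (q1 - 1) + a2 * z powr (q2 - 1)"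
      have Q: "?Q (\<bar>v x\<bar> + \<bar>h n * \<phi> x\<bar>) \<le> ?Q (m x)"
        using hp a q by (intro add_mono mult_left_mono powr_mono2) (auto simp: m_def)
      have Q0: "?Q (m x) \<ge> 0" using a by simp
      have "\<bar>F (v x + h n * \<phi> x) - F (v x)\<bar> \<le> \<bar>h n * \<phi> x\<bar> * ?Q (\<bar>v x\<bar> + \<bar>h n * \<phi> x\<bar>)" by (rule F_increment)
      also have "\<dots> \<le> \<bar>h n * \<phi> x\<bar> * ?Q (m x)" by (rule mult_left_mono[OF Q]) simp
      also have "\<dots> = \<bar>h n\<bar> * (\<bar>\<phi> x\<bar> * ?Q (m x))" by (simp only: abs_mult mult.assoc)
      also have "\<dots> \<le> \<bar>h n\<bar> * (m x * ?Q (m x))"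
        by (intro mult_left_mono mult_right_mono m0 Q0) simp
      finally have "\<bar>F (v x + h n * \<phi> x) - F (v x)\<bar> / \<bar>h n\<bar> \<le> m x * ?Q (m x)"
        using h(2)[of n] by (simp add: divide_le_eq mult.commute)
      also have "m x * ?Q (m x) = a1 * (m x * m x powr (q1 - 1)) + a2 * (m x * m x powr (q2 - 1))" by (simp add: algebra_simps)
      also have "\<dots> = a1 * \<bar>m x\<bar> powr q1 + a2 * \<bar>m x\<bar> powr q2" using m0 by (simp add: powr_step)
      finally show "norm ((F (v x + h n * \<phi> x) - F (v x)) / h n) \<le> a1 * \<bar>m x\<bar> powr q1 + a2 * \<bar>m x\<bar> powr q2" by (simp add: abs_divide)
    qed
    show "AE x in lborel. (\<lambda>n. (F (v x + h n * \<phi> x) - F (v x)) / h n) \<longlonglongrightarrow> fe (v x) * \<phi> x"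
    proof (rule AE_I2)
      fix x
      have "((\<lambda>t. v x + t * \<phi> x) has_real_derivative \<phi> x) (at 0)" by (auto intro!: derivative_eq_intros)
      from DERIV_chain2[of F "fe (v x)" "\<lambda>t. v x + t * \<phi> x" 0 "\<phi> x", OF _ this]
      have "((\<lambda>t. F (v x + t * \<phi> x)) has_real_derivative fe (v x) * \<phi> x) (at 0)" using deriv[of "v x"] by simp
      then have "((\<lambda>t. (F (v x + t * \<phi> x) - F (v x + 0 * \<phi> x)) / (t - 0)) \<longlongrightarrow> fe (v x) * \<phi> x) (at 0)"
        unfolding has_field_derivative_iff .
      moreover have "filterlim h (at 0) sequentially" using h(1,2) by (simp add: filterlim_at)
      ultimately have "(\<lambda>n. (F (v x + h n * \<phi> x) - F (v x + 0 * \<phi> x)) / (h n - 0)) \<longlonglongrightarrow> fe (v x) * \<phi> x"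
        by (rule filterlim_compose)
      then show "(\<lambda>n. (F (v x + h n * \<phi> x) - F (v x)) / h n) \<longlonglongrightarrow> fe (v x) * \<phi> x" by simp
    qed
  qed measurable
  then have "(\<lambda>n. ?G + h n * (dirichlet \<phi> / 2) + 1 / (16 * pi) * (4 * ?C + h n * R2 + (h n)\<^sup>2 * R3 + (h n) ^ 3 * R4)
       - (LINT x|lborel. (F (v x + h n * \<phi> x) - F (v x)) / h n)) \<longlonglongrightarrow>
     ?G + 0 * (dirichlet \<phi> / 2) + 1 / (16 * pi) * (4 * ?C + 0 * R2 + 0\<^sup>2 * R3 + 0 ^ 3 * R4) - (LINT x|lborel. fe (v x) * \<phi> x)"
    by (intro tendsto_diff tendsto_add tendsto_mult tendsto_power tendsto_const h(1))
  then show ?thesis unfolding eq by simp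
qed

text \<open>The limit of the difference quotients along steps of either sign.\<close>
lemma Euler_Lagrange:
  assumes v: "v \<in> Er_space" and min: "\<And>u. u \<in> Er_space \<Longrightarrow> Phi v \<le> Phi u" and \<phi>: "\<phi> \<in> Er_space"
  shows "(LINT x|lborel. grad v x \<bullet> grad \<phi> x) + 1 / (4 * pi) * coulomb (\<lambda>x. (v x)\<^sup>2) (\<lambda>x. v x * \<phi> x) = (LINT x|lborel. fe (v x) * \<phi> x)"
proof -
  let ?h = "\<lambda>n. 1 / real (Suc n)" and ?k = "\<lambda>n. - (1 / real (Suc n))"
  have h0: "?h \<longlonglongrightarrow> 0" using LIMSEQ_inverse_real_of_nat by (simp add: inverse_eq_divide)
  have k0: "?k \<longlonglongrightarrow> 0" using tendsto_minus[OF h0] by simp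
  have hn: "?h n \<noteq> 0" "\<bar>?h n\<bar> \<le> 1" "?k n \<noteq> 0" "\<bar>?k n\<bar> \<le> 1" for n by auto
  have D: "0 \<le> Phi (\<lambda>x. v x + s * \<phi> x) - Phi v" for s using min[OF Er_line(1)[OF v \<phi>]] by simp
  have hD: "0 \<le> (Phi (\<lambda>x. v x + ?h n * \<phi> x) - Phi v) / ?h n" for n
    by (rule divide_nonneg_nonneg[OF D]) simp
  have kD: "(Phi (\<lambda>x. v x + ?k n * \<phi> x) - Phi v) / ?k n \<le> 0" for n
    by (rule divide_nonneg_nonpos[OF D]) simp
  have "0 \<le> (LINT x|lborel. grad v x \<bullet> grad \<phi> x) + 1 / (4 * pi) * coulomb (\<lambda>x. (v x)\<^sup>2) (\<lambda>x. v x * \<phi> x) - (LINT x|lborel. fe (v x) * \<phi> x)"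
    by (rule LIMSEQ_le_const[OF Phi_quotient[OF v \<phi> h0 hn(1,2)]]) (use hD in auto)
  moreover have "(LINT x|lborel. grad v x \<bullet> grad \<phi> x) + 1 / (4 * pi) * coulomb (\<lambda>x. (v x)\<^sup>2) (\<lambda>x. v x * \<phi> x) - (LINT x|lborel. fe (v x) * \<phi> x) \<le> 0"
    by (rule LIMSEQ_le_const2[OF Phi_quotient[OF v \<phi> k0 hn(3,4)]]) (use kD in auto)
  ultimately show ?thesis by linarith
qed

end


section \<open>Negative values of the functional\<close>

lemma energy_zero: "dirichlet (\<lambda>x. 0) = 0" "self_energy (\<lambda>x. 0) = 0"
proof -
  show "dirichlet (\<lambda>x. 0) = 0" using dirichlet_eq(1)[OF weak_gradient_zero] by simp
  show "self_energy (\<lambda>x. 0) = 0" by (simp add: self_energy_def coulomb_def coulomb_integrand_def case_prod_unfold)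
qed

lemma energy_zero_AE:
  assumes u: "u \<in> Er_space" and ae: "AE x in lborel. u x = 0"
  shows "energy u = 0"
proof -
  have "AE x in lborel. 0 = u x" using ae by eventually_elim simp
  note c = Er_cong_AE[OF zero_in_Er_space Er_spaceD(4)[OF u] this]
  show ?thesis unfolding energy_def c(2,3) energy_zero by simp
qed

text \<open>Some admissible set has supremum below \<open>l\<close>, and it is nonempty because the empty set has index zero. Any of its members satisfies the
claim; if the integral of \<open>\<bar>v\<bar>\<^sup>3\<close> vanished, \<open>v\<close> would be zero almost everywhere and could not have energy one.\<close>
lemma supercritical_direction:
  assumes l: "ereal l > minimax_eigenvalue k" and k: "k \<ge> 1"
  obtains v where "v \<in> Er_space" "energy v = 1" "l * (LINT x|lborel. \<bar>v x\<bar> powr 3) / 3 > 1"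
proof -
  obtain M where M: "M \<subseteq> M_s" "cohom_index M \<ge> enat k" "(SUP u \<in> M. ereal (1 / J_s u)) < ereal l"
    using l unfolding minimax_eigenvalue_def INF_less_iff by blast
  have "M \<noteq> {}" using M(2) k by (auto simp: cohom_index_def zero_enat_def)
  then obtain U where U: "U \<in> M" by blast
  let ?v = "rep_Er U"
  note v = rep_Er_in_Er_space[of U]
  have "ereal (1 / J_s U) \<le> (SUP u \<in> M. ereal (1 / J_s u))" using U by (rule SUP_upper)
  from le_less_trans[OF this M(3)] have less: "1 / J_s U < l" by simp
  have I: "energy ?v = 1" using U M(1) by (auto simp: M_s_def I_s_def energy_def dirichlet_def self_energy_def)
  have J: "J_s U = (LINT x|lborel. \<bar>?v x\<bar> powr 3) / 3" by (simp add: J_s_def powr_numeral)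
  have n: "(LINT x|lborel. \<bar>?v x\<bar> powr 3) \<ge> 0" by (rule integral_nonneg_AE) simp
  have "(LINT x|lborel. \<bar>?v x\<bar> powr 3) \<noteq> 0"
  proof
    assume "(LINT x|lborel. \<bar>?v x\<bar> powr 3) = 0"
    then have "AE x in lborel. \<bar>?v x\<bar> powr 3 = 0"
      using integral_nonneg_eq_0_iff_AE[OF Lq_integrable[OF v, of 3]] by simp
    then have "AE x in lborel. ?v x = 0" by eventually_elim simp
    then show False using energy_zero_AE[OF v] I by simp
  qed
  with n have "(LINT x|lborel. \<bar>?v x\<bar> powr 3) > 0" by linarith
  then have "J_s U > 0" unfolding J by linarith
  then have "l * J_s U > 1" using less by (simp add: field_simps)
  then show ?thesis using that[OF v I] J by simp
qed

context subcubic
begin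

text \<open>The mean value theorem for \<open>F t - l / 3 * t\<^sup>3\<close>.\<close>
lemma F_lower:
  assumes near: "\<And>t. t \<ge> 0 \<Longrightarrow> \<bar>fe t - l * t\<^sup>2\<bar> \<le> a3 * t powr (q3 - 1) + a4 * t powr (q4 - 1)"
    and a': "a3 \<ge> 0" "a4 \<ge> 0" and q': "q3 > 1" "q4 > 1"
  shows "l / 3 * \<bar>s\<bar> powr 3 - (a3 * \<bar>s\<bar> powr q3 + a4 * \<bar>s\<bar> powr q4) \<le> F s"
proof (cases "s = 0")
  case True
  then show ?thesis using F0 by simp
next
  case False
  let ?r = "\<bar>s\<bar>"
  have r: "?r > 0" using False by simp
  have "\<exists>z. 0 < z \<and> z < ?r \<and> (F ?r - l / 3 * ?r ^ 3) - (F 0 - l / 3 * 0 ^ 3) = (?r - 0) * (fe z - l * z\<^sup>2)"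
    by (rule MVT2[OF r]) (auto intro!: derivative_eq_intros deriv simp: power2_eq_square)
  then obtain z where z: "0 < z" "z < ?r" "F ?r - l / 3 * ?r ^ 3 = ?r * (fe z - l * z\<^sup>2)"
    using F0 by auto
  have "z powr (q3 - 1) \<le> ?r powr (q3 - 1)" "z powr (q4 - 1) \<le> ?r powr (q4 - 1)"
    using z q' by (auto intro!: powr_mono2)
  then have "a3 * z powr (q3 - 1) + a4 * z powr (q4 - 1) \<le> a3 * ?r powr (q3 - 1) + a4 * ?r powr (q4 - 1)"
    using a' by (intro add_mono mult_left_mono)
  then have "- (a3 * ?r powr (q3 - 1) + a4 * ?r powr (q4 - 1)) \<le> fe z - l * z\<^sup>2"
    using near[of z] z(1) by linarith
  then have "?r * - (a3 * ?r powr (q3 - 1) + a4 * ?r powr (q4 - 1)) \<le> F ?r - l / 3 * ?r ^ 3"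
    unfolding z(3) by (rule mult_left_mono) simp
  moreover have "?r * - (a3 * ?r powr (q3 - 1) + a4 * ?r powr (q4 - 1))
      = - (a3 * (?r * ?r powr (q3 - 1)) + a4 * (?r * ?r powr (q4 - 1)))" by (simp add: algebra_simps)
  ultimately have "- (a3 * ?r powr q3 + a4 * ?r powr q4) \<le> F s - l / 3 * ?r ^ 3"
    by (simp only: powr_step[OF abs_ge_zero] even)
  moreover have "?r powr 3 = ?r ^ 3" using r by (simp add: powr_numeral)
  ultimately show ?thesis by simp
qed

text \<open>All terms are compared with \<open>t\<^sup>3\<close> along the scaling: the cubic one has the negative coefficient \<open>1 - l * J\<close>, and the others carry an additional
factor \<open>t powr (2 * q - 6)\<close> that tends to zero with \<open>t\<close>.\<close>
lemma Phi_negative: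
  assumes near: "\<And>t. t \<ge> 0 \<Longrightarrow> \<bar>fe t - l * t\<^sup>2\<bar> \<le> a3 * t powr (q3 - 1) + a4 * t powr (q4 - 1)"
    and a': "a3 \<ge> 0" "a4 \<ge> 0" and q': "3 < q3" "q3 < 6" "3 < q4" "q4 < 6"
    and v: "v \<in> Er_space" "energy v = 1" "l * (LINT x|lborel. \<bar>v x\<bar> powr 3) / 3 > 1"
  obtains u where "u \<in> Er_space" "Phi u < 0"
proof -
  define L where "L p = (LINT x|lborel. \<bar>v x\<bar> powr p)" for p
  define t where "t n = real (Suc n) powr (- 1)" for n
  have t: "t n > 0" for n by (simp add: t_def)
  let ?d = "1 - l * L 3 / 3"
  have d: "?d < 0" using v(3) by (simp add: L_def)
  have lim: "(\<lambda>n. t n powr (2 * p - 6)) \<longlonglongrightarrow> 0" if "p > 3" for p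
  proof -
    have "(\<lambda>n. real (Suc n) powr (- (2 * p - 6))) \<longlonglongrightarrow> 0"
    proof (rule tendsto_neg_powr)
      show "filterlim (\<lambda>n. real (Suc n)) at_top sequentially"
        by (rule filterlim_compose[OF filterlim_real_sequentially filterlim_Suc])
    qed (use that in simp)
    moreover have "t n powr (2 * p - 6) = real (Suc n) powr (- (2 * p - 6))" for n
      unfolding t_def powr_powr by simp
    ultimately show ?thesis by simp
  qed
  have "(\<lambda>n. ?d + (a3 * (t n powr (2 * q3 - 6) * L q3) + a4 * (t n powr (2 * q4 - 6) * L q4)))
      \<longlonglongrightarrow> ?d + (a3 * (0 * L q3) + a4 * (0 * L q4))"
    using q' by (intro tendsto_add tendsto_mult tendsto_const lim) auto
  then have "\<forall>\<^sub>F n in sequentially. ?d + (a3 * (t n powr (2 * q3 - 6) * L q3) + a4 * (t n powr (2 * q4 - 6) * L q4)) < 0"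
    using d by (intro order_tendstoD(2)) auto
  then obtain n where n: "?d + (a3 * (t n powr (2 * q3 - 6) * L q3) + a4 * (t n powr (2 * q4 - 6) * L q4)) < 0"
    by (auto simp: eventually_sequentially)
  let ?t = "t n"
  let ?u = "\<lambda>x. ?t\<^sup>2 * v (?t *\<^sub>R x)"
  note s = Er_scale[OF v(1) t[of n]]
  have "energy ?u \<le> ?t ^ 3 * energy v" using s(2) unfolding energy_def s(3) by (simp add: algebra_simps)
  then have energy: "energy ?u \<le> ?t ^ 3" using v(2) by simp
  have t3: "?t powr 3 = ?t ^ 3" using t[of n] by (simp add: powr_numeral)
  have tp: "?t powr (2 * p - 3) = ?t ^ 3 * ?t powr (2 * p - 6)" for p
    unfolding t3[symmetric] powr_add[symmetric] by simp
  note i = Lq_integrable[OF s(1)]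
  have "(LINT x|lborel. l / 3 * \<bar>?u x\<bar> powr 3 - (a3 * \<bar>?u x\<bar> powr q3 + a4 * \<bar>?u x\<bar> powr q4)) \<le> potential ?u"
    unfolding potential_def
  proof (rule integral_mono)
    show "integrable lborel (\<lambda>x. l / 3 * \<bar>?u x\<bar> powr 3 - (a3 * \<bar>?u x\<bar> powr q3 + a4 * \<bar>?u x\<bar> powr q4))"
      using i[of 3] i[of q3] i[of q4] q' by simp
    show "l / 3 * \<bar>?u x\<bar> powr 3 - (a3 * \<bar>?u x\<bar> powr q3 + a4 * \<bar>?u x\<bar> powr q4) \<le> F (?u x)" for x
      by (rule F_lower[OF near a']) (use q' in auto)
  qed (rule F_integrable[OF s(1)])
  also have "(LINT x|lborel. l / 3 * \<bar>?u x\<bar> powr 3 - (a3 * \<bar>?u x\<bar> powr q3 + a4 * \<bar>?u x\<bar> powr q4))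
      = l / 3 * (LINT x|lborel. \<bar>?u x\<bar> powr 3) - (a3 * (LINT x|lborel. \<bar>?u x\<bar> powr q3) + a4 * (LINT x|lborel. \<bar>?u x\<bar> powr q4))"
    using i[of 3] i[of q3] i[of q4] q' by simp
  also have "\<dots> = ?t ^ 3 * (l / 3 * L 3 - (a3 * (?t powr (2 * q3 - 6) * L q3) + a4 * (?t powr (2 * q4 - 6) * L q4)))"
    unfolding s(4) tp L_def[symmetric] using t[of n] by (simp add: algebra_simps)
  finally have "Phi ?u \<le> ?t ^ 3 - ?t ^ 3 * (l / 3 * L 3 - (a3 * (?t powr (2 * q3 - 6) * L q3) + a4 * (?t powr (2 * q4 - 6) * L q4)))"
    using energy unfolding Phi_def by linarith
  also have "\<dots> = ?t ^ 3 * (?d + (a3 * (?t powr (2 * q3 - 6) * L q3) + a4 * (?t powr (2 * q4 - 6) * L q4)))"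
    by (simp add: algebra_simps)
  also have "\<dots> < 0" using n t[of n] by (simp add: mult_pos_neg)
  finally show ?thesis using that[OF s(1)] by blast
qed

end


section \<open>Solutions of one sign\<close>

lemma even_primitive:
  fixes h :: "real \<Rightarrow> real"
  assumes h: "continuous_on UNIV h" and odd: "\<And>t. h (- t) = - h t"
  obtains H where "\<And>t. (H has_real_derivative h t) (at t)" "H 0 = 0" "\<And>t. H \<bar>t\<bar> = H t"
proof -
  have "isCont h x" for x using h by (simp add: continuous_on_eq_continuous_at)
  then have "\<exists>G. \<forall>x. - \<infinity> < ereal x \<longrightarrow> ereal x < \<infinity> \<longrightarrow> (G has_vector_derivative h x) (at x)"
    by (intro einterval_antiderivative) auto
  then obtain G where G: "\<And>t. (G has_real_derivative h t) (at t)"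
    by (auto simp: has_real_derivative_iff_has_vector_derivative)
  have refl: "G (- t) = G t" for t
  proof -
    have "((\<lambda>s. G (- s) - G s) has_real_derivative 0) (at s)" for s
    proof -
      have "((\<lambda>s. G (- s)) has_real_derivative h (- s) * (- 1)) (at s)"
        by (rule DERIV_chain2[OF G]) (auto intro!: derivative_eq_intros)
      from DERIV_diff[OF this G[of s]] show ?thesis by (simp add: odd)
    qed
    then have "G (- t) - G t = G (- 0) - G 0"
      by (intro DERIV_isconst_all[of "\<lambda>s. G (- s) - G s"]) auto
    then show ?thesis by simp
  qed
  show ?thesis
  proof (rule that[of "\<lambda>t. G t - G 0"])
    show "((\<lambda>t. G t - G 0) has_real_derivative h t) (at t)" for t
      using DERIV_diff[OF G[of t] DERIV_const[of "G 0"]] by simp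
    show "G \<bar>t\<bar> - G 0 = G t - G 0" for t using refl[of t] by (simp add: abs_if)
  qed simp
qed

lemma rep_abs_Er:
  assumes "w \<in> Er_space"
  shows "AE x in lborel. rep_Er (abs_Er w) x = w x"
  using Quotient_rep_abs[OF Quotient_Er, of w] assms by (simp add: Er_rel_def)

lemma Er_eq_zero_iff: "W = 0 \<longleftrightarrow> (AE x in lborel. rep_Er W x = 0)"
proof -
  have z: "AE x in lborel. rep_Er 0 x = 0" using rep_abs_Er[OF zero_in_Er_space] by (simp add: zero_Er_def)
  show ?thesis unfolding Er_eq_iff
  proof
    assume "AE x in lborel. rep_Er W x = rep_Er 0 x"
    with z show "AE x in lborel. rep_Er W x = 0" by eventually_elim simp
  next
    assume "AE x in lborel. rep_Er W x = 0"
    with z show "AE x in lborel. rep_Er W x = rep_Er 0 x" by eventually_elim simp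
  qed
qed

lemma coulomb_cmult: "coulomb \<rho> (\<lambda>x. c * \<eta> x) = c * coulomb \<rho> \<eta>"
proof -
  have "coulomb_integrand \<rho> (\<lambda>x. c * \<eta> x) = (\<lambda>z. c * coulomb_integrand \<rho> \<eta> z)"
    by (auto simp: coulomb_integrand_def fun_eq_iff)
  then show ?thesis by (simp add: coulomb_def)
qed

text \<open>A nonnegative minimiser \<open>v\<close> of the even functional built from \<open>f\<close> on values of sign \<open>\<sigma>\<close>; then \<open>\<sigma> * v\<close> represents the solution. The
Euler equation is applied to \<open>\<sigma>\<close> times the chosen representative of the class, which equals \<open>v\<close> almost everywhere.\<close>
lemma one_sided_solution:
  fixes f g :: "real \<Rightarrow> real"
  assumes sg: "\<sigma> = 1 \<or> \<sigma> = (- 1 :: real)" and f: "continuous_on UNIV f"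
    and a: "a1 > 0" "a2 > 0" and q: "18/7 < q1" "q1 < q2" "q2 < 3"
    and fb: "\<And>t. \<bar>f t\<bar> \<le> a1 * \<bar>t\<bar> powr (q1 - 1) + a2 * \<bar>t\<bar> powr (q2 - 1)"
    and fg: "\<And>t. f t = l * \<bar>t\<bar> * t + g t"
    and a': "a3 > 0" "a4 > 0" and q': "3 < q3" "q3 < q4" "q4 < 6"
    and gb: "\<And>t. \<bar>g t\<bar> \<le> a3 * \<bar>t\<bar> powr (q3 - 1) + a4 * \<bar>t\<bar> powr (q4 - 1)"
    and v0: "v0 \<in> Er_space" "energy v0 = 1" "l * (LINT x|lborel. \<bar>v0 x\<bar> powr 3) / 3 > 1"
  obtains W :: Er where "W \<noteq> 0" "AE x in lborel. 0 \<le> \<sigma> * rep_Er W x" "solution f W"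
proof -
  have ss: "\<sigma> * \<sigma> = 1" "\<bar>\<sigma>\<bar> = 1" "\<sigma> * (\<sigma> * z) = z" "\<sigma>\<^sup>2 = 1" for z using sg by auto
  \<comment> \<open>Since \<open>f 0 = 0\<close>, one of the two terms always vanishes; in this form continuity and oddness are immediate.\<close>
  define fe where "fe t = \<sigma> * (f (\<sigma> * max t 0) - f (\<sigma> * max (- t) 0))" for t
  have f0: "f 0 = 0" using fb[of 0] by simp
  have fe_pos: "fe t = \<sigma> * f (\<sigma> * t)" if "t \<ge> 0" for t using that f0 by (simp add: fe_def)
  have fe_odd: "fe (- t) = - fe t" for t by (simp add: fe_def algebra_simps)
  have fe_cont: "continuous_on UNIV fe"
    unfolding fe_def by (intro continuous_intros continuous_on_compose2[OF f]) auto
  have fe_pos_bound: "\<bar>fe t\<bar> \<le> a1 * \<bar>t\<bar> powr (q1 - 1) + a2 * \<bar>t\<bar> powr (q2 - 1)" if "t \<ge> 0" for t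
    using fb[of "\<sigma> * t"] by (simp add: fe_pos[OF that] abs_mult ss)
  have fe_bound: "\<bar>fe t\<bar> \<le> a1 * \<bar>t\<bar> powr (q1 - 1) + a2 * \<bar>t\<bar> powr (q2 - 1)" for t
    using fe_pos_bound[of t] fe_pos_bound[of "- t"] by (cases "t \<ge> 0") (auto simp: fe_odd)
  have near: "\<bar>fe t - l * t\<^sup>2\<bar> \<le> a3 * t powr (q3 - 1) + a4 * t powr (q4 - 1)" if t: "t \<ge> 0" for t
  proof -
    have "fe t - l * t\<^sup>2 = \<sigma> * g (\<sigma> * t)"
      using t sg by (auto simp: fe_pos fg abs_mult power2_eq_square)
    then show ?thesis using gb[of "\<sigma> * t"] t by (simp add: abs_mult ss)
  qed
  obtain F where F: "\<And>t. (F has_real_derivative fe t) (at t)" "F 0 = 0" "\<And>t. F \<bar>t\<bar> = F t"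
    using even_primitive[OF fe_cont fe_odd] by blast
  interpret subcubic F fe a1 a2 q1 q2
    by unfold_locales (use F fe_cont a q fe_bound in auto)
  obtain u0 where u0: "u0 \<in> Er_space" "Phi u0 < 0"
    by (rule Phi_negative[OF near _ _ _ _ _ _ v0]) (use a' q' in auto)
  obtain v where v: "v \<in> Er_space" "\<And>x. 0 \<le> v x" "\<And>u. u \<in> Er_space \<Longrightarrow> Phi v \<le> Phi u"
    using minimizer by blast
  have neg: "Phi v < 0" using v(3)[OF u0(1)] u0(2) by linarith
  have sv: "(\<lambda>x. \<sigma> * v x) \<in> Er_space" using Er_line(1)[OF zero_in_Er_space v(1), of \<sigma>] by simp
  define W where "W = abs_Er (\<lambda>x. \<sigma> * v x)"
  let ?w = "rep_Er W"
  note w = rep_Er_in_Er_space[of W]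
  have wv: "AE x in lborel. ?w x = \<sigma> * v x" unfolding W_def by (rule rep_abs_Er[OF sv])
  let ?u = "\<lambda>x. \<sigma> * ?w x"
  have vu: "AE x in lborel. v x = ?u x" using wv by eventually_elim (simp add: ss)
  note [measurable] = Er_spaceD(4)[OF v(1)] Er_spaceD(4)[OF w]
  have um: "?u \<in> borel_measurable borel" by measurable
  note u = Er_cong_AE[OF v(1) um vu]
  have "potential ?u = potential v" unfolding potential_def by (rule integral_cong_AE) (use vu in auto)
  then have Phi_u: "Phi ?u = Phi v" unfolding Phi_def energy_def u(2,3) by simp
  have min: "Phi ?u \<le> Phi z" if "z \<in> Er_space" for z unfolding Phi_u by (rule v(3)[OF that])
  have upos: "AE x in lborel. 0 \<le> ?u x" using vu
  proof eventually_elim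
    case (elim x)
    then show ?case using v(2)[of x] by simp
  qed
  have "W \<noteq> 0"
  proof
    assume "W = 0"
    then have w0: "AE x in lborel. ?u x = 0" unfolding Er_eq_zero_iff by eventually_elim simp
    have "potential ?u = (LINT x|(lborel :: R3 measure). 0)" unfolding potential_def
      by (rule integral_cong_AE) (use w0 F(2) in auto)
    then have "Phi ?u = 0" using energy_zero_AE[OF u(1) w0] unfolding Phi_def by simp
    then show False using neg Phi_u by simp
  qed
  moreover have "solution f W"
    unfolding solution_def
  proof
    fix V :: Er
    let ?p = "rep_Er V"
    note p = rep_Er_in_Er_space[of V]
    note gw = D12_grad[OF Er_spaceD(1)[OF w]] and gp = D12_grad[OF Er_spaceD(1)[OF p]]
      and gu = D12_grad[OF Er_spaceD(1)[OF u(1)]]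
    note [measurable] = weak_gradient_measurable[OF gw(1)] weak_gradient_measurable[OF gp(1)]
      weak_gradient_measurable[OF gu(1)] Er_spaceD(4)[OF p] borel_measurable_continuous_onI[OF f]
    have "AE x in lborel. grad ?u x = \<sigma> *\<^sub>R grad ?w x"
      using Er_line(3)[OF zero_in_Er_space w, of \<sigma>] grad_AE_eq[OF weak_gradient_zero] by eventually_elim simp
    then have "(LINT x|lborel. grad ?u x \<bullet> grad ?p x) = (LINT x|lborel. \<sigma> * (grad ?w x \<bullet> grad ?p x))"
      by (intro integral_cong_AE) auto
    then have 1: "(LINT x|lborel. grad ?u x \<bullet> grad ?p x) = \<sigma> * (LINT x|lborel. grad ?w x \<bullet> grad ?p x)" by simp
    have 2: "coulomb (\<lambda>x. (?u x)\<^sup>2) (\<lambda>x. ?u x * ?p x) = \<sigma> * coulomb (\<lambda>x. (?w x)\<^sup>2) (\<lambda>x. ?w x * ?p x)"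
      by (simp add: power_mult_distrib ss mult.assoc coulomb_cmult)
    have "AE x in lborel. fe (?u x) = \<sigma> * f (?w x)"
      using upos by eventually_elim (simp add: fe_pos ss)
    then have "(LINT x|lborel. fe (?u x) * ?p x) = (LINT x|lborel. \<sigma> * (f (?w x) * ?p x))"
      by (intro integral_cong_AE) auto
    then have 3: "(LINT x|lborel. fe (?u x) * ?p x) = \<sigma> * (LINT x|lborel. f (?w x) * ?p x)" by simp
    have "\<sigma> * ((LINT x|lborel. grad ?w x \<bullet> grad ?p x) + 1 / (4 * pi) * coulomb (\<lambda>x. (?w x)\<^sup>2) (\<lambda>x. ?w x * ?p x))
        = \<sigma> * (LINT x|lborel. f (?w x) * ?p x)"
      using Euler_Lagrange[OF u(1) min p] unfolding 1 2 3 by (simp add: algebra_simps)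
    then show "(LINT x|lborel. grad ?w x \<bullet> grad ?p x) + 1 / (4 * pi) * coulomb (\<lambda>x. (?w x)\<^sup>2) (\<lambda>x. ?w x * ?p x)
        = (LINT x|lborel. f (?w x) * ?p x)"
      using sg by auto
  qed
  ultimately show ?thesis using that upos by blast
qed

theorem theorem1p21:
  fixes f g :: "real \<Rightarrow> real"
    and a\<^sub>1 a\<^sub>2 a\<^sub>3 a\<^sub>4 q\<^sub>1 q\<^sub>2 q\<^sub>3 q\<^sub>4 l :: real
  assumes "continuous_on UNIV f"
    and "a\<^sub>1 > 0" and "a\<^sub>2 > 0" and "18 / 7 < q\<^sub>1" and "q\<^sub>1 < q\<^sub>2" and "q\<^sub>2 < 3"
    and "\<And>t. \<bar>f t\<bar> \<le> a\<^sub>1 * \<bar>t\<bar> powr (q\<^sub>1 - 1) + a\<^sub>2 * \<bar>t\<bar> powr (q\<^sub>2 - 1)"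
    and "\<And>t. f t = l * \<bar>t\<bar> * t + g t"
    and "a\<^sub>3 > 0" and "a\<^sub>4 > 0" and "3 < q\<^sub>3" and "q\<^sub>3 < q\<^sub>4" and "q\<^sub>4 < 6"
    and "\<And>t. \<bar>g t\<bar> \<le> a\<^sub>3 * \<bar>t\<bar> powr (q\<^sub>3 - 1) + a\<^sub>4 * \<bar>t\<bar> powr (q\<^sub>4 - 1)"
    and "\<And>t. t \<noteq> 0 \<Longrightarrow> (LBINT \<tau>=ereal 0..ereal t. g \<tau>) < 0"
  shows "(ereal l > minimax_eigenvalue 1 \<longrightarrow> (\<exists>u :: Er. u \<noteq> 0 \<and> solution f u)) \<and>
    (ereal l > minimax_eigenvalue 2 \<longrightarrow>
       (\<exists>u v :: Er. u \<noteq> v \<and> u \<noteq> 0 \<and> v \<noteq> 0 \<and> solution f u \<and> solution f v))"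
proof -
  have pair: "\<exists>u v :: Er. u \<noteq> v \<and> u \<noteq> 0 \<and> v \<noteq> 0 \<and> solution f u \<and> solution f v"
    if k: "ereal l > minimax_eigenvalue k" "k \<ge> 1" for k
  proof -
    obtain v0 where v0: "v0 \<in> Er_space" "energy v0 = 1" "l * (LINT x|lborel. \<bar>v0 x\<bar> powr 3) / 3 > 1"
      using supercritical_direction[OF k] by blast
    obtain U :: Er where U: "U \<noteq> 0" "AE x in lborel. 0 \<le> 1 * rep_Er U x" "solution f U"
      by (rule one_sided_solution[OF disjI1[OF refl] assms(1-14) v0])
    obtain V :: Er where V: "V \<noteq> 0" "AE x in lborel. 0 \<le> - 1 * rep_Er V x" "solution f V"
      by (rule one_sided_solution[OF disjI2[OF refl] assms(1-14) v0])
    have "U \<noteq> V"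
    proof
      assume "U = V"
      with U(2) V(2) have "AE x in lborel. rep_Er U x = 0" by (auto elim: eventually_elim2)
      then show False using U(1) Er_eq_zero_iff by blast
    qed
    then show ?thesis using U V by blast
  qed
  show ?thesis using pair[of 1] pair[of 2] by auto
qed

end
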